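(* Let $\Omega\subset\mathbb{R}^n$ be a bounded strictly Lipschitz domain, let $s>0$, $s\notin\mathbb{N}$, and let $f,g\in \mathrm{Dom}(Q^{\mathrm{DSp}}_s)$ be non-negative non-trivial functions (i.e. $f,g\ge 0$ a.e. in $\Omega$ and $f\neq 0$, $g\neq 0$ in $L_2(\Omega)$) such that $fg=0$ a.e. in $\Omega$. Then $$Q^{\mathrm{DSp}}_s[f+g]<Q^{\mathrm{DSp}}_s[f-g]\quad\text{if }\lfloor s\rfloor\text{ is even},$$ $$Q^{\mathrm{DSp}}_s[f+g]>Q^{\mathrm{DSp}}_s[f-g]\quad\text{if }\lfloor s\rfloor\text{ is odd}.$$ If in addition $f,g\in \mathrm{Dom}(Q^{\mathrm{DR}}_s)=\widetilde H^s(\Omega)$, then the same inequalities hold for $Q^{\mathrm{DR}}_s$, that is, $Q^{\mathrm{DR}}_s[f+g]<Q^{\mathrm{DR}}_s[f-g]$ if $\lfloor s\rfloor$ is even, and $Q^{\mathrm{DR}}_s[f+g]>Q^{\mathrm{DR}}_s[f-g]$ if $\lfloor s\rfloor$ is odd.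
   Context: A domain is a connected open set. All functions are real-valued. Let $\lambda_j$, $j\in\mathbb{N}=\{1,2,\dots\}$, be the nondecreasing sequence of eigenvalues of the Dirichlet Laplacian $-\Delta$ in $\Omega$ (form domain $H^1_0(\Omega)$), counted with multiplicity, and let $\varphi_j$ be corresponding eigenfunctions forming a complete orthonormal system in $L_2(\Omega)$. The quadratic form of the spectral fractional Dirichlet Laplacian of order $s>0$ is $$Q^{\mathrm{DSp}}_s[v]=\sum_{j\ge1}\lambda_j^{s}\,(v,\varphi_j)_{L_2(\Omega)}^2,\qquad \mathrm{Dom}(Q^{\mathrm{DSp}}_s)=\{v\in L_2(\Omega):Q^{\mathrm{DSp}}_s[v]<\infty\}.$$ Let $\mathcal F$ be the (unitary) Fourier transform on $\mathbb{R}^n$ and $H^s(\mathbb{R}^n)=\{u\in\mathcal S'(\mathbb{R}^n):(1+|\xi|^2)^{s/2}\mathcal Fu(\xi)\in L_2(\mathbb{R}^n)\}$. Set $\widetilde H^s(\Omega)=\{u\in H^s(\mathbb{R}^n):\operatorname{supp}(u)\subset\overline\Omega\}$; its elements are identified with functions on $\Omega$ extended by zero to $\mathbb{R}^n$. The quadratic form of the restricted fractional Dirichlet Laplacian is $$Q^{\mathrm{DR}}_s[v]=\int_{\mathbb{R}^n}|\xi|^{2s}|(\mathcal Fv)(\xi)|^2\,d\xi,\qquad \mathrm{Dom}(Q^{\mathrm{DR}}_s)=\widetilde H^s(\Omega).$$ *)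

theory Defs
  imports "HOL-Analysis.Analysis"
begin

section \<open>Smooth functions, test functions, square-integrable functions\<close>

text \<open>Iterated partial derivatives; the multi-index is given by the list of its directions.\<close>

fun partials ::
  "'a::euclidean_space list \<Rightarrow> ('a \<Rightarrow> 'b::real_normed_vector) \<Rightarrow> 'a \<Rightarrow> 'b" where
  "partials [] f = f"
| "partials (b # bs) f = (\<lambda>x. frechet_derivative (partials bs f) (at x) b)"

definition C_infinity :: "('a::euclidean_space \<Rightarrow> 'b::real_normed_vector) set" where
  "C_infinity = {f. \<forall>bs \<in> lists Basis. \<forall>x. partials bs f differentiable (at x)}"

definition test_functions ::
  "'a::euclidean_space set \<Rightarrow> ('a \<Rightarrow> 'b::real_normed_vector) set" where
  "test_functions U =
     {f \<in> C_infinity. compact (closure {x. f x \<noteq> 0}) \<and> closure {x. f x \<noteq> 0} \<subseteq> U}"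

definition classical_gradient :: "('a::euclidean_space \<Rightarrow> real) \<Rightarrow> 'a \<Rightarrow> 'a" where
  "classical_gradient f x = (\<Sum>b\<in>Basis. frechet_derivative f (at x) b *\<^sub>R b)"

text \<open>Elements of \<open>L2_on U\<close> are representatives; their values outside \<open>U\<close> are irrelevant.\<close>

definition L2_on ::
  "'a::euclidean_space set \<Rightarrow> ('a \<Rightarrow> 'b::real_normed_vector) set" where
  "L2_on U = {f \<in> borel_measurable (lebesgue_on U).
     integrable (lebesgue_on U) (\<lambda>x. (norm (f x))\<^sup>2)}"

definition L2_inner ::
  "'a::euclidean_space set \<Rightarrow> ('a \<Rightarrow> real) \<Rightarrow> ('a \<Rightarrow> real) \<Rightarrow> real" where
  "L2_inner U u v = (LINT x|lebesgue_on U. u x * v x)"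


section \<open>Strictly Lipschitz sets\<close>

text \<open>
  Near every boundary point the set is, in a suitable Cartesian system, the strict epigraph of a
  Lipschitz function. The unit vector \<open>e\<close> is the vertical direction, the horizontal coordinates
  range over the hyperplane orthogonal to \<open>e\<close>.
\<close>

definition strictly_lipschitz :: "'a::euclidean_space set \<Rightarrow> bool" where
  "strictly_lipschitz \<Omega> \<longleftrightarrow>
     (\<forall>x0 \<in> frontier \<Omega>. \<exists>U e \<gamma> L.
        open U \<and> x0 \<in> U \<and> norm e = 1 \<and> L-lipschitz_on {y. y \<bullet> e = 0} (\<gamma> :: 'a \<Rightarrow> real) \<and>
        \<Omega> \<inter> U = {y \<in> U. \<gamma> (y - (y \<bullet> e) *\<^sub>R e) < y \<bullet> e})"


section \<open>The spectral fractional Dirichlet Laplacian\<close>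

definition weak_gradient ::
  "'a::euclidean_space set \<Rightarrow> ('a \<Rightarrow> real) \<Rightarrow> ('a \<Rightarrow> 'a) \<Rightarrow> bool" where
  "weak_gradient \<Omega> u G \<longleftrightarrow> u \<in> L2_on \<Omega> \<and> G \<in> L2_on \<Omega> \<and>
     (\<forall>\<psi> \<in> test_functions \<Omega>. \<forall>b \<in> Basis.
        (LINT x|lebesgue_on \<Omega>. u x * frechet_derivative \<psi> (at x) b) =
        - (LINT x|lebesgue_on \<Omega>. (G x \<bullet> b) * \<psi> x))"

text \<open>The closure of the test functions in the \<open>H\<^sup>1\<close>-norm.\<close>

definition H1_0 :: "'a::euclidean_space set \<Rightarrow> ('a \<Rightarrow> real) set" where
  "H1_0 \<Omega> = {u. \<exists>G. weak_gradient \<Omega> u G \<and>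
     (\<exists>\<psi> :: nat \<Rightarrow> 'a \<Rightarrow> real. (\<forall>k. \<psi> k \<in> test_functions \<Omega>) \<and>
        (\<lambda>k. LINT x|lebesgue_on \<Omega>.
           (\<psi> k x - u x)\<^sup>2 + (norm (classical_gradient (\<psi> k) x - G x))\<^sup>2) \<longlonglongrightarrow> 0)}"

text \<open>
  \<open>u\<close> lies in the domain of the operator generated by the Dirichlet form on \<open>H1_0 \<Omega>\<close>, and
  this operator maps \<open>u\<close> to \<open>\<mu> u\<close>. Weak gradients are unique almost everywhere, so the choice of
  \<open>G\<close> and \<open>H\<close> does not matter.
\<close>

definition dirichlet_eigen :: "'a::euclidean_space set \<Rightarrow> real \<Rightarrow> ('a \<Rightarrow> real) \<Rightarrow> bool" where
  "dirichlet_eigen \<Omega> \<mu> u \<longleftrightarrow> u \<in> H1_0 \<Omega> \<and>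
     (\<forall>v \<in> H1_0 \<Omega>. \<forall>G H. weak_gradient \<Omega> u G \<longrightarrow> weak_gradient \<Omega> v H \<longrightarrow>
        (LINT x|lebesgue_on \<Omega>. G x \<bullet> H x) = \<mu> * L2_inner \<Omega> u v)"

text \<open>
  The sequences are indexed from \<open>0\<close>. Completeness of the orthonormal system forces \<open>\<Lambda>\<close> to
  list all eigenvalues with their multiplicities.
\<close>

definition dirichlet_eigensystem ::
  "'a::euclidean_space set \<Rightarrow> (nat \<Rightarrow> real) \<Rightarrow> (nat \<Rightarrow> 'a \<Rightarrow> real) \<Rightarrow> bool" where
  "dirichlet_eigensystem \<Omega> \<Lambda> \<phi> \<longleftrightarrow>
     incseq \<Lambda> \<and>
     (\<forall>j. dirichlet_eigen \<Omega> (\<Lambda> j) (\<phi> j)) \<and>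
     (\<forall>i j. L2_inner \<Omega> (\<phi> i) (\<phi> j) = (if i = j then 1 else 0)) \<and>
     (\<forall>v \<in> L2_on \<Omega>. (\<forall>j. L2_inner \<Omega> v (\<phi> j) = 0) \<longrightarrow> (AE x in lebesgue_on \<Omega>. v x = 0))"

definition Q_DSp ::
  "'a::euclidean_space set \<Rightarrow> (nat \<Rightarrow> real) \<Rightarrow> (nat \<Rightarrow> 'a \<Rightarrow> real) \<Rightarrow> real \<Rightarrow> ('a \<Rightarrow> real) \<Rightarrow> ennreal"
  where
  "Q_DSp \<Omega> \<Lambda> \<phi> s v = (\<Sum>j. ennreal (\<Lambda> j powr s * (L2_inner \<Omega> v (\<phi> j))\<^sup>2))"

definition Dom_DSp ::
  "'a::euclidean_space set \<Rightarrow> (nat \<Rightarrow> real) \<Rightarrow> (nat \<Rightarrow> 'a \<Rightarrow> real) \<Rightarrow> real \<Rightarrow> ('a \<Rightarrow> real) set" where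
  "Dom_DSp \<Omega> \<Lambda> \<phi> s = {v \<in> L2_on \<Omega>. Q_DSp \<Omega> \<Lambda> \<phi> s v < \<infinity>}"


section \<open>Tempered distributions and the Fourier transform\<close>

definition schwartz :: "('a::euclidean_space \<Rightarrow> complex) set" where
  "schwartz = {f \<in> C_infinity. \<forall>k::nat. \<forall>bs \<in> lists Basis.
     bounded (range (\<lambda>x. (1 + norm x) ^ k *\<^sub>R partials bs f x))}"

definition schwartz_null :: "(nat \<Rightarrow> 'a::euclidean_space \<Rightarrow> complex) \<Rightarrow> bool" where
  "schwartz_null f \<longleftrightarrow> (\<forall>m. f m \<in> schwartz) \<and>
     (\<forall>k::nat. \<forall>bs \<in> lists Basis.
        uniform_limit UNIV (\<lambda>m x. (1 + norm x) ^ k *\<^sub>R partials bs (f m) x) (\<lambda>_. 0) sequentially)"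

text \<open>
  A distribution is a functional whose values outside \<open>schwartz\<close> are irrelevant. The Schwartz
  space is metrizable, so continuity is sequential continuity at \<open>0\<close>.
\<close>

definition tempered :: "(('a::euclidean_space \<Rightarrow> complex) \<Rightarrow> complex) \<Rightarrow> bool" where
  "tempered T \<longleftrightarrow>
     (\<forall>f \<in> schwartz. \<forall>g \<in> schwartz. T (\<lambda>x. f x + g x) = T f + T g) \<and>
     (\<forall>c. \<forall>f \<in> schwartz. T (\<lambda>x. c * f x) = c * T f) \<and>
     (\<forall>f. schwartz_null f \<longrightarrow> (\<lambda>m. T (f m)) \<longlonglongrightarrow> 0)"

definition dist_support ::
  "(('a::euclidean_space \<Rightarrow> complex) \<Rightarrow> complex) \<Rightarrow> 'a set" where
  "dist_support T = - \<Union>{U. open U \<and> (\<forall>f \<in> test_functions U. T f = 0)}"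

definition dist_of ::
  "('a::euclidean_space \<Rightarrow> complex) \<Rightarrow> ('a \<Rightarrow> complex) \<Rightarrow> complex" where
  "dist_of w f = (LINT x|lebesgue. w x * f x)"

definition represents ::
  "('a::euclidean_space \<Rightarrow> complex) \<Rightarrow> (('a \<Rightarrow> complex) \<Rightarrow> complex) \<Rightarrow> bool" where
  "represents w T \<longleftrightarrow> w \<in> borel_measurable lebesgue \<and>
     (\<forall>f \<in> schwartz. integrable lebesgue (\<lambda>x. w x * f x) \<and> T f = dist_of w f)"

definition fourier :: "('a::euclidean_space \<Rightarrow> complex) \<Rightarrow> 'a \<Rightarrow> complex" where
  "fourier f \<xi> =
     complex_of_real ((2 * pi) powr (- real DIM('a) / 2)) *
     (LINT x|lebesgue. cis (- (x \<bullet> \<xi>)) * f x)"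

definition fourier_dist ::
  "(('a::euclidean_space \<Rightarrow> complex) \<Rightarrow> complex) \<Rightarrow> ('a \<Rightarrow> complex) \<Rightarrow> complex" where
  "fourier_dist T f = T (fourier f)"

text \<open>The Fourier transform as a function, meaningful if it is one; unique almost everywhere.\<close>

definition fourier_fun ::
  "(('a::euclidean_space \<Rightarrow> complex) \<Rightarrow> complex) \<Rightarrow> 'a \<Rightarrow> complex" where
  "fourier_fun T = (SOME w. represents w (fourier_dist T))"


section \<open>The restricted fractional Dirichlet Laplacian\<close>

definition sobolev_H ::
  "real \<Rightarrow> (('a::euclidean_space \<Rightarrow> complex) \<Rightarrow> complex) set" where
  "sobolev_H s = {T. tempered T \<and>
     (\<exists>w. represents w (fourier_dist T) \<and>
        (\<lambda>\<xi>. (1 + (norm \<xi>)\<^sup>2) powr (s / 2) *\<^sub>R w \<xi>) \<in> L2_on UNIV)}"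

definition sobolev_H_tilde ::
  "real \<Rightarrow> 'a::euclidean_space set \<Rightarrow> (('a \<Rightarrow> complex) \<Rightarrow> complex) set" where
  "sobolev_H_tilde s \<Omega> = {T \<in> sobolev_H s. dist_support T \<subseteq> closure \<Omega>}"

text \<open>The distribution on the whole space given by the extension of \<open>v\<close> by zero.\<close>

definition zero_ext ::
  "'a::euclidean_space set \<Rightarrow> ('a \<Rightarrow> real) \<Rightarrow> ('a \<Rightarrow> complex) \<Rightarrow> complex" where
  "zero_ext \<Omega> v = dist_of (\<lambda>x. complex_of_real (if x \<in> \<Omega> then v x else 0))"

definition Q_DR :: "'a::euclidean_space set \<Rightarrow> real \<Rightarrow> ('a \<Rightarrow> real) \<Rightarrow> ennreal" where
  "Q_DR \<Omega> s v =
     (\<integral>\<^sup>+ \<xi>. ennreal (norm \<xi> powr (2 * s) * (cmod (fourier_fun (zero_ext \<Omega> v) \<xi>))\<^sup>2) \<partial>lebesgue)"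

text \<open>
  For \<open>s > 0\<close> all elements of \<open>sobolev_H s\<close> are square-integrable functions, so requiring
  \<open>v \<in> L2_on \<Omega>\<close> loses nothing; it ensures that \<open>zero_ext \<Omega> v\<close> is given by convergent integrals.
\<close>

definition Dom_DR :: "'a::euclidean_space set \<Rightarrow> real \<Rightarrow> ('a \<Rightarrow> real) set" where
  "Dom_DR \<Omega> s = {v \<in> L2_on \<Omega>. zero_ext \<Omega> v \<in> sobolev_H_tilde s \<Omega>}"

end

(*
  Both forms satisfy Q[f + g] - Q[f - g] = 4 B(f, g) with B(f, g) = int lambda^s dr, where the
  signed measure r is the joint spectral measure of (f, g) (lambda = |xi|^2 in the restricted case).
  Put m = floor s. Since fg = 0 and the operators -Delta^k are local, the moments int lambda^k dr
  vanish for k <= m. Up to a positive factor, lambda^s is the integral over mu > 0 of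
  mu^(s - m - 1) lambda^(m+1) / (lambda + mu), and modulo polynomials of degree m in lambda the
  integrand equals (-1)^(m+1) mu^s / (lambda + mu). Hence (-1)^(m+1) B(f, g) is a positive
  superposition of the resolvent pairings ((-Delta + mu)^-1 f, g), which are positive: on R^n because
  exp(t Delta) has a positive kernel, on the domain because the Dirichlet form contracts under
  u -> |u| and the domain is connected.

  For strict positivity on the domain without a maximum principle: if the pairing vanishes, then
  the set E where the resolvent of f is positive is invariant under resolvents, so multiplication
  by the indicator of E preserves the form domain. An indicator that is locally in H^1 is locally
  constant, so E is null or of full measure.
*)

theory Submission
  imports Defs "HOL-Probability.Probability"
begin

section \<open>Square-integrable functions and complete orthonormal systems\<close>

text \<open>The obstacle behind locality is that f and g are disjoint only almost everywhere: their
  zero sets are measurable, not open, so no argument with supports applies. What is needed is that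
  weak derivatives vanish almost everywhere on the zero set of the function. This is read off
  difference quotients. The indicator of the nonzero set is continuous in L2 under shifts, so at
  almost every zero the shifted points are eventually zeros too, along a subsequence, and the
  quotients there are 0; Plancherel provides their L2 limit. On the domain, weak gradients are known
  only against test functions, so the argument is applied to products with a smooth bump; for -Delta
  u such a product has its second derivatives in L2. That an indicator of E preserves the form
  domain comes from the bounded forms with symbol nu lambda / (lambda + nu). They increase to the
  Dirichlet form, and for each of them the two pieces of a cut function are exactly orthogonal,
  because resolvents do not leak out of E. That an indicator locally in H1 is locally constant comes
  from a bound quadratic in the shift, which subdivision of the shift improves to 0.\<close>

definition l2 :: "'a measure \<Rightarrow> ('a \<Rightarrow> real) set" where
  "l2 M = {f \<in> borel_measurable M. integrable M (\<lambda>x. (f x)\<^sup>2)}"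

definition ip :: "'a measure \<Rightarrow> ('a \<Rightarrow> real) \<Rightarrow> ('a \<Rightarrow> real) \<Rightarrow> real" where
  "ip M f g = (LINT x|M. f x * g x)"

definition nrm :: "'a measure \<Rightarrow> ('a \<Rightarrow> real) \<Rightarrow> real" where
  "nrm M f = sqrt (ip M f f)"

lemma l2_measurable [measurable_dest]: "f \<in> l2 M \<Longrightarrow> f \<in> borel_measurable M"
  by (simp add: l2_def)

lemma l2_integrable_square: "f \<in> l2 M \<Longrightarrow> integrable M (\<lambda>x. (f x)\<^sup>2)"
  by (simp add: l2_def)

lemma l2_dominated:
  assumes "f \<in> borel_measurable M" "g \<in> l2 M" "AE x in M. \<bar>f x\<bar> \<le> \<bar>g x\<bar>"
  shows "f \<in> l2 M"
proof -
  have "integrable M (\<lambda>x. (f x)\<^sup>2)"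
    by (rule Bochner_Integration.integrable_bound[OF l2_integrable_square[OF assms(2)]])
      (use assms in \<open>auto simp: abs_le_square_iff\<close>)
  then show ?thesis using assms by (simp add: l2_def)
qed

lemma l2_mult_integrable:
  assumes "f \<in> l2 M" "g \<in> l2 M"
  shows "integrable M (\<lambda>x. f x * g x)"
proof (rule Bochner_Integration.integrable_bound)
  show "integrable M (\<lambda>x. (f x)\<^sup>2 + (g x)\<^sup>2)"
    using assms by (simp add: l2_integrable_square)
  show "(\<lambda>x. f x * g x) \<in> borel_measurable M" using assms by measurable
  have "\<bar>a * b\<bar> \<le> a\<^sup>2 + b\<^sup>2" for a b :: real
  proof -
    have "0 \<le> \<bar>a\<bar> * \<bar>b\<bar>" by simp
    then show ?thesis using sum_squares_bound[of "\<bar>a\<bar>" "\<bar>b\<bar>"]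
      unfolding abs_mult power2_abs mult.assoc by linarith
  qed
  then show "AE x in M. norm (f x * g x) \<le> norm ((f x)\<^sup>2 + (g x)\<^sup>2)"
    by (auto intro!: AE_I2)
qed

lemma l2_zero [simp]: "(\<lambda>x. 0) \<in> l2 M"
  by (simp add: l2_def)

lemma l2_scale: "f \<in> l2 M \<Longrightarrow> (\<lambda>x. c * f x) \<in> l2 M"
  by (auto simp: l2_def power_mult_distrib)

lemma l2_add:
  assumes "f \<in> l2 M" "g \<in> l2 M" shows "(\<lambda>x. f x + g x) \<in> l2 M"
proof -
  have "integrable M (\<lambda>x. (f x)\<^sup>2 + (g x)\<^sup>2 + 2 * (f x * g x))"
    using assms by (intro Bochner_Integration.integrable_add integrable_mult_right)
      (auto simp: l2_integrable_square l2_mult_integrable)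
  moreover have "(\<lambda>x. (f x)\<^sup>2 + (g x)\<^sup>2 + 2 * (f x * g x)) = (\<lambda>x. (f x + g x)\<^sup>2)"
    by (simp add: power2_sum mult.assoc)
  ultimately show ?thesis using assms unfolding l2_def by auto
qed

lemma l2_uminus: "f \<in> l2 M \<Longrightarrow> (\<lambda>x. - f x) \<in> l2 M"
  using l2_scale[of f M "-1"] by simp

lemma l2_diff: "f \<in> l2 M \<Longrightarrow> g \<in> l2 M \<Longrightarrow> (\<lambda>x. f x - g x) \<in> l2 M"
  using l2_add[of f M "\<lambda>x. - g x"] l2_uminus[of g M] by simp

lemma l2_sum: "(\<And>i. i \<in> I \<Longrightarrow> f i \<in> l2 M) \<Longrightarrow> (\<lambda>x. \<Sum>i\<in>I. f i x) \<in> l2 M"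
  by (induction I rule: infinite_finite_induct) (auto simp: l2_add)

lemma ip_commute: "ip M f g = ip M g f"
  by (simp add: ip_def mult.commute)

lemma ip_self_nonneg [simp]: "0 \<le> ip M f f"
  by (simp add: ip_def)

lemma nrm_nonneg [simp]: "0 \<le> nrm M f"
  by (simp add: nrm_def)

lemma nrm_square [simp]: "(nrm M f)\<^sup>2 = ip M f f"
  by (simp add: nrm_def)

lemma ip_add_left: "f \<in> l2 M \<Longrightarrow> g \<in> l2 M \<Longrightarrow> h \<in> l2 M \<Longrightarrow>
    ip M (\<lambda>x. f x + g x) h = ip M f h + ip M g h"
  by (simp add: ip_def distrib_right l2_mult_integrable)

lemma ip_diff_left: "f \<in> l2 M \<Longrightarrow> g \<in> l2 M \<Longrightarrow> h \<in> l2 M \<Longrightarrow>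
    ip M (\<lambda>x. f x - g x) h = ip M f h - ip M g h"
  by (simp add: ip_def left_diff_distrib l2_mult_integrable)

lemma ip_add_right: "f \<in> l2 M \<Longrightarrow> g \<in> l2 M \<Longrightarrow> h \<in> l2 M \<Longrightarrow>
    ip M h (\<lambda>x. f x + g x) = ip M h f + ip M h g"
  by (simp add: ip_def distrib_left l2_mult_integrable)

lemma ip_diff_right: "f \<in> l2 M \<Longrightarrow> g \<in> l2 M \<Longrightarrow> h \<in> l2 M \<Longrightarrow>
    ip M h (\<lambda>x. f x - g x) = ip M h f - ip M h g"
  by (simp add: ip_def right_diff_distrib l2_mult_integrable)

lemma ip_scale_left: "ip M (\<lambda>x. c * f x) g = c * ip M f g"
  by (simp add: ip_def mult.assoc)

lemma ip_scale_right: "ip M g (\<lambda>x. c * f x) = c * ip M g f"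
  by (simp add: ip_commute[of M g] ip_scale_left)

lemma ip_zero_left [simp]: "ip M (\<lambda>x. 0) g = 0" and ip_zero_right [simp]: "ip M g (\<lambda>x. 0) = 0"
  by (simp_all add: ip_def)

lemma ip_sum_left: "(\<And>i. i \<in> I \<Longrightarrow> f i \<in> l2 M) \<Longrightarrow> g \<in> l2 M \<Longrightarrow>
    ip M (\<lambda>x. \<Sum>i\<in>I. f i x) g = (\<Sum>i\<in>I. ip M (f i) g)"
  by (simp add: ip_def sum_distrib_right l2_mult_integrable)

lemma ip_cong_AE:
  assumes "f \<in> borel_measurable M" "f' \<in> borel_measurable M" "g \<in> borel_measurable M"
    "g' \<in> borel_measurable M" "AE x in M. f x = f' x" "AE x in M. g x = g' x"
  shows "ip M f g = ip M f' g'"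
  unfolding ip_def using assms by (intro integral_cong_AE) auto

lemma l2_cong_AE:
  assumes "f \<in> l2 M" "g \<in> borel_measurable M" "AE x in M. f x = g x"
  shows "g \<in> l2 M"
  using assms by (intro l2_dominated[OF assms(2,1)]) auto

lemma ip_self_diff: "f \<in> l2 M \<Longrightarrow> g \<in> l2 M \<Longrightarrow>
    ip M (\<lambda>x. f x - g x) (\<lambda>x. f x - g x) = ip M f f - 2 * ip M f g + ip M g g"
  by (simp add: ip_diff_left ip_diff_right l2_diff ip_commute[of M g f])

lemma ip_self_add: "f \<in> l2 M \<Longrightarrow> g \<in> l2 M \<Longrightarrow>
    ip M (\<lambda>x. f x + g x) (\<lambda>x. f x + g x) = ip M f f + 2 * ip M f g + ip M g g"
  by (simp add: ip_add_left ip_add_right l2_add ip_commute[of M g f])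

lemma ip_self_eq_0_iff: "f \<in> l2 M \<Longrightarrow> ip M f f = 0 \<longleftrightarrow> (AE x in M. f x = 0)"
  unfolding ip_def using l2_mult_integrable[of f M f]
  by (subst integral_nonneg_eq_0_iff_AE) auto

lemma ip_Cauchy_Schwarz:
  assumes f: "f \<in> l2 M" and g: "g \<in> l2 M"
  shows "\<bar>ip M f g\<bar> \<le> nrm M f * nrm M g"
proof -
  have *: "0 \<le> ip M f f - 2 * t * ip M f g + t\<^sup>2 * ip M g g" for t
    using ip_self_nonneg[of M "\<lambda>x. f x - t * g x"] f g
    by (simp only: ip_self_diff l2_scale) (simp add: ip_scale_left ip_scale_right power2_eq_square mult.assoc)
  have "(ip M f g)\<^sup>2 \<le> ip M f f * ip M g g"
  proof (cases "ip M g g = 0")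
    case True
    show ?thesis
    proof (cases "ip M f g = 0")
      case False
      \<comment> \<open>For \<open>ip M g g = 0\<close> the quadratic in t degenerates to an affine
        function, and this choice of t gives it the value -1.\<close>
      then have "0 \<le> ip M f f - 2 * ((ip M f f + 1) / (2 * ip M f g)) * ip M f g"
        using *[of "(ip M f f + 1) / (2 * ip M f g)"] True by simp
      with False show ?thesis by (simp add: field_simps)
    qed (use True in simp)
  next
    case False
    then have pos: "ip M g g > 0" using ip_self_nonneg[of M g] by linarith
    have "0 \<le> ip M f f - (ip M f g)\<^sup>2 / ip M g g"
      using *[of "ip M f g / ip M g g"] pos by (simp add: field_simps power2_eq_square)
    then show ?thesis using pos by (simp add: field_simps)
  qed
  then show ?thesis unfolding nrm_def
    by (metis real_sqrt_abs real_sqrt_le_iff real_sqrt_mult)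
qed

lemma nrm_triangle:
  assumes f: "f \<in> l2 M" and g: "g \<in> l2 M"
  shows "nrm M (\<lambda>x. f x + g x) \<le> nrm M f + nrm M g"
proof (rule power2_le_imp_le)
  show "(nrm M (\<lambda>x. f x + g x))\<^sup>2 \<le> (nrm M f + nrm M g)\<^sup>2"
    using ip_Cauchy_Schwarz[OF f g] by (simp add: power2_sum ip_self_add f g)
qed simp

lemma nrm_scale: "nrm M (\<lambda>x. c * f x) = \<bar>c\<bar> * nrm M f"
  by (simp add: nrm_def ip_scale_left ip_scale_right real_sqrt_mult)

lemma nrm_minus_commute: "nrm M (\<lambda>x. f x - g x) = nrm M (\<lambda>x. g x - f x)"
  unfolding nrm_def ip_def by (intro arg_cong[where f=sqrt] Bochner_Integration.integral_cong) (auto simp: algebra_simps)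

lemma nrm_triangle_diff:
  assumes "f \<in> l2 M" "g \<in> l2 M" "h \<in> l2 M"
  shows "nrm M (\<lambda>x. f x - h x) \<le> nrm M (\<lambda>x. f x - g x) + nrm M (\<lambda>x. g x - h x)"
  using nrm_triangle[of "\<lambda>x. f x - g x" M "\<lambda>x. g x - h x"] assms by (simp add: l2_diff)

lemma nrm_reverse_triangle:
  assumes "f \<in> l2 M" "g \<in> l2 M"
  shows "\<bar>nrm M f - nrm M g\<bar> \<le> nrm M (\<lambda>x. f x - g x)"
  using nrm_triangle_diff[of f M g "\<lambda>x. 0"] nrm_triangle_diff[of g M f "\<lambda>x. 0"] assms
    nrm_minus_commute[of M f g] by simp

lemma nrm_mono:
  assumes "f \<in> borel_measurable M" "g \<in> l2 M" "AE x in M. \<bar>f x\<bar> \<le> \<bar>g x\<bar>"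
  shows "nrm M f \<le> nrm M g"
proof -
  have "f \<in> l2 M" using assms by (rule l2_dominated)
  with assms have "ip M f f \<le> ip M g g" unfolding ip_def
    by (intro integral_mono_AE l2_mult_integrable) (auto simp: abs_le_square_iff power2_eq_square)
  then show ?thesis by (simp add: nrm_def)
qed

lemma ip_tendsto:
  assumes "\<And>n. u n \<in> l2 M" "v \<in> l2 M" "w \<in> l2 M" "(\<lambda>n. nrm M (\<lambda>x. u n x - v x)) \<longlonglongrightarrow> 0"
  shows "(\<lambda>n. ip M (u n) w) \<longlonglongrightarrow> ip M v w"
proof -
  have a: "(\<lambda>n. nrm M (\<lambda>x. u n x - v x) * nrm M w) \<longlonglongrightarrow> 0"
    using tendsto_mult_left_zero[OF assms(4)] .
  have b: "norm (ip M (u n) w - ip M v w) \<le> nrm M (\<lambda>x. u n x - v x) * nrm M w" for n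
    using ip_Cauchy_Schwarz[of "\<lambda>x. u n x - v x" M w] assms by (simp add: ip_diff_left l2_diff)
  from Lim_null_comparison[OF always_eventually[OF allI[OF b]] a]
  show ?thesis by (rule LIM_zero_cancel)
qed

lemma nrm_tendsto:
  assumes "\<And>n. u n \<in> l2 M" "v \<in> l2 M" "(\<lambda>n. nrm M (\<lambda>x. u n x - v x)) \<longlonglongrightarrow> 0"
  shows "(\<lambda>n. nrm M (u n)) \<longlonglongrightarrow> nrm M v"
proof -
  have "norm (nrm M (u n) - nrm M v) \<le> nrm M (\<lambda>x. u n x - v x)" for n
    using nrm_reverse_triangle[OF assms(1,2)] by simp
  from Lim_null_comparison[OF always_eventually[OF allI[OF this]] assms(3)]
  show ?thesis by (rule LIM_zero_cancel)
qed

lemma l2_AE_subseq: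
  assumes "\<And>n. u n \<in> l2 M" "v \<in> l2 M" "(\<lambda>n. nrm M (\<lambda>x. u n x - v x)) \<longlonglongrightarrow> 0"
  shows "\<exists>r::nat\<Rightarrow>nat. strict_mono r \<and> (AE x in M. (\<lambda>n. u (r n) x) \<longlonglongrightarrow> v x)"
proof -
  have "(\<lambda>n. (nrm M (\<lambda>x. u n x - v x))\<^sup>2) \<longlonglongrightarrow> 0\<^sup>2"
    using assms(3) by (rule tendsto_power)
  then have "(\<lambda>n. LINT x|M. norm ((u n x - v x) * (u n x - v x))) \<longlonglongrightarrow> 0"
    by (simp add: ip_def)
  moreover have "integrable M (\<lambda>x. (u n x - v x) * (u n x - v x))" for n
    using assms by (intro l2_mult_integrable l2_diff)
  ultimately obtain r :: "nat \<Rightarrow> nat" where r: "strict_mono r"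
    "AE x in M. (\<lambda>n. (u (r n) x - v x) * (u (r n) x - v x)) \<longlonglongrightarrow> 0"
    using tendsto_L1_AE_subseq[of M "\<lambda>n x. (u n x - v x) * (u n x - v x)"] by blast
  have "(\<lambda>n. u (r n) x) \<longlonglongrightarrow> v x"
    if "(\<lambda>n. (u (r n) x - v x) * (u (r n) x - v x)) \<longlonglongrightarrow> 0" for x
  proof -
    have "(\<lambda>n. sqrt ((u (r n) x - v x) * (u (r n) x - v x))) \<longlonglongrightarrow> sqrt 0"
      using that by (rule tendsto_real_sqrt)
    then have "(\<lambda>n. \<bar>u (r n) x - v x\<bar>) \<longlonglongrightarrow> 0" by simp
    then show ?thesis using LIM_zero_cancel tendsto_rabs_zero_iff by blast
  qed
  with r(2) have "AE x in M. (\<lambda>n. u (r n) x) \<longlonglongrightarrow> v x" by auto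
  with r(1) show ?thesis by blast
qed

text \<open>Vanishing almost everywhere on a fixed set survives L2 limits, since a subsequence
  converges pointwise almost everywhere.\<close>

lemma AE_zero_if_l2_limit:
  assumes "\<And>n. u n \<in> l2 M" "v \<in> l2 M" "(\<lambda>n. nrm M (\<lambda>x. u n x - v x)) \<longlonglongrightarrow> 0"
    "\<And>n. AE x in M. x \<in> S \<longrightarrow> u n x = 0"
  shows "AE x in M. x \<in> S \<longrightarrow> v x = 0"
proof -
  obtain r :: "nat \<Rightarrow> nat" where r: "AE x in M. (\<lambda>n. u (r n) x) \<longlonglongrightarrow> v x"
    using l2_AE_subseq[OF assms(1-3)] by blast
  have "AE x in M. \<forall>n. x \<in> S \<longrightarrow> u (r n) x = 0"
    unfolding AE_all_countable using assms(4) by blast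
  with r show ?thesis by eventually_elim (auto simp: LIMSEQ_const_iff)
qed

section \<open>Completeness of L2\<close>

lemma nn_integral_square_l2:
  "f \<in> l2 M \<Longrightarrow> (\<integral>\<^sup>+x. ennreal ((f x)\<^sup>2) \<partial>M) = ennreal (ip M f f)"
  using nn_integral_eq_integral[OF l2_integrable_square[of f M]]
  by (simp add: ip_def power2_eq_square)

lemma l2_complete:
  assumes u: "\<And>n. u n \<in> l2 M"
    and cauchy: "\<And>e. e > 0 \<Longrightarrow> \<exists>N. \<forall>m\<ge>N. \<forall>n\<ge>N. nrm M (\<lambda>x. u m x - u n x) < e"
  shows "\<exists>v \<in> l2 M. (\<lambda>n. nrm M (\<lambda>x. u n x - v x)) \<longlonglongrightarrow> 0"
proof -
  note [measurable] = l2_measurable[OF u]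
  have "\<exists>N. \<forall>m\<ge>N. \<forall>n\<ge>N. nrm M (\<lambda>x. u m x - u n x) < (1/2)^k" for k :: nat
    using cauchy[of "(1/2)^k"] by simp
  then obtain N where N: "\<And>k m n. m \<ge> N k \<Longrightarrow> n \<ge> N k \<Longrightarrow> nrm M (\<lambda>x. u m x - u n x) < (1/2)^k"
    by metis
  \<comment> \<open>Adding up the \<open>N i\<close> makes \<open>r\<close> increasing with
    \<open>r k \<ge> N k\<close>, and the summand k gives \<open>r k \<ge> k\<close>, which lets the
    subsequence pass any given index.\<close>
  define r where "r k = (\<Sum>i\<le>k. N i) + k" for k
  have rN: "r k \<ge> N k" for k unfolding r_def
    using member_le_sum[of k "{..k}" N] by simp
  have rmono: "r k \<le> r (Suc k)" for k unfolding r_def by simp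
  define d where "d k x = u (r (Suc k)) x - u (r k) x" for k x
  have d: "d k \<in> l2 M" for k unfolding d_def using u by (intro l2_diff)
  note [measurable] = l2_measurable[OF d]
  have dn: "nrm M (d k) < (1/2)^k" for k
    unfolding d_def using N[of k "r (Suc k)" "r k"] rN[of k] rmono[of k] by auto
  \<comment> \<open>The bound \<open>(1/4)^k\<close> leaves room for the weight \<open>2^k\<close>
    below: the weighted series of squares still has finite integral, and wherever it converges the
    increments are eventually at most \<open>(sqrt (1/2))^k\<close>, hence summable.\<close>
  have dsq: "ip M (d k) (d k) \<le> (1/4)^k" for k
  proof -
    have "(nrm M (d k))\<^sup>2 \<le> ((1/2)^k)\<^sup>2" using dn[of k] by (intro power_mono) auto
    then show ?thesis unfolding nrm_square by (simp add: power2_eq_square flip: power_mult_distrib)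
  qed
  have "(\<integral>\<^sup>+x. (\<Sum>k. ennreal (2^k * (d k x)\<^sup>2)) \<partial>M) = (\<Sum>k. \<integral>\<^sup>+x. ennreal (2^k * (d k x)\<^sup>2) \<partial>M)"
    by (rule nn_integral_suminf) measurable
  also have "\<dots> = (\<Sum>k. ennreal (2^k * ip M (d k) (d k)))"
    by (simp add: ennreal_mult nn_integral_cmult nn_integral_square_l2[OF d])
  also have "\<dots> \<le> (\<Sum>k. ennreal ((1/2)^k))"
  proof (intro suminf_le ennreal_leI)
    fix k
    have "2^k * ip M (d k) (d k) \<le> 2^k * (1/4)^k" using dsq[of k] by (intro mult_left_mono) auto
    also have "\<dots> = (1/2)^k" by (simp flip: power_mult_distrib)
    finally show "2^k * ip M (d k) (d k) \<le> (1/2)^k" .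
  qed auto
  also have "\<dots> = ennreal (\<Sum>k. (1/2)^k)"
    by (rule suminf_ennreal2) auto
  finally have "(\<integral>\<^sup>+x. (\<Sum>k. ennreal (2^k * (d k x)\<^sup>2)) \<partial>M) \<noteq> \<infinity>"
    by (auto simp: top_unique)
  then have fin: "AE x in M. (\<Sum>k. ennreal (2^k * (d k x)\<^sup>2)) \<noteq> \<infinity>"
    by (intro nn_integral_PInf_AE) auto
  have conv: "convergent (\<lambda>k. u (r k) x)" if x: "(\<Sum>k. ennreal (2^k * (d k x)\<^sup>2)) \<noteq> \<infinity>" for x
  proof -
    have "summable (\<lambda>k. 2^k * (d k x)\<^sup>2)"
      using x by (intro summable_suminf_not_top) auto
    then have "(\<lambda>k. 2^k * (d k x)\<^sup>2) \<longlonglongrightarrow> 0" by (rule summable_LIMSEQ_zero)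
    then have "eventually (\<lambda>k. 2^k * (d k x)\<^sup>2 < 1) sequentially"
      by (rule order_tendstoD) simp
    then have ev: "eventually (\<lambda>k. norm (d k x) \<le> (sqrt (1/2))^k) sequentially"
    proof eventually_elim
      case (elim k)
      have "(d k x)\<^sup>2 \<le> (1/2)^k" using elim by (simp add: field_simps)
      then have "sqrt ((d k x)\<^sup>2) \<le> sqrt ((1/2)^k)" by (rule real_sqrt_le_mono)
      then show ?case unfolding real_sqrt_abs by (simp add: real_sqrt_power)
    qed
    have "sqrt (1/2) < (1::real)" using real_sqrt_less_iff[of "1/2" 1] by simp
    then have "summable (\<lambda>k. (sqrt (1/2))^k :: real)" by (intro summable_geometric) auto
    with ev have "summable (\<lambda>k. d k x)"
      by (intro summable_comparison_test_ev[of "\<lambda>k. d k x" "\<lambda>k. (sqrt (1/2))^k"])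
    then have "convergent (\<lambda>n. \<Sum>k<n. d k x)" by (simp add: summable_iff_convergent)
    moreover have "(\<Sum>k<n. d k x) = u (r n) x - u (r 0) x" for n
      unfolding d_def by (rule sum_lessThan_telescope)
    ultimately have "convergent (\<lambda>n. u (r n) x - u (r 0) x)" by simp
    then show ?thesis using convergent_diff_const_right_iff[of "\<lambda>n. u (r n) x" "u (r 0) x"]
      by (simp add: convergent_diff_const_right_iff)
  qed
  define v where "v x = lim (\<lambda>k. u (r k) x)" for x
  have [measurable]: "v \<in> borel_measurable M" unfolding v_def by measurable
  have lim: "AE x in M. (\<lambda>k. u (r k) x) \<longlonglongrightarrow> v x"
    using fin
  proof eventually_elim
    case (elim x)
    from conv[OF elim] show ?case unfolding v_def convergent_LIMSEQ_iff .
  qed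
  \<comment> \<open>Fatou along the subsequence turns the Cauchy condition into a bound on the
    distance to the pointwise limit. It is stated with the nonnegative integral because membership
    of \<open>v\<close> in \<open>l2\<close> is still to be derived from it.\<close>
  have est: "(\<integral>\<^sup>+x. ennreal ((u n x - v x)\<^sup>2) \<partial>M) \<le> ennreal (e\<^sup>2)"
    if "\<forall>m\<ge>K. \<forall>n\<ge>K. nrm M (\<lambda>x. u m x - u n x) < e" "n \<ge> K" "e > 0" for n K e
  proof -
    have "(\<integral>\<^sup>+x. ennreal ((u n x - v x)\<^sup>2) \<partial>M)
        = (\<integral>\<^sup>+x. liminf (\<lambda>k. ennreal ((u n x - u (r k) x)\<^sup>2)) \<partial>M)"
    proof (rule nn_integral_cong_AE)
      show "AE x in M. ennreal ((u n x - v x)\<^sup>2) = liminf (\<lambda>k. ennreal ((u n x - u (r k) x)\<^sup>2))"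
        using lim
      proof eventually_elim
        case (elim x)
        have "(\<lambda>k. ennreal ((u n x - u (r k) x)\<^sup>2)) \<longlonglongrightarrow> ennreal ((u n x - v x)\<^sup>2)"
          by (intro tendsto_ennrealI tendsto_intros elim)
        from lim_imp_Liminf[OF _ this] show ?case by simp
      qed
    qed
    also have "\<dots> \<le> liminf (\<lambda>k. \<integral>\<^sup>+x. ennreal ((u n x - u (r k) x)\<^sup>2) \<partial>M)"
      by (rule nn_integral_liminf) measurable
    also have "\<dots> = liminf (\<lambda>k. ennreal (ip M (\<lambda>x. u n x - u (r k) x) (\<lambda>x. u n x - u (r k) x)))"
      using nn_integral_square_l2[OF l2_diff[OF u u]] by simp
    also have "\<dots> \<le> liminf (\<lambda>k. ennreal (e\<^sup>2))"
    proof (rule Liminf_mono)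
      have "ennreal (ip M (\<lambda>x. u n x - u (r k) x) (\<lambda>x. u n x - u (r k) x)) \<le> ennreal (e\<^sup>2)" if "k \<ge> K" for k
      proof -
        have "r k \<ge> K" using that unfolding r_def by simp
        then have "(nrm M (\<lambda>x. u n x - u (r k) x))\<^sup>2 \<le> e\<^sup>2"
          using \<open>\<forall>m\<ge>K. \<forall>n\<ge>K. nrm M (\<lambda>x. u m x - u n x) < e\<close> \<open>n \<ge> K\<close>
          by (intro power_mono) (auto intro: less_imp_le)
        then show ?thesis by (simp add: ennreal_leI)
      qed
      then show "\<forall>\<^sub>F k in sequentially. ennreal (ip M (\<lambda>x. u n x - u (r k) x) (\<lambda>x. u n x - u (r k) x)) \<le> ennreal (e\<^sup>2)"
        by (auto simp: eventually_sequentially)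
    qed
    also have "\<dots> = ennreal (e\<^sup>2)" by (simp add: Liminf_const)
    finally show ?thesis .
  qed
  have diff: "(\<lambda>x. u n x - v x) \<in> l2 M \<and> nrm M (\<lambda>x. u n x - v x) \<le> e"
    if "\<forall>m\<ge>K. \<forall>n\<ge>K. nrm M (\<lambda>x. u m x - u n x) < e" "n \<ge> K" "e > 0" for n K e
  proof
    show *: "(\<lambda>x. u n x - v x) \<in> l2 M" unfolding l2_def
      using est[OF that] by (auto intro!: integrableI_bounded simp: le_less_trans)
    have "ennreal (ip M (\<lambda>x. u n x - v x) (\<lambda>x. u n x - v x)) \<le> ennreal (e\<^sup>2)"
      using est[OF that] nn_integral_square_l2[OF *] by simp
    then have "ip M (\<lambda>x. u n x - v x) (\<lambda>x. u n x - v x) \<le> e\<^sup>2" by (simp add: ennreal_le_iff)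
    then show "nrm M (\<lambda>x. u n x - v x) \<le> e" unfolding nrm_def using \<open>e > 0\<close> by (intro real_le_lsqrt) auto
  qed
  obtain K where "\<forall>m\<ge>K. \<forall>n\<ge>K. nrm M (\<lambda>x. u m x - u n x) < 1" using cauchy[of 1] by auto
  then have "(\<lambda>x. u K x - v x) \<in> l2 M" using diff by force
  from l2_diff[OF u[of K] this] have "v \<in> l2 M" by simp
  moreover have "(\<lambda>n. nrm M (\<lambda>x. u n x - v x)) \<longlonglongrightarrow> 0"
  proof (rule LIMSEQ_I)
    fix e :: real assume "e > 0"
    then obtain K where "\<forall>m\<ge>K. \<forall>n\<ge>K. nrm M (\<lambda>x. u m x - u n x) < e / 2"
      using cauchy[of "e / 2"] by auto
    then have "\<forall>n\<ge>K. nrm M (\<lambda>x. u n x - v x) \<le> e / 2" using diff[of K "e / 2"] \<open>e > 0\<close> by auto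
    then show "\<exists>no. \<forall>n\<ge>no. norm (nrm M (\<lambda>x. u n x - v x) - 0) < e"
      using \<open>e > 0\<close> by (intro exI[of _ K]) fastforce
  qed
  ultimately show ?thesis by blast
qed

text \<open>The blocks of a convergent series are small, so the sequence is Cauchy. This is the form
  in which both the expansions of functions and those of their gradients are summed.\<close>

lemma l2_convergent_if_summable_bound:
  assumes u: "\<And>n. u n \<in> l2 M" and a: "summable (a :: nat \<Rightarrow> real)"
    and le: "\<And>m n. n \<le> m \<Longrightarrow> ip M (\<lambda>x. u m x - u n x) (\<lambda>x. u m x - u n x) \<le> (\<Sum>j\<in>{n..<m}. a j)"
  shows "\<exists>v \<in> l2 M. (\<lambda>n. nrm M (\<lambda>x. u n x - v x)) \<longlonglongrightarrow> 0"
proof (rule l2_complete[OF u])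
  fix e :: real assume e: "e > 0"
  then obtain N where N: "\<And>m n. m \<ge> N \<Longrightarrow> norm (\<Sum>j\<in>{m..<n}. a j) < e\<^sup>2"
    using a summable_Cauchy[of a] by (metis zero_less_power)
  have *: "nrm M (\<lambda>x. u m x - u n x) < e" if "n \<ge> N" "n \<le> m" for m n
  proof -
    have "ip M (\<lambda>x. u m x - u n x) (\<lambda>x. u m x - u n x) < e\<^sup>2"
      using le[OF that(2)] N[OF that(1), of m] by simp
    then have "(nrm M (\<lambda>x. u m x - u n x))\<^sup>2 < e\<^sup>2" by simp
    then show ?thesis using e by (intro power2_less_imp_less[of _ e]) auto
  qed
  have "nrm M (\<lambda>x. u m x - u n x) < e" if "n \<ge> N" "m \<ge> N" for m n
    using *[of n m] *[of m n] that nrm_minus_commute[of M "u m" "u n"] by (cases "n \<le> m") auto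
  then show "\<exists>N. \<forall>m\<ge>N. \<forall>n\<ge>N. nrm M (\<lambda>x. u m x - u n x) < e" by blast
qed

section \<open>Expansions in an abstract complete orthonormal system\<close>

locale complete_orthonormal =
  fixes M :: "'a measure" and \<phi> :: "nat \<Rightarrow> 'a \<Rightarrow> real"
  assumes basis_l2: "\<And>j. \<phi> j \<in> l2 M"
    and orthonormal: "\<And>i j. ip M (\<phi> i) (\<phi> j) = (if i = j then 1 else 0)"
    and complete: "\<And>v. v \<in> l2 M \<Longrightarrow> (\<And>j. ip M v (\<phi> j) = 0) \<Longrightarrow> AE x in M. v x = 0"
begin

abbreviation coef :: "('a \<Rightarrow> real) \<Rightarrow> nat \<Rightarrow> real" where "coef v j \<equiv> ip M v (\<phi> j)"

definition psum :: "(nat \<Rightarrow> real) \<Rightarrow> nat \<Rightarrow> 'a \<Rightarrow> real" where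
  "psum c n x = (\<Sum>j<n. c j * \<phi> j x)"

lemma psum_l2: "psum c n \<in> l2 M"
  unfolding psum_def[abs_def] by (intro l2_sum l2_scale basis_l2)

lemma ip_psum: "v \<in> l2 M \<Longrightarrow> ip M (psum c n) v = (\<Sum>j<n. c j * coef v j)"
  unfolding psum_def[abs_def]
  by (subst ip_sum_left) (auto simp: l2_scale basis_l2 ip_scale_left ip_commute[of M v])

lemma coef_psum: "coef (psum c n) j = (if j < n then c j else 0)"
  by (subst ip_psum[OF basis_l2]) (simp add: orthonormal if_distrib sum.delta' cong: if_cong)

lemma coef_add: "u \<in> l2 M \<Longrightarrow> v \<in> l2 M \<Longrightarrow> coef (\<lambda>x. u x + v x) j = coef u j + coef v j"
  by (simp add: ip_add_left basis_l2)

lemma coef_diff: "u \<in> l2 M \<Longrightarrow> v \<in> l2 M \<Longrightarrow> coef (\<lambda>x. u x - v x) j = coef u j - coef v j"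
  by (simp add: ip_diff_left basis_l2)

lemma coef_eq_imp_AE_eq:
  assumes "u \<in> l2 M" "v \<in> l2 M" "\<And>j. coef u j = coef v j"
  shows "AE x in M. u x = v x"
  using complete[of "\<lambda>x. u x - v x"] assms by (auto simp: l2_diff coef_diff)

lemma psum_diff_square:
  assumes "n \<le> m"
  shows "ip M (\<lambda>x. psum c m x - psum c n x) (\<lambda>x. psum c m x - psum c n x) = (\<Sum>j\<in>{n..<m}. (c j)\<^sup>2)"
proof -
  have le: "(\<Sum>j<n. c j * (if j < m then c j else 0)) = (\<Sum>j<n. (c j)\<^sup>2)"
    using assms by (intro sum.cong) (auto simp: power2_eq_square)
  have "ip M (\<lambda>x. psum c m x - psum c n x) (\<lambda>x. psum c m x - psum c n x)
    = (\<Sum>j<m. (c j)\<^sup>2) - (\<Sum>j<n. (c j)\<^sup>2)"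
    using le by (simp add: ip_self_diff psum_l2 ip_commute[of M "psum c m" "psum c n"] ip_psum coef_psum power2_eq_square)
  also have "\<dots> = (\<Sum>j\<in>{n..<m}. (c j)\<^sup>2)"
    using sum_diff_nat_ivl[of 0 n m "\<lambda>j. (c j)\<^sup>2"] assms by (simp add: atLeast0LessThan)
  finally show ?thesis .
qed

lemma riesz_fischer:
  assumes "summable (\<lambda>j. (c j)\<^sup>2)"
  shows "\<exists>u \<in> l2 M. (\<forall>j. coef u j = c j) \<and> (\<lambda>n. nrm M (\<lambda>x. psum c n x - u x)) \<longlonglongrightarrow> 0"
proof -
  obtain u where u: "u \<in> l2 M" "(\<lambda>n. nrm M (\<lambda>x. psum c n x - u x)) \<longlonglongrightarrow> 0"
    using l2_convergent_if_summable_bound[of "psum c" M, OF psum_l2 assms] psum_diff_square by fastforce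
  have "coef u j = c j" for j
  proof -
    have "(\<lambda>n. coef (psum c n) j) \<longlonglongrightarrow> coef u j"
      by (rule ip_tendsto[OF psum_l2 u(1) basis_l2 u(2)])
    moreover have "(\<lambda>n. coef (psum c n) j) \<longlonglongrightarrow> c j"
      by (rule tendsto_eventually) (auto simp: coef_psum eventually_sequentially intro!: exI[of _ "Suc j"])
    ultimately show ?thesis by (rule LIMSEQ_unique)
  qed
  with u show ?thesis by blast
qed

lemma bessel:
  assumes "u \<in> l2 M"
  shows "(\<Sum>j<n. (coef u j)\<^sup>2) \<le> ip M u u"
proof -
  have "0 \<le> ip M (\<lambda>x. u x - psum (coef u) n x) (\<lambda>x. u x - psum (coef u) n x)" by simp
  also have "\<dots> = ip M u u - (\<Sum>j<n. (coef u j)\<^sup>2)"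
    using assms by (simp add: ip_self_diff psum_l2 ip_psum coef_psum ip_commute[of M u "psum (coef u) n"]
       power2_eq_square)
  finally show ?thesis by simp
qed

lemma summable_coef_square: "u \<in> l2 M \<Longrightarrow> summable (\<lambda>j. (coef u j)\<^sup>2)"
  by (rule bounded_imp_summable[where B="ip M u u"]) (auto simp: bessel simp del: sum.lessThan_Suc simp flip: lessThan_Suc_atMost)

text \<open>Riesz-Fischer supplies some limit of the partial sums; it has the coefficients of
  \<open>u\<close>, so completeness identifies it with \<open>u\<close> almost everywhere.\<close>

lemma psum_coef_tendsto:
  assumes "u \<in> l2 M"
  shows "(\<lambda>n. nrm M (\<lambda>x. psum (coef u) n x - u x)) \<longlonglongrightarrow> 0"
proof -
  obtain v where v: "v \<in> l2 M" "\<And>j. coef v j = coef u j"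
    "(\<lambda>n. nrm M (\<lambda>x. psum (coef u) n x - v x)) \<longlonglongrightarrow> 0"
    using riesz_fischer[OF summable_coef_square[OF assms]] by blast
  have "AE x in M. v x = u x" using coef_eq_imp_AE_eq[OF v(1) assms v(2)] .
  then have "nrm M (\<lambda>x. psum (coef u) n x - v x) = nrm M (\<lambda>x. psum (coef u) n x - u x)" for n
    unfolding nrm_def using l2_measurable[OF v(1)] l2_measurable[OF assms] l2_measurable[OF psum_l2]
    by (intro arg_cong[where f=sqrt] ip_cong_AE) auto
  with v(3) show ?thesis by simp
qed

lemma parseval:
  assumes "u \<in> l2 M" "v \<in> l2 M"
  shows "(\<lambda>j. coef u j * coef v j) sums ip M u v"
  unfolding sums_def
  using ip_tendsto[OF psum_l2 assms(1) assms(2) psum_coef_tendsto[OF assms(1)]] by (simp add: ip_psum assms)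

end

section \<open>Fractional powers as superpositions of resolvents\<close>

text \<open>\<open>l + \<mu>\<close> divides \<open>l ^ n - (-\<mu>) ^ n\<close>, and the quotient
  has degree n - 1 in \<open>l\<close>. With n = m + 1 it contains only powers whose moments
  vanish.\<close>

lemma resolvent_expansion:
  fixes l \<mu> :: real
  assumes "l + \<mu> \<noteq> 0"
  shows "l ^ n / (l + \<mu>) = (\<Sum>k<n. (-\<mu>) ^ (n - 1 - k) * l ^ k) + (-\<mu>) ^ n / (l + \<mu>)"
proof -
  have "l ^ n - (-\<mu>) ^ n = (l - (-\<mu>)) * (\<Sum>k<n. (-\<mu>) ^ (n - Suc k) * l ^ k)"
    by (rule power_diff_sumr2)
  then have "l ^ n = (l + \<mu>) * (\<Sum>k<n. (-\<mu>) ^ (n - Suc k) * l ^ k) + (-\<mu>) ^ n"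
    by simp
  then show ?thesis using assms by (simp add: add_divide_distrib)
qed

text \<open>A witness of positive measure: a nonnegative function on the line that is positive on
  the unit interval cannot have integral 0. Each strict positivity proof for an integral over \<mu>
  or over time ends here.\<close>

lemma AE_not_unit_interval: "\<not> (AE x in lborel. x \<notin> {0<..<1::real})"
proof
  assume "AE x in lborel. x \<notin> {0<..<1::real}"
  then have "{0<..<1::real} \<in> null_sets lborel"
    by (subst AE_iff_null_sets) auto
  then show False by auto
qed

text \<open>The integrand is below \<mu>^(\<sigma> - 1) near 0 and below \<mu>^(\<sigma> - 2) from 1
  on; these are integrable because \<sigma> > 0 and \<sigma> < 1 respectively.\<close>

lemma stieltjes_constant:
  fixes \<sigma> :: real
  assumes "0 < \<sigma>" "\<sigma> < 1"
  shows "\<exists>K>0. (\<integral>\<^sup>+\<mu>\<in>{0<..}. ennreal (\<mu> powr (\<sigma> - 1) / (1 + \<mu>)) \<partial>lborel) = ennreal K"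
proof -
  let ?h = "\<lambda>\<mu>::real. \<mu> powr (\<sigma> - 1) / (1 + \<mu>)"
  let ?I = "\<integral>\<^sup>+\<mu>\<in>{0<..}. ennreal (?h \<mu>) \<partial>lborel"
  have i1: "set_integrable lborel {0<..<1} (\<lambda>\<mu>::real. \<mu> powr (\<sigma> - 1))"
  proof -
    have "(\<lambda>\<mu>::real. \<mu> powr (\<sigma> - 1)) absolutely_integrable_on {0..1}"
      using has_integral_powr_from_0[of "\<sigma> - 1" 1] assms
      by (intro nonnegative_absolutely_integrable_1) (auto simp: integrable_on_def)
    then have "(\<lambda>\<mu>::real. \<mu> powr (\<sigma> - 1)) absolutely_integrable_on {0<..<1}"
      by (rule set_integrable_subset) auto
    then show ?thesis unfolding set_integrable_def
      by (subst (asm) integrable_completion) auto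
  qed
  have i2: "set_integrable lborel {1..} (\<lambda>\<mu>::real. \<mu> powr (\<sigma> - 2))"
  proof -
    have "(\<lambda>\<mu>::real. \<mu> powr (\<sigma> - 2)) absolutely_integrable_on {1..}"
      using has_integral_powr_to_inf[of "\<sigma> - 2" 1] assms
      by (intro nonnegative_absolutely_integrable_1) (auto simp: integrable_on_def)
    then show ?thesis unfolding set_integrable_def
      by (subst (asm) integrable_completion) auto
  qed
  have "?I \<le> (\<integral>\<^sup>+\<mu>. ennreal (indicator {0<..<1} \<mu> *\<^sub>R \<mu> powr (\<sigma> - 1) + indicator {1..} \<mu> *\<^sub>R \<mu> powr (\<sigma> - 2)) \<partial>lborel)"
  proof (intro nn_integral_mono)
    fix \<mu> :: real
    have "?h \<mu> \<le> \<mu> powr (\<sigma> - 1)" if "\<mu> > 0"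
      using that by (simp add: divide_le_eq mult_le_cancel_left1)
    moreover have "?h \<mu> \<le> \<mu> powr (\<sigma> - 2)" if "\<mu> \<ge> 1"
    proof -
      have "\<mu> powr (\<sigma> - 1) = \<mu> powr (\<sigma> - 2) * \<mu>"
        using that powr_add[of \<mu> "\<sigma> - 2" 1] by simp
      then show ?thesis using that by (simp add: divide_le_eq)
    qed
    ultimately show "ennreal (?h \<mu>) * indicator {0<..} \<mu> \<le>
       ennreal (indicator {0<..<1} \<mu> *\<^sub>R \<mu> powr (\<sigma> - 1) + indicator {1..} \<mu> *\<^sub>R \<mu> powr (\<sigma> - 2))"
      by (auto simp: indicator_def intro!: ennreal_leI)
  qed
  also have "\<dots> < \<infinity>"
    using i1 i2 unfolding set_integrable_def
    by (subst nn_integral_eq_integral) auto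
  finally have fin: "?I < \<infinity>" .
  have "?I \<noteq> 0"
  proof
    assume "?I = 0"
    then have "AE \<mu> in lborel. ennreal (?h \<mu>) * indicator {0<..} \<mu> = 0"
      by (subst (asm) nn_integral_0_iff_AE) auto
    then have "AE \<mu> in lborel. \<mu> \<notin> {0<..<1::real}"
      by eventually_elim (auto simp: indicator_def)
    then show False using AE_not_unit_interval by blast
  qed
  with fin show ?thesis
    by (intro exI[of _ "enn2real ?I"]) (auto simp: enn2real_positive_iff zero_less_iff_neq_zero)
qed

text \<open>Substituting \<open>l * \<mu>\<close> for \<open>\<mu>\<close>: the integrand is
  homogeneous of degree \<sigma> - 2 in (l, \<mu>), and the measure contributes one more power of
  \<open>l\<close>.\<close>

lemma stieltjes_powr:
  fixes \<sigma> l :: real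
  assumes "0 < \<sigma>" "\<sigma> < 1" "l > 0"
  shows "(\<integral>\<^sup>+\<mu>\<in>{0<..}. ennreal (\<mu> powr (\<sigma> - 1) / (l + \<mu>)) \<partial>lborel) =
    ennreal (l powr (\<sigma> - 1)) * (\<integral>\<^sup>+\<mu>\<in>{0<..}. ennreal (\<mu> powr (\<sigma> - 1) / (1 + \<mu>)) \<partial>lborel)"
proof -
  have "(\<integral>\<^sup>+\<mu>. ennreal (\<mu> powr (\<sigma> - 1) / (l + \<mu>)) * indicator {0<..} \<mu> \<partial>lborel)
    = ennreal \<bar>l\<bar> * (\<integral>\<^sup>+\<mu>. ennreal ((0 + l * \<mu>) powr (\<sigma> - 1) / (l + (0 + l * \<mu>))) * indicator {0<..} (0 + l * \<mu>) \<partial>lborel)"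
    using assms by (intro nn_integral_real_affine) auto
  also have "\<dots> = (\<integral>\<^sup>+\<mu>. ennreal (l powr (\<sigma> - 1)) * (ennreal (\<mu> powr (\<sigma> - 1) / (1 + \<mu>)) * indicator {0<..} \<mu>) \<partial>lborel)"
  proof (subst nn_integral_cmult[symmetric], measurable, intro nn_integral_cong)
    fix \<mu> :: real
    show "ennreal \<bar>l\<bar> * (ennreal ((0 + l * \<mu>) powr (\<sigma> - 1) / (l + (0 + l * \<mu>))) * indicator {0<..} (0 + l * \<mu>))
      = ennreal (l powr (\<sigma> - 1)) * (ennreal (\<mu> powr (\<sigma> - 1) / (1 + \<mu>)) * indicator {0<..} \<mu>)"
    proof (cases "\<mu> > 0")
      case True
      have "l * ((l * \<mu>) powr (\<sigma> - 1) / (l + l * \<mu>)) = l powr (\<sigma> - 1) * (\<mu> powr (\<sigma> - 1) / (1 + \<mu>))"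
        using assms True by (simp add: powr_mult distrib_left[of l 1 \<mu>, simplified, symmetric])
      then show ?thesis using True assms by (simp add: zero_less_mult_iff flip: ennreal_mult)
    qed (use assms in \<open>auto simp: zero_less_mult_iff\<close>)
  qed
  also have "\<dots> = ennreal (l powr (\<sigma> - 1)) * (\<integral>\<^sup>+\<mu>\<in>{0<..}. ennreal (\<mu> powr (\<sigma> - 1) / (1 + \<mu>)) \<partial>lborel)"
    by (rule nn_integral_cmult) measurable
  finally show ?thesis .
qed

text \<open>The sign comes from writing \<open>\<lambda>\<^sup>s\<close> as a superposition of \<open>\<lambda>\<^sup>m\<^sup>+\<^sup>1 / (\<lambda> + \<mu>)\<close>; modulo polynomials
  of degree \<open>m\<close> in \<open>\<lambda>\<close> the latter is \<open>(-\<mu>)\<^sup>m\<^sup>+\<^sup>1 / (\<lambda> + \<mu>)\<close>.\<close>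

lemma fractional_power_sign:
  fixes l c :: "'a \<Rightarrow> real" and s :: real and m :: nat
  assumes sf: "sigma_finite_measure M"
    and [measurable]: "l \<in> borel_measurable M" "c \<in> borel_measurable M"
    and l0: "\<And>x. l x \<ge> 0"
    and s: "real m < s" "s < real m + 1"
    and c: "integrable M c" and cs: "integrable M (\<lambda>x. l x powr s * c x)"
    and poly: "\<And>k. k \<le> m \<Longrightarrow> (LINT x|M. l x ^ k * c x) = 0"
    and pos: "\<And>\<mu>. \<mu> > 0 \<Longrightarrow> (LINT x|M. c x / (l x + \<mu>)) > 0"
  shows "(-1) ^ Suc m * (LINT x|M. l x powr s * c x) > 0"
proof -
  interpret sigma_finite_measure M by (rule sf)
  interpret pair_sigma_finite M "lborel :: real measure" ..
  define \<sigma> where "\<sigma> = s - real m"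
  have \<sigma>: "0 < \<sigma>" "\<sigma> < 1" using s by (auto simp: \<sigma>_def)
  obtain K where K: "K > 0" "(\<integral>\<^sup>+\<mu>\<in>{0<..}. ennreal (\<mu> powr (\<sigma> - 1) / (1 + \<mu>)) \<partial>lborel) = ennreal K"
    using stieltjes_constant[OF \<sigma>] by blast
  have powle: "l x ^ k \<le> 1 + l x powr s" if "k \<le> m" for x k
  proof (cases "l x \<le> 1")
    case True
    then have "l x ^ k \<le> 1" using l0 by (intro power_le_one) auto
    then show ?thesis by (smt (verit) powr_ge_zero)
  next
    case False
    then have "l x ^ k = l x powr real k" by (simp add: powr_realpow)
    also have "\<dots> \<le> l x powr s" using False s that by (intro powr_mono) auto
    finally show ?thesis by simp
  qed
  have ck: "integrable M (\<lambda>x. l x ^ k * c x)" if "k \<le> m" for k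
  proof (rule Bochner_Integration.integrable_bound)
    show "integrable M (\<lambda>x. \<bar>c x\<bar> + \<bar>l x powr s * c x\<bar>)" using c cs by auto
    have "\<bar>l x ^ k * c x\<bar> \<le> \<bar>c x\<bar> + \<bar>l x powr s * c x\<bar>" for x
    proof -
      have "\<bar>l x ^ k * c x\<bar> \<le> (1 + l x powr s) * \<bar>c x\<bar>"
        unfolding abs_mult using powle[OF that, of x] l0[of x] by (intro mult_right_mono) auto
      then show ?thesis by (simp add: algebra_simps abs_mult)
    qed
    then show "AE x in M. norm (l x ^ k * c x) \<le> norm (\<bar>c x\<bar> + \<bar>l x powr s * c x\<bar>)" by auto
  qed measurable
  have cr: "integrable M (\<lambda>x. c x / (l x + \<mu>))" if "\<mu> > 0" for \<mu>
  proof (rule Bochner_Integration.integrable_bound)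
    show "integrable M (\<lambda>x. \<bar>c x\<bar> / \<mu>)" using c by auto
    show "AE x in M. norm (c x / (l x + \<mu>)) \<le> norm (\<bar>c x\<bar> / \<mu>)"
      using that l0 by (auto intro!: AE_I2 divide_left_mono mult_pos_pos add_nonneg_pos)
  qed measurable
  \<comment> \<open>The pairing of \<open>c\<close> with the integrand of the superposition at a
    fixed \<mu>. Its polynomial part has degree at most m in \<open>l\<close> and is removed by
    \<open>poly\<close>, which leaves the resolvent pairing with the sign of (-\<mu>)^(m +
    1).\<close>
  define \<Psi> where "\<Psi> \<mu> = (LINT x|M. l x ^ Suc m * c x / (l x + \<mu>))" for \<mu>
  have \<Psi>: "\<Psi> \<mu> = (-\<mu>) ^ Suc m * (LINT x|M. c x / (l x + \<mu>))" if \<mu>: "\<mu> > 0" for \<mu>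
  proof -
    have "l x ^ Suc m * c x / (l x + \<mu>) =
       (\<Sum>k<Suc m. (-\<mu>) ^ (Suc m - 1 - k) * (l x ^ k * c x)) + (-\<mu>) ^ Suc m * (c x / (l x + \<mu>))" for x
    proof -
      have "l x ^ Suc m * c x / (l x + \<mu>) = (l x ^ Suc m / (l x + \<mu>)) * c x" by simp
      also have "l x ^ Suc m / (l x + \<mu>) = (\<Sum>k<Suc m. (-\<mu>) ^ (Suc m - 1 - k) * l x ^ k) + (-\<mu>) ^ Suc m / (l x + \<mu>)"
        using \<mu> l0[of x] by (intro resolvent_expansion) auto
      finally show ?thesis by (simp only: distrib_right sum_distrib_right mult.assoc) simp
    qed
    then have "\<Psi> \<mu> = (LINT x|M. (\<Sum>k<Suc m. (-\<mu>) ^ (Suc m - 1 - k) * (l x ^ k * c x)) + (-\<mu>) ^ Suc m * (c x / (l x + \<mu>)))"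
      unfolding \<Psi>_def by presburger
    also have "\<dots> = (LINT x|M. (\<Sum>k<Suc m. (-\<mu>) ^ (Suc m - 1 - k) * (l x ^ k * c x))) + (LINT x|M. (-\<mu>) ^ Suc m * (c x / (l x + \<mu>)))"
      by (intro Bochner_Integration.integral_add Bochner_Integration.integrable_sum integrable_mult_right ck cr \<mu>) auto
    also have "(LINT x|M. (\<Sum>k<Suc m. (-\<mu>) ^ (Suc m - 1 - k) * (l x ^ k * c x)))
      = (\<Sum>k<Suc m. (LINT x|M. (-\<mu>) ^ (Suc m - 1 - k) * (l x ^ k * c x)))"
      by (intro Bochner_Integration.integral_sum integrable_mult_right ck) auto
    also have "\<dots> = 0"
      using poly by (intro sum.neutral) auto
    finally show ?thesis unfolding integral_mult_right_zero by simp
  qed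
  define F where "F x \<mu> = l x ^ Suc m * c x / (l x + \<mu>) * (\<mu> powr (\<sigma> - 1) * indicator {0<..} \<mu>)" for x \<mu>
  have F_meas [measurable]: "(\<lambda>(x, \<mu>). F x \<mu>) \<in> borel_measurable (M \<Otimes>\<^sub>M lborel)"
    unfolding F_def by measurable
  \<comment> \<open>The powers combine to m + 1 + (\<sigma> - 1) = s. At \<open>l x = 0\<close> both
    sides are 0, since \<open>0 powr s = 0\<close>.\<close>
  have inner: "(\<integral>\<^sup>+\<mu>. ennreal (l x ^ Suc m / (l x + \<mu>) * (\<mu> powr (\<sigma> - 1) * indicator {0<..} \<mu>)) \<partial>lborel)
      = ennreal (K * l x powr s)" for x
  proof (cases "l x = 0")
    case False
    then have lx: "l x > 0" using l0[of x] by simp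
    have "(\<integral>\<^sup>+\<mu>. ennreal (l x ^ Suc m / (l x + \<mu>) * (\<mu> powr (\<sigma> - 1) * indicator {0<..} \<mu>)) \<partial>lborel)
      = (\<integral>\<^sup>+\<mu>. ennreal (l x ^ Suc m) * (ennreal (\<mu> powr (\<sigma> - 1) / (l x + \<mu>)) * indicator {0<..} \<mu>) \<partial>lborel)"
      using lx by (intro nn_integral_cong) (auto simp: indicator_def ennreal_mult[symmetric] simp del: power_Suc)
    also have "\<dots> = ennreal (l x ^ Suc m) * (ennreal (l x powr (\<sigma> - 1)) * ennreal K)"
      using stieltjes_powr[OF \<sigma> lx] K by (subst nn_integral_cmult) auto
    also have "\<dots> = ennreal (K * (l x ^ Suc m * l x powr (\<sigma> - 1)))"
      using lx K by (simp add: ennreal_mult[symmetric] mult_ac del: power_Suc)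
    also have "l x ^ Suc m * l x powr (\<sigma> - 1) = l x powr s"
      using lx by (simp add: powr_realpow[symmetric] powr_add[symmetric] \<sigma>_def del: power_Suc)
    finally show ?thesis .
  qed simp
  have F_abs: "(\<integral>\<^sup>+\<mu>. ennreal (norm (F x \<mu>)) \<partial>lborel) = ennreal (K * \<bar>l x powr s * c x\<bar>)" for x
  proof -
    have "(\<integral>\<^sup>+\<mu>. ennreal (norm (F x \<mu>)) \<partial>lborel) =
       (\<integral>\<^sup>+\<mu>. ennreal \<bar>c x\<bar> * ennreal (l x ^ Suc m / (l x + \<mu>) * (\<mu> powr (\<sigma> - 1) * indicator {0<..} \<mu>)) \<partial>lborel)"
      using l0[of x] by (intro nn_integral_cong)
        (auto simp: F_def abs_mult indicator_def ennreal_mult[symmetric] simp del: power_Suc)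
    also have "\<dots> = ennreal \<bar>c x\<bar> * ennreal (K * l x powr s)"
      unfolding inner[symmetric] by (rule nn_integral_cmult) measurable
    finally show ?thesis using K by (simp add: ennreal_mult[symmetric] abs_mult mult_ac)
  qed
  \<comment> \<open>Absolute integrability on the product space follows from that of
    \<open>l x powr s * c x\<close>, because the \<mu>-integral of the modulus is exactly K times
    its modulus. This licenses Fubini.\<close>
  have F_int: "integrable (M \<Otimes>\<^sub>M lborel) (\<lambda>(x, \<mu>). F x \<mu>)"
  proof (rule integrableI_bounded)
    have "(\<integral>\<^sup>+z. ennreal (norm (case z of (x, \<mu>) \<Rightarrow> F x \<mu>)) \<partial>(M \<Otimes>\<^sub>M lborel)) =
      (\<integral>\<^sup>+x. \<integral>\<^sup>+\<mu>. ennreal (norm (F x \<mu>)) \<partial>lborel \<partial>M)"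
      by (subst lborel.nn_integral_fst[symmetric]) auto
    also have "\<dots> = (\<integral>\<^sup>+x. ennreal (K * \<bar>l x powr s * c x\<bar>) \<partial>M)" by (simp only: F_abs)
    also have "\<dots> < \<infinity>" using cs by (subst nn_integral_eq_integral) (use K in auto)
    finally show "(\<integral>\<^sup>+z. ennreal (norm (case z of (x, \<mu>) \<Rightarrow> F x \<mu>)) \<partial>(M \<Otimes>\<^sub>M lborel)) < \<infinity>" .
  qed measurable
  have F_inner: "(LINT \<mu>|lborel. F x \<mu>) = K * (l x powr s * c x)" for x
  proof -
    have "(LINT \<mu>|lborel. F x \<mu>) = (LINT \<mu>|lborel. c x * (l x ^ Suc m / (l x + \<mu>) * (\<mu> powr (\<sigma> - 1) * indicator {0<..} \<mu>)))"
      by (simp add: F_def mult_ac)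
    also have "\<dots> = c x * (LINT \<mu>|lborel. l x ^ Suc m / (l x + \<mu>) * (\<mu> powr (\<sigma> - 1) * indicator {0<..} \<mu>))"
      by (rule integral_mult_right_zero)
    also have "(LINT \<mu>|lborel. l x ^ Suc m / (l x + \<mu>) * (\<mu> powr (\<sigma> - 1) * indicator {0<..} \<mu>)) = K * l x powr s"
    proof (subst integral_eq_nn_integral)
      show "AE \<mu> in lborel. 0 \<le> l x ^ Suc m / (l x + \<mu>) * (\<mu> powr (\<sigma> - 1) * indicator {0<..} \<mu>)"
        using l0[of x] by (auto simp: indicator_def simp del: power_Suc)
    qed (use K in \<open>simp_all only: inner enn2real_ennreal\<close>, auto)
    finally show ?thesis by simp
  qed
  \<comment> \<open>The exponent \<open>s - 1 + 1\<close> is s, obtained as (m + 1) + (\<sigma> -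
    1).\<close>
  have F_outer: "(LINT x|M. F x \<mu>) = (-1) ^ Suc m * (\<mu> powr (s - 1 + 1) * indicator {0<..} \<mu> * (LINT x|M. c x / (l x + \<mu>)))" for \<mu>
  proof (cases "\<mu> > 0")
    case True
    have "(LINT x|M. F x \<mu>) = \<Psi> \<mu> * \<mu> powr (\<sigma> - 1)"
    proof -
      have "(\<lambda>x. F x \<mu>) = (\<lambda>x. l x ^ Suc m * c x / (l x + \<mu>) * \<mu> powr (\<sigma> - 1))"
        using True by (simp add: F_def del: power_Suc)
      then show ?thesis unfolding \<Psi>_def by (simp only: integral_mult_left_zero)
    qed
    also have "\<dots> = (-1) ^ Suc m * ((\<mu> ^ Suc m * \<mu> powr (\<sigma> - 1)) * (LINT x|M. c x / (l x + \<mu>)))"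
      unfolding \<Psi>[OF True] power_minus[of \<mu>] by (simp del: power_Suc)
    also have "\<mu> ^ Suc m * \<mu> powr (\<sigma> - 1) = \<mu> powr (s - 1 + 1)"
      using True by (simp add: powr_realpow[symmetric] powr_add[symmetric] \<sigma>_def del: power_Suc)
    finally show ?thesis using True by simp
  qed (simp add: F_def)
  define H where "H \<mu> = \<mu> powr (s - 1 + 1) * indicator {0<..} \<mu> * (LINT x|M. c x / (l x + \<mu>))" for \<mu>
  have H0: "H \<mu> \<ge> 0" and Hpos: "\<mu> > 0 \<Longrightarrow> H \<mu> > 0" for \<mu>
    using pos[of \<mu>] unfolding H_def by (cases "\<mu> > 0"; simp)+
  have HF: "H = (\<lambda>\<mu>. (-1) ^ Suc m * (LINT x|M. F x \<mu>))"
    by (rule ext) (simp add: F_outer H_def mult.assoc[symmetric] flip: power_add)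
  have Hint: "integrable lborel H"
    unfolding HF using integrable_snd[OF F_int] by (intro integrable_mult_right) auto
  have "K * ((-1) ^ Suc m * (LINT x|M. l x powr s * c x)) = (-1) ^ Suc m * (LINT x|M. LINT \<mu>|lborel. F x \<mu>)"
    by (simp add: F_inner)
  also have "(LINT x|M. LINT \<mu>|lborel. F x \<mu>) = (LINT \<mu>|lborel. LINT x|M. F x \<mu>)"
    by (rule Fubini_integral[OF F_int, symmetric])
  also have "(-1) ^ Suc m * (LINT \<mu>|lborel. LINT x|M. F x \<mu>) = (LINT \<mu>|lborel. H \<mu>)"
    unfolding HF by simp
  also have "\<dots> > 0"
  proof -
    have "(LINT \<mu>|lborel. H \<mu>) \<noteq> 0"
    proof
      assume "(LINT \<mu>|lborel. H \<mu>) = 0"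
      then have "AE \<mu> in lborel. H \<mu> = 0"
        using integral_nonneg_eq_0_iff_AE[OF Hint] H0 by auto
      then have "AE \<mu> in lborel. \<mu> \<notin> {0<..<1::real}"
        by eventually_elim (use Hpos in force)
      then show False using AE_not_unit_interval by blast
    qed
    moreover have "(LINT \<mu>|lborel. H \<mu>) \<ge> 0" using H0 by simp
    ultimately show ?thesis by simp
  qed
  finally show ?thesis using K(1) zero_less_mult_pos by blast
qed

section \<open>Smooth functions and test functions\<close>

lemma partials_append: "partials (bs @ cs) f = partials bs (partials cs f)"
  by (induction bs) auto

text \<open>Smoothness quantifies over all lists of directions; a set of differentiable functions
  that is closed under partial derivatives carries the induction over the list once and for
  all.\<close>

lemma C_infinity_coinduct:
  assumes "f \<in> S" "\<And>g x. g \<in> S \<Longrightarrow> g differentiable (at x)"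
    "\<And>g b. g \<in> S \<Longrightarrow> b \<in> Basis \<Longrightarrow> (\<lambda>x. frechet_derivative g (at x) b) \<in> S"
  shows "f \<in> C_infinity"
proof -
  have "partials bs f \<in> S" if "bs \<in> lists Basis" for bs
    using that assms(1,3) by (induction bs) auto
  with assms(2) show ?thesis by (simp add: C_infinity_def)
qed

lemma C_infinity_coinduct_deriv:
  assumes "f \<in> S" "\<And>g. g \<in> S \<Longrightarrow> \<exists>D. (\<forall>x. (g has_derivative D x) (at x)) \<and> (\<forall>b\<in>Basis. (\<lambda>x. D x b) \<in> S)"
  shows "f \<in> C_infinity"
proof (rule C_infinity_coinduct[OF assms(1)])
  fix g b x assume "g \<in> S"
  then obtain D where D: "\<And>x. (g has_derivative D x) (at x)" "\<And>b. b \<in> Basis \<Longrightarrow> (\<lambda>x. D x b) \<in> S"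
    using assms(2) by blast
  show "g differentiable (at x)" using D(1) by (auto simp: differentiable_def)
  have "frechet_derivative g (at x) = D x" for x
    using frechet_derivative_at[OF D(1)] by simp
  then show "(\<lambda>x. frechet_derivative g (at x) b) \<in> S" if "b \<in> Basis" using D(2)[OF that] by simp
qed

lemma C_infinity_differentiable: "f \<in> C_infinity \<Longrightarrow> f differentiable (at x)"
  unfolding C_infinity_def by (drule CollectD, drule bspec[of _ _ "[]"]) auto

lemma C_infinity_has_derivative:
  "f \<in> C_infinity \<Longrightarrow> (f has_derivative frechet_derivative f (at x)) (at x)"
  using C_infinity_differentiable frechet_derivative_works by blast

lemma C_infinity_partial:
  assumes "f \<in> C_infinity" "b \<in> Basis"
  shows "(\<lambda>x. frechet_derivative f (at x) b) \<in> C_infinity"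
  unfolding C_infinity_def
proof (intro CollectI ballI allI)
  fix bs :: "'a list" and x assume "bs \<in> lists Basis"
  \<comment> \<open>\<open>partials\<close> applies the last entry of the list first, so the
    derivative already taken goes to the end of the list.\<close>
  then have "bs @ [b] \<in> lists Basis" using assms(2) by auto
  then have "partials (bs @ [b]) f differentiable (at x)" using assms(1) unfolding C_infinity_def by blast
  then show "partials bs (\<lambda>x. frechet_derivative f (at x) b) differentiable (at x)"
    by (simp add: partials_append)
qed

lemma C_infinity_continuous: "f \<in> C_infinity \<Longrightarrow> continuous_on A f"
  by (intro continuous_at_imp_continuous_on ballI differentiable_imp_continuous_within C_infinity_differentiable)

lemma C_infinity_borel_measurable [measurable_dest]: "f \<in> C_infinity \<Longrightarrow> f \<in> borel_measurable borel"
  by (intro borel_measurable_continuous_onI C_infinity_continuous)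

lemma C_infinity_const [simp]: "(\<lambda>_. c) \<in> C_infinity"
  by (rule C_infinity_coinduct_deriv[where S="range (\<lambda>c _. c)"])
    (auto intro!: exI[of _ "\<lambda>_ _. 0"])

lemma C_infinity_inner [simp]: "(\<lambda>x. x \<bullet> a) \<in> C_infinity"
proof (rule C_infinity_coinduct_deriv[where S="insert (\<lambda>x. x \<bullet> a) (range (\<lambda>c _. c))"])
  fix g assume "g \<in> insert (\<lambda>x. x \<bullet> a) (range (\<lambda>c _. c))"
  then consider "g = (\<lambda>x. x \<bullet> a)" | c where "g = (\<lambda>_. c)" by auto
  then show "\<exists>D. (\<forall>x. (g has_derivative D x) (at x)) \<and> (\<forall>b\<in>Basis. (\<lambda>x. D x b) \<in> insert (\<lambda>x. x \<bullet> a) (range (\<lambda>c _. c)))"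
  proof cases
    case 1
    then show ?thesis by (intro exI[of _ "\<lambda>_ h. h \<bullet> a"]) (auto intro!: derivative_eq_intros)
  next
    case 2
    then show ?thesis by (intro exI[of _ "\<lambda>_ _. 0"]) auto
  qed
qed simp

lemma C_infinity_sin_cos: "(\<lambda>x::real. \<alpha> * sin x + \<beta> * cos x) \<in> C_infinity"
proof (rule C_infinity_coinduct_deriv[where S="{\<lambda>x. \<alpha> * sin x + \<beta> * cos x |\<alpha> \<beta>. True}"])
  fix g :: "real \<Rightarrow> real" assume "g \<in> {\<lambda>x. \<alpha> * sin x + \<beta> * cos x |\<alpha> \<beta>. True}"
  then obtain \<alpha> \<beta> where g: "g = (\<lambda>x. \<alpha> * sin x + \<beta> * cos x)" by auto
  show "\<exists>D. (\<forall>x. (g has_derivative D x) (at x)) \<and>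
      (\<forall>b\<in>Basis. (\<lambda>x. D x b) \<in> {\<lambda>x. \<alpha> * sin x + \<beta> * cos x |\<alpha> \<beta>. True})"
  proof (intro exI[of _ "\<lambda>x h. h * (- \<beta> * sin x + \<alpha> * cos x)"] conjI allI ballI)
    show "(g has_derivative (\<lambda>h. h * (- \<beta> * sin x + \<alpha> * cos x))) (at x)" for x
      unfolding g by (auto intro!: derivative_eq_intros simp: algebra_simps)
    show "(\<lambda>x. b * (- \<beta> * sin x + \<alpha> * cos x)) \<in> {\<lambda>x. \<alpha> * sin x + \<beta> * cos x |\<alpha> \<beta>. True}"
      if "b \<in> Basis" for b
      using that by (intro CollectI exI[of _ "- \<beta>"] exI[of _ \<alpha>]) (simp add: Basis_real_def)
  qed
qed auto

text \<open>The member with k = 0 is the usual smooth function exp(-1/t) that is flat at the origin.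
  The factor (1/t)^k is carried along because the derivative of one member is a linear combination
  of other members.\<close>

definition flat :: "nat \<Rightarrow> real \<Rightarrow> real" where
  "flat k t = (if t > 0 then (1 / t) ^ k * exp (- (1 / t)) else 0)"

text \<open>On the right, with y = 1/t, the difference quotient is y^(k + 1) / exp y, which tends to
  0 as y grows; on the left it is 0 identically.\<close>

lemma flat_has_derivative_at_0: "(flat k has_real_derivative 0) (at 0)"
proof -
  have "((\<lambda>t. (inverse t) ^ Suc k / exp (inverse t)) \<longlongrightarrow> 0) (at_right (0::real))"
    by (rule filterlim_compose[OF tendsto_power_div_exp_0 filterlim_inverse_at_top_right])
  moreover have "eventually (\<lambda>t. (inverse t) ^ Suc k / exp (inverse t) = (flat k t - flat k 0) / (t - 0)) (at_right (0::real))"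
    unfolding flat_def by (simp add: eventually_at_filter exp_minus field_simps)
  ultimately have "((\<lambda>t. (flat k t - flat k 0) / (t - 0)) \<longlongrightarrow> 0) (at_right 0)"
    by (rule Lim_transform_eventually)
  moreover have "((\<lambda>t. (flat k t - flat k 0) / (t - 0)) \<longlongrightarrow> 0) (at_left 0)"
    by (rule tendsto_eventually) (simp add: flat_def eventually_at_filter)
  ultimately have "((\<lambda>t. (flat k t - flat k 0) / (t - 0)) \<longlongrightarrow> 0) (at 0)"
    by (simp add: filterlim_split_at)
  then show ?thesis by (simp add: has_field_derivative_iff)
qed

lemma flat_has_derivative:
  "(flat k has_real_derivative flat (k + 2) t - real k * flat (k + 1) t) (at t)"
proof -
  consider "t > 0" | "t < 0" | "t = 0" by linarith
  then show ?thesis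
  proof cases
    case 1
    have "((\<lambda>t. (1 / t) ^ k * exp (- (1 / t))) has_real_derivative
       (1 / t) ^ (k + 2) * exp (- (1 / t)) - real k * ((1 / t) ^ (k + 1) * exp (- (1 / t)))) (at t)"
    proof -
      have d: "((\<lambda>t. 1 / t) has_real_derivative - ((1 / t)\<^sup>2)) (at t)"
        using 1 by (auto intro!: derivative_eq_intros simp: power2_eq_square)
      have "((\<lambda>t. (1 / t) ^ k * exp (- (1 / t))) has_real_derivative
         (1 / t) ^ k * (exp (- (1 / t)) * - (- ((1 / t)\<^sup>2))) + real k * (- ((1 / t)\<^sup>2) * (1 / t) ^ (k - Suc 0)) * exp (- (1 / t))) (at t)"
        by (intro DERIV_mult' DERIV_power DERIV_fun_exp DERIV_minus d)
      moreover have "(1 / t) ^ k * (exp (- (1 / t)) * - (- ((1 / t)\<^sup>2))) + real k * (- ((1 / t)\<^sup>2) * (1 / t) ^ (k - Suc 0)) * exp (- (1 / t))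
        = (1 / t) ^ (k + 2) * exp (- (1 / t)) - real k * ((1 / t) ^ (k + 1) * exp (- (1 / t)))"
        by (cases k) (simp_all add: power2_eq_square mult_ac)
      ultimately show ?thesis by simp
    qed
    then have "(flat k has_real_derivative
       (1 / t) ^ (k + 2) * exp (- (1 / t)) - real k * ((1 / t) ^ (k + 1) * exp (- (1 / t)))) (at t)"
      by (rule has_field_derivative_transform_within_open[of _ _ _ "{0<..}"])
        (use 1 in \<open>auto simp: flat_def\<close>)
    then show ?thesis using 1 by (simp add: flat_def)
  next
    case 2
    have "(flat k has_real_derivative 0) (at t)"
      by (rule has_field_derivative_transform_within_open[of "\<lambda>_. 0" _ _ "{..<0}"])
        (use 2 in \<open>auto simp: flat_def\<close>)
    then show ?thesis using 2 by (simp add: flat_def)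
  next
    case 3
    then show ?thesis using flat_has_derivative_at_0[of k] by (simp add: flat_def)
  qed
qed

text \<open>This class is closed under partial derivatives, so its elements are smooth by coinduction; all closure
  properties of \<open>C_infinity\<close> are obtained at once.\<close>

inductive_set smooth_algebra :: "('a::euclidean_space \<Rightarrow> real) set" where
  base: "f \<in> C_infinity \<Longrightarrow> f \<in> smooth_algebra"
| add: "f \<in> smooth_algebra \<Longrightarrow> g \<in> smooth_algebra \<Longrightarrow> (\<lambda>x. f x + g x) \<in> smooth_algebra"
| mult: "f \<in> smooth_algebra \<Longrightarrow> g \<in> smooth_algebra \<Longrightarrow> (\<lambda>x. f x * g x) \<in> smooth_algebra"
| comp: "(F :: real \<Rightarrow> real) \<in> C_infinity \<Longrightarrow> g \<in> C_infinity \<Longrightarrow> (\<lambda>x. F (g x)) \<in> smooth_algebra"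
| powr: "g \<in> C_infinity \<Longrightarrow> (\<And>x. g x > 0) \<Longrightarrow> (\<lambda>x. g x powr p) \<in> smooth_algebra"
| flat: "g \<in> C_infinity \<Longrightarrow> (\<lambda>x. flat k (g x)) \<in> smooth_algebra"

lemma smooth_algebra_C_infinity: "f \<in> smooth_algebra \<Longrightarrow> f \<in> C_infinity"
proof (erule C_infinity_coinduct_deriv)
  have cst: "(\<lambda>_. c) \<in> smooth_algebra" for c :: real by (rule smooth_algebra.base) simp
  have part: "(\<lambda>x. frechet_derivative g (at x) b) \<in> smooth_algebra"
    if "g \<in> C_infinity" "b \<in> Basis" for g :: "'a \<Rightarrow> real" and b
    by (rule smooth_algebra.base[OF C_infinity_partial[OF that]])
  fix f :: "'a \<Rightarrow> real" assume "f \<in> smooth_algebra"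
  then show "\<exists>D. (\<forall>x. (f has_derivative D x) (at x)) \<and> (\<forall>b\<in>Basis. (\<lambda>x. D x b) \<in> smooth_algebra)"
  proof induction
    case (base f)
    then show ?case
      by (intro exI[of _ "\<lambda>x. frechet_derivative f (at x)"]) (auto intro: C_infinity_has_derivative part)
  next
    case (add f g)
    then obtain D E where D: "\<And>x. (f has_derivative D x) (at x)" "\<And>b. b \<in> Basis \<Longrightarrow> (\<lambda>x. D x b) \<in> smooth_algebra"
      and E: "\<And>x. (g has_derivative E x) (at x)" "\<And>b. b \<in> Basis \<Longrightarrow> (\<lambda>x. E x b) \<in> smooth_algebra" by blast
    show ?case
      by (intro exI[of _ "\<lambda>x h. D x h + E x h"]) (auto intro!: has_derivative_add D E smooth_algebra.add)
  next
    case (mult f g)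
    then obtain D E where D: "\<And>x. (f has_derivative D x) (at x)" "\<And>b. b \<in> Basis \<Longrightarrow> (\<lambda>x. D x b) \<in> smooth_algebra"
      and E: "\<And>x. (g has_derivative E x) (at x)" "\<And>b. b \<in> Basis \<Longrightarrow> (\<lambda>x. E x b) \<in> smooth_algebra" by blast
    show ?case
      by (intro exI[of _ "\<lambda>x h. f x * E x h + D x h * g x"])
        (auto intro!: has_derivative_mult D E smooth_algebra.add smooth_algebra.mult mult.hyps)
  next
    case (comp F g)
    have F': "(F has_real_derivative frechet_derivative F (at t) 1) (at t)" for t
    proof -
      have lin: "linear (frechet_derivative F (at t))"
        using C_infinity_has_derivative[OF comp(1)] has_derivative_linear by blast
      have "frechet_derivative F (at t) h = frechet_derivative F (at t) 1 * h" for h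
      proof -
        have "frechet_derivative F (at t) (h *\<^sub>R 1) = h *\<^sub>R frechet_derivative F (at t) 1"
          by (rule linear_scale[OF lin])
        then show ?thesis by (metis real_scaleR_def mult.right_neutral mult.commute)
      qed
      then have "frechet_derivative F (at t) = (*) (frechet_derivative F (at t) 1)" by (rule ext)
      from subst[OF this, of "\<lambda>D. (F has_derivative D) (at t)"]
      show ?thesis using C_infinity_has_derivative[OF comp(1), of t]
        unfolding has_field_derivative_def by blast
    qed
    show ?case
    proof (intro exI[of _ "\<lambda>x h. frechet_derivative g (at x) h * frechet_derivative F (at (g x)) 1"] conjI allI ballI)
      show "((\<lambda>x. F (g x)) has_derivative (\<lambda>h. frechet_derivative g (at x) h * frechet_derivative F (at (g x)) 1)) (at x)" for x
        by (rule DERIV_compose_FDERIV[OF F' C_infinity_has_derivative[OF comp(2)]])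
      show "(\<lambda>x. frechet_derivative g (at x) b * frechet_derivative F (at (g x)) 1) \<in> smooth_algebra" if "b \<in> Basis" for b
        using smooth_algebra.comp[OF C_infinity_partial[OF comp(1), of 1] comp(2)]
        by (intro smooth_algebra.mult part comp that) (simp add: Basis_real_def)
    qed
  next
    case (powr g p)
    show ?case
    proof (intro exI[of _ "\<lambda>x h. frechet_derivative g (at x) h * (p * g x powr (p - 1))"] conjI allI ballI)
      show "((\<lambda>x. g x powr p) has_derivative (\<lambda>h. frechet_derivative g (at x) h * (p * g x powr (p - 1)))) (at x)" for x
        by (rule DERIV_compose_FDERIV[OF has_real_derivative_powr C_infinity_has_derivative])
          (use powr in auto)
      show "(\<lambda>x. frechet_derivative g (at x) b * (p * g x powr (p - 1))) \<in> smooth_algebra" if "b \<in> Basis" for b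
        by (intro smooth_algebra.mult part smooth_algebra.powr powr cst that)
    qed
  next
    case (flat g k)
    show ?case
    proof (intro exI[of _ "\<lambda>x h. frechet_derivative g (at x) h * (flat (k + 2) (g x) - real k * flat (k + 1) (g x))"] conjI allI ballI)
      show "((\<lambda>x. flat k (g x)) has_derivative (\<lambda>h. frechet_derivative g (at x) h * (flat (k + 2) (g x) - real k * flat (k + 1) (g x)))) (at x)" for x
        by (rule DERIV_compose_FDERIV[OF flat_has_derivative C_infinity_has_derivative[OF flat]])
      have "(\<lambda>x. flat (k + 2) (g x) + (- real k) * flat (k + 1) (g x)) \<in> smooth_algebra"
        by (intro smooth_algebra.add smooth_algebra.mult smooth_algebra.flat flat cst)
      then have "(\<lambda>x. flat (k + 2) (g x) - real k * flat (k + 1) (g x)) \<in> smooth_algebra" by simp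
      then show "(\<lambda>x. frechet_derivative g (at x) b * (flat (k + 2) (g x) - real k * flat (k + 1) (g x))) \<in> smooth_algebra" if "b \<in> Basis" for b
        by (intro smooth_algebra.mult part flat that)
    qed
  qed
qed

lemma C_infinity_add: "f \<in> C_infinity \<Longrightarrow> g \<in> C_infinity \<Longrightarrow> (\<lambda>x. f x + g x :: real) \<in> C_infinity"
  by (rule smooth_algebra_C_infinity[OF smooth_algebra.add[OF smooth_algebra.base smooth_algebra.base]])

lemma C_infinity_mult: "f \<in> C_infinity \<Longrightarrow> g \<in> C_infinity \<Longrightarrow> (\<lambda>x. f x * g x :: real) \<in> C_infinity"
  by (rule smooth_algebra_C_infinity[OF smooth_algebra.mult[OF smooth_algebra.base smooth_algebra.base]])

lemma C_infinity_diff: "f \<in> C_infinity \<Longrightarrow> g \<in> C_infinity \<Longrightarrow> (\<lambda>x. f x - g x :: real) \<in> C_infinity"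
  using C_infinity_add[of f "\<lambda>x. (-1) * g x"] C_infinity_mult[of "\<lambda>_. -1" g] by simp

lemma C_infinity_compose: "F \<in> C_infinity \<Longrightarrow> g \<in> C_infinity \<Longrightarrow> (\<lambda>x. F (g x :: real) :: real) \<in> C_infinity"
  by (rule smooth_algebra_C_infinity[OF smooth_algebra.comp])

lemma C_infinity_powr: "g \<in> C_infinity \<Longrightarrow> (\<And>x. g x > 0) \<Longrightarrow> (\<lambda>x. g x powr p :: real) \<in> C_infinity"
  by (rule smooth_algebra_C_infinity[OF smooth_algebra.powr])

lemma C_infinity_flat: "g \<in> C_infinity \<Longrightarrow> (\<lambda>x. flat k (g x)) \<in> C_infinity"
  by (rule smooth_algebra_C_infinity[OF smooth_algebra.flat])

lemma C_infinity_prod: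
  "(\<And>i. i \<in> I \<Longrightarrow> f i \<in> C_infinity) \<Longrightarrow> (\<lambda>x. \<Prod>i\<in>I. f i x :: real) \<in> C_infinity"
  by (induction I rule: infinite_finite_induct) (simp_all add: C_infinity_mult)

lemma C_infinity_sin: "(sin :: real \<Rightarrow> real) \<in> C_infinity" and C_infinity_cos: "(cos :: real \<Rightarrow> real) \<in> C_infinity"
  using C_infinity_sin_cos[of 1 0] C_infinity_sin_cos[of 0 1] by simp_all

text \<open>Connects the real test functions used in the proof with the complex Schwartz functions
  on which distributions act.\<close>

lemma partials_of_real:
  fixes f :: "'a::euclidean_space \<Rightarrow> real"
  assumes "f \<in> C_infinity" "bs \<in> lists Basis"
  shows "partials bs (\<lambda>x. complex_of_real (f x)) = (\<lambda>x. complex_of_real (partials bs f x))"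
  using assms(2)
proof (induction bs)
  case (Cons b bs)
  then have bs: "bs \<in> lists Basis" by simp
  have "partials bs f differentiable (at x)" for x
    using assms(1) bs unfolding C_infinity_def by blast
  then have "(partials bs f has_derivative frechet_derivative (partials bs f) (at x)) (at x)" for x
    using frechet_derivative_works by blast
  then have "((\<lambda>x. complex_of_real (partials bs f x)) has_derivative (\<lambda>h. complex_of_real (frechet_derivative (partials bs f) (at x) h))) (at x)" for x
    by (rule has_derivative_of_real)
  from frechet_derivative_at[OF this, symmetric] show ?case by (simp add: Cons.IH)
qed simp

lemma C_infinity_of_real:
  fixes f :: "'a::euclidean_space \<Rightarrow> real"
  assumes "f \<in> C_infinity"
  shows "(\<lambda>x. complex_of_real (f x)) \<in> C_infinity"
  unfolding C_infinity_def
proof (intro CollectI ballI allI)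
  fix bs :: "'a list" and x assume bs: "bs \<in> lists Basis"
  have "partials bs f differentiable (at x)" using assms bs unfolding C_infinity_def by blast
  then have "(partials bs f has_derivative frechet_derivative (partials bs f) (at x)) (at x)"
    using frechet_derivative_works by blast
  from has_derivative_of_real[OF this]
  show "partials bs (\<lambda>x. complex_of_real (f x)) differentiable (at x)"
    unfolding partials_of_real[OF assms bs] by (auto simp: differentiable_def)
qed

text \<open>Any compact subset of \<open>U\<close> outside which \<psi> vanishes can stand in for
  the closure of the nonzero set. Closure properties then only need such a set and never the exact
  support.\<close>

lemma test_functions_iff:
  "\<psi> \<in> test_functions U \<longleftrightarrow> \<psi> \<in> C_infinity \<and> (\<exists>K. compact K \<and> K \<subseteq> U \<and> (\<forall>x. x \<notin> K \<longrightarrow> \<psi> x = 0))"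
proof
  assume "\<psi> \<in> test_functions U"
  then have *: "\<psi> \<in> C_infinity" "compact (closure {x. \<psi> x \<noteq> 0})" "closure {x. \<psi> x \<noteq> 0} \<subseteq> U"
    by (auto simp: test_functions_def)
  moreover have "\<forall>x. x \<notin> closure {x. \<psi> x \<noteq> 0} \<longrightarrow> \<psi> x = 0"
    using closure_subset[of "{x. \<psi> x \<noteq> 0}"] by auto
  ultimately show "\<psi> \<in> C_infinity \<and> (\<exists>K. compact K \<and> K \<subseteq> U \<and> (\<forall>x. x \<notin> K \<longrightarrow> \<psi> x = 0))"
    by blast
next
  assume "\<psi> \<in> C_infinity \<and> (\<exists>K. compact K \<and> K \<subseteq> U \<and> (\<forall>x. x \<notin> K \<longrightarrow> \<psi> x = 0))"
  then obtain K where K: "\<psi> \<in> C_infinity" "compact K" "K \<subseteq> U" "\<And>x. x \<notin> K \<Longrightarrow> \<psi> x = 0" by blast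
  have sub: "closure {x. \<psi> x \<noteq> 0} \<subseteq> K"
    using K by (intro closure_minimal compact_imp_closed) auto
  then have "compact (closure {x. \<psi> x \<noteq> 0})"
    using K(2) compact_Int_closed[OF K(2) closed_closure, of "{x. \<psi> x \<noteq> 0}"] by (simp add: Int_absorb1)
  with K sub show "\<psi> \<in> test_functions U" by (auto simp: test_functions_def)
qed

lemma test_functions_C_infinity: "\<psi> \<in> test_functions U \<Longrightarrow> \<psi> \<in> C_infinity"
  by (simp add: test_functions_def)

lemma test_functions_outside: "\<psi> \<in> test_functions U \<Longrightarrow> x \<notin> U \<Longrightarrow> \<psi> x = 0"
  unfolding test_functions_iff by blast

lemma test_functions_zero [simp]: "(\<lambda>x. 0) \<in> test_functions U"
  unfolding test_functions_iff by (auto intro: exI[of _ "{}"])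

lemma test_functions_add:
  fixes \<psi> \<eta> :: "'a::euclidean_space \<Rightarrow> real"
  assumes "\<psi> \<in> test_functions U" "\<eta> \<in> test_functions U"
  shows "(\<lambda>x. \<psi> x + \<eta> x) \<in> test_functions U"
proof -
  obtain K L where "compact K" "K \<subseteq> U" "\<And>x. x \<notin> K \<Longrightarrow> \<psi> x = 0"
    "compact L" "L \<subseteq> U" "\<And>x. x \<notin> L \<Longrightarrow> \<eta> x = 0"
    using assms unfolding test_functions_iff by blast
  then have "compact (K \<union> L) \<and> K \<union> L \<subseteq> U \<and> (\<forall>x. x \<notin> K \<union> L \<longrightarrow> \<psi> x + \<eta> x = 0)" by auto
  with assms show ?thesis unfolding test_functions_iff[of "\<lambda>x. \<psi> x + \<eta> x"]
    by (blast intro: C_infinity_add test_functions_C_infinity)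
qed

lemma test_functions_mult:
  fixes \<psi> \<eta> :: "'a::euclidean_space \<Rightarrow> real"
  assumes "\<psi> \<in> test_functions U" "\<eta> \<in> C_infinity"
  shows "(\<lambda>x. \<psi> x * \<eta> x) \<in> test_functions U"
proof -
  obtain K where "compact K" "K \<subseteq> U" "\<And>x. x \<notin> K \<Longrightarrow> \<psi> x = 0"
    using assms unfolding test_functions_iff by blast
  then have "compact K \<and> K \<subseteq> U \<and> (\<forall>x. x \<notin> K \<longrightarrow> \<psi> x * \<eta> x = 0)" by auto
  with assms show ?thesis unfolding test_functions_iff[of "\<lambda>x. \<psi> x * \<eta> x"]
    by (blast intro: C_infinity_mult test_functions_C_infinity)
qed

lemma test_functions_scale: "\<psi> \<in> test_functions U \<Longrightarrow> (\<lambda>x. c * \<psi> x :: real) \<in> test_functions U"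
  using test_functions_mult[of \<psi> U "\<lambda>_. c"] by (simp add: mult.commute)

lemma test_functions_compose:
  fixes \<psi> :: "'a::euclidean_space \<Rightarrow> real" and F :: "real \<Rightarrow> real"
  assumes "\<psi> \<in> test_functions U" "F \<in> C_infinity" "F 0 = 0"
  shows "(\<lambda>x. F (\<psi> x)) \<in> test_functions U"
proof -
  obtain K where "compact K" "K \<subseteq> U" "\<And>x. x \<notin> K \<Longrightarrow> \<psi> x = 0"
    using assms unfolding test_functions_iff by blast
  then have "compact K \<and> K \<subseteq> U \<and> (\<forall>x. x \<notin> K \<longrightarrow> F (\<psi> x) = 0)" using assms(3) by auto
  with assms show ?thesis unfolding test_functions_iff[of "\<lambda>x. F (\<psi> x)"]
    by (blast intro: C_infinity_compose test_functions_C_infinity)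
qed

lemma test_functions_partial:
  fixes \<psi> :: "'a::euclidean_space \<Rightarrow> 'b::real_normed_vector"
  assumes "\<psi> \<in> test_functions U" "b \<in> Basis"
  shows "(\<lambda>x. frechet_derivative \<psi> (at x) b) \<in> test_functions U"
proof -
  obtain K where K: "compact K" "K \<subseteq> U" "\<And>x. x \<notin> K \<Longrightarrow> \<psi> x = 0"
    using assms unfolding test_functions_iff by blast
  have "frechet_derivative \<psi> (at x) b = 0" if x: "x \<notin> K" for x
  proof -
    have "(\<psi> has_derivative (\<lambda>_. 0)) (at x)"
      by (rule has_derivative_transform_within_open[of "\<lambda>_. 0" _ _ _ "- K"])
        (use K x in \<open>auto intro: compact_imp_closed\<close>)
    from frechet_derivative_at[OF this] show ?thesis by metis
  qed
  with K assms show ?thesis unfolding test_functions_iff[of "\<lambda>x. frechet_derivative \<psi> (at x) b"]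
    by (blast intro: C_infinity_partial test_functions_C_infinity)
qed

lemma test_functions_continuous: "\<psi> \<in> test_functions U \<Longrightarrow> continuous_on A \<psi>"
  by (intro C_infinity_continuous test_functions_C_infinity)

lemma test_functions_borel [measurable_dest]: "\<psi> \<in> test_functions U \<Longrightarrow> \<psi> \<in> borel_measurable borel"
  by (intro C_infinity_borel_measurable test_functions_C_infinity)

lemma test_functions_bounded:
  assumes "\<psi> \<in> test_functions U"
  shows "\<exists>B\<ge>0. \<forall>x. norm (\<psi> x) \<le> B"
proof -
  obtain K where K: "compact K" "\<And>x. x \<notin> K \<Longrightarrow> \<psi> x = 0"
    using assms unfolding test_functions_iff by blast
  have "compact (\<psi> ` K)" by (intro compact_continuous_image test_functions_continuous[OF assms] K)
  then obtain B where B: "\<And>x. x \<in> K \<Longrightarrow> norm (\<psi> x) \<le> B"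
    by (meson bounded_iff compact_imp_bounded imageI)
  have "norm (\<psi> x) \<le> max 0 B" for x using B[of x] K(2)[of x] by (cases "x \<in> K") auto
  then show ?thesis by (meson max.cobounded1)
qed

lemma test_functions_support:
  assumes "\<psi> \<in> test_functions U"
  shows "\<exists>R\<ge>0. \<forall>x. norm x > R \<longrightarrow> \<psi> x = 0"
proof -
  obtain K where K: "compact K" "\<And>x. x \<notin> K \<Longrightarrow> \<psi> x = 0"
    using assms unfolding test_functions_iff by blast
  then obtain R where "\<And>x. x \<in> K \<Longrightarrow> norm x \<le> R"
    by (meson bounded_iff compact_imp_bounded)
  with K show ?thesis by (intro exI[of _ "max 0 R"]) force
qed

lemma C_infinity_partial_mult:
  fixes f g :: "'a::euclidean_space \<Rightarrow> real"
  assumes "f \<in> C_infinity" "g \<in> C_infinity"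
  shows "frechet_derivative (\<lambda>x. f x * g x) (at x) b =
    f x * frechet_derivative g (at x) b + frechet_derivative f (at x) b * g x"
  using frechet_derivative_at[OF has_derivative_mult[OF assms[THEN C_infinity_has_derivative]]] by metis

lemma C_infinity_partial_add:
  fixes f g :: "'a::euclidean_space \<Rightarrow> real"
  assumes "f \<in> C_infinity" "g \<in> C_infinity"
  shows "frechet_derivative (\<lambda>x. f x + g x) (at x) b =
    frechet_derivative f (at x) b + frechet_derivative g (at x) b"
  using frechet_derivative_at[OF has_derivative_add[OF assms[THEN C_infinity_has_derivative]]] by metis

lemma C_infinity_partial_scale:
  fixes f :: "'a::euclidean_space \<Rightarrow> real"
  assumes "f \<in> C_infinity"
  shows "frechet_derivative (\<lambda>x. c * f x) (at x) b = c * frechet_derivative f (at x) b"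
  using C_infinity_partial_mult[OF C_infinity_const[of c] assms, of x b]
  by simp

section \<open>Plane waves and smooth bumps on boxes\<close>

lemma C_infinity_cos_inner [simp]: "(\<lambda>x. cos (x \<bullet> \<xi>)) \<in> C_infinity"
  and C_infinity_sin_inner [simp]: "(\<lambda>x. sin (x \<bullet> \<xi>)) \<in> C_infinity"
  by (rule C_infinity_compose[OF C_infinity_cos C_infinity_inner] C_infinity_compose[OF C_infinity_sin C_infinity_inner])+

lemma partial_cos_inner: "frechet_derivative (\<lambda>x. cos (x \<bullet> \<xi>)) (at x) b = - (b \<bullet> \<xi>) * sin (x \<bullet> \<xi>)"
proof -
  have "((\<lambda>x. cos (x \<bullet> \<xi>)) has_derivative (\<lambda>h. - (h \<bullet> \<xi>) * sin (x \<bullet> \<xi>))) (at x)"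
    by (auto intro!: derivative_eq_intros)
  from frechet_derivative_at[OF this] show ?thesis by metis
qed

lemma partial_sin_inner: "frechet_derivative (\<lambda>x. sin (x \<bullet> \<xi>)) (at x) b = (b \<bullet> \<xi>) * cos (x \<bullet> \<xi>)"
proof -
  have "((\<lambda>x. sin (x \<bullet> \<xi>)) has_derivative (\<lambda>h. (h \<bullet> \<xi>) * cos (x \<bullet> \<xi>))) (at x)"
    by (auto intro!: derivative_eq_intros)
  from frechet_derivative_at[OF this] show ?thesis by metis
qed

text \<open>Positive exactly on the open box. The factor \<open>N\<close> makes the family converge
  to the indicator of the box, since exp(-1/(N t)) tends to 1 for every t > 0.\<close>

definition box_bump :: "real \<Rightarrow> 'a::euclidean_space \<Rightarrow> 'a \<Rightarrow> 'a \<Rightarrow> real" where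
  "box_bump N a c x = (\<Prod>b\<in>Basis. flat 0 (N * (x \<bullet> b - a \<bullet> b)) * flat 0 (N * (c \<bullet> b - x \<bullet> b)))"

lemma flat_0_bounds: "0 \<le> flat 0 t" "flat 0 t \<le> 1" "0 < flat 0 t \<longleftrightarrow> 0 < t"
  by (auto simp: flat_def)

lemma box_bump_C_infinity: "box_bump N a c \<in> C_infinity"
  unfolding box_bump_def[abs_def]
  by (intro C_infinity_prod C_infinity_mult C_infinity_flat C_infinity_const C_infinity_diff C_infinity_inner)

lemma box_bump_bounds: "0 \<le> box_bump N a c x" "box_bump N a c x \<le> 1"
  unfolding box_bump_def by (auto intro!: prod_nonneg prod_le_1 mult_le_one mult_nonneg_nonneg flat_0_bounds)

lemma box_bump_pos_iff:
  assumes "N > 0" shows "0 < box_bump N a c x \<longleftrightarrow> x \<in> box a c"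
proof
  assume "x \<in> box a c"
  then show "0 < box_bump N a c x" unfolding box_bump_def
    using assms by (intro prod_pos) (auto simp: box_def flat_0_bounds intro!: mult_pos_pos)
next
  assume *: "0 < box_bump N a c x"
  have "0 < flat 0 (N * (x \<bullet> b - a \<bullet> b)) \<and> 0 < flat 0 (N * (c \<bullet> b - x \<bullet> b))" if "b \<in> Basis" for b
  proof (rule ccontr)
    assume "\<not> ?thesis"
    then have "flat 0 (N * (x \<bullet> b - a \<bullet> b)) * flat 0 (N * (c \<bullet> b - x \<bullet> b)) = 0"
      using flat_0_bounds(1)[of "N * (x \<bullet> b - a \<bullet> b)"] flat_0_bounds(1)[of "N * (c \<bullet> b - x \<bullet> b)"] by auto
    then have "box_bump N a c x = 0" unfolding box_bump_def using that by (intro prod_zero) auto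
    with * show False by simp
  qed
  then show "x \<in> box a c" using assms by (auto simp: box_def flat_0_bounds zero_less_mult_iff)
qed

lemma box_bump_test:
  assumes "N > 0" "cbox a c \<subseteq> U"
  shows "box_bump N a c \<in> test_functions U"
proof -
  have "box_bump N a c x = 0" if "x \<notin> cbox a c" for x
    using box_bump_pos_iff[OF assms(1), of a c x] box_bump_bounds(1)[of N a c x] that box_subset_cbox by force
  with assms(2) show ?thesis
    unfolding test_functions_iff by (auto simp: box_bump_C_infinity intro!: exI[of _ "cbox a c"])
qed

lemma box_bump_tendsto: "(\<lambda>n. box_bump (real (Suc n)) a c x) \<longlonglongrightarrow> indicator (box a c) x"
proof (cases "x \<in> box a c")
  case True
  have *: "(\<lambda>n. flat 0 (real (Suc n) * t)) \<longlonglongrightarrow> 1" if "t > 0" for t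
  proof -
    have "(\<lambda>n. exp (- (1 / t * inverse (real (Suc n))))) \<longlonglongrightarrow> exp (- (1 / t * 0))"
      by (intro tendsto_intros LIMSEQ_inverse_real_of_nat)
    moreover have "flat 0 (real (Suc n) * t) = exp (- (1 / t * inverse (real (Suc n))))" for n
    proof -
      have "real (Suc n) * t > 0" using that by (intro mult_pos_pos) auto
      then show ?thesis unfolding flat_def by (simp add: divide_inverse mult.commute del: of_nat_Suc)
    qed
    ultimately show ?thesis by simp
  qed
  have "(\<lambda>n. box_bump (real (Suc n)) a c x) \<longlonglongrightarrow> (\<Prod>b\<in>(Basis::'a set). 1 * 1)"
    unfolding box_bump_def using True by (intro tendsto_prod tendsto_mult *) (auto simp: box_def)
  then show ?thesis using True by simp
next
  case False
  then have "box_bump (real (Suc n)) a c x = 0" for n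
    using box_bump_pos_iff[of "real (Suc n)" a c x] box_bump_bounds(1)[of "real (Suc n)" a c x] by force
  then show ?thesis using False by simp
qed

section \<open>Integrals of test functions and integration by parts\<close>

lemma test_functions_integrable_mult:
  fixes \<psi> g :: "'a::euclidean_space \<Rightarrow> real"
  assumes "\<psi> \<in> test_functions U" "continuous_on UNIV g"
  shows "integrable lborel (\<lambda>x. \<psi> x * g x)"
proof -
  obtain K where K: "compact K" "\<And>x. x \<notin> K \<Longrightarrow> \<psi> x = 0"
    using assms unfolding test_functions_iff by blast
  have "integrable lborel (\<lambda>x. indicator K x *\<^sub>R (\<psi> x * g x))"
    by (rule borel_integrable_compact[OF K(1)])
      (intro continuous_intros test_functions_continuous[OF assms(1)] continuous_on_subset[OF assms(2)] subset_UNIV)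
  moreover have "(\<lambda>x. indicator K x *\<^sub>R (\<psi> x * g x)) = (\<lambda>x. \<psi> x * g x)"
    by (rule ext) (use K(2) in \<open>auto simp: indicator_def\<close>)
  ultimately show ?thesis by simp
qed

lemma test_functions_integrable: "\<psi> \<in> test_functions U \<Longrightarrow> integrable lborel (\<psi> :: 'a::euclidean_space \<Rightarrow> real)"
  using test_functions_integrable_mult[of \<psi> U "\<lambda>_. 1"] by simp

lemma test_functions_l2: "\<psi> \<in> test_functions U \<Longrightarrow> (\<psi> :: 'a::euclidean_space \<Rightarrow> real) \<in> l2 lborel"
  using test_functions_integrable_mult[of \<psi> U \<psi>] test_functions_continuous[of \<psi> U UNIV]
  by (simp add: l2_def power2_eq_square test_functions_borel)

lemma integral_lborel_shift:
  fixes f :: "'a::euclidean_space \<Rightarrow> 'b::{banach, second_countable_topology}"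
  assumes [measurable]: "f \<in> borel_measurable borel"
  shows "(LINT x|lborel. f (x + h)) = (LINT x|lborel. f x)"
proof -
  have "(LINT x|distr lborel borel ((+) h). f x) = (LINT x|lborel. f (h + x))"
    by (rule integral_distr) measurable
  then show ?thesis by (simp add: lborel_distr_plus add.commute)
qed

lemma integrable_lborel_shift:
  fixes f :: "'a::euclidean_space \<Rightarrow> 'b::{banach, second_countable_topology}"
  assumes "integrable lborel f"
  shows "integrable lborel (\<lambda>x. f (x + h))"
proof -
  have "f \<in> borel_measurable borel" using borel_measurable_integrable[OF assms] by simp
  then have "integrable (distr lborel borel ((+) h)) f \<longleftrightarrow> integrable lborel (\<lambda>x. f (h + x))"
    by (intro integrable_distr_eq) auto
  with assms show ?thesis by (simp add: lborel_distr_plus add.commute)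
qed

text \<open>The integral of each difference quotient is 0 by translation invariance of
  \<open>lborel\<close>, and the quotients converge dominatedly to the derivative.\<close>

lemma integral_partial_test_function:
  fixes \<psi> :: "'a::euclidean_space \<Rightarrow> real"
  assumes \<psi>: "\<psi> \<in> test_functions U" and b: "b \<in> Basis"
  shows "(LINT x|lborel. frechet_derivative \<psi> (at x) b) = 0"
proof -
  define h where "h n = inverse (real (Suc n))" for n
  have h: "h n > 0" "h n \<le> 1" "h \<longlonglongrightarrow> 0" for n
    unfolding h_def by (simp, simp add: inverse_eq_divide, rule LIMSEQ_inverse_real_of_nat)
  define D where "D n x = (\<psi> (x + h n *\<^sub>R b) - \<psi> x) / h n" for n x
  obtain B where B: "B \<ge> 0" "\<And>x. \<bar>frechet_derivative \<psi> (at x) b\<bar> \<le> B"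
    using test_functions_bounded[OF test_functions_partial[OF \<psi> b]] by auto
  obtain R where R: "R \<ge> 0" "\<And>x. norm x > R \<Longrightarrow> \<psi> x = 0" using test_functions_support[OF \<psi>] by auto
  note [measurable] = test_functions_borel[OF \<psi>] test_functions_borel[OF test_functions_partial[OF \<psi> b]]
  have line: "((\<lambda>t. \<psi> (x + t *\<^sub>R b)) has_real_derivative frechet_derivative \<psi> (at (x + t *\<^sub>R b)) b) (at t)" for x t
  proof -
    have d: "(\<psi> has_derivative frechet_derivative \<psi> (at (x + t *\<^sub>R b))) (at (x + t *\<^sub>R b))"
      by (rule C_infinity_has_derivative[OF test_functions_C_infinity[OF \<psi>]])
    have "((\<lambda>t. \<psi> (x + t *\<^sub>R b)) has_derivative (\<lambda>s. frechet_derivative \<psi> (at (x + t *\<^sub>R b)) (s *\<^sub>R b))) (at t)"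
      by (rule has_derivative_compose[where g=\<psi> and f="\<lambda>t. x + t *\<^sub>R b", OF _ d]) (auto intro!: derivative_eq_intros)
    moreover have "frechet_derivative \<psi> (at (x + t *\<^sub>R b)) (s *\<^sub>R b) = frechet_derivative \<psi> (at (x + t *\<^sub>R b)) b * s" for s
      using linear_scale[OF has_derivative_linear[OF d], of s b] by (simp add: mult.commute)
    ultimately show ?thesis unfolding has_field_derivative_def by simp
  qed
  \<comment> \<open>By the mean value theorem the quotients inherit the bound of the derivative. As
    the steps have length at most 1, all of them vanish outside the ball of radius R + 1, so
    \<open>B\<close> times the indicator of that ball dominates.\<close>
  have Dle: "\<bar>D n x\<bar> \<le> B" for n x
  proof -
    obtain t where t: "\<psi> (x + h n *\<^sub>R b) - \<psi> (x + 0 *\<^sub>R b) = (h n - 0) * frechet_derivative \<psi> (at (x + t *\<^sub>R b)) b"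
      using MVT2[of 0 "h n" "\<lambda>t. \<psi> (x + t *\<^sub>R b)" "\<lambda>t. frechet_derivative \<psi> (at (x + t *\<^sub>R b)) b", OF h(1) line] by blast
    then have "D n x = frechet_derivative \<psi> (at (x + t *\<^sub>R b)) b"
      unfolding D_def using h(1)[of n] by (simp add: field_simps)
    then show ?thesis using B by simp
  qed
  have D0: "D n x = 0" if "norm x > R + 1" for n x
  proof -
    have "norm x - norm (x + h n *\<^sub>R b) \<le> norm (x - (x + h n *\<^sub>R b))" by (rule norm_triangle_ineq2)
    also have "\<dots> = h n" using h(1)[of n] b by (simp add: norm_minus_commute)
    finally show ?thesis unfolding D_def using R that h(2)[of n] by force
  qed
  have Dlim: "(\<lambda>n. D n x) \<longlonglongrightarrow> frechet_derivative \<psi> (at x) b" for x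
  proof -
    have "((\<lambda>t. (\<psi> (x + t *\<^sub>R b) - \<psi> (x + 0 *\<^sub>R b)) / (t - 0)) \<longlongrightarrow> frechet_derivative \<psi> (at (x + 0 *\<^sub>R b)) b) (at 0)"
      using line[of x 0] unfolding has_field_derivative_iff by simp
    then have "((\<lambda>n. (\<psi> (x + h n *\<^sub>R b) - \<psi> (x + 0 *\<^sub>R b)) / (h n - 0)) \<longlonglongrightarrow> frechet_derivative \<psi> (at (x + 0 *\<^sub>R b)) b)"
      by (rule filterlim_compose) (use h in \<open>auto simp: filterlim_at intro!: always_eventually, metis less_irrefl\<close>)
    then show ?thesis unfolding D_def by simp
  qed
  have "(\<lambda>n. LINT x|lborel. D n x) \<longlonglongrightarrow> (LINT x|lborel. frechet_derivative \<psi> (at x) b)"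
  proof (rule integral_dominated_convergence)
    show "integrable lborel (\<lambda>x. B * indicat_real (cball (0::'a) (R + 1)) x)"
      by (intro integrable_mult_right integrable_real_indicator) (use emeasure_bounded_finite[OF bounded_cball, of "0::'a" "R + 1"] in auto)
    show "AE x in lborel. norm (D n x) \<le> B * indicat_real (cball 0 (R + 1)) x" for n
      using Dle D0 by (auto simp: indicator_def)
    show "AE x in lborel. (\<lambda>n. D n x) \<longlonglongrightarrow> frechet_derivative \<psi> (at x) b" using Dlim by simp
    show "D n \<in> borel_measurable lborel" for n unfolding D_def by measurable
  qed measurable
  moreover have "(LINT x|lborel. D n x) = 0" for n
    unfolding D_def using test_functions_integrable[OF \<psi>] integral_lborel_shift[of \<psi> "h n *\<^sub>R b"]
    by (simp add: integrable_lborel_shift)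
  ultimately show ?thesis by (simp add: LIMSEQ_const_iff)
qed

lemma integral_by_parts_test_function:
  fixes \<psi> \<eta> :: "'a::euclidean_space \<Rightarrow> real"
  assumes \<psi>: "\<psi> \<in> test_functions U" and \<eta>: "\<eta> \<in> C_infinity" and b: "b \<in> Basis"
  shows "(LINT x|lborel. \<psi> x * frechet_derivative \<eta> (at x) b) = - (LINT x|lborel. frechet_derivative \<psi> (at x) b * \<eta> x)"
proof -
  have "0 = (LINT x|lborel. \<psi> x * frechet_derivative \<eta> (at x) b + frechet_derivative \<psi> (at x) b * \<eta> x)"
    using integral_partial_test_function[OF test_functions_mult[OF \<psi> \<eta>] b]
    by (simp add: C_infinity_partial_mult[OF test_functions_C_infinity[OF \<psi>] \<eta>])
  also have "\<dots> = (LINT x|lborel. \<psi> x * frechet_derivative \<eta> (at x) b) + (LINT x|lborel. frechet_derivative \<psi> (at x) b * \<eta> x)"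
    by (intro Bochner_Integration.integral_add test_functions_integrable_mult[OF \<psi>]
        test_functions_integrable_mult[OF test_functions_partial[OF \<psi> b]] C_infinity_continuous C_infinity_partial \<eta> b)
  finally show ?thesis by simp
qed

section \<open>The Fourier transform of compactly supported square-integrable functions\<close>

text \<open>The transform without the unitary factor (2 pi)^(-n/2), taken over
  \<open>lborel\<close>. The factor reappears as \<open>fourier_const\<close> when the result is
  compared with \<open>fourier\<close>.\<close>

definition ft :: "('a::euclidean_space \<Rightarrow> real) \<Rightarrow> 'a \<Rightarrow> complex" where
  "ft f \<xi> = (LINT x|lborel. cis (- (x \<bullet> \<xi>)) * complex_of_real (f x))"

text \<open>This is (2 pi)^n times the kernel of exp(t Delta), the normalization that belongs to the
  transform without unitary factor.\<close>

definition heat_kernel :: "real \<Rightarrow> 'a::euclidean_space \<Rightarrow> real" where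
  "heat_kernel t z = (sqrt (pi / t)) ^ DIM('a) * exp (- (norm z)\<^sup>2 / (4 * t))"

lemma cis_measurable [measurable]: "cis \<in> borel_measurable borel"
  by (intro borel_measurable_continuous_onI continuous_intros)

text \<open>Rescaling by sqrt(2 t) turns the weight into the standard normal density, whose
  characteristic function is known.\<close>

lemma gaussian_integral_real:
  fixes t z :: real assumes t: "t > 0"
  shows "integrable lborel (\<lambda>\<xi>. complex_of_real (exp (- t * \<xi>\<^sup>2)) * cis (z * \<xi>))"
    "(LINT \<xi>|lborel. complex_of_real (exp (- t * \<xi>\<^sup>2)) * cis (z * \<xi>)) =
      complex_of_real (sqrt (pi / t) * exp (- z\<^sup>2 / (4 * t)))"
proof -
  define c where "c = sqrt (2 * t)"
  have c: "c > 0" "c\<^sup>2 = 2 * t" using t by (auto simp: c_def)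
  have char: "(LINT y|lborel. complex_of_real (std_normal_density y) * cis (u * y)) = complex_of_real (exp (- (u\<^sup>2) / 2))" for u
  proof -
    have "char std_normal_distribution u = (LINT y|lborel. std_normal_density y *\<^sub>R iexp (u * y))"
      unfolding char_def by (subst integral_density) (auto simp: normal_density_nonneg)
    then show ?thesis using char_std_normal_distribution
      by (simp add: cis_conv_exp scaleR_conv_of_real)
  qed
  have int: "integrable lborel (\<lambda>y. complex_of_real (std_normal_density y) * cis (u * y))" for u
  proof (rule Bochner_Integration.integrable_bound)
    show "integrable lborel std_normal_density" by (rule integrable_normal_density) simp
  qed (auto simp: norm_mult)
  have eq: "complex_of_real (exp (- t * \<xi>\<^sup>2)) * cis (z * \<xi>) =
     complex_of_real (sqrt (2 * pi)) * (complex_of_real (std_normal_density (0 + c * \<xi>)) * cis (z / c * (0 + c * \<xi>)))" for \<xi>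
    using c by (simp add: normal_density_def power_mult_distrib real_sqrt_mult)
  have int': "integrable lborel (\<lambda>\<xi>. complex_of_real (std_normal_density (0 + c * \<xi>)) * cis (z / c * (0 + c * \<xi>)))"
    using lborel_integrable_real_affine[OF int[of "z / c"], of c 0] c by simp
  show "integrable lborel (\<lambda>\<xi>. complex_of_real (exp (- t * \<xi>\<^sup>2)) * cis (z * \<xi>))"
    unfolding eq by (rule integrable_mult_right[OF int'])
  have "(LINT y|lborel. complex_of_real (std_normal_density y) * cis (z / c * y)) =
     \<bar>c\<bar> *\<^sub>R (LINT \<xi>|lborel. complex_of_real (std_normal_density (0 + c * \<xi>)) * cis (z / c * (0 + c * \<xi>)))"
    using c by (intro lborel_integral_real_affine) auto
  then have "(LINT \<xi>|lborel. complex_of_real (std_normal_density (0 + c * \<xi>)) * cis (z / c * (0 + c * \<xi>)))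
     = complex_of_real (exp (- ((z / c)\<^sup>2) / 2) / c)"
    unfolding char using c by (simp add: scaleR_conv_of_real field_simps)
  then have "(LINT \<xi>|lborel. complex_of_real (exp (- t * \<xi>\<^sup>2)) * cis (z * \<xi>)) =
     complex_of_real (sqrt (2 * pi)) * complex_of_real (exp (- ((z / c)\<^sup>2) / 2) / c)"
    unfolding eq integral_mult_right_zero by simp
  also have "\<dots> = complex_of_real (sqrt (pi / t) * exp (- z\<^sup>2 / (4 * t)))"
  proof -
    have "sqrt (2 * pi) / c = sqrt (pi / t)" unfolding c_def real_sqrt_divide[symmetric] using t by simp
    moreover have "- ((z / c)\<^sup>2) / 2 = - z\<^sup>2 / (4 * t)" using c by (simp add: power_divide)
    ultimately show ?thesis by (metis of_real_mult times_divide_eq_left times_divide_eq_right mult.commute)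
  qed
  finally show "(LINT \<xi>|lborel. complex_of_real (exp (- t * \<xi>\<^sup>2)) * cis (z * \<xi>)) =
      complex_of_real (sqrt (pi / t) * exp (- z\<^sup>2 / (4 * t)))" .
qed

lemma cis_sum: "finite I \<Longrightarrow> cis (\<Sum>i\<in>I. f i) = (\<Prod>i\<in>I. cis (f i))"
  by (induction I rule: finite_induct) (auto simp: cis_mult[symmetric])

text \<open>\<open>lborel\<close> is the image of the product of one-dimensional measures under the
  coordinate map. Used for Gaussians and for the integrable majorant of Schwartz functions.\<close>

lemma product_lborel:
  fixes f :: "'a::euclidean_space \<Rightarrow> real \<Rightarrow> complex"
  assumes f: "\<And>b. b \<in> Basis \<Longrightarrow> integrable lborel (f b)"
  shows "integrable lborel (\<lambda>x::'a. \<Prod>b\<in>Basis. f b (x \<bullet> b))"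
    "(LINT x|lborel. (\<Prod>b\<in>(Basis::'a set). f b (x \<bullet> b))) = (\<Prod>b\<in>Basis. LINT y|lborel. f b y)"
proof -
  interpret product_sigma_finite "\<lambda>_::'a. lborel :: real measure" ..
  have [measurable]: "f b \<in> borel_measurable borel" if "b \<in> Basis" for b
    using borel_measurable_integrable[OF f[OF that]] by simp
  let ?T = "\<lambda>g::'a \<Rightarrow> real. \<Sum>b\<in>Basis. g b *\<^sub>R b"
  have T: "?T \<in> measurable (\<Pi>\<^sub>M b\<in>Basis. lborel) borel" by measurable
  have comp: "(\<Prod>b\<in>(Basis::'a set). f b (?T g \<bullet> b)) = (\<Prod>b\<in>Basis. f b (g b))" for g
    by (intro prod.cong refl) simp
  have m: "(\<lambda>x::'a. \<Prod>b\<in>Basis. f b (x \<bullet> b)) \<in> borel_measurable borel" by measurable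
  show "integrable lborel (\<lambda>x::'a. \<Prod>b\<in>Basis. f b (x \<bullet> b))"
    unfolding lborel_eq[where 'a='a] integrable_distr_eq[OF T m] comp
    by (rule product_integrable_prod) (auto intro: f)
  show "(LINT x|lborel. (\<Prod>b\<in>(Basis::'a set). f b (x \<bullet> b))) = (\<Prod>b\<in>Basis. LINT y|lborel. f b y)"
    unfolding lborel_eq[where 'a='a] integral_distr[OF T m] comp
    by (rule product_integral_prod) (auto intro: f)
qed

lemma norm_square_Basis_sum: "(norm z)\<^sup>2 = (\<Sum>b\<in>Basis. (z \<bullet> b)\<^sup>2)" for z :: "'a::euclidean_space"
  unfolding power2_norm_eq_inner by (subst euclidean_inner) (simp add: power2_eq_square)

lemma gaussian_integral:
  fixes z :: "'a::euclidean_space" assumes t: "t > 0"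
  shows "integrable lborel (\<lambda>\<xi>. complex_of_real (exp (- t * (norm \<xi>)\<^sup>2)) * cis (z \<bullet> \<xi>))"
    "(LINT \<xi>|lborel. complex_of_real (exp (- t * (norm \<xi>)\<^sup>2)) * cis (z \<bullet> \<xi>)) = complex_of_real (heat_kernel t z)"
proof -
  let ?f = "\<lambda>b y. complex_of_real (exp (- t * y\<^sup>2)) * cis ((z \<bullet> b) * y)"
  have eq: "complex_of_real (exp (- t * (norm \<xi>)\<^sup>2)) * cis (z \<bullet> \<xi>) = (\<Prod>b\<in>Basis. ?f b (\<xi> \<bullet> b))" for \<xi> :: 'a
  proof -
    have "exp (- t * (norm \<xi>)\<^sup>2) = (\<Prod>b\<in>Basis. exp (- t * (\<xi> \<bullet> b)\<^sup>2))"
      by (simp add: norm_square_Basis_sum exp_sum[symmetric] sum_distrib_left sum_negf)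
    moreover have "cis (z \<bullet> \<xi>) = (\<Prod>b\<in>Basis. cis ((z \<bullet> b) * (\<xi> \<bullet> b)))"
      by (subst euclidean_inner) (simp add: cis_sum)
    ultimately show ?thesis by (simp add: prod.distrib)
  qed
  note i = gaussian_integral_real[OF t]
  show "integrable lborel (\<lambda>\<xi>. complex_of_real (exp (- t * (norm \<xi>)\<^sup>2)) * cis (z \<bullet> \<xi>))"
    unfolding eq by (rule product_lborel(1)[OF i(1)])
  have "(LINT \<xi>|lborel. complex_of_real (exp (- t * (norm \<xi>)\<^sup>2)) * cis (z \<bullet> \<xi>)) =
      (\<Prod>b\<in>(Basis::'a set). complex_of_real (sqrt (pi / t) * exp (- (z \<bullet> b)\<^sup>2 / (4 * t))))"
    unfolding eq product_lborel(2)[OF i(1)] i(2) ..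
  also have "\<dots> = complex_of_real (\<Prod>b\<in>(Basis::'a set). sqrt (pi / t) * exp (- (z \<bullet> b)\<^sup>2 / (4 * t)))"
    by simp
  also have "(\<Prod>b\<in>(Basis::'a set). sqrt (pi / t) * exp (- (z \<bullet> b)\<^sup>2 / (4 * t))) = heat_kernel t z"
    by (simp add: heat_kernel_def prod.distrib norm_square_Basis_sum exp_sum[symmetric] sum_divide_distrib sum_negf)
  finally show "(LINT \<xi>|lborel. complex_of_real (exp (- t * (norm \<xi>)\<^sup>2)) * cis (z \<bullet> \<xi>)) = complex_of_real (heat_kernel t z)" .
qed

text \<open>Functions on a bounded domain, extended by zero, belong to this class up to null sets.
  Its members are integrable as well, so \<open>ft\<close> is an honest integral at every frequency
  and identities of transforms hold pointwise.\<close>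

definition l2c :: "('a::euclidean_space \<Rightarrow> real) set" where
  "l2c = {f \<in> l2 lborel. \<exists>R. \<forall>x. norm x > R \<longrightarrow> f x = 0}"

lemma l2cD: "f \<in> l2c \<Longrightarrow> f \<in> l2 lborel"
  by (simp add: l2c_def)

lemma l2c_measurable [measurable_dest]: "f \<in> l2c \<Longrightarrow> f \<in> borel_measurable borel"
  using l2_measurable[of f lborel] by (simp add: l2c_def)

lemma l2c_support: "f \<in> l2c \<Longrightarrow> \<exists>R\<ge>0. \<forall>x. norm x > R \<longrightarrow> f x = 0"
proof -
  assume "f \<in> l2c"
  then obtain R where "\<And>x. norm x > R \<Longrightarrow> f x = 0" by (auto simp: l2c_def)
  then show ?thesis by (intro exI[of _ "max 0 R"]) auto
qed

lemma indicator_cball_integrable: "integrable lborel (\<lambda>x. indicat_real (cball (0::'a::euclidean_space) R) x)"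
  using emeasure_bounded_finite[OF bounded_cball, of "0::'a" R] by (intro integrable_real_indicator) auto

lemma indicator_cball_l2: "indicat_real (cball (0::'a::euclidean_space) R) \<in> l2 lborel"
  using indicator_cball_integrable[of R] borel_measurable_integrable[OF indicator_cball_integrable[of R]]
  by (simp add: l2_def power2_eq_square indicator_inter_arith[symmetric])

lemma l2c_integrable:
  assumes f: "f \<in> l2c" shows "integrable lborel f"
proof -
  obtain R where R: "\<And>x. norm x > R \<Longrightarrow> f x = 0" using l2c_support[OF f] by auto
  have "f = (\<lambda>x. f x * indicator (cball 0 R) x)"
    by (rule ext) (use R in \<open>auto simp: indicator_def\<close>)
  then show ?thesis using l2_mult_integrable[OF l2cD[OF f] indicator_cball_l2[of R]] by simp
qed

lemma l2c_add: "f \<in> l2c \<Longrightarrow> g \<in> l2c \<Longrightarrow> (\<lambda>x. f x + g x) \<in> l2c"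
proof -
  assume f: "f \<in> l2c" and g: "g \<in> l2c"
  obtain R S where "\<And>x. norm x > R \<Longrightarrow> f x = 0" "\<And>x. norm x > S \<Longrightarrow> g x = 0"
    using l2c_support[OF f] l2c_support[OF g] by auto
  then have "\<forall>x. norm x > max R S \<longrightarrow> f x + g x = 0" by auto
  then show ?thesis unfolding l2c_def using l2_add[OF l2cD[OF f] l2cD[OF g]] by blast
qed

lemma l2c_scale: "f \<in> l2c \<Longrightarrow> (\<lambda>x. c * f x) \<in> l2c"
  unfolding l2c_def using l2_scale[of f lborel c] by fastforce

lemma l2c_diff: "f \<in> l2c \<Longrightarrow> g \<in> l2c \<Longrightarrow> (\<lambda>x. f x - g x) \<in> l2c"
  using l2c_add[of f "\<lambda>x. (-1) * g x"] l2c_scale[of g "-1"] by simp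

lemma l2c_sum: "(\<And>i. i \<in> I \<Longrightarrow> f i \<in> l2c) \<Longrightarrow> (\<lambda>x. \<Sum>i\<in>I. f i x) \<in> l2c"
proof (induction I rule: infinite_finite_induct)
  case (insert i I) then show ?case by (simp add: l2c_add)
qed (auto simp: l2c_def)

lemma l2c_dominated:
  assumes "f \<in> borel_measurable borel" "g \<in> l2c" "\<And>x. \<bar>f x\<bar> \<le> C * \<bar>g x\<bar>"
  shows "f \<in> l2c"
proof -
  have "f \<in> l2 lborel"
  proof (rule l2_dominated[OF _ l2_scale[OF l2cD[OF assms(2)], of C]])
    have "\<bar>f x\<bar> \<le> \<bar>C * g x\<bar>" for x
      using assms(3)[of x] mult_right_mono[OF abs_ge_self[of C], of "\<bar>g x\<bar>"] by (simp add: abs_mult)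
    then show "AE x in lborel. \<bar>f x\<bar> \<le> \<bar>C * g x\<bar>" by simp
  qed (use assms in simp)
  moreover obtain R where R: "\<And>x. norm x > R \<Longrightarrow> g x = 0" using l2c_support[OF assms(2)] by auto
  have "f x = 0" if "norm x > R" for x using assms(3)[of x] R[OF that] by simp
  ultimately show ?thesis unfolding l2c_def by blast
qed

lemma l2c_shift:
  assumes f: "f \<in> l2c" shows "(\<lambda>x. f (x + h)) \<in> l2c"
proof -
  obtain R where R: "\<And>x. norm x > R \<Longrightarrow> f x = 0" using l2c_support[OF f] by auto
  note [measurable] = l2c_measurable[OF f]
  have "integrable (distr lborel borel ((+) h)) (\<lambda>x. (f x)\<^sup>2)"
    using l2_integrable_square[OF l2cD[OF f]] by (simp add: lborel_distr_plus)
  then have "integrable lborel (\<lambda>x. (f (h + x))\<^sup>2)"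
    by (subst (asm) integrable_distr_eq) auto
  then have "(\<lambda>x. f (x + h)) \<in> l2 lborel" by (simp add: l2_def add.commute)
  moreover have "f (x + h) = 0" if "norm x > R + norm h" for x
    using norm_triangle_ineq4[of "x + h" h] that by (intro R) simp
  ultimately show ?thesis unfolding l2c_def by blast
qed

lemma ft_integrable: "integrable lborel f \<Longrightarrow> integrable lborel (\<lambda>x. cis (- (x \<bullet> \<xi>)) * complex_of_real (f x))"
  by (rule Bochner_Integration.integrable_bound[of _ f]) (auto simp: norm_mult)

lemma ft_measurable [measurable]:
  assumes [measurable]: "f \<in> borel_measurable borel"
  shows "ft f \<in> borel_measurable borel"
  unfolding ft_def[abs_def] by measurable

lemma ft_add: "integrable lborel f \<Longrightarrow> integrable lborel g \<Longrightarrow> ft (\<lambda>x. f x + g x) \<xi> = ft f \<xi> + ft g \<xi>"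
  unfolding ft_def using ft_integrable[of f \<xi>] ft_integrable[of g \<xi>] by (simp add: distrib_left)

lemma ft_diff: "integrable lborel f \<Longrightarrow> integrable lborel g \<Longrightarrow> ft (\<lambda>x. f x - g x) \<xi> = ft f \<xi> - ft g \<xi>"
  unfolding ft_def using ft_integrable[of f \<xi>] ft_integrable[of g \<xi>] by (simp add: right_diff_distrib)

lemma ft_scale: "ft (\<lambda>x. c * f x) \<xi> = complex_of_real c * ft f \<xi>"
proof -
  have "(\<lambda>x. cis (- (x \<bullet> \<xi>)) * complex_of_real (c * f x)) = (\<lambda>x. complex_of_real c * (cis (- (x \<bullet> \<xi>)) * complex_of_real (f x)))"
    by (simp add: mult_ac)
  then show ?thesis unfolding ft_def by (simp only: integral_mult_right_zero)
qed

lemma ft_sum: "(\<And>i. i \<in> I \<Longrightarrow> integrable lborel (f i)) \<Longrightarrow> ft (\<lambda>x. \<Sum>i\<in>I. f i x) \<xi> = (\<Sum>i\<in>I. ft (f i) \<xi>)"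
  unfolding ft_def by (simp add: sum_distrib_left Bochner_Integration.integral_sum ft_integrable)

lemma ft_cong_AE:
  assumes "f \<in> borel_measurable borel" "g \<in> borel_measurable borel" "AE x in lborel. f x = g x"
  shows "ft f = ft g"
  unfolding ft_def by (intro ext integral_cong_AE) (use assms in auto)

lemma ft_norm_le: "integrable lborel f \<Longrightarrow> cmod (ft f \<xi>) \<le> (LINT x|lborel. \<bar>f x\<bar>)"
  unfolding ft_def using integral_norm_bound[of lborel "\<lambda>x. cis (- (x \<bullet> \<xi>)) * complex_of_real (f x)"]
  by (simp add: norm_mult)

lemma ft_shift:
  assumes [measurable]: "f \<in> borel_measurable borel"
  shows "ft (\<lambda>x. f (x + h)) \<xi> = cis (h \<bullet> \<xi>) * ft f \<xi>"
proof -
  have m: "(\<lambda>x. cis (h \<bullet> \<xi>) * (cis (- (x \<bullet> \<xi>)) * complex_of_real (f x))) \<in> borel_measurable borel" by measurable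
  have "(LINT x|distr lborel borel ((+) h). cis (h \<bullet> \<xi>) * (cis (- (x \<bullet> \<xi>)) * complex_of_real (f x)))
    = (LINT x|lborel. cis (h \<bullet> \<xi>) * (cis (- ((h + x) \<bullet> \<xi>)) * complex_of_real (f (h + x))))"
    by (rule integral_distr) measurable
  also have "\<dots> = ft (\<lambda>x. f (x + h)) \<xi>"
    unfolding ft_def by (intro Bochner_Integration.integral_cong refl)
      (simp add: mult.assoc[symmetric] cis_mult inner_add_left add.commute)
  finally show ?thesis by (simp add: ft_def lborel_distr_plus)
qed

lemma integrable_pair_product:
  fixes f :: "'a \<Rightarrow> 'c::{real_normed_field, banach, second_countable_topology}"
  assumes "sigma_finite_measure N" and f: "integrable M f" and g: "integrable N g"
  shows "integrable (M \<Otimes>\<^sub>M N) (\<lambda>p. f (fst p) * g (snd p))"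
proof (rule integrableI_bounded)
  interpret sigma_finite_measure N by fact
  have [measurable]: "f \<in> borel_measurable M" "g \<in> borel_measurable N" using f g by auto
  show "(\<lambda>p. f (fst p) * g (snd p)) \<in> borel_measurable (M \<Otimes>\<^sub>M N)" by measurable
  have "(\<integral>\<^sup>+p. ennreal (norm (f (fst p) * g (snd p))) \<partial>(M \<Otimes>\<^sub>M N)) =
    (\<integral>\<^sup>+x. \<integral>\<^sup>+y. ennreal (norm (f x)) * ennreal (norm (g y)) \<partial>N \<partial>M)"
    by (subst nn_integral_fst[symmetric]) (auto simp: norm_mult ennreal_mult)
  also have "\<dots> = (\<integral>\<^sup>+x. ennreal (norm (f x)) \<partial>M) * (\<integral>\<^sup>+y. ennreal (norm (g y)) \<partial>N)"
    by (simp add: nn_integral_cmult nn_integral_multc)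
  also have "\<dots> < \<infinity>"
    using f g unfolding integrable_iff_bounded by (auto intro: ennreal_mult_less_top[THEN iffD2])
  finally show "(\<integral>\<^sup>+p. ennreal (norm (f (fst p) * g (snd p))) \<partial>(M \<Otimes>\<^sub>M N)) < \<infinity>" .
qed

lemma ft_product:
  assumes "integrable lborel f" "integrable lborel g"
  shows "ft f \<xi> * cnj (ft g \<xi>) =
    (LINT p|(lborel \<Otimes>\<^sub>M lborel). cis ((snd p - fst p) \<bullet> \<xi>) * complex_of_real (f (fst p) * g (snd p)))"
    "integrable (lborel \<Otimes>\<^sub>M lborel) (\<lambda>p. f (fst p) * g (snd p))"
proof -
  have cnj: "cnj (ft g \<xi>) = (LINT x|lborel. cis (x \<bullet> \<xi>) * complex_of_real (g x))"
    unfolding ft_def using integral_bounded_linear[OF bounded_linear_cnj ft_integrable[OF assms(2)]]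
    by (simp add: cis_cnj)
  have int: "integrable lborel (\<lambda>x. cis (x \<bullet> \<xi>) * complex_of_real (g x))"
    using assms(2) by (rule Bochner_Integration.integrable_bound) (use assms(2) in \<open>auto simp: norm_mult\<close>)
  have "integrable (lborel \<Otimes>\<^sub>M lborel) (\<lambda>(x, y). (cis (- (x \<bullet> \<xi>)) * complex_of_real (f x)) * (cis (y \<bullet> \<xi>) * complex_of_real (g y)))"
    using integrable_pair_product[OF sigma_finite_lborel ft_integrable[OF assms(1)] int] by (simp add: case_prod_unfold)
  from lborel_pair.integral_fst'[OF this]
  have "(LINT x|lborel. LINT y|lborel. (cis (- (x \<bullet> \<xi>)) * complex_of_real (f x)) * (cis (y \<bullet> \<xi>) * complex_of_real (g y)))
     = (LINT p|(lborel \<Otimes>\<^sub>M lborel). (cis (- (fst p \<bullet> \<xi>)) * complex_of_real (f (fst p))) * (cis (snd p \<bullet> \<xi>) * complex_of_real (g (snd p))))"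
    by (simp add: case_prod_unfold)
  also have "\<dots> = (LINT p|(lborel \<Otimes>\<^sub>M lborel). cis ((snd p - fst p) \<bullet> \<xi>) * complex_of_real (f (fst p) * g (snd p)))"
  proof (intro Bochner_Integration.integral_cong refl)
    fix p
    have "cis ((snd p - fst p) \<bullet> \<xi>) = cis (- (fst p \<bullet> \<xi>)) * cis (snd p \<bullet> \<xi>)"
      by (simp add: cis_mult inner_diff_left)
    then show "(cis (- (fst p \<bullet> \<xi>)) * complex_of_real (f (fst p))) * (cis (snd p \<bullet> \<xi>) * complex_of_real (g (snd p))) =
      cis ((snd p - fst p) \<bullet> \<xi>) * complex_of_real (f (fst p) * g (snd p))" by (simp add: mult_ac)
  qed
  finally show "ft f \<xi> * cnj (ft g \<xi>) =
    (LINT p|(lborel \<Otimes>\<^sub>M lborel). cis ((snd p - fst p) \<bullet> \<xi>) * complex_of_real (f (fst p) * g (snd p)))"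
    unfolding cnj by (simp add: ft_def[of f])
  show "integrable (lborel \<Otimes>\<^sub>M lborel) (\<lambda>p. f (fst p) * g (snd p))"
    using integrable_pair_product[OF sigma_finite_lborel assms] .
qed

text \<open>The Gaussian weight makes the triple integral over \<xi>, x and y absolutely convergent.
  Integrating over \<xi> first replaces the phase by the heat kernel, integrating over (x, y) first
  gives the product of the transforms.\<close>

lemma gaussian_pairing:
  fixes f g :: "'a::euclidean_space \<Rightarrow> real"
  assumes fg: "integrable lborel f" "integrable lborel g" and t: "t > 0"
  shows "(LINT \<xi>|lborel. complex_of_real (exp (- t * (norm \<xi>)\<^sup>2)) * (ft f \<xi> * cnj (ft g \<xi>))) =
    complex_of_real (LINT p|(lborel \<Otimes>\<^sub>M lborel). heat_kernel t (snd p - fst p) * (f (fst p) * g (snd p)))"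
    "integrable lborel (\<lambda>\<xi>. complex_of_real (exp (- t * (norm \<xi>)\<^sup>2)) * (ft f \<xi> * cnj (ft g \<xi>)))"
    "integrable (lborel \<Otimes>\<^sub>M lborel) (\<lambda>p. heat_kernel t (snd p - fst p) * (f (fst p) * g (snd p)))"
proof -
  let ?P = "lborel \<Otimes>\<^sub>M lborel :: ('a \<times> 'a) measure"
  have P: "sigma_finite_measure ?P"
    using lborel_pair.sigma_finite_measure_axioms .
  then interpret P: sigma_finite_measure ?P .
  interpret Q: pair_sigma_finite "lborel :: 'a measure" ?P ..
  have [measurable]: "f \<in> borel_measurable borel" "g \<in> borel_measurable borel"
    using fg borel_measurable_integrable by fastforce+
  define h where "h p = f (fst p) * g (snd p)" for p
  have h [measurable]: "h \<in> borel_measurable ?P" unfolding h_def by measurable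
  have hi: "integrable ?P h" unfolding h_def by (rule ft_product(2)[OF fg])
  have gi: "integrable lborel (\<lambda>\<xi>::'a. exp (- t * (norm \<xi>)\<^sup>2))"
    using integrable_norm[OF gaussian_integral(1)[OF t, of "0::'a"]] by (simp add: norm_mult)
  define G where "G \<xi> p = complex_of_real (exp (- t * (norm \<xi>)\<^sup>2)) * (cis ((snd p - fst p) \<bullet> \<xi>) * complex_of_real (h p))"
    for \<xi> and p :: "'a \<times> 'a"
  have Gi: "integrable (lborel \<Otimes>\<^sub>M ?P) (\<lambda>(\<xi>, p). G \<xi> p)"
  proof (rule Bochner_Integration.integrable_bound)
    show "integrable (lborel \<Otimes>\<^sub>M ?P) (\<lambda>(\<xi>::'a, p). exp (- t * (norm \<xi>)\<^sup>2) * h p)"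
      using integrable_pair_product[OF P gi hi] by (simp add: case_prod_unfold)
    show "(\<lambda>(\<xi>, p). G \<xi> p) \<in> borel_measurable (lborel \<Otimes>\<^sub>M ?P)" unfolding G_def by measurable
  qed (auto simp: G_def norm_mult abs_mult)
  have a: "(LINT p|?P. G \<xi> p) = complex_of_real (exp (- t * (norm \<xi>)\<^sup>2)) * (ft f \<xi> * cnj (ft g \<xi>))" for \<xi>
    unfolding G_def ft_product(1)[OF fg] h_def by (rule integral_mult_right_zero)
  have b: "(LINT \<xi>|lborel. G \<xi> p) = complex_of_real (heat_kernel t (snd p - fst p) * h p)" for p
  proof -
    have "(\<lambda>\<xi>. G \<xi> p) = (\<lambda>\<xi>. (complex_of_real (exp (- t * (norm \<xi>)\<^sup>2)) * cis ((snd p - fst p) \<bullet> \<xi>)) * complex_of_real (h p))"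
      by (simp add: G_def mult.assoc)
    then show ?thesis by (simp only: integral_mult_left_zero gaussian_integral(2)[OF t] of_real_mult)
  qed
  have "(LINT p|?P. LINT \<xi>|lborel. G \<xi> p) = (LINT \<xi>|lborel. LINT p|?P. G \<xi> p)"
    by (rule Q.Fubini_integral[OF Gi])
  then show "(LINT \<xi>|lborel. complex_of_real (exp (- t * (norm \<xi>)\<^sup>2)) * (ft f \<xi> * cnj (ft g \<xi>))) =
    complex_of_real (LINT p|?P. heat_kernel t (snd p - fst p) * (f (fst p) * g (snd p)))"
    unfolding a b integral_complex_of_real unfolding h_def by (rule sym)
  show "integrable lborel (\<lambda>\<xi>. complex_of_real (exp (- t * (norm \<xi>)\<^sup>2)) * (ft f \<xi> * cnj (ft g \<xi>)))"
    using Q.integrable_fst[OF Gi] unfolding a .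
  show "integrable ?P (\<lambda>p. heat_kernel t (snd p - fst p) * (f (fst p) * g (snd p)))"
    using Q.integrable_snd[OF Gi] unfolding b complex_of_real_integrable_eq unfolding h_def .
qed

lemma nrm_tendsto_0_iff: "(\<lambda>n. nrm M (u n)) \<longlonglongrightarrow> 0 \<longleftrightarrow> (\<lambda>n. ip M (u n) (u n)) \<longlonglongrightarrow> 0"
proof
  assume "(\<lambda>n. nrm M (u n)) \<longlonglongrightarrow> 0"
  from tendsto_power[OF this, of 2] show "(\<lambda>n. ip M (u n) (u n)) \<longlonglongrightarrow> 0" by simp
next
  assume "(\<lambda>n. ip M (u n) (u n)) \<longlonglongrightarrow> 0"
  from tendsto_real_sqrt[OF this] show "(\<lambda>n. nrm M (u n)) \<longlonglongrightarrow> 0" by (simp add: nrm_def)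
qed

lemma l2_dominated_convergence:
  assumes u: "\<And>n. u n \<in> borel_measurable M" and v: "v \<in> borel_measurable M" and w: "w \<in> l2 M"
    and lim: "AE x in M. (\<lambda>n. u n x) \<longlonglongrightarrow> v x"
    and bound: "\<And>n. AE x in M. \<bar>u n x - v x\<bar> \<le> w x"
  shows "(\<lambda>n. nrm M (\<lambda>x. u n x - v x)) \<longlonglongrightarrow> 0"
  unfolding nrm_tendsto_0_iff
proof -
  note [measurable] = u v
  have "(\<lambda>n. LINT x|M. (u n x - v x) * (u n x - v x)) \<longlonglongrightarrow> (LINT x|M. 0)"
  proof (rule integral_dominated_convergence)
    show "integrable M (\<lambda>x. w x * w x)" by (rule l2_mult_integrable[OF w w])
    show "AE x in M. (\<lambda>n. (u n x - v x) * (u n x - v x)) \<longlonglongrightarrow> 0"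
      using lim
    proof eventually_elim
      case (elim x)
      have "(\<lambda>n. (u n x - v x) * (u n x - v x)) \<longlonglongrightarrow> (v x - v x) * (v x - v x)"
        by (intro tendsto_intros elim)
      then show ?case by simp
    qed
    show "AE x in M. norm ((u n x - v x) * (u n x - v x)) \<le> w x * w x" for n
      using bound[of n]
    proof eventually_elim
      case (elim x)
      show ?case unfolding real_norm_def abs_mult
        by (rule mult_mono[OF elim elim]) (use elim in linarith, simp)
    qed
  qed measurable
  then show "(\<lambda>n. ip M (\<lambda>x. u n x - v x) (\<lambda>x. u n x - v x)) \<longlonglongrightarrow> 0" by (simp add: ip_def)
qed

text \<open>A Lebesgue measurable function is the limit of continuous functions off a negligible
  set. After bounding and cutting off these functions, pointwise convergence becomes L2 convergence
  by domination.\<close>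

lemma l2c_bounded_approx:
  fixes f :: "'a::euclidean_space \<Rightarrow> real"
  assumes f: "f \<in> l2c" and C: "\<And>x. \<bar>f x\<bar> \<le> C" and e: "e > 0"
  shows "\<exists>k. continuous_on UNIV k \<and> k \<in> l2c \<and> nrm lborel (\<lambda>x. f x - k x) < e"
proof -
  obtain R where R: "R \<ge> 0" "\<And>x. norm x > R \<Longrightarrow> f x = 0" using l2c_support[OF f] by auto
  note [measurable] = l2c_measurable[OF f]
  have C0: "C \<ge> 0" using C[of 0] by linarith
  have "f \<in> borel_measurable lebesgue" using l2c_measurable[OF f] by (simp add: measurable_completion)
  then have "f measurable_on UNIV" by (intro lebesgue_measurable_imp_measurable_on_real) auto
  then obtain N G where N: "negligible N" and G: "\<And>n. continuous_on UNIV (G n)"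
    and lim: "\<And>x. x \<notin> N \<Longrightarrow> (\<lambda>n. G n x) \<longlonglongrightarrow> f x"
    unfolding measurable_on_def by auto
  have "N \<in> null_sets lebesgue" using N by (simp add: negligible_iff_null_sets)
  then obtain N' where N': "N' \<in> null_sets lborel" "N \<subseteq> N'" by (auto simp: null_sets_completion_iff2)
  \<comment> \<open>Clamping to [-C, C] and multiplying by a factor that is 1 up to radius R and 0
    from R + 1 on. Neither operation changes the limit, as |f| is at most C and f vanishes beyond
    R.\<close>
  define k where "k n x = max (- C) (min C (G n x)) * max 0 (min 1 (R + 1 - norm x))" for n x
  have kc: "continuous_on UNIV (k n)" for n
    unfolding k_def by (intro continuous_intros G)
  have [measurable]: "k n \<in> borel_measurable borel" for n
    by (rule borel_measurable_continuous_onI[OF kc])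
  have kb: "\<bar>k n x\<bar> \<le> C * indicator (cball 0 (R + 1)) x" for n x
  proof (cases "norm x \<le> R + 1")
    case True
    have "\<bar>max (- C) (min C (G n x))\<bar> \<le> C" using C0 by auto
    moreover have "\<bar>max 0 (min 1 (R + 1 - norm x))\<bar> \<le> 1" by auto
    ultimately have "\<bar>k n x\<bar> \<le> C * 1" unfolding k_def abs_mult by (intro mult_mono) auto
    then show ?thesis using True by simp
  qed (auto simp: k_def)
  have ind: "(\<lambda>x::'a. c * indicat_real (cball 0 (R + 1)) x) \<in> l2 lborel" for c
    by (intro l2_scale indicator_cball_l2)
  have kl: "k n \<in> l2c" for n
  proof -
    have "k n \<in> l2 lborel" by (rule l2_dominated[OF _ ind[of C]]) (use order_trans[OF kb abs_ge_self] in auto)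
    moreover have "k n x = 0" if "norm x > R + 1" for x using kb[of n x] that by simp
    ultimately show ?thesis unfolding l2c_def by blast
  qed
  have "(\<lambda>n. nrm lborel (\<lambda>x. k n x - f x)) \<longlonglongrightarrow> 0"
  proof (rule l2_dominated_convergence[OF _ _ ind[of "2 * C"]])
    have "(\<lambda>n. k n x) \<longlonglongrightarrow> f x" if "x \<notin> N" for x
    proof -
      have "(\<lambda>n. k n x) \<longlonglongrightarrow> max (- C) (min C (f x)) * max 0 (min 1 (R + 1 - norm x))"
        unfolding k_def by (intro tendsto_intros lim that)
      also have "max (- C) (min C (f x)) * max 0 (min 1 (R + 1 - norm x)) = f x"
        using C[of x] R(2)[of x] by (cases "norm x > R") auto
      finally show ?thesis .
    qed
    then show "AE x in lborel. (\<lambda>n. k n x) \<longlonglongrightarrow> f x"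
      by (intro AE_I'[OF N'(1)]) (use N'(2) in auto)
    have "\<bar>k n x - f x\<bar> \<le> 2 * C * indicator (cball 0 (R + 1)) x" for n x
      using kb[of n x] C[of x] R(2)[of x] by (cases "norm x > R + 1") auto
    then show "AE x in lborel. \<bar>k n x - f x\<bar> \<le> 2 * C * indicator (cball 0 (R + 1)) x" for n by simp
  qed measurable
  then have "eventually (\<lambda>n. nrm lborel (\<lambda>x. k n x - f x) < e) sequentially"
    using e by (rule order_tendstoD)
  then obtain n where "nrm lborel (\<lambda>x. k n x - f x) < e" by (auto simp: eventually_sequentially)
  with kc[of n] kl[of n] show ?thesis using nrm_minus_commute[of lborel f "k n"] by auto
qed

lemma l2c_approx:
  fixes f :: "'a::euclidean_space \<Rightarrow> real"
  assumes f: "f \<in> l2c" and e: "e > 0"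
  shows "\<exists>k. continuous_on UNIV k \<and> k \<in> l2c \<and> nrm lborel (\<lambda>x. f x - k x) < e"
proof -
  define g where "g n x = max (- real n) (min (real n) (f x))" for n x
  note [measurable] = l2c_measurable[OF f]
  have [measurable]: "g n \<in> borel_measurable borel" for n unfolding g_def by measurable
  have gf: "\<bar>g n x\<bar> \<le> 1 * \<bar>f x\<bar>" for n x unfolding g_def by auto
  have gl: "g n \<in> l2c" for n by (rule l2c_dominated[OF _ f gf]) measurable
  have gb: "\<bar>g n x\<bar> \<le> real n" for n x unfolding g_def by auto
  have "(\<lambda>x. \<bar>f x\<bar>) \<in> l2 lborel" by (rule l2_dominated[OF _ l2cD[OF f]]) auto
  then have "(\<lambda>n. nrm lborel (\<lambda>x. g n x - f x)) \<longlonglongrightarrow> 0"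
  proof (rule l2_dominated_convergence[rotated 2])
    have "(\<lambda>n. g n x) \<longlonglongrightarrow> f x" for x
    proof (rule tendsto_eventually)
      obtain m :: nat where "\<bar>f x\<bar> \<le> real m" using real_arch_simple by blast
      then have "\<forall>n\<ge>m. g n x = f x" unfolding g_def by auto
      then show "eventually (\<lambda>n. g n x = f x) sequentially" by (auto simp: eventually_sequentially)
    qed
    then show "AE x in lborel. (\<lambda>n. g n x) \<longlonglongrightarrow> f x" by simp
    have "\<bar>g n x - f x\<bar> \<le> \<bar>f x\<bar>" for n x unfolding g_def by auto
    then show "AE x in lborel. \<bar>g n x - f x\<bar> \<le> \<bar>f x\<bar>" for n by simp
  qed measurable
  then have "eventually (\<lambda>n. nrm lborel (\<lambda>x. g n x - f x) < e / 2) sequentially"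
    using e by (intro order_tendstoD) auto
  then obtain n where n: "nrm lborel (\<lambda>x. f x - g n x) < e / 2"
    using nrm_minus_commute[of lborel f] by (auto simp: eventually_sequentially)
  obtain k where k: "continuous_on UNIV k" "k \<in> l2c" "nrm lborel (\<lambda>x. g n x - k x) < e / 2"
    using l2c_bounded_approx[OF gl gb] e by (meson half_gt_zero)
  have "nrm lborel (\<lambda>x. f x - k x) < e"
    using nrm_triangle_diff[OF l2cD[OF f] l2cD[OF gl[of n]] l2cD[OF k(2)]] n k(3) by linarith
  with k show ?thesis by blast
qed

lemma nrm_shift:
  fixes f :: "'a::euclidean_space \<Rightarrow> real"
  assumes [measurable]: "f \<in> borel_measurable borel"
  shows "nrm lborel (\<lambda>x. f (x + h)) = nrm lborel f"
  unfolding nrm_def ip_def by (subst integral_lborel_shift[of "\<lambda>x. f x * f x"]) auto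

text \<open>Replacing f by a continuous k of bounded support costs the same error before and after
  the shift, since shifts preserve the norm. For k dominated convergence applies on a ball large
  enough for all the shifts.\<close>

lemma l2c_shift_continuous:
  fixes f :: "'a::euclidean_space \<Rightarrow> real"
  assumes f: "f \<in> l2c" and h: "h \<longlonglongrightarrow> 0"
  shows "(\<lambda>n. nrm lborel (\<lambda>x. f (x + h n) - f x)) \<longlonglongrightarrow> 0"
proof (rule LIMSEQ_I)
  fix e :: real assume e: "e > 0"
  then obtain k where k: "continuous_on UNIV k" "k \<in> l2c" "nrm lborel (\<lambda>x. f x - k x) < e / 3"
    using l2c_approx[OF f, of "e / 3"] by auto
  note [measurable] = l2c_measurable[OF f] l2c_measurable[OF k(2)]
  obtain R where R: "R \<ge> 0" "\<And>x. norm x > R \<Longrightarrow> k x = 0" using l2c_support[OF k(2)] by auto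
  have "compact (k ` cball 0 R)" by (intro compact_continuous_image continuous_on_subset[OF k(1)]) auto
  then obtain B where B: "\<And>x. x \<in> cball 0 R \<Longrightarrow> \<bar>k x\<bar> \<le> B"
    by (metis bounded_iff compact_imp_bounded image_eqI real_norm_def)
  have kB: "\<bar>k x\<bar> \<le> B" for x
  proof (cases "norm x \<le> R")
    case False
    then have "k x = 0" using R by simp
    then show ?thesis using B[of 0] R(1) by auto
  qed (use B in auto)
  obtain H where H: "\<And>n. norm (h n) \<le> H" using Bseq_def convergent_imp_Bseq[OF convergentI[OF h]] by blast
  have "(\<lambda>n. nrm lborel (\<lambda>x. k (x + h n) - k x)) \<longlonglongrightarrow> 0"
  proof (rule l2_dominated_convergence[OF _ _ l2_scale[OF indicator_cball_l2[of "R + H"], of "2 * B"]])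
    have "(\<lambda>n. k (x + h n)) \<longlonglongrightarrow> k x" for x
    proof -
      have "(\<lambda>n. x + h n) \<longlonglongrightarrow> x + 0" by (intro tendsto_intros h)
      then show ?thesis
        using k(1) by (intro isCont_tendsto_compose[of x k]) (auto simp: continuous_on_eq_continuous_at)
    qed
    then show "AE x in lborel. (\<lambda>n. k (x + h n)) \<longlonglongrightarrow> k x" by simp
    have "\<bar>k (x + h n) - k x\<bar> \<le> 2 * B * indicator (cball 0 (R + H)) x" for n x
    proof (cases "norm x \<le> R + H")
      case True
      then show ?thesis using kB[of x] kB[of "x + h n"] by (simp add: abs_le_iff)
    next
      case False
      have "norm (x + h n) > R" using norm_triangle_ineq4[of "x + h n" "h n"] H[of n] False by simp
      moreover have "norm x > R" using False H[of n] norm_ge_zero[of "h n"] by linarith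
      ultimately show ?thesis using R(2) False by simp
    qed
    then show "AE x in lborel. \<bar>k (x + h n) - k x\<bar> \<le> 2 * B * indicator (cball 0 (R + H)) x" for n by simp
  qed measurable
  then obtain N where N: "\<And>n. n \<ge> N \<Longrightarrow> nrm lborel (\<lambda>x. k (x + h n) - k x) < e / 3"
    using e LIMSEQ_D[of "\<lambda>n. nrm lborel (\<lambda>x. k (x + h n) - k x)" 0 "e / 3"] by auto
  have "nrm lborel (\<lambda>x. f (x + h n) - f x) < e" if n: "n \<ge> N" for n
  proof -
    note l = l2cD[OF f] l2cD[OF k(2)] l2cD[OF l2c_shift[OF f]] l2cD[OF l2c_shift[OF k(2)]]
    have "nrm lborel (\<lambda>x. f (x + h n) - f x) \<le> nrm lborel (\<lambda>x. f (x + h n) - k (x + h n)) + nrm lborel (\<lambda>x. k (x + h n) - f x)"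
      by (intro nrm_triangle_diff l)
    also have "nrm lborel (\<lambda>x. k (x + h n) - f x) \<le> nrm lborel (\<lambda>x. k (x + h n) - k x) + nrm lborel (\<lambda>x. k x - f x)"
      by (intro nrm_triangle_diff l)
    finally show ?thesis
      using N[OF n] k(3) nrm_shift[of "\<lambda>x. f x - k x" "h n"] nrm_minus_commute[of lborel f k] by simp
  qed
  then show "\<exists>no. \<forall>n\<ge>no. norm (nrm lborel (\<lambda>x. f (x + h n) - f x) - 0) < e" by auto
qed

lemma heat_kernel_nonneg: "t > 0 \<Longrightarrow> 0 < heat_kernel t z"
  by (simp add: heat_kernel_def)

lemma heat_kernel_measurable [measurable]: "heat_kernel t \<in> borel_measurable borel"
  unfolding heat_kernel_def[abs_def] by measurable

text \<open>The kernel is again a Gaussian, with parameter 1/(4 t), so the transform formula at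
  frequency 0 gives its mass. This mass is the constant in \<open>plancherel\<close>.\<close>

lemma heat_kernel_integral:
  fixes c :: "'a::euclidean_space \<Rightarrow> real"
  assumes "t > 0"
  shows "integrable lborel (heat_kernel t :: 'a \<Rightarrow> real)" "(LINT z::'a|lborel. heat_kernel t z) = (2 * pi) ^ DIM('a)"
proof -
  have s: "1 / (4 * t) > 0" using assms by simp
  have eq: "heat_kernel t = (\<lambda>z::'a. (sqrt (pi / t)) ^ DIM('a) * exp (- (1 / (4 * t)) * (norm z)\<^sup>2))"
    by (rule ext) (simp add: heat_kernel_def)
  have c: "integrable lborel (\<lambda>z::'a. complex_of_real (exp (- (1 / (4 * t)) * (norm z)\<^sup>2)))"
    "(LINT z::'a|lborel. complex_of_real (exp (- (1 / (4 * t)) * (norm z)\<^sup>2))) = complex_of_real (heat_kernel (1 / (4 * t)) (0::'a))"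
    using gaussian_integral[OF s, of "0::'a"] by simp_all
  have r: "integrable lborel (\<lambda>z::'a. exp (- (1 / (4 * t)) * (norm z)\<^sup>2))"
    "(LINT z::'a|lborel. exp (- (1 / (4 * t)) * (norm z)\<^sup>2)) = heat_kernel (1 / (4 * t)) (0::'a)"
    using c unfolding complex_of_real_integrable_eq integral_complex_of_real of_real_eq_iff by blast+
  show "integrable lborel (heat_kernel t :: 'a \<Rightarrow> real)"
    unfolding eq by (intro integrable_mult_right r)
  have "(LINT z::'a|lborel. heat_kernel t z) = (sqrt (pi / t)) ^ DIM('a) * heat_kernel (1 / (4 * t)) (0::'a)"
    unfolding eq integral_mult_right_zero r(2) ..
  also have "\<dots> = (sqrt (pi / t) * sqrt (4 * pi * t)) ^ DIM('a)"
    by (simp add: heat_kernel_def power_mult_distrib mult_ac)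
  also have "sqrt (pi / t) * sqrt (4 * pi * t) = sqrt ((2 * pi)\<^sup>2)"
    using assms by (simp add: real_sqrt_mult[symmetric] power2_eq_square)
  also have "\<dots> = 2 * pi" by (simp only: real_sqrt_abs) simp
  finally show "(LINT z::'a|lborel. heat_kernel t z) = (2 * pi) ^ DIM('a)" .
qed

lemma integral_lborel_scale:
  fixes f :: "'a::euclidean_space \<Rightarrow> real"
  assumes [measurable]: "f \<in> borel_measurable borel" and c: "c > 0"
  shows "(LINT x|lborel. f x) = (LINT x|lborel. c ^ DIM('a) * f (c *\<^sub>R x))"
proof -
  have "(LINT x|lborel. f x) = (LINT x|density (distr lborel borel (\<lambda>x. 0 + c *\<^sub>R x)) (\<lambda>_. \<bar>c\<bar> ^ DIM('a)). f x)"
    using lborel_affine[of c "0::'a"] c by simp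
  also have "\<dots> = (LINT x|distr lborel borel (\<lambda>x. 0 + c *\<^sub>R x). c ^ DIM('a) * f x)"
    using c by (subst integral_density) auto
  also have "\<dots> = (LINT x|lborel. c ^ DIM('a) * f (c *\<^sub>R x))"
    by (subst integral_distr) auto
  finally show ?thesis .
qed

lemma autocorrelation_tendsto:
  fixes f :: "'a::euclidean_space \<Rightarrow> real"
  assumes f: "f \<in> l2c" and h: "h \<longlonglongrightarrow> 0"
  shows "(\<lambda>n. ip lborel f (\<lambda>x. f (x + h n))) \<longlonglongrightarrow> ip lborel f f"
  using ip_tendsto[OF l2cD[OF l2c_shift[OF f]] l2cD[OF f] l2cD[OF f] l2c_shift_continuous[OF f h]]
  by (subst ip_commute)

lemma autocorrelation_bound:
  assumes f: "f \<in> l2c"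
  shows "\<bar>ip lborel f (\<lambda>x. f (x + h))\<bar> \<le> ip lborel f f"
proof -
  have "\<bar>ip lborel f (\<lambda>x. f (x + h))\<bar> \<le> nrm lborel f * nrm lborel (\<lambda>x. f (x + h))"
    by (rule ip_Cauchy_Schwarz[OF l2cD[OF f] l2cD[OF l2c_shift[OF f]]])
  also have "nrm lborel (\<lambda>x. f (x + h)) = nrm lborel f" by (rule nrm_shift[OF l2c_measurable[OF f]])
  also have "nrm lborel f * nrm lborel f = ip lborel f f"
    using nrm_square[of lborel f] by (simp only: power2_eq_square)
  finally show ?thesis .
qed

text \<open>The substitution y = x + z in the inner integral. Exchanging the integrals afterwards
  needs integrability in the new variables, which follows from boundedness of the kernel and
  integrability of f.\<close>

lemma gaussian_pairing_autocorrelation: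
  fixes f :: "'a::euclidean_space \<Rightarrow> real"
  assumes f: "f \<in> l2c" and t: "t > 0"
  shows "(LINT p|(lborel \<Otimes>\<^sub>M lborel). heat_kernel t (snd p - fst p) * (f (fst p) * f (snd p))) =
    (LINT z|lborel. heat_kernel t z * ip lborel f (\<lambda>x. f (x + z)))"
proof -
  note [measurable] = l2c_measurable[OF f]
  note fi = l2c_integrable[OF f]
  let ?C = "sqrt (pi / t) ^ DIM('a)"
  have K: "\<bar>heat_kernel t z\<bar> \<le> ?C" for z :: 'a
  proof -
    have "heat_kernel t z \<le> ?C * 1"
      unfolding heat_kernel_def using t by (intro mult_left_mono) auto
    then show ?thesis using heat_kernel_nonneg[OF t, of z] by simp
  qed
  have i1: "integrable (lborel \<Otimes>\<^sub>M lborel) (\<lambda>(x, y). heat_kernel t (y - x) * (f x * f y))"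
    using gaussian_pairing(3)[OF fi fi t] by (simp add: case_prod_unfold)
  have i2: "integrable (lborel \<Otimes>\<^sub>M lborel) (\<lambda>(x, z). heat_kernel t z * (f x * f (x + z)))"
  proof (rule integrableI_bounded)
    have "(\<integral>\<^sup>+p. ennreal (norm (case p of (x, z) \<Rightarrow> heat_kernel t z * (f x * f (x + z)))) \<partial>(lborel \<Otimes>\<^sub>M lborel))
      = (\<integral>\<^sup>+x. \<integral>\<^sup>+z. ennreal (norm (heat_kernel t z * (f x * f (x + z)))) \<partial>lborel \<partial>lborel)"
      by (subst lborel.nn_integral_fst[symmetric]) auto
    also have "\<dots> \<le> (\<integral>\<^sup>+x. \<integral>\<^sup>+z. ennreal (?C * \<bar>f x\<bar>) * ennreal \<bar>f (x + z)\<bar> \<partial>lborel \<partial>lborel)"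
    proof (intro nn_integral_mono)
      fix x z
      have "\<bar>heat_kernel t z * (f x * f (x + z))\<bar> \<le> ?C * \<bar>f x\<bar> * \<bar>f (x + z)\<bar>"
        unfolding abs_mult mult.assoc[symmetric] by (intro mult_right_mono K) auto
      then show "ennreal (norm (heat_kernel t z * (f x * f (x + z)))) \<le> ennreal (?C * \<bar>f x\<bar>) * ennreal \<bar>f (x + z)\<bar>"
        using t by (simp add: ennreal_mult[symmetric] ennreal_leI)
    qed
    also have "\<dots> = (\<integral>\<^sup>+x. ennreal (?C * \<bar>f x\<bar>) * ennreal (LINT z|lborel. \<bar>f z\<bar>) \<partial>lborel)"
    proof (intro nn_integral_cong)
      fix x
      have "(\<integral>\<^sup>+z. ennreal \<bar>f (x + z)\<bar> \<partial>lborel) = ennreal (LINT z|lborel. \<bar>f (z + x)\<bar>)"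
        using integrable_lborel_shift[OF fi, of x] by (subst nn_integral_eq_integral) (auto simp: add.commute)
      also have "(LINT z|lborel. \<bar>f (z + x)\<bar>) = (LINT z|lborel. \<bar>f z\<bar>)"
        by (rule integral_lborel_shift[of "\<lambda>z. \<bar>f z\<bar>"]) measurable
      finally show "(\<integral>\<^sup>+z. ennreal (?C * \<bar>f x\<bar>) * ennreal \<bar>f (x + z)\<bar> \<partial>lborel) = ennreal (?C * \<bar>f x\<bar>) * ennreal (LINT z|lborel. \<bar>f z\<bar>)"
        by (subst nn_integral_cmult) auto
    qed
    also have "\<dots> = ennreal (LINT x|lborel. ?C * \<bar>f x\<bar>) * ennreal (LINT z|lborel. \<bar>f z\<bar>)"
      using fi t by (subst nn_integral_multc) (auto simp: nn_integral_eq_integral)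
    also have "\<dots> < \<infinity>" by (simp add: ennreal_mult_less_top)
    finally show "(\<integral>\<^sup>+p. ennreal (norm (case p of (x, z) \<Rightarrow> heat_kernel t z * (f x * f (x + z)))) \<partial>(lborel \<Otimes>\<^sub>M lborel)) < \<infinity>" .
  qed measurable
  have "(LINT p|(lborel \<Otimes>\<^sub>M lborel). heat_kernel t (snd p - fst p) * (f (fst p) * f (snd p))) =
    (LINT x|lborel. LINT y|lborel. heat_kernel t (y - x) * (f x * f y))"
    using lborel_pair.integral_fst'[OF i1] by (simp add: case_prod_unfold)
  also have "\<dots> = (LINT x|lborel. LINT z|lborel. heat_kernel t z * (f x * f (x + z)))"
  proof (rule Bochner_Integration.integral_cong[OF refl])
    fix x
    show "(LINT y|lborel. heat_kernel t (y - x) * (f x * f y)) = (LINT z|lborel. heat_kernel t z * (f x * f (x + z)))"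
      using integral_lborel_shift[of "\<lambda>y. heat_kernel t (y - x) * (f x * f y)" x] by (simp add: add.commute)
  qed
  also have "\<dots> = (LINT z|lborel. LINT x|lborel. heat_kernel t z * (f x * f (x + z)))"
    by (rule lborel_pair.Fubini_integral[OF i2, symmetric])
  also have "\<dots> = (LINT z|lborel. heat_kernel t z * ip lborel f (\<lambda>x. f (x + z)))"
    unfolding ip_def integral_mult_right_zero ..
  finally show ?thesis .
qed

text \<open>With time r^2 and z replaced by r z the kernel no longer depends on r, while the
  autocorrelation of f is evaluated at r z. It tends to its value at 0, the squared norm, by
  continuity of shifts.\<close>

lemma gaussian_mean_tendsto:
  fixes f :: "'a::euclidean_space \<Rightarrow> real"
  assumes f: "f \<in> l2c"
  shows "(\<lambda>n. LINT \<xi>|lborel. exp (- (inverse (real (Suc n)))\<^sup>2 * (norm \<xi>)\<^sup>2) * (cmod (ft f \<xi>))\<^sup>2)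
      \<longlonglongrightarrow> (2 * pi) ^ DIM('a) * ip lborel f f"
proof -
  define r where "r n = inverse (real (Suc n))" for n
  have r: "r n > 0" "r \<longlonglongrightarrow> 0" for n
    unfolding r_def by (simp, rule LIMSEQ_inverse_real_of_nat)
  define c where "c z = ip lborel f (\<lambda>x. f (x + z))" for z
  note [measurable] = l2c_measurable[OF f]
  have [measurable]: "c \<in> borel_measurable borel" unfolding c_def ip_def by measurable
  have eq: "(LINT \<xi>|lborel. exp (- (r n)\<^sup>2 * (norm \<xi>)\<^sup>2) * (cmod (ft f \<xi>))\<^sup>2) = (LINT z|lborel. heat_kernel 1 z * c (r n *\<^sub>R z))" for n
  proof -
    have t: "(r n)\<^sup>2 > 0" using r(1)[of n] by simp
    have "complex_of_real (exp (- (r n)\<^sup>2 * (norm \<xi>)\<^sup>2)) * (ft f \<xi> * cnj (ft f \<xi>)) =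
      complex_of_real (exp (- (r n)\<^sup>2 * (norm \<xi>)\<^sup>2) * (cmod (ft f \<xi>))\<^sup>2)" for \<xi>
      unfolding complex_norm_square[symmetric] by simp
    then have "(LINT \<xi>|lborel. exp (- (r n)\<^sup>2 * (norm \<xi>)\<^sup>2) * (cmod (ft f \<xi>))\<^sup>2) =
      (LINT z|lborel. heat_kernel ((r n)\<^sup>2) z * c z)"
      using gaussian_pairing(1)[OF l2c_integrable[OF f] l2c_integrable[OF f] t]
      unfolding c_def gaussian_pairing_autocorrelation[OF f t, symmetric] by (simp only: integral_complex_of_real of_real_eq_iff)
    also have "\<dots> = (LINT z|lborel. r n ^ DIM('a) * (heat_kernel ((r n)\<^sup>2) (r n *\<^sub>R z) * c (r n *\<^sub>R z)))"
      by (rule integral_lborel_scale) (use r in auto)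
    also have "\<dots> = (LINT z|lborel. heat_kernel 1 z * c (r n *\<^sub>R z))"
    proof (intro Bochner_Integration.integral_cong refl)
      fix z :: 'a
      have "r n * sqrt (pi / (r n)\<^sup>2) = sqrt pi" using r(1)[of n] by (simp add: real_sqrt_divide)
      moreover have "(norm (r n *\<^sub>R z))\<^sup>2 / (4 * (r n)\<^sup>2) = (norm z)\<^sup>2 / 4" using r(1)[of n] by (simp add: power_mult_distrib)
      ultimately have "r n ^ DIM('a) * heat_kernel ((r n)\<^sup>2) (r n *\<^sub>R z) = heat_kernel 1 z"
        unfolding heat_kernel_def mult.assoc[symmetric] power_mult_distrib[symmetric] by simp
      then show "r n ^ DIM('a) * (heat_kernel ((r n)\<^sup>2) (r n *\<^sub>R z) * c (r n *\<^sub>R z)) = heat_kernel 1 z * c (r n *\<^sub>R z)"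
        by (simp only: mult.assoc[symmetric])
    qed
    finally show ?thesis .
  qed
  have "(\<lambda>n. LINT z|lborel. heat_kernel 1 z * c (r n *\<^sub>R z)) \<longlonglongrightarrow> (LINT z|lborel. heat_kernel 1 (z::'a) * ip lborel f f)"
  proof (rule integral_dominated_convergence)
    show "integrable lborel (\<lambda>z::'a. heat_kernel 1 z * ip lborel f f)"
      by (intro integrable_mult_left heat_kernel_integral) simp
    have "(\<lambda>n. heat_kernel 1 z * c (r n *\<^sub>R z)) \<longlonglongrightarrow> heat_kernel 1 z * ip lborel f f" for z
    proof -
      have "(\<lambda>n. r n *\<^sub>R z) \<longlonglongrightarrow> 0 *\<^sub>R z" by (intro tendsto_intros r)
      then show ?thesis unfolding c_def by (intro tendsto_intros autocorrelation_tendsto[OF f]) simp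
    qed
    then show "AE z in lborel. (\<lambda>n. heat_kernel 1 z * c (r n *\<^sub>R z)) \<longlonglongrightarrow> heat_kernel 1 z * ip lborel f f" by simp
    show "AE z in lborel. norm (heat_kernel 1 z * c (r n *\<^sub>R z)) \<le> heat_kernel 1 z * ip lborel f f" for n
    proof (intro AE_I2)
      fix z :: 'a
      have "\<bar>heat_kernel 1 z\<bar> = heat_kernel 1 z" using heat_kernel_nonneg[of 1 z] by simp
      then show "norm (heat_kernel 1 z * c (r n *\<^sub>R z)) \<le> heat_kernel 1 z * ip lborel f f"
        unfolding real_norm_def abs_mult c_def
        using autocorrelation_bound[OF f, of "r n *\<^sub>R z"] heat_kernel_nonneg[of 1 z] by (simp add: mult_left_mono)
    qed
  qed measurable
  moreover have "(LINT z|lborel. heat_kernel 1 (z::'a) * ip lborel f f) = (2 * pi) ^ DIM('a) * ip lborel f f"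
    unfolding integral_mult_left_zero by (simp add: heat_kernel_integral)
  ultimately have "(\<lambda>n. LINT \<xi>|lborel. exp (- (r n)\<^sup>2 * (norm \<xi>)\<^sup>2) * (cmod (ft f \<xi>))\<^sup>2)
      \<longlonglongrightarrow> (2 * pi) ^ DIM('a) * ip lborel f f"
    unfolding eq by (simp only:)
  then show ?thesis unfolding r_def .
qed

text \<open>The Gaussian weights increase to 1, so monotone convergence delivers integrability and
  the value together.\<close>

lemma plancherel:
  fixes f :: "'a::euclidean_space \<Rightarrow> real"
  assumes f: "f \<in> l2c"
  shows "integrable lborel (\<lambda>\<xi>. (cmod (ft f \<xi>))\<^sup>2)"
    "(LINT \<xi>|lborel. (cmod (ft f \<xi>))\<^sup>2) = (2 * pi) ^ DIM('a) * ip lborel f f"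
proof -
  note [measurable] = l2c_measurable[OF f]
  define F where "F n \<xi> = exp (- (inverse (real (Suc n)))\<^sup>2 * (norm \<xi>)\<^sup>2) * (cmod (ft f \<xi>))\<^sup>2" for n and \<xi> :: 'a
  have Fi: "integrable lborel (F n)" for n
  proof -
    have "complex_of_real (exp (- (inverse (real (Suc n)))\<^sup>2 * (norm \<xi>)\<^sup>2)) * (ft f \<xi> * cnj (ft f \<xi>)) = complex_of_real (F n \<xi>)" for \<xi>
      unfolding complex_norm_square[symmetric] F_def by simp
    then show ?thesis
      using gaussian_pairing(2)[OF l2c_integrable[OF f] l2c_integrable[OF f], of "(inverse (real (Suc n)))\<^sup>2"]
      by (simp only: complex_of_real_integrable_eq) simp
  qed
  have mono: "mono (\<lambda>n. F n \<xi>)" for \<xi>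
    unfolding F_def mono_def
    by (intro allI impI mult_right_mono exp_le_cancel_iff[THEN iffD2]) (auto intro!: mult_right_mono power_mono le_imp_inverse_le)
  have lim: "(\<lambda>n. F n \<xi>) \<longlonglongrightarrow> (cmod (ft f \<xi>))\<^sup>2" for \<xi>
  proof -
    have "(\<lambda>n. F n \<xi>) \<longlonglongrightarrow> exp (- 0\<^sup>2 * (norm \<xi>)\<^sup>2) * (cmod (ft f \<xi>))\<^sup>2"
      unfolding F_def by (intro tendsto_intros LIMSEQ_inverse_real_of_nat)
    then show ?thesis by simp
  qed
  note conv = integral_monotone_convergence_nonneg[where f=F and u="\<lambda>\<xi>. (cmod (ft f \<xi>))\<^sup>2" and x="(2 * pi) ^ DIM('a) * ip lborel f f", OF Fi]
  have pre: "AE \<xi> in lborel. mono (\<lambda>n. F n \<xi>)" "\<And>n. AE \<xi> in lborel. 0 \<le> F n \<xi>" "AE \<xi> in lborel. (\<lambda>n. F n \<xi>) \<longlonglongrightarrow> (cmod (ft f \<xi>))\<^sup>2"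
    "(\<lambda>n. integral\<^sup>L lborel (F n)) \<longlonglongrightarrow> (2 * pi) ^ DIM('a) * ip lborel f f"
    "(\<lambda>\<xi>. (cmod (ft f \<xi>))\<^sup>2) \<in> borel_measurable lborel"
    using mono lim gaussian_mean_tendsto[OF f] by (auto simp: F_def[abs_def])
  show "integrable lborel (\<lambda>\<xi>. (cmod (ft f \<xi>))\<^sup>2)" by (rule conv(1)[OF pre])
  show "(LINT \<xi>|lborel. (cmod (ft f \<xi>))\<^sup>2) = (2 * pi) ^ DIM('a) * ip lborel f f" by (rule conv(2)[OF pre])
qed

lemma Re_mult_cnj_polarization: "Re (a * cnj b) = ((cmod (a + b))\<^sup>2 - (cmod (a - b))\<^sup>2) / 4"
  unfolding cmod_power2 by (simp add: power2_eq_square algebra_simps)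

lemma plancherel_pair:
  fixes f g :: "'a::euclidean_space \<Rightarrow> real"
  assumes f: "f \<in> l2c" and g: "g \<in> l2c"
  shows "integrable lborel (\<lambda>\<xi>. Re (ft f \<xi> * cnj (ft g \<xi>)))"
    "(LINT \<xi>|lborel. Re (ft f \<xi> * cnj (ft g \<xi>))) = (2 * pi) ^ DIM('a) * ip lborel f g"
proof -
  have eq: "Re (ft f \<xi> * cnj (ft g \<xi>)) = ((cmod (ft (\<lambda>x. f x + g x) \<xi>))\<^sup>2 - (cmod (ft (\<lambda>x. f x - g x) \<xi>))\<^sup>2) / 4" for \<xi>
    using f g by (simp only: Re_mult_cnj_polarization ft_add ft_diff l2c_integrable)
  note p = plancherel[OF l2c_add[OF f g]] and m = plancherel[OF l2c_diff[OF f g]]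
  show "integrable lborel (\<lambda>\<xi>. Re (ft f \<xi> * cnj (ft g \<xi>)))"
    unfolding eq by (intro integrable_divide Bochner_Integration.integrable_diff p m)
  have "(LINT \<xi>|lborel. Re (ft f \<xi> * cnj (ft g \<xi>))) =
     ((2 * pi) ^ DIM('a) * ip lborel (\<lambda>x. f x + g x) (\<lambda>x. f x + g x) - (2 * pi) ^ DIM('a) * ip lborel (\<lambda>x. f x - g x) (\<lambda>x. f x - g x)) / 4"
    unfolding eq integral_divide_zero Bochner_Integration.integral_diff[OF p(1) m(1)] p(2) m(2) ..
  also have "\<dots> = (2 * pi) ^ DIM('a) * ip lborel f g"
    by (simp add: ip_self_add ip_self_diff l2cD f g algebra_simps)
  finally show "(LINT \<xi>|lborel. Re (ft f \<xi> * cnj (ft g \<xi>))) = (2 * pi) ^ DIM('a) * ip lborel f g" .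
qed

lemma plancherel_injective:
  assumes "f \<in> l2c" "g \<in> l2c" "\<And>\<xi>. ft f \<xi> = ft g \<xi>"
  shows "AE x in lborel. f x = g x"
proof -
  have "ft (\<lambda>x. f x - g x) \<xi> = 0" for \<xi> using assms by (simp add: ft_diff l2c_integrable)
  then have "ip lborel (\<lambda>x. f x - g x) (\<lambda>x. f x - g x) = 0"
    using plancherel(2)[OF l2c_diff[OF assms(1,2)]] by simp
  then show ?thesis using ip_self_eq_0_iff[OF l2cD[OF l2c_diff[OF assms(1,2)]]] by simp
qed

section \<open>Weak partial derivatives as limits of difference quotients\<close>

lemma cis_minus_one_bound: "cmod (cis t - 1) \<le> \<bar>t\<bar>"
proof -
  have "cmod (cis t - 1) = 2 * \<bar>sin (t / 2)\<bar>"
    using dist_exp_i_1[of t] by (simp add: cis_conv_exp)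
  also have "\<dots> \<le> 2 * \<bar>t / 2\<bar>" using abs_sin_x_le_abs_x[of "t / 2"] by simp
  finally show ?thesis by simp
qed

lemma cis_difference_quotient:
  "(\<lambda>n. complex_of_real (real (Suc n)) * (cis (t / real (Suc n)) - 1)) \<longlonglongrightarrow> \<i> * complex_of_real t"
proof -
  define h where "h n = complex_of_real (inverse (real (Suc n)))" for n
  have h0: "h \<longlonglongrightarrow> 0"
    unfolding h_def using tendsto_of_real[OF LIMSEQ_inverse_real_of_nat, where 'a=complex] by (simp only: of_real_0)
  have hn: "h n \<noteq> 0" for n unfolding h_def by (simp del: of_nat_Suc)
  have "((\<lambda>z. exp (\<i> * complex_of_real t * z)) has_field_derivative (\<i> * complex_of_real t)) (at 0)"
    by (auto intro!: derivative_eq_intros)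
  then have "((\<lambda>z. (exp (\<i> * complex_of_real t * z) - 1) / z) \<longlongrightarrow> \<i> * complex_of_real t) (at 0)"
    unfolding has_field_derivative_iff by simp
  then have "(\<lambda>n. (exp (\<i> * complex_of_real t * h n) - 1) / h n) \<longlonglongrightarrow> \<i> * complex_of_real t"
    by (rule filterlim_compose) (use h0 hn in \<open>auto simp: filterlim_at\<close>)
  moreover have "(exp (\<i> * complex_of_real t * h n) - 1) / h n =
      complex_of_real (real (Suc n)) * (cis (t / real (Suc n)) - 1)" for n
    unfolding h_def cis_conv_exp by (simp add: divide_inverse mult_ac del: of_nat_Suc)
  ultimately show ?thesis by simp
qed

text \<open>The source of all locality. The derivative is the L2 limit of difference quotients,
  whose Cauchy property is checked in frequency through \<open>plancherel\<close>. That it vanishes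
  on the zero set of \<open>w\<close> is seen from the quotients themselves, and the last conclusion
  is put at every point by choosing the representative suitably.\<close>

lemma weak_partial_exists:
  fixes w :: "'a::euclidean_space \<Rightarrow> real" and b :: 'a
  assumes w: "w \<in> l2c" and fin: "integrable lborel (\<lambda>\<xi>. (b \<bullet> \<xi>)\<^sup>2 * (cmod (ft w \<xi>))\<^sup>2)"
  shows "\<exists>F \<in> l2c. (\<forall>\<xi>. ft F \<xi> = \<i> * complex_of_real (b \<bullet> \<xi>) * ft w \<xi>) \<and> (\<forall>x. w x = 0 \<longrightarrow> F x = 0)"
proof -
  note [measurable] = l2c_measurable[OF w]
  define h where "h n = (1 / real (Suc n)) *\<^sub>R b" for n
  have h0: "h \<longlonglongrightarrow> 0"
  proof -
    have "h \<longlonglongrightarrow> 0 *\<^sub>R b" unfolding h_def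
      using LIMSEQ_inverse_real_of_nat by (intro tendsto_intros) (simp add: inverse_eq_divide)
    then show ?thesis by simp
  qed
  define T where "T n x = real (Suc n) * (w (x + h n) - w x)" for n x
  have T: "T n \<in> l2c" for n unfolding T_def by (intro l2c_scale l2c_diff l2c_shift w)
  \<comment> \<open>The symbol of the difference quotient. It converges to the symbol of the
    derivative and is bounded in modulus by \<open>\<bar>b \<bullet> \<xi>\<bar>\<close>, so
    \<open>fin\<close> provides the majorant for dominated convergence.\<close>
  define \<sigma> where "\<sigma> n \<xi> = complex_of_real (real (Suc n)) * (cis ((b \<bullet> \<xi>) / real (Suc n)) - 1)" for n \<xi>
  have ftT: "ft (T n) \<xi> = \<sigma> n \<xi> * ft w \<xi>" for n \<xi>
  proof -
    have "ft (T n) \<xi> = complex_of_real (real (Suc n)) * (ft (\<lambda>x. w (x + h n)) \<xi> - ft w \<xi>)"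
      unfolding T_def[abs_def] ft_scale by (subst ft_diff) (auto intro!: l2c_integrable l2c_shift w)
    also have "ft (\<lambda>x. w (x + h n)) \<xi> = cis ((b \<bullet> \<xi>) / real (Suc n)) * ft w \<xi>"
      by (subst ft_shift) (auto simp: h_def)
    finally show ?thesis unfolding \<sigma>_def by (simp add: algebra_simps)
  qed
  have \<sigma>lim: "(\<lambda>n. \<sigma> n \<xi>) \<longlonglongrightarrow> \<i> * complex_of_real (b \<bullet> \<xi>)" for \<xi>
    unfolding \<sigma>_def by (rule cis_difference_quotient)
  have \<sigma>le: "cmod (\<sigma> n \<xi>) \<le> \<bar>b \<bullet> \<xi>\<bar>" for n \<xi>
  proof -
    have "cmod (\<sigma> n \<xi>) \<le> real (Suc n) * \<bar>(b \<bullet> \<xi>) / real (Suc n)\<bar>"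
      unfolding \<sigma>_def norm_mult norm_of_real by (intro mult_mono cis_minus_one_bound) auto
    then show ?thesis by (simp add: abs_divide del: of_nat_Suc)
  qed
  have [measurable]: "\<sigma> n \<in> borel_measurable borel" for n unfolding \<sigma>_def by measurable
  define a where "a n = (LINT \<xi>|lborel. (cmod (\<sigma> n \<xi> - \<i> * complex_of_real (b \<bullet> \<xi>)))\<^sup>2 * (cmod (ft w \<xi>))\<^sup>2)" for n
  have ab: "norm ((cmod (\<sigma> n \<xi> - \<i> * complex_of_real (b \<bullet> \<xi>)))\<^sup>2 * (cmod (ft w \<xi>))\<^sup>2) \<le> 4 * ((b \<bullet> \<xi>)\<^sup>2 * (cmod (ft w \<xi>))\<^sup>2)" for n \<xi>
  proof -
    have "cmod (\<sigma> n \<xi> - \<i> * complex_of_real (b \<bullet> \<xi>)) \<le> 2 * \<bar>b \<bullet> \<xi>\<bar>"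
      using norm_triangle_ineq4[of "\<sigma> n \<xi>" "\<i> * complex_of_real (b \<bullet> \<xi>)"] \<sigma>le[of n \<xi>] by (simp add: norm_mult)
    then have "(cmod (\<sigma> n \<xi> - \<i> * complex_of_real (b \<bullet> \<xi>)))\<^sup>2 \<le> (2 * \<bar>b \<bullet> \<xi>\<bar>)\<^sup>2" by (intro power_mono) auto
    then have "(cmod (\<sigma> n \<xi> - \<i> * complex_of_real (b \<bullet> \<xi>)))\<^sup>2 * (cmod (ft w \<xi>))\<^sup>2 \<le> (2 * \<bar>b \<bullet> \<xi>\<bar>)\<^sup>2 * (cmod (ft w \<xi>))\<^sup>2"
      by (intro mult_right_mono) auto
    then show ?thesis by (simp add: power_mult_distrib mult.assoc)
  qed
  have ai: "integrable lborel (\<lambda>\<xi>. (cmod (\<sigma> n \<xi> - \<i> * complex_of_real (b \<bullet> \<xi>)))\<^sup>2 * (cmod (ft w \<xi>))\<^sup>2)" for n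
    by (rule Bochner_Integration.integrable_bound[OF integrable_mult_right[OF fin, of 4]])
      (use order_trans[OF ab abs_ge_self] in \<open>auto\<close>)
  have a0: "a \<longlonglongrightarrow> 0"
  proof -
    have "(\<lambda>n. a n) \<longlonglongrightarrow> (LINT \<xi>|(lborel::'a measure). 0)" unfolding a_def
    proof (rule integral_dominated_convergence[where w="\<lambda>\<xi>. 4 * ((b \<bullet> \<xi>)\<^sup>2 * (cmod (ft w \<xi>))\<^sup>2)"])
      show "integrable lborel (\<lambda>\<xi>. 4 * ((b \<bullet> \<xi>)\<^sup>2 * (cmod (ft w \<xi>))\<^sup>2))" by (rule integrable_mult_right[OF fin])
      have "(\<lambda>n. (cmod (\<sigma> n \<xi> - \<i> * complex_of_real (b \<bullet> \<xi>)))\<^sup>2 * (cmod (ft w \<xi>))\<^sup>2) \<longlonglongrightarrow>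
        (cmod (\<i> * complex_of_real (b \<bullet> \<xi>) - \<i> * complex_of_real (b \<bullet> \<xi>)))\<^sup>2 * (cmod (ft w \<xi>))\<^sup>2" for \<xi>
        by (intro tendsto_intros \<sigma>lim)
      then show "AE \<xi> in lborel. (\<lambda>n. (cmod (\<sigma> n \<xi> - \<i> * complex_of_real (b \<bullet> \<xi>)))\<^sup>2 * (cmod (ft w \<xi>))\<^sup>2) \<longlonglongrightarrow> 0"
        by simp
      show "AE \<xi> in lborel. norm ((cmod (\<sigma> n \<xi> - \<i> * complex_of_real (b \<bullet> \<xi>)))\<^sup>2 * (cmod (ft w \<xi>))\<^sup>2) \<le> 4 * ((b \<bullet> \<xi>)\<^sup>2 * (cmod (ft w \<xi>))\<^sup>2)" for n
        using ab by (intro AE_I2)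
    qed measurable
    then show ?thesis by simp
  qed
  define \<kappa> where "\<kappa> = (2 * pi) ^ DIM('a)"
  have \<kappa>: "\<kappa> > 0" by (simp add: \<kappa>_def)
  have diff: "\<kappa> * ip lborel (\<lambda>x. T m x - T n x) (\<lambda>x. T m x - T n x) \<le> 2 * a m + 2 * a n" for m n
  proof -
    have "\<kappa> * ip lborel (\<lambda>x. T m x - T n x) (\<lambda>x. T m x - T n x) = (LINT \<xi>|lborel. (cmod (ft (\<lambda>x. T m x - T n x) \<xi>))\<^sup>2)"
      unfolding \<kappa>_def by (rule plancherel(2)[OF l2c_diff[OF T T], symmetric])
    also have "\<dots> \<le> (LINT \<xi>|lborel. 2 * ((cmod (\<sigma> m \<xi> - \<i> * complex_of_real (b \<bullet> \<xi>)))\<^sup>2 * (cmod (ft w \<xi>))\<^sup>2)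
        + 2 * ((cmod (\<sigma> n \<xi> - \<i> * complex_of_real (b \<bullet> \<xi>)))\<^sup>2 * (cmod (ft w \<xi>))\<^sup>2))"
    proof (rule integral_mono)
      show "integrable lborel (\<lambda>\<xi>. (cmod (ft (\<lambda>x. T m x - T n x) \<xi>))\<^sup>2)" by (rule plancherel(1)[OF l2c_diff[OF T T]])
      show "integrable lborel (\<lambda>\<xi>. 2 * ((cmod (\<sigma> m \<xi> - \<i> * complex_of_real (b \<bullet> \<xi>)))\<^sup>2 * (cmod (ft w \<xi>))\<^sup>2)
        + 2 * ((cmod (\<sigma> n \<xi> - \<i> * complex_of_real (b \<bullet> \<xi>)))\<^sup>2 * (cmod (ft w \<xi>))\<^sup>2))"
        by (intro Bochner_Integration.integrable_add integrable_mult_right ai)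
      fix \<xi>
      let ?p = "\<sigma> m \<xi> - \<i> * complex_of_real (b \<bullet> \<xi>)" and ?q = "\<sigma> n \<xi> - \<i> * complex_of_real (b \<bullet> \<xi>)"
      have "ft (\<lambda>x. T m x - T n x) \<xi> = (?p - ?q) * ft w \<xi>"
        by (subst ft_diff) (auto intro!: l2c_integrable T simp: ftT algebra_simps)
      moreover have "(cmod (?p - ?q))\<^sup>2 \<le> 2 * (cmod ?p)\<^sup>2 + 2 * (cmod ?q)\<^sup>2"
      proof -
        have "(cmod (?p - ?q))\<^sup>2 \<le> (cmod ?p + cmod ?q)\<^sup>2" by (intro power_mono norm_triangle_ineq4) auto
        also have "\<dots> \<le> 2 * (cmod ?p)\<^sup>2 + 2 * (cmod ?q)\<^sup>2"
          using sum_squares_bound[of "cmod ?p" "cmod ?q"] by (simp add: power2_sum)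
        finally show ?thesis .
      qed
      ultimately show "(cmod (ft (\<lambda>x. T m x - T n x) \<xi>))\<^sup>2 \<le> 2 * ((cmod ?p)\<^sup>2 * (cmod (ft w \<xi>))\<^sup>2) + 2 * ((cmod ?q)\<^sup>2 * (cmod (ft w \<xi>))\<^sup>2)"
        using mult_right_mono[of "(cmod (?p - ?q))\<^sup>2" "2 * (cmod ?p)\<^sup>2 + 2 * (cmod ?q)\<^sup>2" "(cmod (ft w \<xi>))\<^sup>2"]
        by (simp add: norm_mult power_mult_distrib distrib_right mult.assoc)
    qed
    also have "\<dots> = 2 * a m + 2 * a n"
      unfolding a_def by (subst Bochner_Integration.integral_add) (auto intro!: integrable_mult_right ai)
    finally show ?thesis .
  qed
  have "\<exists>F\<in>l2 lborel. (\<lambda>n. nrm lborel (\<lambda>x. T n x - F x)) \<longlonglongrightarrow> 0"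
  proof (rule l2_complete[OF l2cD[OF T]])
    fix e :: real assume e: "e > 0"
    then have "\<kappa> * e\<^sup>2 / 4 > 0" using \<kappa> by simp
    from LIMSEQ_D[OF a0 this] obtain N where N: "\<And>n. n \<ge> N \<Longrightarrow> a n < \<kappa> * e\<^sup>2 / 4" by force
    have "nrm lborel (\<lambda>x. T m x - T n x) < e" if "m \<ge> N" "n \<ge> N" for m n
    proof -
      have "\<kappa> * ip lborel (\<lambda>x. T m x - T n x) (\<lambda>x. T m x - T n x) < \<kappa> * e\<^sup>2"
        using diff[of m n] N[OF that(1)] N[OF that(2)] by linarith
      then have "(nrm lborel (\<lambda>x. T m x - T n x))\<^sup>2 < e\<^sup>2" using \<kappa> by (simp add: mult_less_cancel_left_pos)
      from power2_less_imp_less[OF this less_imp_le[OF e]] show ?thesis .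
    qed
    then show "\<exists>N. \<forall>m\<ge>N. \<forall>n\<ge>N. nrm lborel (\<lambda>x. T m x - T n x) < e" by blast
  qed
  then obtain F0 where F0: "F0 \<in> l2 lborel" "(\<lambda>n. nrm lborel (\<lambda>x. T n x - F0 x)) \<longlonglongrightarrow> 0" by blast
  note [measurable] = l2_measurable[OF F0(1), unfolded measurable_lborel1]
  \<comment> \<open>Forces the limit to vanish on the zero set of \<open>w\<close>; below it is
    shown that this alters it only on a null set.\<close>
  define F where "F x = (if w x = 0 then 0 else F0 x)" for x
  have [measurable]: "F \<in> borel_measurable borel" unfolding F_def by measurable
  \<comment> \<open>The indicator of the nonzero set. By continuity of shifts,
    \<open>S (x + h n)\<close> converges to \<open>S x\<close> almost everywhere along a
    subsequence. As only 0 and 1 occur, at a zero of \<open>w\<close> the shifted values are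
    eventually 0, and then the quotients are 0.\<close>
  define S where "S x = (if w x = 0 then 0 else 1 :: real)" for x
  obtain R where R: "R \<ge> 0" "\<And>x. norm x > R \<Longrightarrow> w x = 0" using l2c_support[OF w] by auto
  have S: "S \<in> l2c"
  proof -
    have "S \<in> l2 lborel"
    proof (rule l2_dominated[OF _ indicator_cball_l2[of R]])
      show "S \<in> borel_measurable lborel" unfolding S_def by measurable
      have "\<bar>S x\<bar> \<le> \<bar>indicat_real (cball 0 R) x\<bar>" for x using R(2)[of x] by (auto simp: S_def indicator_def)
      then show "AE x in lborel. \<bar>S x\<bar> \<le> \<bar>indicat_real (cball 0 R) x\<bar>" by simp
    qed
    moreover have "\<forall>x. norm x > R \<longrightarrow> S x = 0" using R(2) by (auto simp: S_def)
    ultimately show ?thesis unfolding l2c_def by blast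
  qed
  have "AE x in lborel. w x = 0 \<longrightarrow> F0 x = 0"
  proof -
    obtain r :: "nat \<Rightarrow> nat" where r: "strict_mono r" "AE x in lborel. (\<lambda>n. S (x + h (r n))) \<longlonglongrightarrow> S x"
      using l2_AE_subseq[OF l2cD[OF l2c_shift[OF S]] l2cD[OF S] l2c_shift_continuous[OF S h0]] by blast
    have "(\<lambda>n. nrm lborel (\<lambda>x. T (r n) x - F0 x)) \<longlonglongrightarrow> 0"
      using LIMSEQ_subseq_LIMSEQ[OF F0(2) r(1)] by (simp add: comp_def)
    from l2_AE_subseq[OF l2cD[OF T] F0(1) this]
    obtain q :: "nat \<Rightarrow> nat" where q: "strict_mono q" "AE x in lborel. (\<lambda>n. T (r (q n)) x) \<longlonglongrightarrow> F0 x" by blast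
    show ?thesis
      using r(2) q(2)
    proof eventually_elim
      case (elim x)
      show ?case
      proof
        assume wx: "w x = 0"
        then have "(\<lambda>n. S (x + h (r n))) \<longlonglongrightarrow> 0" using elim(1) by (simp add: S_def)
        then have "eventually (\<lambda>n. S (x + h (r n)) < 1) sequentially" by (rule order_tendstoD) simp
        then have "eventually (\<lambda>n. T (r n) x = 0) sequentially"
          by eventually_elim (auto simp: T_def S_def wx split: if_splits)
        then have "eventually (\<lambda>n. T (r (q n)) x = 0) sequentially"
          by (rule eventually_subseq[OF q(1)])
        then have "(\<lambda>n. T (r (q n)) x) \<longlonglongrightarrow> 0" by (rule tendsto_eventually)
        with elim(2) show "F0 x = 0" by (rule LIMSEQ_unique)
      qed
    qed
  qed
  then have FF0: "AE x in lborel. F0 x = F x" by eventually_elim (auto simp: F_def)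
  have Fl2: "F \<in> l2 lborel" by (rule l2_cong_AE[OF F0(1) _ FF0]) measurable
  have F: "F \<in> l2c" using Fl2 R(2) unfolding l2c_def F_def by auto
  have lim: "(\<lambda>n. nrm lborel (\<lambda>x. T n x - F x)) \<longlonglongrightarrow> 0"
  proof -
    have "nrm lborel (\<lambda>x. T n x - F0 x) = nrm lborel (\<lambda>x. T n x - F x)" for n
    proof -
      note [measurable] = l2c_measurable[OF T]
      show ?thesis unfolding nrm_def using FF0
        by (intro arg_cong[where f=sqrt] ip_cong_AE) auto
    qed
    with F0(2) show ?thesis by simp
  qed
  \<comment> \<open>All the functions live in one fixed ball, so L2 convergence implies L1
    convergence, and the transforms converge at every frequency rather than only almost
    everywhere.\<close>
  have bnd: "cmod (ft (T n) \<xi> - ft F \<xi>) \<le> nrm lborel (\<lambda>x. T n x - F x) * nrm lborel (indicat_real (cball (0::'a) (R + norm b)))" for n \<xi>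
  proof -
    note [measurable] = l2c_measurable[OF T]
    have z: "T n x - F x = 0" if "norm x > R + norm b" for x
    proof -
      have "norm (h n) \<le> norm b" unfolding h_def by (simp add: divide_le_eq mult_le_cancel_left1)
      then have "norm (x + h n) > R" using norm_triangle_ineq4[of "x + h n" "h n"] that by simp
      moreover have "norm x > R" using that norm_ge_zero[of b] by linarith
      ultimately show ?thesis using R(2) by (simp add: T_def F_def)
    qed
    have "ft (T n) \<xi> - ft F \<xi> = ft (\<lambda>x. T n x - F x) \<xi>"
      by (rule ft_diff[symmetric]) (auto intro!: l2c_integrable T F)
    also have "cmod \<dots> \<le> (LINT x|lborel. \<bar>T n x - F x\<bar>)" by (intro ft_norm_le l2c_integrable l2c_diff T F)
    also have "\<dots> = ip lborel (\<lambda>x. \<bar>T n x - F x\<bar>) (indicat_real (cball 0 (R + norm b)))"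
      unfolding ip_def by (intro Bochner_Integration.integral_cong refl) (use z in \<open>auto simp: indicator_def\<close>)
    also have "\<dots> \<le> nrm lborel (\<lambda>x. \<bar>T n x - F x\<bar>) * nrm lborel (indicat_real (cball (0::'a) (R + norm b)))"
    proof -
      have "(\<lambda>x. \<bar>T n x - F x\<bar>) \<in> l2 lborel"
        by (rule l2_dominated[OF _ l2cD[OF l2c_diff[OF T F]]]) auto
      from ip_Cauchy_Schwarz[OF this indicator_cball_l2] show ?thesis by (meson abs_le_D1)
    qed
    also have "nrm lborel (\<lambda>x. \<bar>T n x - F x\<bar>) = nrm lborel (\<lambda>x. T n x - F x)" by (simp add: nrm_def ip_def)
    finally show ?thesis .
  qed
  have "ft F \<xi> = \<i> * complex_of_real (b \<bullet> \<xi>) * ft w \<xi>" for \<xi>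
  proof -
    have "(\<lambda>n. ft (T n) \<xi> - ft F \<xi>) \<longlonglongrightarrow> 0"
      by (rule Lim_null_comparison[OF always_eventually[OF allI[OF bnd]]]) (intro tendsto_mult_left_zero lim)
    then have "(\<lambda>n. ft (T n) \<xi>) \<longlonglongrightarrow> ft F \<xi>" by (rule LIM_zero_cancel)
    moreover have "(\<lambda>n. ft (T n) \<xi>) \<longlonglongrightarrow> \<i> * complex_of_real (b \<bullet> \<xi>) * ft w \<xi>"
      unfolding ftT by (intro tendsto_intros \<sigma>lim)
    ultimately show ?thesis by (rule LIMSEQ_unique)
  qed
  moreover have "\<forall>x. w x = 0 \<longrightarrow> F x = 0" by (simp add: F_def)
  ultimately show ?thesis using F by blast
qed

section \<open>The restricted fractional Laplacian\<close>

lemma cnj_measurable [measurable]: "cnj \<in> borel_measurable borel"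
  by (intro borel_measurable_continuous_onI continuous_intros)

lemma Re_of_real_mult: "Re (complex_of_real r * z) = r * Re z"
  by simp

lemma weighted_integrable:
  fixes f g :: "'a::euclidean_space \<Rightarrow> real"
  assumes f: "f \<in> l2c" and g: "g \<in> l2c"
    and [measurable]: "W \<in> borel_measurable borel" and W: "\<And>\<xi>. 0 \<le> W \<xi>"
    and i: "integrable lborel (\<lambda>\<xi>. W \<xi> * (cmod (ft f \<xi>))\<^sup>2)" "integrable lborel (\<lambda>\<xi>. W \<xi> * (cmod (ft g \<xi>))\<^sup>2)"
  shows "integrable lborel (\<lambda>\<xi>. W \<xi> * Re (ft f \<xi> * cnj (ft g \<xi>)))"
proof (rule Bochner_Integration.integrable_bound[OF Bochner_Integration.integrable_add[OF i]])
  note [measurable] = l2c_measurable[OF f] l2c_measurable[OF g]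
  show "(\<lambda>\<xi>. W \<xi> * Re (ft f \<xi> * cnj (ft g \<xi>))) \<in> borel_measurable lborel" by measurable
  have "norm (W \<xi> * Re (ft f \<xi> * cnj (ft g \<xi>))) \<le> norm (W \<xi> * (cmod (ft f \<xi>))\<^sup>2 + W \<xi> * (cmod (ft g \<xi>))\<^sup>2)" for \<xi>
  proof -
    have "\<bar>Re (ft f \<xi> * cnj (ft g \<xi>))\<bar> \<le> cmod (ft f \<xi>) * cmod (ft g \<xi>)"
      using abs_Re_le_cmod[of "ft f \<xi> * cnj (ft g \<xi>)"] by (simp only: norm_mult complex_mod_cnj)
    also have "\<dots> \<le> (cmod (ft f \<xi>))\<^sup>2 + (cmod (ft g \<xi>))\<^sup>2"
    proof -
      have "0 \<le> cmod (ft f \<xi>) * cmod (ft g \<xi>)" by simp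
      then show ?thesis using sum_squares_bound[of "cmod (ft f \<xi>)" "cmod (ft g \<xi>)"] by linarith
    qed
    finally have "\<bar>W \<xi> * Re (ft f \<xi> * cnj (ft g \<xi>))\<bar> \<le> W \<xi> * ((cmod (ft f \<xi>))\<^sup>2 + (cmod (ft g \<xi>))\<^sup>2)"
      unfolding abs_mult using W[of \<xi>] by (simp add: mult_left_mono)
    then show ?thesis using W[of \<xi>] by (simp add: distrib_left)
  qed
  then show "AE \<xi> in lborel. norm (W \<xi> * Re (ft f \<xi> * cnj (ft g \<xi>))) \<le> norm (W \<xi> * (cmod (ft f \<xi>))\<^sup>2 + W \<xi> * (cmod (ft g \<xi>))\<^sup>2)"
    by (intro AE_I2)
qed

lemma weighted_integrable_mono:
  fixes f :: "'a::euclidean_space \<Rightarrow> real"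
  assumes f: "f \<in> l2c"
    and [measurable]: "V \<in> borel_measurable borel" and V: "\<And>\<xi>. 0 \<le> V \<xi>" "\<And>\<xi>. V \<xi> \<le> 1 + W \<xi>"
    and i: "integrable lborel (\<lambda>\<xi>. W \<xi> * (cmod (ft f \<xi>))\<^sup>2)"
  shows "integrable lborel (\<lambda>\<xi>. V \<xi> * (cmod (ft f \<xi>))\<^sup>2)"
proof (rule Bochner_Integration.integrable_bound[OF Bochner_Integration.integrable_add[OF plancherel(1)[OF f] i]])
  note [measurable] = l2c_measurable[OF f]
  show "(\<lambda>\<xi>. V \<xi> * (cmod (ft f \<xi>))\<^sup>2) \<in> borel_measurable lborel" by measurable
  have "norm (V \<xi> * (cmod (ft f \<xi>))\<^sup>2) \<le> norm ((cmod (ft f \<xi>))\<^sup>2 + W \<xi> * (cmod (ft f \<xi>))\<^sup>2)" for \<xi>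
  proof -
    have "norm (V \<xi> * (cmod (ft f \<xi>))\<^sup>2) = V \<xi> * (cmod (ft f \<xi>))\<^sup>2" using V(1)[of \<xi>] by simp
    also have "\<dots> \<le> (1 + W \<xi>) * (cmod (ft f \<xi>))\<^sup>2" using V(2)[of \<xi>] by (intro mult_right_mono) auto
    finally show ?thesis by (simp add: distrib_right)
  qed
  then show "AE \<xi> in lborel. norm (V \<xi> * (cmod (ft f \<xi>))\<^sup>2) \<le> norm ((cmod (ft f \<xi>))\<^sup>2 + W \<xi> * (cmod (ft f \<xi>))\<^sup>2)"
    by (intro AE_I2)
qed

text \<open>Writing \<open>\<xi>\<^sub>b\<^sup>2\<close> as one partial derivative of each factor keeps the supports disjoint, whence induction on \<open>k\<close>.\<close>

lemma fourier_local_orthogonality: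
  fixes f g :: "'a::euclidean_space \<Rightarrow> real"
  assumes "f \<in> l2c" "g \<in> l2c" "AE x in lborel. f x * g x = 0"
    "integrable lborel (\<lambda>\<xi>. norm \<xi> ^ (2 * k) * (cmod (ft f \<xi>))\<^sup>2)"
    "integrable lborel (\<lambda>\<xi>. norm \<xi> ^ (2 * k) * (cmod (ft g \<xi>))\<^sup>2)"
  shows "(LINT \<xi>|lborel. norm \<xi> ^ (2 * k) * Re (ft f \<xi> * cnj (ft g \<xi>))) = 0"
  using assms
proof (induction k arbitrary: f g)
  case 0
  have "ip lborel f g = 0" unfolding ip_def using 0(3) by (rule integral_eq_zero_AE)
  then show ?case using plancherel_pair(2)[OF 0(1,2)] by simp
next
  case (Suc k)
  have inner_le: "(b \<bullet> \<xi>)\<^sup>2 \<le> (norm \<xi>)\<^sup>2" if "b \<in> Basis" for b \<xi> :: 'a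
    using Cauchy_Schwarz_ineq2[of b \<xi>] that by (simp add: abs_le_square_iff[symmetric])
  have sq: "(norm \<xi>)\<^sup>2 \<le> 1 + norm \<xi> ^ (2 * Suc k)" for \<xi> :: 'a
  proof (cases "norm \<xi> \<le> 1")
    case True
    then have "(norm \<xi>)\<^sup>2 \<le> 1" by (simp add: power_le_one)
    then show ?thesis using zero_le_power[OF norm_ge_zero, of \<xi> "2 * Suc k"] by linarith
  next
    case False
    then have "(norm \<xi>)\<^sup>2 \<le> norm \<xi> ^ (2 * Suc k)" by (intro power_increasing) auto
    then show ?thesis by simp
  qed
  \<comment> \<open>Differentiating one factor keeps its zero set and trades one order of the weight
    for the derivative, so the induction hypothesis applies to the pair of derivatives.\<close>
  have partial: "\<exists>F \<in> l2c. (\<forall>\<xi>. ft F \<xi> = \<i> * complex_of_real (b \<bullet> \<xi>) * ft f \<xi>) \<and> (\<forall>x. f x = 0 \<longrightarrow> F x = 0)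
      \<and> integrable lborel (\<lambda>\<xi>. norm \<xi> ^ (2 * k) * (cmod (ft F \<xi>))\<^sup>2)"
    if f: "f \<in> l2c" and i: "integrable lborel (\<lambda>\<xi>. norm \<xi> ^ (2 * Suc k) * (cmod (ft f \<xi>))\<^sup>2)" and b: "b \<in> Basis"
    for f :: "'a \<Rightarrow> real" and b
  proof -
    have "integrable lborel (\<lambda>\<xi>. (b \<bullet> \<xi>)\<^sup>2 * (cmod (ft f \<xi>))\<^sup>2)"
      by (rule weighted_integrable_mono[OF f _ _ _ i]) (use order_trans[OF inner_le[OF b] sq] in auto)
    from weak_partial_exists[OF f this]
    obtain F where F: "F \<in> l2c" "\<And>\<xi>. ft F \<xi> = \<i> * complex_of_real (b \<bullet> \<xi>) * ft f \<xi>" "\<And>x. f x = 0 \<Longrightarrow> F x = 0"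
      by blast
    have "integrable lborel (\<lambda>\<xi>. (norm \<xi> ^ (2 * k) * (b \<bullet> \<xi>)\<^sup>2) * (cmod (ft f \<xi>))\<^sup>2)"
    proof (rule weighted_integrable_mono[OF f _ _ _ i])
      fix \<xi> :: 'a
      have "norm \<xi> ^ (2 * k) * (b \<bullet> \<xi>)\<^sup>2 \<le> norm \<xi> ^ (2 * k) * (norm \<xi>)\<^sup>2"
        by (intro mult_left_mono inner_le b) auto
      then show "norm \<xi> ^ (2 * k) * (b \<bullet> \<xi>)\<^sup>2 \<le> 1 + norm \<xi> ^ (2 * Suc k)"
        by (simp add: power_add[symmetric] add.commute)
    qed auto
    moreover have "(cmod (ft F \<xi>))\<^sup>2 = (b \<bullet> \<xi>)\<^sup>2 * (cmod (ft f \<xi>))\<^sup>2" for \<xi>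
      by (simp add: F(2) norm_mult power_mult_distrib)
    ultimately have "integrable lborel (\<lambda>\<xi>. norm \<xi> ^ (2 * k) * (cmod (ft F \<xi>))\<^sup>2)"
      by (simp only: mult.assoc)
    then show ?thesis using F by blast
  qed
  have zero: "(LINT \<xi>|lborel. norm \<xi> ^ (2 * k) * (b \<bullet> \<xi>)\<^sup>2 * Re (ft f \<xi> * cnj (ft g \<xi>))) = 0 \<and>
      integrable lborel (\<lambda>\<xi>. norm \<xi> ^ (2 * k) * (b \<bullet> \<xi>)\<^sup>2 * Re (ft f \<xi> * cnj (ft g \<xi>)))" if b: "b \<in> Basis" for b
  proof -
    obtain F where F: "F \<in> l2c" "\<And>\<xi>. ft F \<xi> = \<i> * complex_of_real (b \<bullet> \<xi>) * ft f \<xi>" "\<And>x. f x = 0 \<Longrightarrow> F x = 0"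
      "integrable lborel (\<lambda>\<xi>. norm \<xi> ^ (2 * k) * (cmod (ft F \<xi>))\<^sup>2)"
      using partial[OF Suc.prems(1,4) b] by blast
    obtain G where G: "G \<in> l2c" "\<And>\<xi>. ft G \<xi> = \<i> * complex_of_real (b \<bullet> \<xi>) * ft g \<xi>" "\<And>x. g x = 0 \<Longrightarrow> G x = 0"
      "integrable lborel (\<lambda>\<xi>. norm \<xi> ^ (2 * k) * (cmod (ft G \<xi>))\<^sup>2)"
      using partial[OF Suc.prems(2,5) b] by blast
    have "AE x in lborel. F x * G x = 0"
      using Suc.prems(3) by eventually_elim (use F(3) G(3) in auto)
    from Suc.IH[OF F(1) G(1) this F(4) G(4)]
    have "(LINT \<xi>|lborel. norm \<xi> ^ (2 * k) * Re (ft F \<xi> * cnj (ft G \<xi>))) = 0" .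
    moreover have "integrable lborel (\<lambda>\<xi>. norm \<xi> ^ (2 * k) * Re (ft F \<xi> * cnj (ft G \<xi>)))"
      by (rule weighted_integrable[OF F(1) G(1) _ _ F(4) G(4)]) auto
    moreover have eq: "norm \<xi> ^ (2 * k) * Re (ft F \<xi> * cnj (ft G \<xi>)) = norm \<xi> ^ (2 * k) * (b \<bullet> \<xi>)\<^sup>2 * Re (ft f \<xi> * cnj (ft g \<xi>))" for \<xi>
    proof -
      \<comment> \<open>The factor \<open>\<i>\<close> meets its conjugate, so the two derivatives
        together produce \<open>(b \<bullet> \<xi>)\<^sup>2\<close> with a positive sign.\<close>
      have "ft F \<xi> * cnj (ft G \<xi>) = complex_of_real ((b \<bullet> \<xi>)\<^sup>2) * (ft f \<xi> * cnj (ft g \<xi>))"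
        unfolding F(2) G(2) by (simp add: power2_eq_square) (simp add: mult_ac)
      then have "Re (ft F \<xi> * cnj (ft G \<xi>)) = (b \<bullet> \<xi>)\<^sup>2 * Re (ft f \<xi> * cnj (ft g \<xi>))"
        by (simp only: Re_of_real_mult)
      then show ?thesis by simp
    qed
    ultimately show ?thesis unfolding eq by blast
  qed
  have "norm \<xi> ^ (2 * Suc k) * Re (ft f \<xi> * cnj (ft g \<xi>)) =
      (\<Sum>b\<in>Basis. norm \<xi> ^ (2 * k) * (b \<bullet> \<xi>)\<^sup>2 * Re (ft f \<xi> * cnj (ft g \<xi>)))" for \<xi>
  proof -
    have "norm \<xi> ^ (2 * Suc k) = norm \<xi> ^ (2 * k) * (norm \<xi>)\<^sup>2" by (simp add: power_add[symmetric] add.commute)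
    also have "(norm \<xi>)\<^sup>2 = (\<Sum>b\<in>Basis. (b \<bullet> \<xi>)\<^sup>2)" by (subst norm_square_Basis_sum) (simp add: inner_commute)
    finally show ?thesis by (simp add: sum_distrib_left sum_distrib_right)
  qed
  then have "(LINT \<xi>|lborel. norm \<xi> ^ (2 * Suc k) * Re (ft f \<xi> * cnj (ft g \<xi>))) =
     (\<Sum>b\<in>Basis. LINT \<xi>|lborel. norm \<xi> ^ (2 * k) * (b \<bullet> \<xi>)\<^sup>2 * Re (ft f \<xi> * cnj (ft g \<xi>)))"
    using zero by (simp only:) (rule Bochner_Integration.integral_sum, blast)
  also have "\<dots> = 0" using zero by (intro sum.neutral) blast
  finally show ?case .
qed

text \<open>In space the pairing is a double integral against a strictly positive kernel. If it were
  0, then f(x) g(y) = 0 for almost every pair, and any x with f(x) nonzero would force g to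
  vanish.\<close>

lemma gaussian_pairing_pos:
  fixes f g :: "'a::euclidean_space \<Rightarrow> real"
  assumes f: "f \<in> l2c" "\<And>x. 0 \<le> f x" "\<not> (AE x in lborel. f x = 0)"
    and g: "g \<in> l2c" "\<And>x. 0 \<le> g x" "\<not> (AE x in lborel. g x = 0)" and t: "t > 0"
  shows "(LINT \<xi>|lborel. exp (- t * (norm \<xi>)\<^sup>2) * Re (ft f \<xi> * cnj (ft g \<xi>))) > 0"
proof -
  note [measurable] = l2c_measurable[OF f(1)] l2c_measurable[OF g(1)]
  let ?H = "\<lambda>p. heat_kernel t (snd p - fst p) * (f (fst p) * g (snd p))"
  note gp = gaussian_pairing[OF l2c_integrable[OF f(1)] l2c_integrable[OF g(1)] t]
  have H0: "?H p \<ge> 0" for p by (intro mult_nonneg_nonneg less_imp_le[OF heat_kernel_nonneg[OF t]] f(2) g(2))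
  have "(LINT p|(lborel \<Otimes>\<^sub>M lborel). ?H p) \<noteq> 0"
  proof
    assume "(LINT p|(lborel \<Otimes>\<^sub>M lborel). ?H p) = 0"
    then have "AE p in lborel \<Otimes>\<^sub>M lborel. ?H p = 0"
      using integral_nonneg_eq_0_iff_AE[OF gp(3)] H0 by auto
    then have "AE p in lborel \<Otimes>\<^sub>M lborel. f (fst p) * g (snd p) = 0"
      by eventually_elim (metis heat_kernel_nonneg[OF t] less_irrefl mult_eq_0_iff)
    from lborel_pair.AE_pair[OF this]
    have "AE x in lborel. AE y in lborel. f x * g y = 0" by simp
    then have "AE x in lborel. f x = 0"
    proof eventually_elim
      case (elim x)
      show ?case
      proof (rule ccontr)
        assume "f x \<noteq> 0"
        with elim have "AE y in lborel. g y = 0" by simp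
        with g(3) show False by blast
      qed
    qed
    with f(3) show False by blast
  qed
  then have pos: "(LINT p|(lborel \<Otimes>\<^sub>M lborel). ?H p) > 0"
    using H0 Bochner_Integration.integral_nonneg[of "lborel \<Otimes>\<^sub>M lborel" ?H] by (simp add: less_le)
  have "(LINT \<xi>|lborel. exp (- t * (norm \<xi>)\<^sup>2) * Re (ft f \<xi> * cnj (ft g \<xi>))) =
    (LINT \<xi>|lborel. Re (complex_of_real (exp (- t * (norm \<xi>)\<^sup>2)) * (ft f \<xi> * cnj (ft g \<xi>))))"
    by (simp only: Re_of_real_mult)
  also have "\<dots> = Re (LINT \<xi>|lborel. complex_of_real (exp (- t * (norm \<xi>)\<^sup>2)) * (ft f \<xi> * cnj (ft g \<xi>)))"
    by (rule integral_Re[OF gp(2)])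
  also have "\<dots> = (LINT p|(lborel \<Otimes>\<^sub>M lborel). ?H p)" unfolding gp(1) by (rule Re_complex_of_real)
  finally show ?thesis using pos by simp
qed

text \<open>1/a is the integral of exp(-a t) over t > 0, so the resolvent pairing is a positive
  superposition of Gaussian pairings, each weighted by exp(-\<mu> t).\<close>

lemma resolvent_pairing_pos:
  fixes f g :: "'a::euclidean_space \<Rightarrow> real"
  assumes f: "f \<in> l2c" "\<And>x. 0 \<le> f x" "\<not> (AE x in lborel. f x = 0)"
    and g: "g \<in> l2c" "\<And>x. 0 \<le> g x" "\<not> (AE x in lborel. g x = 0)" and \<mu>: "\<mu> > 0"
  shows "(LINT \<xi>|lborel. Re (ft f \<xi> * cnj (ft g \<xi>)) / ((norm \<xi>)\<^sup>2 + \<mu>)) > 0"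
proof -
  note [measurable] = l2c_measurable[OF f(1)] l2c_measurable[OF g(1)]
  define c where "c \<xi> = Re (ft f \<xi> * cnj (ft g \<xi>))" for \<xi>
  have c: "integrable lborel c" unfolding c_def by (rule plancherel_pair(1)[OF f(1) g(1)])
  note [measurable] = borel_measurable_integrable[OF c, unfolded measurable_lborel1]
  \<comment> \<open>For a > 0 this is exp(-a t) for t \<ge> 0 and 0 for t < 0. Passing through the
    exponential density makes its integral 1/a a consequence of total mass 1.\<close>
  define E where "E a t = exponential_density a t / a" for a t :: real
  have [measurable]: "(\<lambda>p. E (A p) (B p)) \<in> borel_measurable M"
    if [measurable]: "A \<in> borel_measurable M" "B \<in> borel_measurable M" for A B and M :: "'b measure"
    unfolding E_def exponential_density_def by measurable
  have E0: "E a t \<ge> 0" if "a > 0" for a t using that by (simp add: E_def exponential_density_def)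
  have Enn: "(\<integral>\<^sup>+t. ennreal (E a t) \<partial>lborel) = ennreal (1 / a)" if a: "a > 0" for a
  proof -
    interpret prob_space "density lborel (exponential_density a)" by (rule prob_space_exponential_density[OF a])
    have "(\<integral>\<^sup>+t. ennreal (exponential_density a t) \<partial>lborel) = 1"
      using emeasure_space_1 by (simp add: emeasure_density)
    moreover have "(\<integral>\<^sup>+t. ennreal (E a t) \<partial>lborel) = (\<integral>\<^sup>+t. ennreal (1 / a) * ennreal (exponential_density a t) \<partial>lborel)"
      using a by (intro nn_integral_cong) (simp add: E_def ennreal_mult[symmetric] exponential_density_def)
    ultimately show ?thesis by (subst (asm) nn_integral_cmult) auto
  qed
  have EI: "(LINT t|lborel. E a t) = 1 / a" if a: "a > 0" for a
    using Enn[OF a] E0[OF a] a by (subst integral_eq_nn_integral) (auto simp: E_def)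
  have apos: "(norm \<xi>)\<^sup>2 + \<mu> > 0" for \<xi> :: 'a using \<mu> by (simp add: add_nonneg_pos)
  define G where "G \<xi> t = c \<xi> * E ((norm \<xi>)\<^sup>2 + \<mu>) t" for \<xi> t
  have Gi: "integrable (lborel \<Otimes>\<^sub>M lborel) (\<lambda>(\<xi>, t). G \<xi> t)"
  proof (rule integrableI_bounded)
    show [measurable]: "(\<lambda>(\<xi>, t). G \<xi> t) \<in> borel_measurable (lborel \<Otimes>\<^sub>M lborel)" unfolding G_def by measurable
    have "(\<integral>\<^sup>+p. ennreal (norm (case p of (\<xi>, t) \<Rightarrow> G \<xi> t)) \<partial>(lborel \<Otimes>\<^sub>M lborel)) =
      (\<integral>\<^sup>+\<xi>. \<integral>\<^sup>+t. ennreal (norm (G \<xi> t)) \<partial>lborel \<partial>lborel)"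
      by (subst lborel.nn_integral_fst[symmetric]) auto
    also have "\<dots> = (\<integral>\<^sup>+\<xi>. ennreal \<bar>c \<xi>\<bar> * ennreal (1 / ((norm \<xi>)\<^sup>2 + \<mu>)) \<partial>lborel)"
    proof (rule nn_integral_cong)
      fix \<xi> :: 'a
      have "(\<integral>\<^sup>+t. ennreal (norm (G \<xi> t)) \<partial>lborel) = (\<integral>\<^sup>+t. ennreal \<bar>c \<xi>\<bar> * ennreal (E ((norm \<xi>)\<^sup>2 + \<mu>) t) \<partial>lborel)"
        using E0[OF apos[of \<xi>]] by (intro nn_integral_cong) (simp add: G_def abs_mult ennreal_mult[symmetric])
      also have "\<dots> = ennreal \<bar>c \<xi>\<bar> * ennreal (1 / ((norm \<xi>)\<^sup>2 + \<mu>))"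
        unfolding Enn[OF apos, symmetric] by (rule nn_integral_cmult) measurable
      finally show "(\<integral>\<^sup>+t. ennreal (norm (G \<xi> t)) \<partial>lborel) = ennreal \<bar>c \<xi>\<bar> * ennreal (1 / ((norm \<xi>)\<^sup>2 + \<mu>))" .
    qed
    also have "\<dots> \<le> (\<integral>\<^sup>+\<xi>. ennreal (\<bar>c \<xi>\<bar> * (1 / \<mu>)) \<partial>lborel)"
      using \<mu> by (intro nn_integral_mono) (auto simp: ennreal_mult[symmetric] intro!: ennreal_leI divide_left_mono mult_pos_pos apos)
    also have "\<dots> < \<infinity>" using c \<mu> by (subst nn_integral_eq_integral) auto
    finally show "(\<integral>\<^sup>+p. ennreal (norm (case p of (\<xi>, t) \<Rightarrow> G \<xi> t)) \<partial>(lborel \<Otimes>\<^sub>M lborel)) < \<infinity>" .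
  qed
  define J where "J t = (LINT \<xi>|lborel. G \<xi> t)" for t
  have J: "J t = exp (- t * \<mu>) * (LINT \<xi>|lborel. exp (- t * (norm \<xi>)\<^sup>2) * c \<xi>)" if "t \<ge> 0" for t
  proof -
    have "G \<xi> t = exp (- t * \<mu>) * (exp (- t * (norm \<xi>)\<^sup>2) * c \<xi>)" for \<xi>
    proof -
      have "E ((norm \<xi>)\<^sup>2 + \<mu>) t = exp (- t * ((norm \<xi>)\<^sup>2 + \<mu>))"
        using that apos[of \<xi>] by (simp add: E_def exponential_density_def)
      also have "\<dots> = exp (- t * \<mu>) * exp (- t * (norm \<xi>)\<^sup>2)"
        by (simp add: exp_add[symmetric] algebra_simps)
      finally show ?thesis by (simp add: G_def mult_ac)
    qed
    then show ?thesis unfolding J_def by (simp only: integral_mult_right_zero)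
  qed
  have Jpos: "J t > 0" if "t > 0" for t
    using gaussian_pairing_pos[OF f g that] that unfolding J[OF less_imp_le[OF that]] c_def by simp
  have Jneg: "J t = 0" if "t < 0" for t
    using that unfolding J_def G_def E_def by (simp add: exponential_density_def)
  have Ji: "integrable lborel J"
    using lborel_pair.integrable_snd[OF Gi] unfolding J_def .
  have "(LINT \<xi>|lborel. c \<xi> / ((norm \<xi>)\<^sup>2 + \<mu>)) = (LINT \<xi>|lborel. LINT t|lborel. G \<xi> t)"
    unfolding G_def integral_mult_right_zero EI[OF apos] by simp
  also have "\<dots> = (LINT t|lborel. J t)"
    unfolding J_def by (rule lborel_pair.Fubini_integral[OF Gi, symmetric])
  also have "\<dots> > 0"
  proof -
    \<comment> \<open>The signs are known for t > 0 and for t < 0; the single time 0 is discarded as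
      a null set.\<close>
    have ae: "AE t in lborel. t \<noteq> (0::real)" by (rule AE_lborel_singleton)
    have nn: "AE t in lborel. 0 \<le> J t"
      using ae by eventually_elim (use Jpos Jneg in \<open>metis less_eq_real_def linorder_neqE_linordered_idom\<close>)
    have "(LINT t|lborel. J t) \<noteq> 0"
    proof
      assume "(LINT t|lborel. J t) = 0"
      then have "AE t in lborel. J t = 0"
        using integral_nonneg_eq_0_iff_AE[OF Ji nn] by simp
      then have "AE t in lborel. t \<notin> {0<..<1::real}"
        by eventually_elim (use Jpos in force)
      then show False using AE_not_unit_interval by blast
    qed
    moreover have "(LINT t|lborel. J t) \<ge> 0" using nn by (rule integral_nonneg_AE)
    ultimately show ?thesis by simp
  qed
  finally show ?thesis unfolding c_def .
qed

text \<open>\<open>fractional_power_sign\<close> with spectral variable |\<xi>|^2 and density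
  \<open>Re (ft f \<xi> * cnj (ft g \<xi>))\<close>: locality gives the moments, the heat kernel
  gives the resolvent pairings.\<close>

lemma restricted_form_sign:
  fixes f g :: "'a::euclidean_space \<Rightarrow> real" and m :: nat
  assumes f: "f \<in> l2c" "\<And>x. 0 \<le> f x" "\<not> (AE x in lborel. f x = 0)"
    and g: "g \<in> l2c" "\<And>x. 0 \<le> g x" "\<not> (AE x in lborel. g x = 0)"
    and fg: "AE x in lborel. f x * g x = 0"
    and s: "real m < s" "s < real m + 1"
    and i: "integrable lborel (\<lambda>\<xi>. norm \<xi> powr (2 * s) * (cmod (ft f \<xi>))\<^sup>2)"
      "integrable lborel (\<lambda>\<xi>. norm \<xi> powr (2 * s) * (cmod (ft g \<xi>))\<^sup>2)"
  shows "(-1) ^ Suc m * (LINT \<xi>|lborel. norm \<xi> powr (2 * s) * Re (ft f \<xi> * cnj (ft g \<xi>))) > 0"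
proof -
  note [measurable] = l2c_measurable[OF f(1)] l2c_measurable[OF g(1)]
  have pw: "((norm \<xi>)\<^sup>2) powr s = norm \<xi> powr (2 * s)" for \<xi> :: 'a
  proof -
    have "(norm \<xi>)\<^sup>2 = norm \<xi> powr 2" by (simp add: powr_numeral)
    then show ?thesis by (simp only: powr_powr)
  qed
  have "(-1) ^ Suc m * (LINT \<xi>|lborel. ((norm \<xi>)\<^sup>2) powr s * Re (ft f \<xi> * cnj (ft g \<xi>))) > 0"
  proof (rule fractional_power_sign[OF sigma_finite_lborel])
    show "integrable lborel (\<lambda>\<xi>. Re (ft f \<xi> * cnj (ft g \<xi>)))" by (rule plancherel_pair(1)[OF f(1) g(1)])
    show "integrable lborel (\<lambda>\<xi>. ((norm \<xi>)\<^sup>2) powr s * Re (ft f \<xi> * cnj (ft g \<xi>)))"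
      unfolding pw by (rule weighted_integrable[OF f(1) g(1) _ _ i]) auto
    show "(LINT \<xi>|lborel. Re (ft f \<xi> * cnj (ft g \<xi>)) / ((norm \<xi>)\<^sup>2 + \<mu>)) > 0" if "\<mu> > 0" for \<mu>
      by (rule resolvent_pairing_pos[OF f g that])
    show "(LINT \<xi>|lborel. ((norm \<xi>)\<^sup>2) ^ k * Re (ft f \<xi> * cnj (ft g \<xi>))) = 0" if "k \<le> m" for k
    proof -
      have le: "norm \<xi> ^ (2 * k) \<le> 1 + norm \<xi> powr (2 * s)" for \<xi> :: 'a
      proof (cases "norm \<xi> \<le> 1")
        case True
        then have "norm \<xi> ^ (2 * k) \<le> 1" by (simp add: power_le_one)
        then show ?thesis using powr_ge_zero[of "norm \<xi>" "2 * s"] by linarith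
      next
        case False
        then have "norm \<xi> ^ (2 * k) = norm \<xi> powr real (2 * k)" by (subst powr_realpow) auto
        also have "\<dots> \<le> norm \<xi> powr (2 * s)" using False s that by (intro powr_mono) auto
        finally show ?thesis by simp
      qed
      have "integrable lborel (\<lambda>\<xi>. norm \<xi> ^ (2 * k) * (cmod (ft f \<xi>))\<^sup>2)"
        "integrable lborel (\<lambda>\<xi>. norm \<xi> ^ (2 * k) * (cmod (ft g \<xi>))\<^sup>2)"
        using le by (auto intro!: weighted_integrable_mono[OF f(1) _ _ _ i(1)] weighted_integrable_mono[OF g(1) _ _ _ i(2)])
      from fourier_local_orthogonality[OF f(1) g(1) fg this] show ?thesis by (simp add: power_mult)
    qed
  qed (use s in auto)
  then show ?thesis unfolding pw .
qed

section \<open>From Lebesgue functions on the domain to Borel functions on the whole space\<close>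

lemma AE_lebesgue_on_iff:
  assumes "open \<Omega>"
  shows "(AE x in lebesgue_on \<Omega>. P x) \<longleftrightarrow> (AE x in lborel. x \<in> \<Omega> \<longrightarrow> P x)"
  using assms by (subst AE_restrict_space_iff) (auto simp: AE_completion_iff)

lemma integral_lebesgue_on_borel:
  fixes f :: "'a::euclidean_space \<Rightarrow> real"
  assumes "open \<Omega>" and [measurable]: "f \<in> borel_measurable borel"
  shows "(LINT x|lebesgue_on \<Omega>. f x) = (LINT x|lborel. indicator \<Omega> x * f x)"
    "integrable (lebesgue_on \<Omega>) f \<longleftrightarrow> integrable lborel (\<lambda>x. indicator \<Omega> x * f x)"
proof -
  have [measurable]: "\<Omega> \<in> sets borel" using assms(1) by simp
  have O: "\<Omega> \<inter> space lebesgue \<in> sets lebesgue" using assms(1) by auto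
  have m: "(\<lambda>x. indicator \<Omega> x * f x) \<in> borel_measurable lborel" by measurable
  show "(LINT x|lebesgue_on \<Omega>. f x) = (LINT x|lborel. indicator \<Omega> x * f x)"
    by (subst integral_restrict_space[OF O]) (simp add: integral_completion[OF m])
  show "integrable (lebesgue_on \<Omega>) f \<longleftrightarrow> integrable lborel (\<lambda>x. indicator \<Omega> x * f x)"
    by (subst integrable_restrict_space[OF O]) (simp add: integrable_completion[OF m])
qed

lemma borel_measurable_lebesgue_on: "f \<in> borel_measurable borel \<Longrightarrow> f \<in> borel_measurable (lebesgue_on \<Omega>)"
  by (intro measurable_restrict_space1 measurable_completion) simp

lemma l2_lebesgue_on_borel:
  assumes "open \<Omega>" "f \<in> l2 lborel"
  shows "f \<in> l2 (lebesgue_on \<Omega>)"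
proof -
  have m: "f \<in> borel_measurable borel" using l2_measurable[OF assms(2)] by simp
  then have "(\<lambda>x. (f x)\<^sup>2) \<in> borel_measurable borel" by measurable
  moreover have "integrable lborel (\<lambda>x. indicator \<Omega> x * (f x)\<^sup>2)"
    using integrable_real_mult_indicator[of \<Omega> lborel "\<lambda>x. (f x)\<^sup>2"] assms by (simp add: l2_integrable_square mult.commute)
  ultimately have "integrable (lebesgue_on \<Omega>) (\<lambda>x. (f x)\<^sup>2)"
    using integral_lebesgue_on_borel(2)[OF assms(1)] by blast
  then show ?thesis using borel_measurable_lebesgue_on[OF m] by (simp add: l2_def)
qed

lemma ip_lebesgue_on_borel:
  assumes "open \<Omega>" "f \<in> borel_measurable borel" "g \<in> borel_measurable borel" "\<And>x. x \<notin> \<Omega> \<Longrightarrow> f x = 0"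
  shows "ip (lebesgue_on \<Omega>) f g = ip lborel f g"
proof -
  have m: "(\<lambda>x. f x * g x) \<in> borel_measurable borel" using assms(2,3) by measurable
  have "(\<lambda>x. indicator \<Omega> x * (f x * g x)) = (\<lambda>x. f x * g x)"
    by (rule ext) (use assms(4) in \<open>auto simp: indicator_def\<close>)
  then show ?thesis unfolding ip_def integral_lebesgue_on_borel(1)[OF assms(1) m] by simp
qed

text \<open>Elements of the form domains are only Lebesgue measurable on the domain, while the
  Fourier arguments run over \<open>lborel\<close>. A measurable function for the completion agrees
  almost everywhere with a Borel one, and the indicator of the domain extends it by zero.\<close>

lemma borel_representative:
  fixes \<Omega> :: "'a::euclidean_space set"
  assumes \<Omega>: "open \<Omega>" "bounded \<Omega>" and v: "v \<in> l2 (lebesgue_on \<Omega>)"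
  shows "\<exists>w\<in>l2c. (\<forall>x. x \<notin> \<Omega> \<longrightarrow> w x = 0) \<and> (AE x in lborel. (if x \<in> \<Omega> then v x else 0) = w x)"
proof -
  have O: "\<Omega> \<inter> space lebesgue \<in> sets lebesgue" using \<Omega> by auto
  have [measurable]: "\<Omega> \<in> sets borel" using \<Omega> by simp
  have "(\<lambda>x. indicator \<Omega> x *\<^sub>R v x) \<in> borel_measurable lebesgue"
    using l2_measurable[OF v] unfolding borel_measurable_restrict_space_iff[OF O] .
  from completion_ex_borel_measurable_real[OF this]
  obtain g where g: "g \<in> borel_measurable lborel" "AE x in lborel. indicator \<Omega> x *\<^sub>R v x = g x" by auto
  note [measurable] = g(1)[unfolded measurable_lborel1]
  define w where "w x = indicator \<Omega> x * g x" for x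
  have wm [measurable]: "w \<in> borel_measurable borel" unfolding w_def by measurable
  have ae: "AE x in lborel. (if x \<in> \<Omega> then v x else 0) = w x"
    using g(2) by eventually_elim (auto simp: w_def indicator_def)
  have "AE x in lebesgue_on \<Omega>. v x = w x"
    unfolding AE_lebesgue_on_iff[OF \<Omega>(1)] using ae by eventually_elim auto
  then have "w \<in> l2 (lebesgue_on \<Omega>)"
    by (rule l2_cong_AE[OF v borel_measurable_lebesgue_on[OF wm]])
  then have "integrable (lebesgue_on \<Omega>) (\<lambda>x. (w x)\<^sup>2)" by (rule l2_integrable_square)
  then have "integrable lborel (\<lambda>x. indicator \<Omega> x * (w x)\<^sup>2)"
    by (subst (asm) integral_lebesgue_on_borel(2)[OF \<Omega>(1)]) auto
  moreover have "(\<lambda>x. indicator \<Omega> x * (w x)\<^sup>2) = (\<lambda>x. (w x)\<^sup>2)"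
    by (rule ext) (auto simp: w_def indicator_def)
  ultimately have wl: "w \<in> l2 lborel" by (simp add: l2_def)
  obtain R where "\<And>x. x \<in> \<Omega> \<Longrightarrow> norm x \<le> R" using \<Omega>(2) by (auto simp: bounded_iff)
  then have "\<forall>x. norm x > R \<longrightarrow> w x = 0" by (force simp: w_def indicator_def)
  with wl have "w \<in> l2c" unfolding l2c_def by blast
  moreover have "\<forall>x. x \<notin> \<Omega> \<longrightarrow> w x = 0" by (simp add: w_def)
  ultimately show ?thesis using ae by blast
qed

text \<open>The positive and the negative part of h are densities of two measures that agree and are
  finite on boxes. Boxes form an intersection-stable generator of the Borel sets, so the measures
  and hence the densities coincide.\<close>

lemma AE_zero_if_box_integrals_zero:
  fixes h :: "'a::euclidean_space \<Rightarrow> real"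
  assumes [measurable]: "h \<in> borel_measurable borel"
    and i: "\<And>a c. integrable lborel (\<lambda>x. indicator (box a c) x * h x)"
    and z: "\<And>a c. (LINT x|lborel. indicator (box a c) x * h x) = 0"
  shows "AE x in lborel. h x = 0"
proof -
  define p where "p x = ennreal (h x)" for x
  define q where "q x = ennreal (- h x)" for x
  have [measurable]: "p \<in> borel_measurable borel" "q \<in> borel_measurable borel"
    unfolding p_def q_def by measurable
  have P: "emeasure (density lborel p) (box a c) = ennreal (LINT x|lborel. max 0 (indicator (box a c) x * h x))" for a c
  proof -
    have "emeasure (density lborel p) (box a c) = (\<integral>\<^sup>+x. ennreal (max 0 (indicator (box a c) x * h x)) \<partial>lborel)"
      by (subst emeasure_density) (auto simp: p_def indicator_def max_def ennreal_neg intro!: nn_integral_cong)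
    also have "\<dots> = ennreal (LINT x|lborel. max 0 (indicator (box a c) x * h x))"
      using i by (intro nn_integral_eq_integral) (auto intro: integrable_max)
    finally show ?thesis .
  qed
  have Q: "emeasure (density lborel q) (box a c) = ennreal (LINT x|lborel. max 0 (- (indicator (box a c) x * h x)))" for a c
  proof -
    have "emeasure (density lborel q) (box a c) = (\<integral>\<^sup>+x. ennreal (max 0 (- (indicator (box a c) x * h x))) \<partial>lborel)"
      by (subst emeasure_density) (auto simp: q_def indicator_def max_def ennreal_neg intro!: nn_integral_cong)
    also have "\<dots> = ennreal (LINT x|lborel. max 0 (- (indicator (box a c) x * h x)))"
      using i by (intro nn_integral_eq_integral) (auto intro: integrable_max)
    finally show ?thesis .
  qed
  have PQ: "emeasure (density lborel p) (box a c) = emeasure (density lborel q) (box a c)" for a c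
  proof -
    have "(LINT x|lborel. indicator (box a c) x * h x) =
       (LINT x|lborel. max 0 (indicator (box a c) x * h x) - max 0 (- (indicator (box a c) x * h x)))"
      by (intro Bochner_Integration.integral_cong refl) auto
    also have "\<dots> = (LINT x|lborel. max 0 (indicator (box a c) x * h x)) - (LINT x|lborel. max 0 (- (indicator (box a c) x * h x)))"
      using i by (intro Bochner_Integration.integral_diff) (auto intro: integrable_max)
    finally show ?thesis unfolding P Q using z by simp
  qed
  have "density lborel p = density lborel q"
  proof (rule measure_eqI_generator_eq)
    let ?E = "range (\<lambda>(a, b). box a b :: 'a set)"
    let ?A = "\<lambda>n::nat. box (- (real n *\<^sub>R One)) (real n *\<^sub>R One) :: 'a set"
    show "Int_stable ?E" by (auto simp: Int_stable_def box_Int_box)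
    show "?E \<subseteq> Pow UNIV" "sets (density lborel p) = sigma_sets UNIV ?E" "sets (density lborel q) = sigma_sets UNIV ?E"
      by (simp_all add: borel_eq_box)
    show "range ?A \<subseteq> ?E" "(\<Union>i. ?A i) = UNIV" unfolding UN_box_eq_UNIV by auto
    show "emeasure (density lborel p) (?A n) \<noteq> \<infinity>" for n unfolding P by simp
    show "emeasure (density lborel p) X = emeasure (density lborel q) X" if "X \<in> ?E" for X
      using that PQ by auto
  qed
  then have "AE x in lborel. p x = q x"
    by (subst (asm) sigma_finite_measure.density_unique_iff[OF sigma_finite_lborel]) auto
  then show ?thesis
    by eventually_elim (metis (mono_tags, opaque_lifting) p_def q_def ennreal_eq_0_iff ennreal_neg linorder_le_cases neg_0_le_iff_le order_antisym neg_le_0_iff_le)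
qed

section \<open>Schwartz functions and uniqueness of the function representing a distribution\<close>

lemma test_function_schwartz:
  fixes \<psi> :: "'a::euclidean_space \<Rightarrow> real"
  assumes "\<psi> \<in> test_functions U"
  shows "(\<lambda>x. complex_of_real (\<psi> x)) \<in> schwartz"
  unfolding schwartz_def
proof (intro CollectI conjI allI ballI)
  show "(\<lambda>x. complex_of_real (\<psi> x)) \<in> C_infinity"
    by (rule C_infinity_of_real[OF test_functions_C_infinity[OF assms]])
  fix k and bs :: "'a list" assume bs: "bs \<in> lists Basis"
  have p: "partials bs \<psi> \<in> test_functions U" using bs
    by (induction bs) (auto intro: assms test_functions_partial)
  obtain R where R: "R \<ge> 0" "\<And>x. norm x > R \<Longrightarrow> partials bs \<psi> x = 0" using test_functions_support[OF p] by auto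
  obtain B where B: "B \<ge> 0" "\<And>x. norm (partials bs \<psi> x) \<le> B" using test_functions_bounded[OF p] by auto
  have "norm ((1 + norm x) ^ k *\<^sub>R partials bs (\<lambda>x. complex_of_real (\<psi> x)) x) \<le> (1 + R) ^ k * B" for x
  proof (cases "norm x > R")
    case False
    have "(1 + norm x) ^ k * norm (partials bs \<psi> x) \<le> (1 + R) ^ k * B"
      using False R(1) B by (intro mult_mono power_mono) auto
    then show ?thesis by (simp add: partials_of_real[OF test_functions_C_infinity[OF assms] bs])
  next
    case True
    then show ?thesis using R B by (simp add: partials_of_real[OF test_functions_C_infinity[OF assms] bs])
  qed
  then show "bounded (range (\<lambda>x. (1 + norm x) ^ k *\<^sub>R partials bs (\<lambda>x. complex_of_real (\<psi> x)) x))"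
    by (auto simp: bounded_iff)
qed

lemma schwartz_borel [measurable_dest]: "f \<in> schwartz \<Longrightarrow> f \<in> borel_measurable borel"
  unfolding schwartz_def by (auto intro: C_infinity_borel_measurable)

text \<open>Each 1 + x_b^2 is at most (1 + |x|)^2, so decay of order twice the dimension yields the
  product majorant with factors 1/(1 + x_b^2).\<close>

lemma schwartz_integrable:
  fixes f :: "'a::euclidean_space \<Rightarrow> complex"
  assumes f: "f \<in> schwartz"
  shows "integrable lborel f"
proof -
  have "bounded (range (\<lambda>x. (1 + norm x) ^ (2 * DIM('a)) *\<^sub>R partials [] f x))"
    using f unfolding schwartz_def by blast
  then obtain B where B: "\<And>x. (1 + norm x) ^ (2 * DIM('a)) * cmod (f x) \<le> B"
    by (auto simp: bounded_iff)
  have i1: "integrable lborel (\<lambda>y::real. complex_of_real (inverse (1 + y\<^sup>2)))"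
    using integrable_inverse_1_plus_square unfolding set_integrable_def complex_of_real_integrable_eq by simp
  have "integrable lborel (\<lambda>x::'a. \<Prod>b\<in>Basis. complex_of_real (inverse (1 + (x \<bullet> b)\<^sup>2)))"
    by (rule product_lborel(1)) (rule i1)
  then have i2: "integrable lborel (\<lambda>x::'a. B * (\<Prod>b\<in>Basis. inverse (1 + (x \<bullet> b)\<^sup>2)))"
    unfolding of_real_prod[symmetric] complex_of_real_integrable_eq by (rule integrable_mult_right)
  show ?thesis
  proof (rule Bochner_Integration.integrable_bound[OF i2])
    show "f \<in> borel_measurable lborel" using schwartz_borel[OF f] by simp
    have "norm (f x) \<le> norm (B * (\<Prod>b\<in>Basis. inverse (1 + (x \<bullet> b)\<^sup>2)))" for x
    proof -
      let ?p = "\<Prod>b\<in>(Basis::'a set). 1 + (x \<bullet> b)\<^sup>2"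
      have pp: "?p > 0" by (intro prod_pos) (simp add: add_pos_nonneg)
      have "?p \<le> (\<Prod>b\<in>(Basis::'a set). (1 + norm x)\<^sup>2)"
      proof (intro prod_mono conjI)
        fix b :: 'a assume b: "b \<in> Basis"
        have "(x \<bullet> b)\<^sup>2 \<le> (norm x)\<^sup>2" using Basis_le_norm[OF b, of x] by (simp add: abs_le_square_iff[symmetric])
        then show "1 + (x \<bullet> b)\<^sup>2 \<le> (1 + norm x)\<^sup>2" by (simp add: power2_sum add_increasing2)
      qed simp
      also have "\<dots> = (1 + norm x) ^ (2 * DIM('a))" by (simp add: power_mult)
      finally have "?p * cmod (f x) \<le> (1 + norm x) ^ (2 * DIM('a)) * cmod (f x)" by (intro mult_right_mono) auto
      also have "\<dots> \<le> B" by (rule B)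
      finally have "cmod (f x) \<le> B / ?p" using pp by (simp add: pos_le_divide_eq mult.commute)
      then show ?thesis using norm_ge_zero[of "f x"] by (simp add: prod_inversef[symmetric] comp_def divide_inverse)
    qed
    then show "AE x in lborel. norm (f x) \<le> norm (B * (\<Prod>b\<in>Basis. inverse (1 + (x \<bullet> b)\<^sup>2)))" by (intro AE_I2)
  qed
qed

text \<open>\<open>fourier_fun\<close> selects a representing function by choice; this lemma makes
  \<open>Q_DR\<close> independent of the selection. The difference of two candidates is tested with
  bumps, which approximate indicators of boxes.\<close>

lemma represents_unique:
  fixes T :: "('a::euclidean_space \<Rightarrow> complex) \<Rightarrow> complex"
  assumes v: "represents v T" and w: "represents w T"
  shows "AE x in lebesgue. v x = w x"
proof -
  define d where "d x = v x - w x" for x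
  have dm: "d \<in> borel_measurable lebesgue" using v w unfolding represents_def d_def by auto
  have di: "integrable lebesgue (\<lambda>x. d x * f x) \<and> (LINT x|lebesgue. d x * f x) = 0" if f: "f \<in> schwartz" for f
  proof -
    have i: "integrable lebesgue (\<lambda>x. v x * f x)" "integrable lebesgue (\<lambda>x. w x * f x)"
      and e: "(LINT x|lebesgue. v x * f x) = (LINT x|lebesgue. w x * f x)"
      using v w f unfolding represents_def dist_of_def by metis+
    show ?thesis unfolding d_def left_diff_distrib using i e by simp
  qed
  \<comment> \<open>Real and imaginary part are handled by one argument; the second premise on
    \<open>P\<close> lets it pass by a real-valued test function.\<close>
  have part: "AE x in lebesgue. P (d x) = 0"
    if P: "bounded_linear P" "\<And>z r. P (z * complex_of_real r) = P z * r" for P :: "complex \<Rightarrow> real"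
  proof -
    have Pm: "P \<in> borel_measurable borel"
      by (intro borel_measurable_continuous_onI linear_continuous_on P(1))
    have "(\<lambda>x. P (d x)) \<in> borel_measurable lebesgue" using measurable_compose[OF dm Pm] .
    from completion_ex_borel_measurable_real[OF this]
    obtain h where h: "h \<in> borel_measurable lborel" "AE x in lborel. P (d x) = h x" by auto
    note [measurable] = h(1)[unfolded measurable_lborel1]
    have hb: "integrable lborel (\<lambda>x. h x * \<psi> x) \<and> (LINT x|lborel. h x * \<psi> x) = 0"
      if \<psi>: "\<psi> \<in> test_functions UNIV" for \<psi> :: "'a \<Rightarrow> real"
    proof -
      note [measurable] = test_functions_borel[OF \<psi>]
      note dd = di[OF test_function_schwartz[OF \<psi>]]
      have i: "integrable lebesgue (\<lambda>x. P (d x) * \<psi> x)" and z: "(LINT x|lebesgue. P (d x) * \<psi> x) = 0"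
        using integrable_bounded_linear[OF P(1) conjunct1[OF dd]] integral_bounded_linear[OF P(1) conjunct1[OF dd]]
          conjunct2[OF dd] linear_0[OF bounded_linear.linear[OF P(1)]] by (simp_all add: P(2))
      have m: "(\<lambda>x. h x * \<psi> x) \<in> borel_measurable lborel" by measurable
      have ae: "AE x in lebesgue. P (d x) * \<psi> x = h x * \<psi> x"
        unfolding AE_completion_iff using h(2) by eventually_elim simp
      have "integrable lebesgue (\<lambda>x. h x * \<psi> x)"
        by (rule integrable_cong_AE_imp[OF i measurable_completion[OF m] ae])
      moreover have "(LINT x|lebesgue. h x * \<psi> x) = 0"
        using integral_cong_AE[OF borel_measurable_integrable[OF i] measurable_completion[OF m] ae] z by simp
      ultimately show ?thesis using integrable_completion[OF m] integral_completion[OF m] by simp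
    qed
    \<comment> \<open>Only products with test functions are known to be integrable. A bump on an
      enlarged box has a positive minimum on the closed box, so dividing by this minimum dominates h
      on the box.\<close>
    have ib: "integrable lborel (\<lambda>x. indicator (box a c) x * h x)" for a c
    proof (cases "cbox a c = {}")
      case True
      then have "box a c = {}" using box_subset_cbox by blast
      then show ?thesis by simp
    next
      case False
      let ?\<psi> = "box_bump 1 (a - One) (c + One)"
      have "cbox a c \<subseteq> box (a - One) (c + One)"
        by (auto simp: mem_box inner_diff_left inner_add_left) (smt (verit))+
      then have pos: "?\<psi> x > 0" if "x \<in> cbox a c" for x using that by (subst box_bump_pos_iff) auto
      obtain x0 where x0: "x0 \<in> cbox a c" "\<And>x. x \<in> cbox a c \<Longrightarrow> ?\<psi> x0 \<le> ?\<psi> x"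
        using continuous_attains_inf[OF compact_cbox False C_infinity_continuous[OF box_bump_C_infinity]] by blast
      have t: "?\<psi> \<in> test_functions UNIV" by (rule box_bump_test) auto
      show ?thesis
      proof (rule Bochner_Integration.integrable_bound)
        show "integrable lborel (\<lambda>x. (1 / ?\<psi> x0) * (h x * ?\<psi> x))" using hb[OF t] by (intro integrable_mult_right) blast
        have "norm (indicator (box a c) x * h x) \<le> norm ((1 / ?\<psi> x0) * (h x * ?\<psi> x))" for x
        proof (cases "x \<in> box a c")
          case True
          then have x: "x \<in> cbox a c" using box_subset_cbox by blast
          have "1 \<le> ?\<psi> x / ?\<psi> x0" using x0(2)[OF x] pos[OF x0(1)] by simp
          then have "\<bar>h x\<bar> * 1 \<le> \<bar>h x\<bar> * (?\<psi> x / ?\<psi> x0)" by (intro mult_left_mono) auto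
          then show ?thesis using True pos[OF x0(1)] pos[OF x] by (simp add: abs_mult)
        qed simp
        then show "AE x in lborel. norm (indicator (box a c) x * h x) \<le> norm ((1 / ?\<psi> x0) * (h x * ?\<psi> x))" by (intro AE_I2)
      qed measurable
    qed
    have "AE x in lborel. h x = 0"
    proof (rule AE_zero_if_box_integrals_zero[OF _ ib])
      fix a c :: 'a
      have bm: "box_bump N a c \<in> borel_measurable borel" for N by (rule C_infinity_borel_measurable[OF box_bump_C_infinity])
      have "(\<lambda>n. LINT x|lborel. h x * box_bump (real (Suc n)) a c x) \<longlonglongrightarrow> (LINT x|lborel. indicator (box a c) x * h x)"
      proof (rule integral_dominated_convergence[where w="\<lambda>x. \<bar>indicator (box a c) x * h x\<bar>"])
        show "(\<lambda>x. h x * box_bump (real (Suc n)) a c x) \<in> borel_measurable lborel" for n using bm by measurable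
        show "integrable lborel (\<lambda>x. \<bar>indicator (box a c) x * h x\<bar>)" using ib by (intro integrable_abs)
        have "(\<lambda>n. h x * box_bump (real (Suc n)) a c x) \<longlonglongrightarrow> h x * indicator (box a c) x" for x
          by (intro tendsto_intros box_bump_tendsto)
        then show "AE x in lborel. (\<lambda>n. h x * box_bump (real (Suc n)) a c x) \<longlonglongrightarrow> indicator (box a c) x * h x"
          by (simp add: mult.commute)
        have "norm (h x * box_bump (real (Suc n)) a c x) \<le> \<bar>indicator (box a c) x * h x\<bar>" for n x
        proof (cases "x \<in> box a c")
          case True
          have "\<bar>h x\<bar> * box_bump (real (Suc n)) a c x \<le> \<bar>h x\<bar> * 1" by (intro mult_left_mono box_bump_bounds) auto
          then show ?thesis using True box_bump_bounds(1)[of "real (Suc n)" a c x] by (simp add: abs_mult)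
        next
          case False
          then have "box_bump (real (Suc n)) a c x = 0"
            using box_bump_pos_iff[of "real (Suc n)" a c x] box_bump_bounds(1)[of "real (Suc n)" a c x] by force
          then show ?thesis by simp
        qed
        then show "AE x in lborel. norm (h x * box_bump (real (Suc n)) a c x) \<le> \<bar>indicator (box a c) x * h x\<bar>" for n
          by (intro AE_I2)
      qed measurable
      moreover have "(LINT x|lborel. h x * box_bump (real (Suc n)) a c x) = 0" for n
        using hb[OF box_bump_test[of "real (Suc n)" a c UNIV]] by simp
      ultimately show "(LINT x|lborel. indicator (box a c) x * h x) = 0" by (simp add: LIMSEQ_const_iff)
    qed measurable
    then show ?thesis unfolding AE_completion_iff using h(2) by eventually_elim simp
  qed
  have "AE x in lebesgue. Re (d x) = 0" by (rule part[OF bounded_linear_Re]) simp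
  moreover have "AE x in lebesgue. Im (d x) = 0" by (rule part[OF bounded_linear_Im]) simp
  ultimately show ?thesis by eventually_elim (simp add: d_def complex_eq_iff)
qed

section \<open>The Fourier transform of the extension by zero\<close>

lemma L2_on_eq_l2: "(L2_on \<Omega> :: ('a::euclidean_space \<Rightarrow> real) set) = l2 (lebesgue_on \<Omega>)"
  by (simp add: L2_on_def l2_def)

lemma L2_inner_eq_ip: "L2_inner \<Omega> = ip (lebesgue_on \<Omega>)"
  by (intro ext) (simp add: L2_inner_def ip_def)

text \<open>The multiplication formula, by Fubini. It moves the transform from the Schwartz function
  to \<open>w\<close> and so identifies the distributional transform of \<open>w\<close>.\<close>

lemma ft_duality:
  fixes w :: "'a::euclidean_space \<Rightarrow> real" and \<phi> :: "'a \<Rightarrow> complex"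
  assumes w: "integrable lborel w" and \<phi>: "integrable lborel \<phi>"
  shows "(LINT x|lborel. complex_of_real (w x) * (LINT \<xi>|lborel. cis (- (\<xi> \<bullet> x)) * \<phi> \<xi>)) = (LINT \<xi>|lborel. ft w \<xi> * \<phi> \<xi>)"
    "integrable lborel (\<lambda>\<xi>. ft w \<xi> * \<phi> \<xi>)"
proof -
  have [measurable]: "w \<in> borel_measurable borel" "\<phi> \<in> borel_measurable borel"
    using borel_measurable_integrable[OF w] borel_measurable_integrable[OF \<phi>] by simp_all
  have G: "integrable (lborel \<Otimes>\<^sub>M lborel) (\<lambda>(x, \<xi>). complex_of_real (w x) * (cis (- (\<xi> \<bullet> x)) * \<phi> \<xi>))"
  proof (rule Bochner_Integration.integrable_bound)
    show "integrable (lborel \<Otimes>\<^sub>M lborel) (\<lambda>p. complex_of_real (w (fst p)) * \<phi> (snd p))"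
      by (rule integrable_pair_product[OF sigma_finite_lborel _ \<phi>]) (use w in \<open>simp add: complex_of_real_integrable_eq\<close>)
  qed (measurable, auto simp: norm_mult)
  have a: "(LINT x|lborel. complex_of_real (w x) * (cis (- (\<xi> \<bullet> x)) * \<phi> \<xi>)) = ft w \<xi> * \<phi> \<xi>" for \<xi>
  proof -
    have "(\<lambda>x. complex_of_real (w x) * (cis (- (\<xi> \<bullet> x)) * \<phi> \<xi>)) = (\<lambda>x. (cis (- (x \<bullet> \<xi>)) * complex_of_real (w x)) * \<phi> \<xi>)"
      by (simp add: inner_commute mult_ac)
    then show ?thesis unfolding ft_def by (simp only: integral_mult_left_zero)
  qed
  have "(LINT \<xi>|lborel. LINT x|lborel. complex_of_real (w x) * (cis (- (\<xi> \<bullet> x)) * \<phi> \<xi>)) =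
    (LINT x|lborel. LINT \<xi>|lborel. complex_of_real (w x) * (cis (- (\<xi> \<bullet> x)) * \<phi> \<xi>))"
    by (rule lborel_pair.Fubini_integral[OF G])
  then show "(LINT x|lborel. complex_of_real (w x) * (LINT \<xi>|lborel. cis (- (\<xi> \<bullet> x)) * \<phi> \<xi>)) = (LINT \<xi>|lborel. ft w \<xi> * \<phi> \<xi>)"
    unfolding a integral_mult_right_zero by (rule sym)
  show "integrable lborel (\<lambda>\<xi>. ft w \<xi> * \<phi> \<xi>)"
    using lborel_pair.integrable_snd[OF G] unfolding a .
qed

text \<open>Holds because \<open>lebesgue\<close> is complete. It is applied to the zero extension
  itself, which is compared with its Borel representative only almost everywhere.\<close>

lemma lebesgue_measurable_cong_AE:
  fixes f g :: "'a::euclidean_space \<Rightarrow> 'b::topological_space"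
  assumes f: "f \<in> borel_measurable lebesgue" and fg: "AE x in lebesgue. f x = g x"
  shows "g \<in> borel_measurable lebesgue"
proof (rule measurableI)
  fix S :: "'b set" assume S: "S \<in> sets borel"
  show "g -` S \<inter> space lebesgue \<in> sets lebesgue"
  proof (rule completion.in_sets_AE)
    show "f -` S \<inter> space lebesgue \<in> sets lebesgue" using measurable_sets[OF f S] .
    show "AE x in lebesgue. x \<in> f -` S \<inter> space lebesgue \<longleftrightarrow> x \<in> g -` S \<inter> space lebesgue"
      using fg by eventually_elim auto
  qed auto
qed auto

text \<open>The factor of the unitary transform that \<open>ft\<close> omits. It enters
  \<open>Q_DR\<close> squared.\<close>

definition fourier_const :: "'a::euclidean_space itself \<Rightarrow> real" where
  "fourier_const _ = (2 * pi) powr (- real DIM('a) / 2)"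

lemma represents_zero_ext:
  fixes w v :: "'a::euclidean_space \<Rightarrow> real"
  assumes w: "w \<in> l2c" and v: "AE x in lborel. (if x \<in> \<Omega> then v x else 0) = w x"
  shows "represents (\<lambda>\<xi>. complex_of_real (fourier_const TYPE('a)) * ft w \<xi>) (fourier_dist (zero_ext \<Omega> v))"
  unfolding represents_def
proof (intro conjI ballI)
  let ?c = "complex_of_real (fourier_const TYPE('a))"
  note [measurable] = l2c_measurable[OF w]
  show "(\<lambda>\<xi>. ?c * ft w \<xi>) \<in> borel_measurable lebesgue" by (intro measurable_completion) measurable
  fix \<phi> :: "'a \<Rightarrow> complex" assume \<phi>: "\<phi> \<in> schwartz"
  note [measurable] = schwartz_borel[OF \<phi>]
  note \<phi>i = schwartz_integrable[OF \<phi>]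
  note D = ft_duality[OF l2c_integrable[OF w] \<phi>i]
  have m: "(\<lambda>\<xi>. ?c * ft w \<xi> * \<phi> \<xi>) \<in> borel_measurable lborel" by measurable
  have i: "integrable lborel (\<lambda>\<xi>. ?c * ft w \<xi> * \<phi> \<xi>)"
    unfolding mult.assoc by (intro integrable_mult_right D)
  then show "integrable lebesgue (\<lambda>\<xi>. ?c * ft w \<xi> * \<phi> \<xi>)" using integrable_completion[OF m] by simp
  have four: "fourier \<phi> x = ?c * (LINT \<xi>|lborel. cis (- (\<xi> \<bullet> x)) * \<phi> \<xi>)" for x
  proof -
    have "(\<lambda>\<xi>. cis (- (\<xi> \<bullet> x)) * \<phi> \<xi>) \<in> borel_measurable lborel" by measurable
    then show ?thesis unfolding fourier_def fourier_const_def by (simp add: integral_completion)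
  qed
  have [measurable]: "fourier \<phi> \<in> borel_measurable borel" unfolding four[abs_def] by measurable
  have wm: "(\<lambda>x. complex_of_real (w x) * fourier \<phi> x) \<in> borel_measurable lborel" by measurable
  have ae: "AE x in lebesgue. complex_of_real (if x \<in> \<Omega> then v x else 0) * fourier \<phi> x = complex_of_real (w x) * fourier \<phi> x"
    unfolding AE_completion_iff using v by eventually_elim (simp only:)
  have "(\<lambda>x. complex_of_real (if x \<in> \<Omega> then v x else 0) * fourier \<phi> x) \<in> borel_measurable lebesgue"
  proof -
    have "AE x in lebesgue. complex_of_real (w x) * fourier \<phi> x = complex_of_real (if x \<in> \<Omega> then v x else 0) * fourier \<phi> x"
      using ae by eventually_elim (simp only:)
    then show ?thesis
      by (rule lebesgue_measurable_cong_AE[OF measurable_completion[OF wm]])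
  qed
  then have "fourier_dist (zero_ext \<Omega> v) \<phi> = (LINT x|lebesgue. complex_of_real (w x) * fourier \<phi> x)"
    unfolding fourier_dist_def zero_ext_def dist_of_def
    by (rule integral_cong_AE[OF _ measurable_completion[OF wm] ae])
  also have "\<dots> = (LINT x|lborel. complex_of_real (w x) * fourier \<phi> x)" by (rule integral_completion[OF wm])
  also have "\<dots> = (LINT x|lborel. ?c * (complex_of_real (w x) * (LINT \<xi>|lborel. cis (- (\<xi> \<bullet> x)) * \<phi> \<xi>)))"
    unfolding four by (simp add: mult_ac)
  also have "\<dots> = ?c * (LINT \<xi>|lborel. ft w \<xi> * \<phi> \<xi>)"
    unfolding integral_mult_right_zero D(1) ..
  also have "\<dots> = (LINT \<xi>|lborel. ?c * ft w \<xi> * \<phi> \<xi>)"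
    unfolding mult.assoc integral_mult_right_zero ..
  also have "\<dots> = dist_of (\<lambda>\<xi>. ?c * ft w \<xi>) \<phi>"
    unfolding dist_of_def by (rule integral_completion[OF m, symmetric])
  finally show "fourier_dist (zero_ext \<Omega> v) \<phi> = dist_of (\<lambda>\<xi>. ?c * ft w \<xi>) \<phi>" .
qed

lemma fourier_const_pos: "fourier_const T > 0"
  by (simp add: fourier_const_def)

text \<open>The choice in \<open>fourier_fun\<close> is legitimate because
  \<open>represents_zero_ext\<close> exhibits a representing function, and harmless because any two
  agree almost everywhere.\<close>

lemma Q_DR_eq:
  fixes w v :: "'a::euclidean_space \<Rightarrow> real"
  assumes w: "w \<in> l2c" and v: "AE x in lborel. (if x \<in> \<Omega> then v x else 0) = w x"
    and i: "integrable lborel (\<lambda>\<xi>. norm \<xi> powr (2 * s) * (cmod (ft w \<xi>))\<^sup>2)"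
  shows "Q_DR \<Omega> s v = ennreal ((fourier_const TYPE('a))\<^sup>2 * (LINT \<xi>|lborel. norm \<xi> powr (2 * s) * (cmod (ft w \<xi>))\<^sup>2))"
proof -
  let ?c = "fourier_const TYPE('a)"
  note [measurable] = l2c_measurable[OF w]
  have r: "represents (\<lambda>\<xi>. complex_of_real ?c * ft w \<xi>) (fourier_dist (zero_ext \<Omega> v))" by (rule represents_zero_ext[OF w v])
  then have "represents (fourier_fun (zero_ext \<Omega> v)) (fourier_dist (zero_ext \<Omega> v))"
    unfolding fourier_fun_def by (rule someI[where P="\<lambda>u. represents u (fourier_dist (zero_ext \<Omega> v))"])
  from represents_unique[OF this r]
  have ae: "AE \<xi> in lebesgue. fourier_fun (zero_ext \<Omega> v) \<xi> = complex_of_real ?c * ft w \<xi>" .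
  have "Q_DR \<Omega> s v = (\<integral>\<^sup>+\<xi>. ennreal (norm \<xi> powr (2 * s) * (cmod (complex_of_real ?c * ft w \<xi>))\<^sup>2) \<partial>lebesgue)"
    unfolding Q_DR_def
  proof (rule nn_integral_cong_AE)
    show "AE \<xi> in lebesgue. ennreal (norm \<xi> powr (2 * s) * (cmod (fourier_fun (zero_ext \<Omega> v) \<xi>))\<^sup>2) =
       ennreal (norm \<xi> powr (2 * s) * (cmod (complex_of_real ?c * ft w \<xi>))\<^sup>2)"
      using ae by eventually_elim (simp only:)
  qed
  also have "\<dots> = (\<integral>\<^sup>+\<xi>. ennreal (norm \<xi> powr (2 * s) * (cmod (complex_of_real ?c * ft w \<xi>))\<^sup>2) \<partial>lborel)"
    by (rule nn_integral_completion)
  also have "\<dots> = (\<integral>\<^sup>+\<xi>. ennreal (?c\<^sup>2 * (norm \<xi> powr (2 * s) * (cmod (ft w \<xi>))\<^sup>2)) \<partial>lborel)"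
    by (simp add: norm_mult power_mult_distrib mult_ac)
  also have "\<dots> = ennreal (LINT \<xi>|lborel. ?c\<^sup>2 * (norm \<xi> powr (2 * s) * (cmod (ft w \<xi>))\<^sup>2))"
    by (intro nn_integral_eq_integral integrable_mult_right i) simp
  finally show ?thesis by simp
qed

text \<open>|\<xi>|^(2 s) is at most (1 + |\<xi>|^2)^s, the square of the weight in
  \<open>sobolev_H\<close>; the function w supplied by membership is \<open>ft w\<close> up to the
  constant, by uniqueness.\<close>

lemma sobolev_H_integrable:
  fixes w v :: "'a::euclidean_space \<Rightarrow> real"
  assumes w: "w \<in> l2c" and v: "AE x in lborel. (if x \<in> \<Omega> then v x else 0) = w x"
    and s: "s > 0" and H: "zero_ext \<Omega> v \<in> sobolev_H s"
  shows "integrable lborel (\<lambda>\<xi>. norm \<xi> powr (2 * s) * (cmod (ft w \<xi>))\<^sup>2)"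
proof -
  let ?c = "fourier_const TYPE('a)"
  note [measurable] = l2c_measurable[OF w]
  obtain u where u: "represents u (fourier_dist (zero_ext \<Omega> v))"
    "(\<lambda>\<xi>. (1 + (norm \<xi>)\<^sup>2) powr (s / 2) *\<^sub>R u \<xi>) \<in> L2_on UNIV"
    using H unfolding sobolev_H_def by blast
  from u(2) have i: "integrable lebesgue (\<lambda>\<xi>. (norm ((1 + (norm \<xi>)\<^sup>2) powr (s / 2) *\<^sub>R u \<xi>))\<^sup>2)"
    unfolding L2_on_def lebesgue_on_UNIV_eq by simp
  have ae: "AE \<xi> in lebesgue. u \<xi> = complex_of_real ?c * ft w \<xi>"
    by (rule represents_unique[OF u(1) represents_zero_ext[OF w v]])
  have m: "(\<lambda>\<xi>. ?c\<^sup>2 * (norm \<xi> powr (2 * s) * (cmod (ft w \<xi>))\<^sup>2)) \<in> borel_measurable lborel" by measurable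
  have "integrable lebesgue (\<lambda>\<xi>. ?c\<^sup>2 * (norm \<xi> powr (2 * s) * (cmod (ft w \<xi>))\<^sup>2))"
  proof (rule Bochner_Integration.integrable_bound[OF i measurable_completion[OF m]])
    show "AE \<xi> in lebesgue. norm (?c\<^sup>2 * (norm \<xi> powr (2 * s) * (cmod (ft w \<xi>))\<^sup>2)) \<le> norm ((norm ((1 + (norm \<xi>)\<^sup>2) powr (s / 2) *\<^sub>R u \<xi>))\<^sup>2)"
      using ae
    proof eventually_elim
      case (elim \<xi>)
      have pos: "1 + (norm \<xi>)\<^sup>2 > 0" by (simp add: add_pos_nonneg)
      have "norm \<xi> powr (2 * s) = ((norm \<xi>)\<^sup>2) powr s"
      proof -
        have "(norm \<xi>)\<^sup>2 = norm \<xi> powr 2" by (simp add: powr_numeral)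
        then show ?thesis by (simp only: powr_powr)
      qed
      also have "\<dots> \<le> (1 + (norm \<xi>)\<^sup>2) powr s" using s by (intro powr_mono2) auto
      also have "\<dots> = ((1 + (norm \<xi>)\<^sup>2) powr (s / 2))\<^sup>2"
        using pos by (simp add: power2_eq_square powr_add[symmetric])
      finally have "norm \<xi> powr (2 * s) * (?c\<^sup>2 * (cmod (ft w \<xi>))\<^sup>2) \<le> ((1 + (norm \<xi>)\<^sup>2) powr (s / 2))\<^sup>2 * (?c\<^sup>2 * (cmod (ft w \<xi>))\<^sup>2)"
        by (intro mult_right_mono) auto
      then show ?case unfolding elim by (simp add: norm_mult power_mult_distrib mult_ac)
    qed
  qed
  then have "integrable lborel (\<lambda>\<xi>. ?c\<^sup>2 * (norm \<xi> powr (2 * s) * (cmod (ft w \<xi>))\<^sup>2))"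
    using integrable_completion[OF m] by simp
  then show ?thesis using fourier_const_pos[of "TYPE('a)"] by (simp add: integrable_mult_right_iff)
qed

lemma nonneg_borel_representative:
  fixes \<Omega> :: "'a::euclidean_space set"
  assumes \<Omega>: "open \<Omega>" "bounded \<Omega>" and v: "v \<in> l2 (lebesgue_on \<Omega>)" and v0: "AE x in lebesgue_on \<Omega>. 0 \<le> v x"
  shows "\<exists>w\<in>l2c. (\<forall>x. 0 \<le> w x) \<and> (AE x in lborel. (if x \<in> \<Omega> then v x else 0) = w x)"
proof -
  obtain w where w: "w \<in> l2c" "AE x in lborel. (if x \<in> \<Omega> then v x else 0) = w x"
    using borel_representative[OF \<Omega> v] by blast
  note [measurable] = l2c_measurable[OF w(1)]
  have "(\<lambda>x. \<bar>w x\<bar>) \<in> l2c" by (rule l2c_dominated[OF _ w(1), of _ 1]) auto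
  moreover have "AE x in lborel. (if x \<in> \<Omega> then v x else 0) = \<bar>w x\<bar>"
    using w(2) v0[unfolded AE_lebesgue_on_iff[OF \<Omega>(1)]] by eventually_elim (auto split: if_splits)
  ultimately show ?thesis by (intro bexI[of _ "\<lambda>x. \<bar>w x\<bar>"]) auto
qed

text \<open>Expanding the squared moduli gives A + B + 2 C for the sum and A + B - 2 C for the
  difference, up to one common positive factor, so the comparison is decided by the sign of
  C.\<close>

lemma restricted_form_inequality:
  fixes \<Omega> :: "'a::euclidean_space set" and m :: nat
  assumes \<Omega>: "open \<Omega>" "bounded \<Omega>"
    and f: "f \<in> l2 (lebesgue_on \<Omega>)" "AE x in lebesgue_on \<Omega>. 0 \<le> f x" "\<not> (AE x in lebesgue_on \<Omega>. f x = 0)"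
    and g: "g \<in> l2 (lebesgue_on \<Omega>)" "AE x in lebesgue_on \<Omega>. 0 \<le> g x" "\<not> (AE x in lebesgue_on \<Omega>. g x = 0)"
    and fg: "AE x in lebesgue_on \<Omega>. f x * g x = 0"
    and s: "real m < s" "s < real m + 1" "s > 0"
    and H: "zero_ext \<Omega> f \<in> sobolev_H s" "zero_ext \<Omega> g \<in> sobolev_H s"
  shows "even m \<Longrightarrow> Q_DR \<Omega> s (\<lambda>x. f x + g x) < Q_DR \<Omega> s (\<lambda>x. f x - g x)"
    and "odd m \<Longrightarrow> Q_DR \<Omega> s (\<lambda>x. f x - g x) < Q_DR \<Omega> s (\<lambda>x. f x + g x)"
proof -
  obtain u where u: "u \<in> l2c" "\<And>x. 0 \<le> u x" "AE x in lborel. (if x \<in> \<Omega> then f x else 0) = u x"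
    using nonneg_borel_representative[OF \<Omega> f(1,2)] by blast
  obtain w where w: "w \<in> l2c" "\<And>x. 0 \<le> w x" "AE x in lborel. (if x \<in> \<Omega> then g x else 0) = w x"
    using nonneg_borel_representative[OF \<Omega> g(1,2)] by blast
  have unz: "\<not> (AE x in lborel. u x = 0)"
  proof
    assume "AE x in lborel. u x = 0"
    with u(3) have "AE x in lborel. x \<in> \<Omega> \<longrightarrow> f x = 0" by eventually_elim auto
    with f(3) show False unfolding AE_lebesgue_on_iff[OF \<Omega>(1)] by blast
  qed
  have wnz: "\<not> (AE x in lborel. w x = 0)"
  proof
    assume "AE x in lborel. w x = 0"
    with w(3) have "AE x in lborel. x \<in> \<Omega> \<longrightarrow> g x = 0" by eventually_elim auto
    with g(3) show False unfolding AE_lebesgue_on_iff[OF \<Omega>(1)] by blast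
  qed
  have uw: "AE x in lborel. u x * w x = 0"
    using u(3) w(3) fg[unfolded AE_lebesgue_on_iff[OF \<Omega>(1)]]
    by eventually_elim (auto split: if_splits)
  let ?W = "\<lambda>\<xi>::'a. norm \<xi> powr (2 * s)"
  note iu = sobolev_H_integrable[OF u(1,3) s(3) H(1)] and iw = sobolev_H_integrable[OF w(1,3) s(3) H(2)]
  have ic: "integrable lborel (\<lambda>\<xi>. ?W \<xi> * Re (ft u \<xi> * cnj (ft w \<xi>)))"
    by (rule weighted_integrable[OF u(1) w(1) _ _ iu iw]) auto
  define A where "A = (LINT \<xi>|lborel. ?W \<xi> * (cmod (ft u \<xi>))\<^sup>2)"
  define B where "B = (LINT \<xi>|lborel. ?W \<xi> * (cmod (ft w \<xi>))\<^sup>2)"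
  define C where "C = (LINT \<xi>|lborel. ?W \<xi> * Re (ft u \<xi> * cnj (ft w \<xi>)))"
  have sgn: "(-1) ^ Suc m * C > 0"
    unfolding C_def by (rule restricted_form_sign[OF u(1,2) unz w(1,2) wnz uw s(1,2) iu iw])
  have plus_eq: "?W \<xi> * (cmod (ft (\<lambda>x. u x + w x) \<xi>))\<^sup>2 =
      ?W \<xi> * (cmod (ft u \<xi>))\<^sup>2 + ?W \<xi> * (cmod (ft w \<xi>))\<^sup>2 + 2 * (?W \<xi> * Re (ft u \<xi> * cnj (ft w \<xi>)))" for \<xi>
  proof -
    have "(cmod (ft u \<xi> + ft w \<xi>))\<^sup>2 = (cmod (ft u \<xi>))\<^sup>2 + (cmod (ft w \<xi>))\<^sup>2 + 2 * Re (ft u \<xi> * cnj (ft w \<xi>))"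
      unfolding cmod_power2 by (simp add: power2_eq_square algebra_simps)
    moreover have "ft (\<lambda>x. u x + w x) \<xi> = ft u \<xi> + ft w \<xi>" by (intro ft_add l2c_integrable u w)
    ultimately show ?thesis by (simp only: distrib_left mult.left_commute)
  qed
  have minus_eq: "?W \<xi> * (cmod (ft (\<lambda>x. u x - w x) \<xi>))\<^sup>2 =
      ?W \<xi> * (cmod (ft u \<xi>))\<^sup>2 + ?W \<xi> * (cmod (ft w \<xi>))\<^sup>2 - 2 * (?W \<xi> * Re (ft u \<xi> * cnj (ft w \<xi>)))" for \<xi>
  proof -
    have "(cmod (ft u \<xi> - ft w \<xi>))\<^sup>2 = (cmod (ft u \<xi>))\<^sup>2 + (cmod (ft w \<xi>))\<^sup>2 - 2 * Re (ft u \<xi> * cnj (ft w \<xi>))"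
      unfolding cmod_power2 by (simp add: power2_eq_square algebra_simps)
    moreover have "ft (\<lambda>x. u x - w x) \<xi> = ft u \<xi> - ft w \<xi>" by (intro ft_diff l2c_integrable u w)
    ultimately show ?thesis by (simp only: distrib_left right_diff_distrib mult.left_commute)
  qed
  have ip: "integrable lborel (\<lambda>\<xi>. ?W \<xi> * (cmod (ft (\<lambda>x. u x + w x) \<xi>))\<^sup>2)"
    unfolding plus_eq by (intro Bochner_Integration.integrable_add integrable_mult_right iu iw ic)
  have im: "integrable lborel (\<lambda>\<xi>. ?W \<xi> * (cmod (ft (\<lambda>x. u x - w x) \<xi>))\<^sup>2)"
    unfolding minus_eq by (intro Bochner_Integration.integrable_add Bochner_Integration.integrable_diff integrable_mult_right iu iw ic)
  have vp: "(LINT \<xi>|lborel. ?W \<xi> * (cmod (ft (\<lambda>x. u x + w x) \<xi>))\<^sup>2) = A + B + 2 * C"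
    unfolding plus_eq A_def B_def C_def
    by (simp only: Bochner_Integration.integral_add Bochner_Integration.integrable_add integrable_mult_right iu iw ic integral_mult_right_zero)
  have vm: "(LINT \<xi>|lborel. ?W \<xi> * (cmod (ft (\<lambda>x. u x - w x) \<xi>))\<^sup>2) = A + B - 2 * C"
    unfolding minus_eq A_def B_def C_def
    by (simp only: Bochner_Integration.integral_add Bochner_Integration.integral_diff Bochner_Integration.integrable_add integrable_mult_right iu iw ic integral_mult_right_zero)
  have "AE x in lborel. (if x \<in> \<Omega> then f x + g x else 0) = u x + w x"
    using u(3) w(3) by eventually_elim (auto split: if_splits)
  from Q_DR_eq[OF l2c_add[OF u(1) w(1)] this ip]
  have qp: "Q_DR \<Omega> s (\<lambda>x. f x + g x) = ennreal ((fourier_const TYPE('a))\<^sup>2 * (A + B + 2 * C))" unfolding vp .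
  have "AE x in lborel. (if x \<in> \<Omega> then f x - g x else 0) = u x - w x"
    using u(3) w(3) by eventually_elim (auto split: if_splits)
  from Q_DR_eq[OF l2c_diff[OF u(1) w(1)] this im]
  have qm: "Q_DR \<Omega> s (\<lambda>x. f x - g x) = ennreal ((fourier_const TYPE('a))\<^sup>2 * (A + B - 2 * C))" unfolding vm .
  have c: "(fourier_const TYPE('a))\<^sup>2 > 0" using fourier_const_pos[of "TYPE('a)"] by simp
  have p0: "0 \<le> A + B + 2 * C" unfolding vp[symmetric] by simp
  have m0: "0 \<le> A + B - 2 * C" unfolding vm[symmetric] by simp
  show "even m \<Longrightarrow> Q_DR \<Omega> s (\<lambda>x. f x + g x) < Q_DR \<Omega> s (\<lambda>x. f x - g x)"
    unfolding qp qm using sgn c p0 by (subst ennreal_less_iff) auto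
  show "odd m \<Longrightarrow> Q_DR \<Omega> s (\<lambda>x. f x - g x) < Q_DR \<Omega> s (\<lambda>x. f x + g x)"
    unfolding qp qm using sgn c m0 by (subst ennreal_less_iff) auto
qed

section \<open>The Dirichlet form\<close>

text \<open>Vector fields are treated through their coordinates, so that the scalar theory applies
  to each of them.\<close>

definition vl2 :: "'b measure \<Rightarrow> ('b \<Rightarrow> 'a::euclidean_space) set" where
  "vl2 M = {G. \<forall>b\<in>Basis. (\<lambda>x. G x \<bullet> b) \<in> l2 M}"

definition vip :: "'b measure \<Rightarrow> ('b \<Rightarrow> 'a::euclidean_space) \<Rightarrow> ('b \<Rightarrow> 'a) \<Rightarrow> real" where
  "vip M G H = (\<Sum>b\<in>Basis. ip M (\<lambda>x. G x \<bullet> b) (\<lambda>x. H x \<bullet> b))"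

lemma vl2D: "G \<in> vl2 M \<Longrightarrow> b \<in> Basis \<Longrightarrow> (\<lambda>x. G x \<bullet> b) \<in> l2 M"
  by (simp add: vl2_def)

lemma norm_square_components: "(norm z)\<^sup>2 = (\<Sum>b\<in>Basis. (z \<bullet> b) * (z \<bullet> b))" for z :: "'a::euclidean_space"
  using norm_square_Basis_sum[of z] by (simp only: power2_eq_square)

lemma L2_on_eq_vl2: "(L2_on \<Omega> :: ('a::euclidean_space \<Rightarrow> 'a) set) = vl2 (lebesgue_on \<Omega>)"
proof (intro equalityI subsetI)
  fix G :: "'a \<Rightarrow> 'a" assume G: "G \<in> L2_on \<Omega>"
  then have [measurable]: "G \<in> borel_measurable (lebesgue_on \<Omega>)" by (simp add: L2_on_def)
  have "(\<lambda>x. norm (G x)) \<in> l2 (lebesgue_on \<Omega>)" using G by (simp add: L2_on_def l2_def)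
  then have "(\<lambda>x. G x \<bullet> b) \<in> l2 (lebesgue_on \<Omega>)" if "b \<in> Basis" for b
    by (rule l2_dominated[rotated]) (use Basis_le_norm[OF that] in auto)
  then show "G \<in> vl2 (lebesgue_on \<Omega>)" by (simp add: vl2_def)
next
  fix G :: "'a \<Rightarrow> 'a" assume G: "G \<in> vl2 (lebesgue_on \<Omega>)"
  have m: "(\<lambda>x. G x \<bullet> b) \<in> borel_measurable (lebesgue_on \<Omega>)" if "b \<in> Basis" for b
    by (rule l2_measurable[OF vl2D[OF G that]])
  have "(\<lambda>x. \<Sum>b\<in>Basis. (G x \<bullet> b) *\<^sub>R b) \<in> borel_measurable (lebesgue_on \<Omega>)"
    by (intro borel_measurable_sum borel_measurable_scaleR m) auto
  then have "G \<in> borel_measurable (lebesgue_on \<Omega>)" by (simp add: euclidean_representation)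
  moreover have "integrable (lebesgue_on \<Omega>) (\<lambda>x. (norm (G x))\<^sup>2)"
    unfolding norm_square_components by (intro Bochner_Integration.integrable_sum l2_mult_integrable vl2D[OF G])
  ultimately show "G \<in> L2_on \<Omega>" by (simp add: L2_on_def)
qed

lemma vip_eq_integral:
  assumes "G \<in> vl2 M" "H \<in> vl2 M"
  shows "(LINT x|M. G x \<bullet> H x) = vip M G H"
proof -
  have "(LINT x|M. G x \<bullet> H x) = (LINT x|M. (\<Sum>b\<in>Basis. (G x \<bullet> b) * (H x \<bullet> b)))"
    by (subst euclidean_inner) (rule refl)
  also have "\<dots> = vip M G H"
    unfolding vip_def ip_def using assms by (intro Bochner_Integration.integral_sum l2_mult_integrable vl2D)
  finally show ?thesis .
qed

lemma vip_self_nonneg [simp]: "0 \<le> vip M G G"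
  by (simp add: vip_def sum_nonneg)

lemma vip_commute: "vip M G H = vip M H G"
  unfolding vip_def by (intro sum.cong refl ip_commute)

lemma vip_self_diff: "G \<in> vl2 M \<Longrightarrow> H \<in> vl2 M \<Longrightarrow>
    vip M (\<lambda>x. G x - H x) (\<lambda>x. G x - H x) = vip M G G - 2 * vip M G H + vip M H H"
  unfolding vip_def by (simp add: inner_diff_left ip_self_diff vl2D sum.distrib sum_subtractf sum_distrib_left)

lemma vl2_add: "G \<in> vl2 M \<Longrightarrow> H \<in> vl2 M \<Longrightarrow> (\<lambda>x. G x + H x) \<in> vl2 M"
  by (simp add: vl2_def inner_add_left l2_add)

lemma vl2_scale: "G \<in> vl2 M \<Longrightarrow> (\<lambda>x. c *\<^sub>R G x) \<in> vl2 M"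
  by (simp add: vl2_def l2_scale)

lemma vip_add_left: "G \<in> vl2 M \<Longrightarrow> H \<in> vl2 M \<Longrightarrow> K \<in> vl2 M \<Longrightarrow>
    vip M (\<lambda>x. G x + H x) K = vip M G K + vip M H K"
  unfolding vip_def by (simp add: inner_add_left ip_add_left vl2D sum.distrib)

lemma vip_scale_left: "vip M (\<lambda>x. c *\<^sub>R G x) K = c * vip M G K"
  unfolding vip_def by (simp add: ip_scale_left sum_distrib_left)

lemma classical_gradient_inner: "b \<in> Basis \<Longrightarrow> classical_gradient f x \<bullet> b = frechet_derivative f (at x) b"
  by (simp add: classical_gradient_def)

lemma test_functions_l2_on: "open \<Omega> \<Longrightarrow> \<psi> \<in> test_functions U \<Longrightarrow> (\<psi> :: 'a::euclidean_space \<Rightarrow> real) \<in> l2 (lebesgue_on \<Omega>)"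
  by (intro l2_lebesgue_on_borel test_functions_l2)

lemma test_gradient_vl2:
  assumes "open \<Omega>" "\<psi> \<in> test_functions U"
  shows "classical_gradient (\<psi> :: 'a::euclidean_space \<Rightarrow> real) \<in> vl2 (lebesgue_on \<Omega>)"
  unfolding vl2_def using assms
  by (auto simp: classical_gradient_inner intro!: test_functions_l2_on[OF assms(1)] test_functions_partial[OF assms(2)])

text \<open>\<open>H1_0\<close> hides the gradient and measures convergence by one integral. Here
  the gradient is an explicit argument and the convergence is split into scalar L2 limits.\<close>

definition h10 :: "'a::euclidean_space set \<Rightarrow> ('a \<Rightarrow> real) \<Rightarrow> ('a \<Rightarrow> 'a) \<Rightarrow> bool" where
  "h10 \<Omega> u G \<longleftrightarrow> weak_gradient \<Omega> u G \<and> (\<exists>\<psi>. (\<forall>k::nat. \<psi> k \<in> test_functions \<Omega>) \<and>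
     (\<lambda>k. nrm (lebesgue_on \<Omega>) (\<lambda>x. \<psi> k x - u x)) \<longlonglongrightarrow> 0 \<and>
     (\<forall>b\<in>Basis. (\<lambda>k. nrm (lebesgue_on \<Omega>) (\<lambda>x. frechet_derivative (\<psi> k) (at x) b - G x \<bullet> b)) \<longlonglongrightarrow> 0))"

lemma weak_gradient_l2: "weak_gradient \<Omega> u G \<Longrightarrow> u \<in> l2 (lebesgue_on \<Omega>) \<and> G \<in> vl2 (lebesgue_on \<Omega>)"
  by (simp add: weak_gradient_def L2_on_eq_l2 L2_on_eq_vl2)

lemma h10_l2: "h10 \<Omega> u G \<Longrightarrow> u \<in> l2 (lebesgue_on \<Omega>)" and h10_vl2: "h10 \<Omega> u G \<Longrightarrow> G \<in> vl2 (lebesgue_on \<Omega>)"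
  unfolding h10_def using weak_gradient_l2 by blast+

lemma H1_distance:
  fixes u :: "'a::euclidean_space \<Rightarrow> real"
  assumes O: "open \<Omega>" and \<psi>: "\<psi> \<in> test_functions \<Omega>" and u: "u \<in> l2 (lebesgue_on \<Omega>)" and G: "G \<in> vl2 (lebesgue_on \<Omega>)"
  shows "(LINT x|lebesgue_on \<Omega>. (\<psi> x - u x)\<^sup>2 + (norm (classical_gradient \<psi> x - G x))\<^sup>2) =
    ip (lebesgue_on \<Omega>) (\<lambda>x. \<psi> x - u x) (\<lambda>x. \<psi> x - u x) +
    (\<Sum>b\<in>Basis. ip (lebesgue_on \<Omega>) (\<lambda>x. frechet_derivative \<psi> (at x) b - G x \<bullet> b) (\<lambda>x. frechet_derivative \<psi> (at x) b - G x \<bullet> b))"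
proof -
  have l: "(\<lambda>x. \<psi> x - u x) \<in> l2 (lebesgue_on \<Omega>)" by (intro l2_diff test_functions_l2_on[OF O \<psi>] u)
  have lb: "(\<lambda>x. frechet_derivative \<psi> (at x) b - G x \<bullet> b) \<in> l2 (lebesgue_on \<Omega>)" if "b \<in> Basis" for b
    by (intro l2_diff test_functions_l2_on[OF O test_functions_partial[OF \<psi> that]] vl2D[OF G that])
  have "(norm (classical_gradient \<psi> x - G x))\<^sup>2 =
    (\<Sum>b\<in>Basis. (frechet_derivative \<psi> (at x) b - G x \<bullet> b) * (frechet_derivative \<psi> (at x) b - G x \<bullet> b))" for x
    unfolding norm_square_components by (intro sum.cong refl) (simp add: inner_diff_left classical_gradient_inner)
  then have "(LINT x|lebesgue_on \<Omega>. (\<psi> x - u x)\<^sup>2 + (norm (classical_gradient \<psi> x - G x))\<^sup>2) =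
    (LINT x|lebesgue_on \<Omega>. (\<psi> x - u x) * (\<psi> x - u x) + (\<Sum>b\<in>Basis. (frechet_derivative \<psi> (at x) b - G x \<bullet> b) * (frechet_derivative \<psi> (at x) b - G x \<bullet> b)))"
    by (simp only: power2_eq_square[of "\<psi> _ - u _"])
  also have "\<dots> = (LINT x|lebesgue_on \<Omega>. (\<psi> x - u x) * (\<psi> x - u x)) +
    (LINT x|lebesgue_on \<Omega>. (\<Sum>b\<in>Basis. (frechet_derivative \<psi> (at x) b - G x \<bullet> b) * (frechet_derivative \<psi> (at x) b - G x \<bullet> b)))"
    by (intro Bochner_Integration.integral_add l2_mult_integrable l Bochner_Integration.integrable_sum lb)
  also have "(LINT x|lebesgue_on \<Omega>. (\<Sum>b\<in>Basis. (frechet_derivative \<psi> (at x) b - G x \<bullet> b) * (frechet_derivative \<psi> (at x) b - G x \<bullet> b)))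
    = (\<Sum>b\<in>Basis. ip (lebesgue_on \<Omega>) (\<lambda>x. frechet_derivative \<psi> (at x) b - G x \<bullet> b) (\<lambda>x. frechet_derivative \<psi> (at x) b - G x \<bullet> b))"
    unfolding ip_def by (intro Bochner_Integration.integral_sum l2_mult_integrable lb)
  finally show ?thesis by (simp add: ip_def)
qed

text \<open>The integral in \<open>H1_0\<close> is a finite sum of squared norms, and a sum of
  nonnegative terms tends to 0 exactly when each of them does.\<close>

lemma H1_0_iff_h10:
  assumes O: "open \<Omega>"
  shows "u \<in> H1_0 \<Omega> \<longleftrightarrow> (\<exists>G. h10 \<Omega> u G)"
proof -
  let ?M = "lebesgue_on \<Omega>"
  have iff: "(\<lambda>k. LINT x|?M. (\<psi> k x - u x)\<^sup>2 + (norm (classical_gradient (\<psi> k) x - G x))\<^sup>2) \<longlonglongrightarrow> 0 \<longleftrightarrow>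
     (\<lambda>k. nrm ?M (\<lambda>x. \<psi> k x - u x)) \<longlonglongrightarrow> 0 \<and>
     (\<forall>b\<in>Basis. (\<lambda>k. nrm ?M (\<lambda>x. frechet_derivative (\<psi> k) (at x) b - G x \<bullet> b)) \<longlonglongrightarrow> 0)"
    if w: "weak_gradient \<Omega> u G" and \<psi>: "\<And>k::nat. \<psi> k \<in> test_functions \<Omega>" for G \<psi>
  proof -
    note uG = weak_gradient_l2[OF w]
    let ?A = "\<lambda>k. ip ?M (\<lambda>x. \<psi> k x - u x) (\<lambda>x. \<psi> k x - u x)"
    let ?B = "\<lambda>b k. ip ?M (\<lambda>x. frechet_derivative (\<psi> k) (at x) b - G x \<bullet> b) (\<lambda>x. frechet_derivative (\<psi> k) (at x) b - G x \<bullet> b)"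
    have "(\<lambda>k. ?A k + (\<Sum>b\<in>Basis. ?B b k)) \<longlonglongrightarrow> 0 \<longleftrightarrow> ?A \<longlonglongrightarrow> 0 \<and> (\<forall>b\<in>Basis. ?B b \<longlonglongrightarrow> 0)"
    proof (intro iffI conjI ballI)
      assume *: "(\<lambda>k. ?A k + (\<Sum>b\<in>Basis. ?B b k)) \<longlonglongrightarrow> 0"
      have s0: "0 \<le> (\<Sum>b\<in>Basis. ?B b k)" for k by (intro sum_nonneg) simp
      show "?A \<longlonglongrightarrow> 0"
        by (rule tendsto_sandwich[OF _ _ tendsto_const *]) (use s0 in auto)
      fix b :: 'a assume b: "b \<in> Basis"
      have "?B b k \<le> ?A k + (\<Sum>b\<in>Basis. ?B b k)" for k
      proof -
        have "?B b k \<le> (\<Sum>b\<in>Basis. ?B b k)" by (rule member_le_sum[OF b]) auto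
        moreover have "0 \<le> ?A k" by simp
        ultimately show ?thesis by linarith
      qed
      then show "?B b \<longlonglongrightarrow> 0"
        by (intro tendsto_sandwich[OF _ _ tendsto_const *]) auto
    next
      assume *: "?A \<longlonglongrightarrow> 0 \<and> (\<forall>b\<in>Basis. ?B b \<longlonglongrightarrow> 0)"
      have "(\<lambda>k. ?A k + (\<Sum>b\<in>Basis. ?B b k)) \<longlonglongrightarrow> 0 + (\<Sum>b\<in>(Basis::'a set). 0)"
        using * by (intro tendsto_add tendsto_sum) auto
      then show "(\<lambda>k. ?A k + (\<Sum>b\<in>Basis. ?B b k)) \<longlonglongrightarrow> 0" by simp
    qed
    then show ?thesis unfolding nrm_tendsto_0_iff using H1_distance[OF O \<psi> conjunct1[OF uG] conjunct2[OF uG]] by presburger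
  qed
  show ?thesis
  proof
    assume "u \<in> H1_0 \<Omega>"
    then obtain G \<psi> where *: "weak_gradient \<Omega> u G" "\<And>k::nat. \<psi> k \<in> test_functions \<Omega>"
      "(\<lambda>k. LINT x|?M. (\<psi> k x - u x)\<^sup>2 + (norm (classical_gradient (\<psi> k) x - G x))\<^sup>2) \<longlonglongrightarrow> 0"
      unfolding H1_0_def mem_Collect_eq by (elim exE conjE) blast
    have "h10 \<Omega> u G" unfolding h10_def
      by (intro conjI *(1) exI[of _ \<psi>] allI *(2)) (use iff[OF *(1,2)] *(3) in auto)
    then show "\<exists>G. h10 \<Omega> u G" by (rule exI[of _ G])
  next
    assume "\<exists>G. h10 \<Omega> u G"
    then obtain G \<psi> where *: "weak_gradient \<Omega> u G" "\<And>k::nat. \<psi> k \<in> test_functions \<Omega>"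
      "(\<lambda>k. nrm ?M (\<lambda>x. \<psi> k x - u x)) \<longlonglongrightarrow> 0 \<and>
       (\<forall>b\<in>Basis. (\<lambda>k. nrm ?M (\<lambda>x. frechet_derivative (\<psi> k) (at x) b - G x \<bullet> b)) \<longlonglongrightarrow> 0)"
      unfolding h10_def by blast
    show "u \<in> H1_0 \<Omega>" unfolding H1_0_def mem_Collect_eq
      by (intro exI[of _ G] conjI *(1) exI[of _ \<psi>] allI *(2)) (use iff[OF *(1,2)] *(3) in auto)
  qed
qed

lemma weak_gradient_add:
  assumes O: "open \<Omega>" and u: "weak_gradient \<Omega> u G" and v: "weak_gradient \<Omega> v H"
  shows "weak_gradient \<Omega> (\<lambda>x. u x + v x) (\<lambda>x. G x + H x)"
  unfolding weak_gradient_def L2_on_eq_l2 L2_on_eq_vl2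
proof (intro conjI ballI)
  note ul = weak_gradient_l2[OF u] weak_gradient_l2[OF v]
  show "(\<lambda>x. u x + v x) \<in> l2 (lebesgue_on \<Omega>)" "(\<lambda>x. G x + H x) \<in> vl2 (lebesgue_on \<Omega>)"
    using ul by (auto intro: l2_add vl2_add)
  fix \<psi> :: "'a \<Rightarrow> real" and b :: 'a assume \<psi>: "\<psi> \<in> test_functions \<Omega>" and b: "b \<in> Basis"
  note t = test_functions_l2_on[OF O \<psi>] test_functions_l2_on[OF O test_functions_partial[OF \<psi> b]]
  have e: "ip (lebesgue_on \<Omega>) u (\<lambda>x. frechet_derivative \<psi> (at x) b) = - ip (lebesgue_on \<Omega>) (\<lambda>x. G x \<bullet> b) \<psi>"
    "ip (lebesgue_on \<Omega>) v (\<lambda>x. frechet_derivative \<psi> (at x) b) = - ip (lebesgue_on \<Omega>) (\<lambda>x. H x \<bullet> b) \<psi>"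
    using u v \<psi> b unfolding weak_gradient_def ip_def by blast+
  have "ip (lebesgue_on \<Omega>) (\<lambda>x. u x + v x) (\<lambda>x. frechet_derivative \<psi> (at x) b) = - ip (lebesgue_on \<Omega>) (\<lambda>x. G x \<bullet> b + H x \<bullet> b) \<psi>"
    using ul t b e by (simp add: ip_add_left vl2D)
  then show "(LINT x|lebesgue_on \<Omega>. (u x + v x) * frechet_derivative \<psi> (at x) b) = - (LINT x|lebesgue_on \<Omega>. ((G x + H x) \<bullet> b) * \<psi> x)"
    by (simp add: ip_def inner_add_left)
qed

lemma weak_gradient_scale:
  assumes u: "weak_gradient \<Omega> u G"
  shows "weak_gradient \<Omega> (\<lambda>x. c * u x) (\<lambda>x. c *\<^sub>R G x)"
  unfolding weak_gradient_def L2_on_eq_l2 L2_on_eq_vl2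
proof (intro conjI ballI)
  note ul = weak_gradient_l2[OF u]
  show "(\<lambda>x. c * u x) \<in> l2 (lebesgue_on \<Omega>)" "(\<lambda>x. c *\<^sub>R G x) \<in> vl2 (lebesgue_on \<Omega>)"
    using ul by (auto intro: l2_scale vl2_scale)
  fix \<psi> :: "'a \<Rightarrow> real" and b :: 'a assume \<psi>: "\<psi> \<in> test_functions \<Omega>" and b: "b \<in> Basis"
  have "ip (lebesgue_on \<Omega>) u (\<lambda>x. frechet_derivative \<psi> (at x) b) = - ip (lebesgue_on \<Omega>) (\<lambda>x. G x \<bullet> b) \<psi>"
    using u \<psi> b unfolding weak_gradient_def ip_def by blast
  then have "ip (lebesgue_on \<Omega>) (\<lambda>x. c * u x) (\<lambda>x. frechet_derivative \<psi> (at x) b) = - ip (lebesgue_on \<Omega>) (\<lambda>x. c * (G x \<bullet> b)) \<psi>"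
    by (simp add: ip_scale_left)
  then show "(LINT x|lebesgue_on \<Omega>. (c * u x) * frechet_derivative \<psi> (at x) b) = - (LINT x|lebesgue_on \<Omega>. ((c *\<^sub>R G x) \<bullet> b) * \<psi> x)"
    by (simp add: ip_def)
qed

lemma nrm_add_tendsto_0:
  assumes "\<And>k. u k \<in> l2 M" "\<And>k. v k \<in> l2 M" "(\<lambda>k. nrm M (u k)) \<longlonglongrightarrow> 0" "(\<lambda>k. nrm M (v k)) \<longlonglongrightarrow> 0"
  shows "(\<lambda>k. nrm M (\<lambda>x. u k x + v k x)) \<longlonglongrightarrow> 0"
proof (rule tendsto_sandwich[OF _ _ tendsto_const tendsto_add_zero[OF assms(3,4)]])
  show "\<forall>\<^sub>F k in sequentially. nrm M (\<lambda>x. u k x + v k x) \<le> nrm M (u k) + nrm M (v k)"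
    by (intro always_eventually allI nrm_triangle assms)
qed (intro always_eventually allI nrm_nonneg)

lemma h10_add:
  assumes O: "open \<Omega>" and u: "h10 \<Omega> u G" and v: "h10 \<Omega> v H"
  shows "h10 \<Omega> (\<lambda>x. u x + v x) (\<lambda>x. G x + H x)"
proof -
  let ?M = "lebesgue_on \<Omega>"
  obtain \<psi> where \<psi>: "\<And>k. \<psi> k \<in> test_functions \<Omega>" "(\<lambda>k. nrm ?M (\<lambda>x. \<psi> k x - u x)) \<longlonglongrightarrow> 0"
    "\<And>b. b \<in> Basis \<Longrightarrow> (\<lambda>k. nrm ?M (\<lambda>x. frechet_derivative (\<psi> k) (at x) b - G x \<bullet> b)) \<longlonglongrightarrow> 0"
    using u unfolding h10_def by blast
  obtain \<eta> where \<eta>: "\<And>k. \<eta> k \<in> test_functions \<Omega>" "(\<lambda>k. nrm ?M (\<lambda>x. \<eta> k x - v x)) \<longlonglongrightarrow> 0"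
    "\<And>b. b \<in> Basis \<Longrightarrow> (\<lambda>k. nrm ?M (\<lambda>x. frechet_derivative (\<eta> k) (at x) b - H x \<bullet> b)) \<longlonglongrightarrow> 0"
    using v unfolding h10_def by blast
  note l = h10_l2[OF u] h10_l2[OF v]
  have a: "(\<lambda>k. nrm ?M (\<lambda>x. (\<psi> k x + \<eta> k x) - (u x + v x))) \<longlonglongrightarrow> 0"
    using nrm_add_tendsto_0[OF _ _ \<psi>(2) \<eta>(2)] l2_diff[OF test_functions_l2_on[OF O \<psi>(1)] l(1)] l2_diff[OF test_functions_l2_on[OF O \<eta>(1)] l(2)]
    by (simp add: add_diff_add)
  have bb: "(\<lambda>k. nrm ?M (\<lambda>x. frechet_derivative (\<lambda>x. \<psi> k x + \<eta> k x) (at x) b - (G x + H x) \<bullet> b)) \<longlonglongrightarrow> 0" if b: "b \<in> Basis" for b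
    using nrm_add_tendsto_0[OF _ _ \<psi>(3)[OF b] \<eta>(3)[OF b]]
      l2_diff[OF test_functions_l2_on[OF O test_functions_partial[OF \<psi>(1) b]] vl2D[OF h10_vl2[OF u] b]]
      l2_diff[OF test_functions_l2_on[OF O test_functions_partial[OF \<eta>(1) b]] vl2D[OF h10_vl2[OF v] b]]
    by (simp add: add_diff_add C_infinity_partial_add test_functions_C_infinity[OF \<psi>(1)] test_functions_C_infinity[OF \<eta>(1)] inner_add_left)
  have "weak_gradient \<Omega> (\<lambda>x. u x + v x) (\<lambda>x. G x + H x)"
    using u v unfolding h10_def by (blast intro: weak_gradient_add[OF O])
  then show ?thesis unfolding h10_def
    using a bb by (intro conjI exI[of _ "\<lambda>k x. \<psi> k x + \<eta> k x"] allI ballI test_functions_add \<psi>(1) \<eta>(1)) auto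
qed

lemma h10_scale:
  assumes u: "h10 \<Omega> u G"
  shows "h10 \<Omega> (\<lambda>x. c * u x) (\<lambda>x. c *\<^sub>R G x)"
proof -
  let ?M = "lebesgue_on \<Omega>"
  obtain \<psi> where \<psi>: "\<And>k. \<psi> k \<in> test_functions \<Omega>" "(\<lambda>k. nrm ?M (\<lambda>x. \<psi> k x - u x)) \<longlonglongrightarrow> 0"
    "\<And>b. b \<in> Basis \<Longrightarrow> (\<lambda>k. nrm ?M (\<lambda>x. frechet_derivative (\<psi> k) (at x) b - G x \<bullet> b)) \<longlonglongrightarrow> 0"
    using u unfolding h10_def by blast
  have a: "(\<lambda>k. nrm ?M (\<lambda>x. c * \<psi> k x - c * u x)) \<longlonglongrightarrow> 0"
    using tendsto_mult_right_zero[OF \<psi>(2), of "\<bar>c\<bar>"] by (simp add: nrm_scale[symmetric] right_diff_distrib)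
  have bb: "(\<lambda>k. nrm ?M (\<lambda>x. frechet_derivative (\<lambda>x. c * \<psi> k x) (at x) b - (c *\<^sub>R G x) \<bullet> b)) \<longlonglongrightarrow> 0" if b: "b \<in> Basis" for b
    using tendsto_mult_right_zero[OF \<psi>(3)[OF b], of "\<bar>c\<bar>"]
    by (simp add: nrm_scale[symmetric] right_diff_distrib C_infinity_partial_scale[OF test_functions_C_infinity[OF \<psi>(1)]])
  have "weak_gradient \<Omega> (\<lambda>x. c * u x) (\<lambda>x. c *\<^sub>R G x)"
    using u unfolding h10_def by (blast intro: weak_gradient_scale)
  then show ?thesis unfolding h10_def
    using a bb by (intro conjI exI[of _ "\<lambda>k x. c * \<psi> k x"] allI ballI test_functions_scale \<psi>(1)) auto
qed

lemma h10_test_function: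
  assumes O: "open \<Omega>" and \<psi>: "\<psi> \<in> test_functions \<Omega>"
  shows "h10 \<Omega> \<psi> (classical_gradient \<psi>)"
  unfolding h10_def weak_gradient_def L2_on_eq_l2 L2_on_eq_vl2
proof (intro conjI ballI exI[of _ "\<lambda>_. \<psi>"] allI)
  show "\<psi> \<in> l2 (lebesgue_on \<Omega>)" by (rule test_functions_l2_on[OF O \<psi>])
  show "classical_gradient \<psi> \<in> vl2 (lebesgue_on \<Omega>)" by (rule test_gradient_vl2[OF O \<psi>])
  show "\<psi> \<in> test_functions \<Omega>" by (rule \<psi>)
  show "(\<lambda>k. nrm (lebesgue_on \<Omega>) (\<lambda>x. \<psi> x - \<psi> x)) \<longlonglongrightarrow> 0" by (simp add: nrm_def)
  show "(\<lambda>k. nrm (lebesgue_on \<Omega>) (\<lambda>x. frechet_derivative \<psi> (at x) b - classical_gradient \<psi> x \<bullet> b)) \<longlonglongrightarrow> 0"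
    if "b \<in> Basis" for b using that by (simp add: nrm_def classical_gradient_inner)
  fix \<eta> :: "'a \<Rightarrow> real" and b :: 'a assume \<eta>: "\<eta> \<in> test_functions \<Omega>" and b: "b \<in> Basis"
  have m: "\<psi> \<in> borel_measurable borel" "\<eta> \<in> borel_measurable borel"
    "(\<lambda>x. frechet_derivative \<psi> (at x) b) \<in> borel_measurable borel" "(\<lambda>x. frechet_derivative \<eta> (at x) b) \<in> borel_measurable borel"
    using \<psi> \<eta> test_functions_partial[OF \<psi> b] test_functions_partial[OF \<eta> b] by (auto intro: test_functions_borel)
  have "(LINT x|lebesgue_on \<Omega>. \<psi> x * frechet_derivative \<eta> (at x) b) = ip lborel \<psi> (\<lambda>x. frechet_derivative \<eta> (at x) b)"
    using ip_lebesgue_on_borel[OF O m(1,4)] test_functions_outside[OF \<psi>] by (simp add: ip_def)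
  also have "\<dots> = - ip lborel (\<lambda>x. frechet_derivative \<psi> (at x) b) \<eta>"
    unfolding ip_def by (rule integral_by_parts_test_function[OF \<psi> test_functions_C_infinity[OF \<eta>] b])
  also have "\<dots> = - (LINT x|lebesgue_on \<Omega>. (classical_gradient \<psi> x \<bullet> b) * \<eta> x)"
    using ip_lebesgue_on_borel[OF O m(3,2)] test_functions_outside[OF test_functions_partial[OF \<psi> b]]
    by (simp add: ip_def classical_gradient_inner[OF b])
  finally show "(LINT x|lebesgue_on \<Omega>. \<psi> x * frechet_derivative \<eta> (at x) b) = - (LINT x|lebesgue_on \<Omega>. (classical_gradient \<psi> x \<bullet> b) * \<eta> x)" .
qed

section \<open>Eigenfunction expansions and the Dirichlet form\<close>

locale dirichlet_system =
  fixes \<Omega> :: "'a::euclidean_space set" and \<Lambda> :: "nat \<Rightarrow> real" and \<phi> :: "nat \<Rightarrow> 'a \<Rightarrow> real"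
  assumes open_domain: "open \<Omega>" and bounded_domain: "bounded \<Omega>"
    and eigensystem: "dirichlet_eigensystem \<Omega> \<Lambda> \<phi>"
begin

abbreviation M :: "'a measure" where "M \<equiv> lebesgue_on \<Omega>"

lemma eigenfunction_h10: "\<exists>G. h10 \<Omega> (\<phi> j) G"
  using eigensystem unfolding dirichlet_eigensystem_def dirichlet_eigen_def
  by (simp add: H1_0_iff_h10[OF open_domain])

sublocale complete_orthonormal M \<phi>
proof
  show "\<phi> j \<in> l2 M" for j using eigenfunction_h10 h10_l2 by blast
  show "ip M (\<phi> i) (\<phi> j) = (if i = j then 1 else 0)" for i j
    using eigensystem unfolding dirichlet_eigensystem_def L2_inner_eq_ip by blast
  show "AE x in M. v x = 0" if "v \<in> l2 M" "\<And>j. ip M v (\<phi> j) = 0" for v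
    using eigensystem that unfolding dirichlet_eigensystem_def L2_inner_eq_ip L2_on_eq_l2 by blast
qed

text \<open>One fixed choice of gradient for each eigenfunction, as gradients are determined only
  almost everywhere.\<close>

definition \<Phi> :: "nat \<Rightarrow> 'a \<Rightarrow> 'a" where "\<Phi> j = (SOME G. h10 \<Omega> (\<phi> j) G)"

lemma \<Phi>: "h10 \<Omega> (\<phi> j) (\<Phi> j)"
  unfolding \<Phi>_def by (rule someI_ex[OF eigenfunction_h10])

lemma eigen_identity:
  assumes "h10 \<Omega> v H"
  shows "vip M (\<Phi> j) H = \<Lambda> j * coef v j"
proof -
  have "dirichlet_eigen \<Omega> (\<Lambda> j) (\<phi> j)" using eigensystem unfolding dirichlet_eigensystem_def by blast
  moreover have "v \<in> H1_0 \<Omega>" unfolding H1_0_iff_h10[OF open_domain] using assms by (rule exI[of _ H])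
  moreover have "weak_gradient \<Omega> (\<phi> j) (\<Phi> j)" using \<Phi> unfolding h10_def by blast
  moreover have "weak_gradient \<Omega> v H" using assms unfolding h10_def by blast
  ultimately have "(LINT x|M. \<Phi> j x \<bullet> H x) = \<Lambda> j * L2_inner \<Omega> (\<phi> j) v"
    unfolding dirichlet_eigen_def by blast
  then show ?thesis
    using vip_eq_integral[OF h10_vl2[OF \<Phi>] h10_vl2[OF assms]] by (simp add: L2_inner_eq_ip ip_commute[of M "\<phi> j" v])
qed

text \<open>Tested against itself, a normalized eigenfunction has Dirichlet energy equal to its
  eigenvalue.\<close>

lemma eigenvalue_nonneg: "0 \<le> \<Lambda> j"
  using eigen_identity[OF \<Phi>, of j j] vip_self_nonneg[of M "\<Phi> j"] by (simp add: orthonormal)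

definition gpsum :: "(nat \<Rightarrow> real) \<Rightarrow> nat \<Rightarrow> 'a \<Rightarrow> 'a" where
  "gpsum c n x = (\<Sum>j<n. c j *\<^sub>R \<Phi> j x)"

lemma gpsum_h10: "h10 \<Omega> (psum c n) (gpsum c n)"
proof (induction n)
  case 0
  have "h10 \<Omega> (\<lambda>x. 0) (classical_gradient (\<lambda>x. 0))"
    by (rule h10_test_function[OF open_domain]) simp
  moreover have "classical_gradient (\<lambda>x. 0::real) = (\<lambda>x::'a. 0)"
    unfolding classical_gradient_def by simp
  ultimately show ?case by (simp add: psum_def[abs_def] gpsum_def[abs_def])
next
  case (Suc n)
  from h10_add[OF open_domain Suc h10_scale[OF \<Phi>, of "c n" n]]
  show ?case by (simp add: psum_def[abs_def] gpsum_def[abs_def])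
qed

lemma vip_gpsum: "h10 \<Omega> v H \<Longrightarrow> vip M (gpsum c n) H = (\<Sum>j<n. c j * (\<Lambda> j * coef v j))"
proof (induction n)
  case 0
  then show ?case by (simp add: gpsum_def[abs_def] vip_def)
next
  case (Suc n)
  have "gpsum c (Suc n) = (\<lambda>x. gpsum c n x + c n *\<^sub>R \<Phi> n x)" by (simp add: gpsum_def[abs_def])
  then show ?case
    using Suc eigen_identity[OF Suc.prems] h10_vl2[OF gpsum_h10] h10_vl2[OF \<Phi>] h10_vl2[OF Suc.prems]
    by (simp add: vip_add_left vl2_scale vip_scale_left)
qed

text \<open>Bessel's inequality for the gradients: the cross term and the energy of the partial sum
  are both equal to the sum on the left.\<close>

lemma energy_bessel:
  assumes v: "h10 \<Omega> v H"
  shows "(\<Sum>j<n. \<Lambda> j * (coef v j)\<^sup>2) \<le> vip M H H"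
proof -
  let ?G = "gpsum (coef v) n"
  have "0 \<le> vip M (\<lambda>x. H x - ?G x) (\<lambda>x. H x - ?G x)" by simp
  also have "\<dots> = vip M H H - 2 * vip M H ?G + vip M ?G ?G"
    by (rule vip_self_diff[OF h10_vl2[OF v] h10_vl2[OF gpsum_h10]])
  also have "vip M H ?G = (\<Sum>j<n. \<Lambda> j * (coef v j)\<^sup>2)"
    by (subst vip_commute, subst vip_gpsum[OF v]) (simp add: power2_eq_square mult_ac)
  also have "vip M ?G ?G = (\<Sum>j<n. \<Lambda> j * (coef v j)\<^sup>2)"
    by (subst vip_gpsum[OF gpsum_h10], intro sum.cong refl) (simp add: coef_psum power2_eq_square)
  finally show ?thesis by simp
qed

lemma gpsum_diff_square:
  assumes "n \<le> m"
  shows "vip M (\<lambda>x. gpsum c m x - gpsum c n x) (\<lambda>x. gpsum c m x - gpsum c n x) = (\<Sum>j\<in>{n..<m}. \<Lambda> j * (c j)\<^sup>2)"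
proof -
  have sq: "vip M (gpsum c k) (gpsum c l) = (\<Sum>j<k. \<Lambda> j * (c j)\<^sup>2)" if "k \<le> l" for k l
    by (subst vip_gpsum[OF gpsum_h10], intro sum.cong refl) (use that in \<open>auto simp: coef_psum power2_eq_square\<close>)
  have "vip M (\<lambda>x. gpsum c m x - gpsum c n x) (\<lambda>x. gpsum c m x - gpsum c n x) =
    (\<Sum>j<m. \<Lambda> j * (c j)\<^sup>2) - (\<Sum>j<n. \<Lambda> j * (c j)\<^sup>2)"
    using sq[OF assms] sq[of m m] sq[of n n]
    by (simp add: vip_self_diff h10_vl2[OF gpsum_h10] vip_commute[of M "gpsum c m" "gpsum c n"])
  also have "\<dots> = (\<Sum>j\<in>{n..<m}. \<Lambda> j * (c j)\<^sup>2)"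
    using sum_diff_nat_ivl[of 0 n m "\<lambda>j. \<Lambda> j * (c j)\<^sup>2"] assms by (simp add: atLeast0LessThan)
  finally show ?thesis .
qed

lemma nrm_component_le_vip: "b \<in> Basis \<Longrightarrow> ip M (\<lambda>x. G x \<bullet> b) (\<lambda>x. G x \<bullet> b) \<le> vip M G G" for G :: "'a \<Rightarrow> 'a"
  unfolding vip_def by (rule member_le_sum[of b Basis "\<lambda>b. ip M (\<lambda>x. G x \<bullet> b) (\<lambda>x. G x \<bullet> b)"]) auto

text \<open>The converse of \<open>energy_bessel\<close>: finite spectral energy puts u into the
  form domain. The gradients of the partial sums are Cauchy by \<open>gpsum_diff_square\<close>, and
  their limit is a weak gradient because the defining identity passes to L2 limits.\<close>

lemma energy_gradient:
  assumes u: "u \<in> l2 M" and s: "summable (\<lambda>j. \<Lambda> j * (coef u j)\<^sup>2)"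
  shows "\<exists>G. h10 \<Omega> u G \<and> (\<forall>v H. h10 \<Omega> v H \<longrightarrow> (\<lambda>j. \<Lambda> j * coef u j * coef v j) sums vip M G H)"
proof -
  let ?c = "coef u"
  let ?G = "\<lambda>n. gpsum ?c n"
  note O = open_domain
  note Gl = vl2D[OF h10_vl2[OF gpsum_h10]]
  have "\<exists>g \<in> l2 M. (\<lambda>n. nrm M (\<lambda>x. ?G n x \<bullet> b - g x)) \<longlonglongrightarrow> 0" if b: "b \<in> Basis" for b
  proof (rule l2_convergent_if_summable_bound[OF Gl[OF b] s])
    fix m n :: nat assume "n \<le> m"
    then show "ip M (\<lambda>x. ?G m x \<bullet> b - ?G n x \<bullet> b) (\<lambda>x. ?G m x \<bullet> b - ?G n x \<bullet> b) \<le> (\<Sum>j\<in>{n..<m}. \<Lambda> j * (?c j)\<^sup>2)"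
      using nrm_component_le_vip[OF b, of "\<lambda>x. ?G m x - ?G n x"] by (simp add: gpsum_diff_square inner_diff_left)
  qed
  then have "\<forall>b\<in>Basis. \<exists>g. g \<in> l2 M \<and> (\<lambda>n. nrm M (\<lambda>x. ?G n x \<bullet> b - g x)) \<longlonglongrightarrow> 0" by blast
  from bchoice[OF this] obtain g where
    "\<forall>b\<in>Basis. g b \<in> l2 M \<and> (\<lambda>n. nrm M (\<lambda>x. ?G n x \<bullet> b - g b x)) \<longlonglongrightarrow> 0" by blast
  then have g: "\<And>b. b \<in> Basis \<Longrightarrow> g b \<in> l2 M"
    "\<And>b. b \<in> Basis \<Longrightarrow> (\<lambda>n. nrm M (\<lambda>x. ?G n x \<bullet> b - g b x)) \<longlonglongrightarrow> 0"
    by blast+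
  define G where "G x = (\<Sum>b\<in>Basis. g b x *\<^sub>R b)" for x
  have Gb: "(\<lambda>x. G x \<bullet> b) = g b" if "b \<in> Basis" for b unfolding G_def using that by simp
  have Gv: "G \<in> vl2 M" using g(1) by (simp add: vl2_def Gb)
  have limu: "(\<lambda>n. nrm M (\<lambda>x. psum ?c n x - u x)) \<longlonglongrightarrow> 0" by (rule psum_coef_tendsto[OF u])
  have wg: "weak_gradient \<Omega> u G"
    unfolding weak_gradient_def L2_on_eq_l2 L2_on_eq_vl2
  proof (intro conjI u Gv ballI)
    fix \<psi> :: "'a \<Rightarrow> real" and b :: 'a assume \<psi>: "\<psi> \<in> test_functions \<Omega>" and b: "b \<in> Basis"
    let ?d = "\<lambda>x. frechet_derivative \<psi> (at x) b"
    note t = test_functions_l2_on[OF O \<psi>] test_functions_l2_on[OF O test_functions_partial[OF \<psi> b]]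
    have "(\<lambda>n. ip M (psum ?c n) ?d) \<longlonglongrightarrow> ip M u ?d" by (rule ip_tendsto[OF psum_l2 u t(2) limu])
    moreover have "ip M (psum ?c n) ?d = - ip M (\<lambda>x. ?G n x \<bullet> b) \<psi>" for n
    proof -
      have "weak_gradient \<Omega> (psum ?c n) (?G n)" using gpsum_h10 unfolding h10_def by blast
      then show ?thesis unfolding weak_gradient_def ip_def using \<psi> b by blast
    qed
    moreover have "(\<lambda>n. - ip M (\<lambda>x. ?G n x \<bullet> b) \<psi>) \<longlonglongrightarrow> - ip M (g b) \<psi>"
      by (intro tendsto_minus ip_tendsto[OF Gl[OF b] g(1)[OF b] t(1) g(2)[OF b]])
    ultimately have "ip M u ?d = - ip M (g b) \<psi>" using LIMSEQ_unique by auto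
    then show "(LINT x|M. u x * ?d x) = - (LINT x|M. (G x \<bullet> b) * \<psi> x)"
      unfolding ip_def Gb[OF b, symmetric] .
  qed
  define e where "e n = inverse (real (Suc n))" for n
  have e: "e \<longlonglongrightarrow> 0" "e n > 0" for n unfolding e_def by (rule LIMSEQ_inverse_real_of_nat) simp
  \<comment> \<open>A diagonal choice: each partial sum has test functions converging to it in H1,
    and one of them within 1/(n + 1) is selected, so that the selected functions converge to u
    itself.\<close>
  have "\<exists>\<psi>. \<psi> \<in> test_functions \<Omega> \<and> nrm M (\<lambda>x. \<psi> x - psum ?c n x) < e n \<and>
      (\<forall>b\<in>Basis. nrm M (\<lambda>x. frechet_derivative \<psi> (at x) b - ?G n x \<bullet> b) < e n)" for n
  proof -
    obtain \<psi> where \<psi>: "\<And>k. \<psi> k \<in> test_functions \<Omega>" "(\<lambda>k. nrm M (\<lambda>x. \<psi> k x - psum ?c n x)) \<longlonglongrightarrow> 0"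
      "\<And>b. b \<in> Basis \<Longrightarrow> (\<lambda>k. nrm M (\<lambda>x. frechet_derivative (\<psi> k) (at x) b - ?G n x \<bullet> b)) \<longlonglongrightarrow> 0"
      using gpsum_h10[of ?c n] unfolding h10_def by blast
    have "\<forall>\<^sub>F k in sequentially. nrm M (\<lambda>x. \<psi> k x - psum ?c n x) < e n"
      using \<psi>(2) e(2) by (rule order_tendstoD)
    moreover have "\<forall>\<^sub>F k in sequentially. \<forall>b\<in>Basis. nrm M (\<lambda>x. frechet_derivative (\<psi> k) (at x) b - ?G n x \<bullet> b) < e n"
      by (intro eventually_ball_finite ballI finite_Basis order_tendstoD(2)[OF \<psi>(3) e(2)])
    ultimately have "\<forall>\<^sub>F k in sequentially. nrm M (\<lambda>x. \<psi> k x - psum ?c n x) < e n \<and>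
      (\<forall>b\<in>Basis. nrm M (\<lambda>x. frechet_derivative (\<psi> k) (at x) b - ?G n x \<bullet> b) < e n)"
      by (rule eventually_conj)
    from eventually_happens'[OF sequentially_bot this]
    obtain k where k: "nrm M (\<lambda>x. \<psi> k x - psum ?c n x) < e n \<and>
      (\<forall>b\<in>Basis. nrm M (\<lambda>x. frechet_derivative (\<psi> k) (at x) b - ?G n x \<bullet> b) < e n)"
      by (rule exE)
    show ?thesis by (intro exI[of _ "\<psi> k"] conjI \<psi>(1) k[THEN conjunct1] k[THEN conjunct2])
  qed
  then have "\<forall>n. \<exists>\<psi>. \<psi> \<in> test_functions \<Omega> \<and> nrm M (\<lambda>x. \<psi> x - psum ?c n x) < e n \<and>
      (\<forall>b\<in>Basis. nrm M (\<lambda>x. frechet_derivative \<psi> (at x) b - ?G n x \<bullet> b) < e n)" by (rule allI)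
  from choice[OF this] obtain \<psi> where
    "\<forall>n. \<psi> n \<in> test_functions \<Omega> \<and> nrm M (\<lambda>x. \<psi> n x - psum ?c n x) < e n \<and>
      (\<forall>b\<in>Basis. nrm M (\<lambda>x. frechet_derivative (\<psi> n) (at x) b - ?G n x \<bullet> b) < e n)" by (rule exE)
  then have \<psi>: "\<And>n. \<psi> n \<in> test_functions \<Omega>" "\<And>n. nrm M (\<lambda>x. \<psi> n x - psum ?c n x) < e n"
    "\<And>n b. b \<in> Basis \<Longrightarrow> nrm M (\<lambda>x. frechet_derivative (\<psi> n) (at x) b - ?G n x \<bullet> b) < e n"
    by blast+
  have "(\<lambda>n. nrm M (\<lambda>x. \<psi> n x - u x)) \<longlonglongrightarrow> 0"
  proof (rule tendsto_sandwich[OF _ _ tendsto_const tendsto_add_zero[OF e(1) limu]])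
    have "nrm M (\<lambda>x. \<psi> n x - u x) \<le> e n + nrm M (\<lambda>x. psum ?c n x - u x)" for n
      using nrm_triangle_diff[OF test_functions_l2_on[OF O \<psi>(1)] psum_l2 u, of n ?c n] \<psi>(2)[of n] by linarith
    then show "\<forall>\<^sub>F n in sequentially. nrm M (\<lambda>x. \<psi> n x - u x) \<le> e n + nrm M (\<lambda>x. psum ?c n x - u x)" by simp
  qed simp
  moreover have "(\<lambda>n. nrm M (\<lambda>x. frechet_derivative (\<psi> n) (at x) b - G x \<bullet> b)) \<longlonglongrightarrow> 0" if b: "b \<in> Basis" for b
  proof (rule tendsto_sandwich[OF _ _ tendsto_const tendsto_add_zero[OF e(1) g(2)[OF b]]])
    have "nrm M (\<lambda>x. frechet_derivative (\<psi> n) (at x) b - g b x) \<le> e n + nrm M (\<lambda>x. ?G n x \<bullet> b - g b x)" for n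
      using nrm_triangle_diff[OF test_functions_l2_on[OF O test_functions_partial[OF \<psi>(1)[of n] b]] Gl[OF b] g(1)[OF b], of ?c n] \<psi>(3)[OF b, of n]
      by linarith
    then show "\<forall>\<^sub>F n in sequentially. nrm M (\<lambda>x. frechet_derivative (\<psi> n) (at x) b - G x \<bullet> b) \<le> e n + nrm M (\<lambda>x. ?G n x \<bullet> b - g b x)"
      using Gb[OF b] by (simp add: fun_eq_iff)
  qed simp
  ultimately have "h10 \<Omega> u G" unfolding h10_def using wg \<psi>(1) by blast
  moreover have "(\<lambda>j. \<Lambda> j * ?c j * coef v j) sums vip M G H" if v: "h10 \<Omega> v H" for v H
  proof -
    have "(\<lambda>n. vip M (?G n) H) \<longlonglongrightarrow> vip M G H"
      unfolding vip_def
    proof (rule tendsto_sum)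
      fix b :: 'a assume b: "b \<in> Basis"
      show "(\<lambda>n. ip M (\<lambda>x. ?G n x \<bullet> b) (\<lambda>x. H x \<bullet> b)) \<longlonglongrightarrow> ip M (\<lambda>x. G x \<bullet> b) (\<lambda>x. H x \<bullet> b)"
        unfolding Gb[OF b] by (rule ip_tendsto[OF Gl[OF b] g(1)[OF b] vl2D[OF h10_vl2[OF v] b] g(2)[OF b]])
    qed
    then show ?thesis unfolding sums_def vip_gpsum[OF v] by (simp add: mult_ac)
  qed
  ultimately show ?thesis by blast
qed

lemma l2_bounded_function:
  assumes "f \<in> borel_measurable M" "\<And>x. \<bar>f x\<bar> \<le> C"
  shows "f \<in> l2 M"
proof -
  have "emeasure lebesgue \<Omega> < \<infinity>"
    using emeasure_bounded_finite[OF bounded_domain] open_domain by simp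
  then have "emeasure M (space M) < \<infinity>"
    by (simp add: emeasure_restrict_space open_domain)
  then interpret finite_measure M by (intro finite_measureI) auto
  have "(\<lambda>x. C) \<in> l2 M" by (simp add: l2_def)
  then show ?thesis by (rule l2_dominated[OF assms(1)]) (use order_trans[OF assms(2) abs_ge_self] in auto)
qed

text \<open>The contraction property of the Dirichlet form under u -> |u|. It is proved for a
  smoothed modulus of approximating test functions and survives in the limit.\<close>

lemma energy_abs:
  assumes u: "u \<in> l2 M" and s: "summable (\<lambda>j. \<Lambda> j * (coef u j)\<^sup>2)"
  shows "(\<lambda>x. \<bar>u x\<bar>) \<in> l2 M"
    "(\<Sum>j<N. \<Lambda> j * (coef (\<lambda>x. \<bar>u x\<bar>) j)\<^sup>2) \<le> (\<Sum>j. \<Lambda> j * (coef u j)\<^sup>2)"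
proof -
  note O = open_domain
  note [measurable] = l2_measurable[OF u]
  show al: "(\<lambda>x. \<bar>u x\<bar>) \<in> l2 M" by (rule l2_dominated[OF _ u]) auto
  obtain G where G: "h10 \<Omega> u G" "\<And>v H. h10 \<Omega> v H \<Longrightarrow> (\<lambda>j. \<Lambda> j * coef u j * coef v j) sums vip M G H"
    using energy_gradient[OF u s] by blast
  have E: "vip M G G = (\<Sum>j. \<Lambda> j * (coef u j)\<^sup>2)"
    using sums_unique[OF G(2)[OF G(1)]] by (simp add: power2_eq_square mult_ac)
  obtain \<psi> where \<psi>: "\<And>k. \<psi> k \<in> test_functions \<Omega>" "(\<lambda>k. nrm M (\<lambda>x. \<psi> k x - u x)) \<longlonglongrightarrow> 0"
    "\<And>b. b \<in> Basis \<Longrightarrow> (\<lambda>k. nrm M (\<lambda>x. frechet_derivative (\<psi> k) (at x) b - G x \<bullet> b)) \<longlonglongrightarrow> 0"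
    using G(1) unfolding h10_def by blast
  define e where "e n = inverse (real (Suc n))" for n
  have e: "e \<longlonglongrightarrow> 0" "e n > 0" for n unfolding e_def by (rule LIMSEQ_inverse_real_of_nat) simp
  \<comment> \<open>A smooth modulus: it is 0 at 0, so supports stay compact; its slope is at most
    1, so gradients do not grow; and it differs from |t| by at most \<open>e n\<close>. The form
    \<open>powr (1 / 2)\<close> fits \<open>C_infinity_powr\<close>.\<close>
  define F where "F n t = (t\<^sup>2 + (e n)\<^sup>2) powr (1 / 2) - e n" for n t
  have F_sqrt: "F n t = sqrt (t\<^sup>2 + (e n)\<^sup>2) - e n" for n t
    unfolding F_def by (simp add: powr_half_sqrt)
  have pos: "t\<^sup>2 + (e n)\<^sup>2 > 0" for t :: real and n using e(2)[of n] by (simp add: add_nonneg_pos)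
  have F_smooth: "F n \<in> C_infinity" for n
  proof -
    have "(\<lambda>t::real. t \<bullet> 1) \<in> C_infinity" by (rule C_infinity_inner)
    then have "(\<lambda>t::real. t * t + (e n)\<^sup>2) \<in> C_infinity" by (intro C_infinity_add C_infinity_mult C_infinity_const) auto
    then have "(\<lambda>t::real. t\<^sup>2 + (e n)\<^sup>2) \<in> C_infinity" by (simp add: power2_eq_square)
    then show ?thesis unfolding F_def by (intro C_infinity_diff C_infinity_powr C_infinity_const pos)
  qed
  have F0: "F n 0 = 0" for n using e(2)[of n] by (simp add: F_sqrt)
  have F_near: "\<bar>F n t - \<bar>t\<bar>\<bar> \<le> e n" for n t
  proof -
    have "sqrt (t\<^sup>2 + (e n)\<^sup>2) \<le> \<bar>t\<bar> + e n"
      using sqrt_add_le_add_sqrt[of "t\<^sup>2" "(e n)\<^sup>2"] e(2)[of n] by simp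
    moreover have "\<bar>t\<bar> \<le> sqrt (t\<^sup>2 + (e n)\<^sup>2)" by (rule real_le_rsqrt) simp
    moreover have "e n \<ge> 0" using e(2)[of n] by simp
    ultimately show ?thesis unfolding F_sqrt by linarith
  qed
  have F_deriv: "(F n has_real_derivative t / sqrt (t\<^sup>2 + (e n)\<^sup>2)) (at t)" for n t
    unfolding F_sqrt[abs_def] using pos[of t n] by (auto intro!: derivative_eq_intros simp: field_simps)
  have F_deriv_le: "\<bar>t / sqrt (t\<^sup>2 + (e n)\<^sup>2)\<bar> \<le> 1" for n t
  proof -
    have "\<bar>t\<bar> \<le> sqrt (t\<^sup>2 + (e n)\<^sup>2)" by (rule real_le_rsqrt) simp
    then show ?thesis using pos[of t n] by (simp add: abs_divide)
  qed
  define \<eta> where "\<eta> n x = F n (\<psi> n x)" for n x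
  have \<eta>: "\<eta> n \<in> test_functions \<Omega>" for n
    unfolding \<eta>_def[abs_def] by (rule test_functions_compose[OF \<psi>(1) F_smooth F0])
  have \<eta>_deriv: "\<bar>frechet_derivative (\<eta> n) (at x) b\<bar> \<le> \<bar>frechet_derivative (\<psi> n) (at x) b\<bar>" for n x b
  proof -
    have "(\<eta> n has_derivative (\<lambda>h. frechet_derivative (\<psi> n) (at x) h * (\<psi> n x / sqrt ((\<psi> n x)\<^sup>2 + (e n)\<^sup>2)))) (at x)"
      unfolding \<eta>_def[abs_def]
      by (rule DERIV_compose_FDERIV[OF F_deriv C_infinity_has_derivative[OF test_functions_C_infinity[OF \<psi>(1)]]])
    from frechet_derivative_at[OF this]
    have "frechet_derivative (\<eta> n) (at x) b = frechet_derivative (\<psi> n) (at x) b * (\<psi> n x / sqrt ((\<psi> n x)\<^sup>2 + (e n)\<^sup>2))" by metis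
    then show ?thesis using mult_left_mono[OF F_deriv_le abs_ge_zero] by (simp only: abs_mult mult_1_right)
  qed
  let ?D = "\<lambda>f b x. frechet_derivative f (at x) b"
  have le: "(\<Sum>j<N. \<Lambda> j * (coef (\<eta> n) j)\<^sup>2) \<le> (\<Sum>b\<in>Basis. (nrm M (?D (\<psi> n) b))\<^sup>2)" for n
  proof -
    have "(\<Sum>j<N. \<Lambda> j * (coef (\<eta> n) j)\<^sup>2) \<le> vip M (classical_gradient (\<eta> n)) (classical_gradient (\<eta> n))"
      by (rule energy_bessel[OF h10_test_function[OF O \<eta>]])
    also have "\<dots> = (\<Sum>b\<in>Basis. (nrm M (?D (\<eta> n) b))\<^sup>2)"
      unfolding vip_def nrm_square by (intro sum.cong refl) (simp add: classical_gradient_inner)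
    also have "\<dots> \<le> (\<Sum>b\<in>Basis. (nrm M (?D (\<psi> n) b))\<^sup>2)"
    proof (intro sum_mono power_mono nrm_nonneg)
      fix b :: 'a assume b: "b \<in> Basis"
      show "nrm M (?D (\<eta> n) b) \<le> nrm M (?D (\<psi> n) b)"
        using \<eta>_deriv by (intro nrm_mono l2_measurable test_functions_l2_on[OF O test_functions_partial[OF \<eta> b]]
            test_functions_l2_on[OF O test_functions_partial[OF \<psi>(1) b]] AE_I2)
    qed
    finally show ?thesis .
  qed
  have R: "(\<lambda>n. \<Sum>b\<in>Basis. (nrm M (?D (\<psi> n) b))\<^sup>2) \<longlonglongrightarrow> (\<Sum>j. \<Lambda> j * (coef u j)\<^sup>2)"
  proof -
    have "(\<lambda>n. \<Sum>b\<in>Basis. (nrm M (?D (\<psi> n) b))\<^sup>2) \<longlonglongrightarrow> (\<Sum>b\<in>Basis. (nrm M (\<lambda>x. G x \<bullet> b))\<^sup>2)"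
      by (intro tendsto_sum tendsto_power nrm_tendsto \<psi>(3) vl2D[OF h10_vl2[OF G(1)]]
          test_functions_l2_on[OF O test_functions_partial[OF \<psi>(1)]])
    then show ?thesis unfolding E[symmetric] vip_def by simp
  qed
  have one: "(\<lambda>x. 1) \<in> l2 M" by (rule l2_bounded_function[of _ 1]) auto
  have lim: "(\<lambda>n. nrm M (\<lambda>x. \<eta> n x - \<bar>u x\<bar>)) \<longlonglongrightarrow> 0"
  proof (rule tendsto_sandwich[OF _ _ tendsto_const])
    have "(\<lambda>n. e n * nrm M (\<lambda>x. 1)) \<longlonglongrightarrow> 0" by (rule tendsto_mult_left_zero[OF e(1)])
    from tendsto_add_zero[OF this \<psi>(2)]
    show "(\<lambda>n. e n * nrm M (\<lambda>x. 1) + nrm M (\<lambda>x. \<psi> n x - u x)) \<longlonglongrightarrow> 0" .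
    have "nrm M (\<lambda>x. \<eta> n x - \<bar>u x\<bar>) \<le> e n * nrm M (\<lambda>x. 1) + nrm M (\<lambda>x. \<psi> n x - u x)" for n
    proof -
      note pl = test_functions_l2_on[OF O \<psi>(1)[of n]]
      note [measurable] = l2_measurable[OF pl]
      have apl: "(\<lambda>x. \<bar>\<psi> n x\<bar>) \<in> l2 M" by (rule l2_dominated[OF _ pl]) auto
      have "nrm M (\<lambda>x. \<eta> n x - \<bar>u x\<bar>) \<le> nrm M (\<lambda>x. \<eta> n x - \<bar>\<psi> n x\<bar>) + nrm M (\<lambda>x. \<bar>\<psi> n x\<bar> - \<bar>u x\<bar>)"
        by (rule nrm_triangle_diff[OF test_functions_l2_on[OF O \<eta>] apl al])
      also have "nrm M (\<lambda>x. \<eta> n x - \<bar>\<psi> n x\<bar>) \<le> nrm M (\<lambda>x. e n * 1)"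
        using F_near by (intro nrm_mono l2_scale[OF one] l2_measurable[OF l2_diff[OF test_functions_l2_on[OF O \<eta>] apl]] AE_I2)
          (auto simp: \<eta>_def intro: order_trans[OF F_near])
      also have "\<dots> = e n * nrm M (\<lambda>x. 1)" unfolding nrm_scale using e(2)[of n] by simp
      also have "nrm M (\<lambda>x. \<bar>\<psi> n x\<bar> - \<bar>u x\<bar>) \<le> nrm M (\<lambda>x. \<psi> n x - u x)"
        by (intro nrm_mono l2_diff[OF pl u] l2_measurable[OF l2_diff[OF apl al]] AE_I2 abs_triangle_ineq3)
      finally show ?thesis by simp
    qed
    then show "\<forall>\<^sub>F n in sequentially. nrm M (\<lambda>x. \<eta> n x - \<bar>u x\<bar>) \<le> e n * nrm M (\<lambda>x. 1) + nrm M (\<lambda>x. \<psi> n x - u x)"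
      by simp
  qed simp
  \<comment> \<open>With N fixed only finitely many coefficients occur, and these are continuous
    under L2 convergence. No convergence of the gradients of the smoothed functions is
    required.\<close>
  have L: "(\<lambda>n. \<Sum>j<N. \<Lambda> j * (coef (\<eta> n) j)\<^sup>2) \<longlonglongrightarrow> (\<Sum>j<N. \<Lambda> j * (coef (\<lambda>x. \<bar>u x\<bar>) j)\<^sup>2)"
    by (intro tendsto_intros ip_tendsto[OF test_functions_l2_on[OF O \<eta>] al basis_l2 lim])
  show "(\<Sum>j<N. \<Lambda> j * (coef (\<lambda>x. \<bar>u x\<bar>) j)\<^sup>2) \<le> (\<Sum>j. \<Lambda> j * (coef u j)\<^sup>2)"
    by (rule LIMSEQ_le[OF L R]) (use le in auto)
qed

subsection \<open>Positivity of the resolvent\<close>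

text \<open>The operator (-Delta + \<mu>)^-1 through its coefficients. The function is determined
  only up to null sets, which is why its algebraic rules below hold almost everywhere.\<close>

definition res :: "real \<Rightarrow> ('a \<Rightarrow> real) \<Rightarrow> 'a \<Rightarrow> real" where
  "res \<mu> f = (SOME u. u \<in> l2 M \<and> (\<forall>j. coef u j = coef f j / (\<Lambda> j + \<mu>)))"

lemma shifted_eigenvalue_pos: "\<mu> > 0 \<Longrightarrow> \<Lambda> j + \<mu> > 0"
  using eigenvalue_nonneg[of j] by linarith

lemma res:
  assumes "\<mu> > 0" "f \<in> l2 M"
  shows res_l2: "res \<mu> f \<in> l2 M" and coef_res: "coef (res \<mu> f) j = coef f j / (\<Lambda> j + \<mu>)"
proof -
  have "summable (\<lambda>j. (coef f j / (\<Lambda> j + \<mu>))\<^sup>2)"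
  proof (rule summable_comparison_test')
    show "summable (\<lambda>j. (1 / \<mu>\<^sup>2) * (coef f j)\<^sup>2)"
      by (intro summable_mult summable_coef_square assms)
    show "norm ((coef f j / (\<Lambda> j + \<mu>))\<^sup>2) \<le> (1 / \<mu>\<^sup>2) * (coef f j)\<^sup>2" if "j \<ge> 0" for j
    proof -
      have "\<mu>\<^sup>2 \<le> (\<Lambda> j + \<mu>)\<^sup>2" using eigenvalue_nonneg[of j] assms(1) by (intro power_mono) auto
      then have "(coef f j)\<^sup>2 / (\<Lambda> j + \<mu>)\<^sup>2 \<le> (coef f j)\<^sup>2 / \<mu>\<^sup>2"
        using assms(1) by (intro divide_left_mono) (auto intro!: mult_pos_pos simp: zero_less_power2 dest: shifted_eigenvalue_pos[of \<mu> j])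
      then show ?thesis by (simp add: power_divide)
    qed
  qed
  from riesz_fischer[OF this]
  have "\<exists>u. u \<in> l2 M \<and> (\<forall>j. coef u j = coef f j / (\<Lambda> j + \<mu>))" by blast
  from someI_ex[OF this] show "res \<mu> f \<in> l2 M" "coef (res \<mu> f) j = coef f j / (\<Lambda> j + \<mu>)"
    unfolding res_def by blast+
qed

lemma res_energy:
  assumes "\<mu> > 0" "f \<in> l2 M"
  shows "summable (\<lambda>j. \<Lambda> j * (coef (res \<mu> f) j)\<^sup>2)"
proof (rule summable_comparison_test')
  show "summable (\<lambda>j. (1 / \<mu>) * (coef f j)\<^sup>2)"
    by (intro summable_mult summable_coef_square assms)
  show "norm (\<Lambda> j * (coef (res \<mu> f) j)\<^sup>2) \<le> (1 / \<mu>) * (coef f j)\<^sup>2" if "j \<ge> 0" for j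
  proof -
    have p: "\<Lambda> j + \<mu> > 0" "\<Lambda> j \<ge> 0" using shifted_eigenvalue_pos[OF assms(1)] eigenvalue_nonneg by auto
    have "\<Lambda> j * \<mu> \<le> (\<Lambda> j + \<mu>)\<^sup>2" using p assms(1) by (simp add: power2_eq_square algebra_simps)
    then have "\<Lambda> j / (\<Lambda> j + \<mu>)\<^sup>2 \<le> 1 / \<mu>" using p assms(1) by (simp add: divide_simps)
    then have "\<Lambda> j / (\<Lambda> j + \<mu>)\<^sup>2 * (coef f j)\<^sup>2 \<le> (1 / \<mu>) * (coef f j)\<^sup>2" by (rule mult_right_mono) simp
    then show ?thesis using p by (simp add: coef_res[OF assms] power_divide)
  qed
qed

text \<open>The solution u minimizes energy plus \<mu> times the squared norm minus twice the
  pairing with f. By \<open>energy_abs\<close> and f \<ge> 0 the competitor |u| does no worse, and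
  by strict convexity |u| = u almost everywhere.\<close>

lemma res_nonneg:
  assumes \<mu>: "\<mu> > 0" and f: "f \<in> l2 M" and f0: "AE x in M. 0 \<le> f x"
  shows "AE x in M. 0 \<le> res \<mu> f x"
proof -
  define u where "u = res \<mu> f"
  have u: "u \<in> l2 M" "\<And>j. coef u j = coef f j / (\<Lambda> j + \<mu>)" unfolding u_def by (simp_all add: res[OF \<mu> f])
  have s: "summable (\<lambda>j. \<Lambda> j * (coef u j)\<^sup>2)" unfolding u_def by (rule res_energy[OF \<mu> f])
  define v where "v x = \<bar>u x\<bar>" for x
  note ea = energy_abs[OF u(1) s]
  have v: "v \<in> l2 M" unfolding v_def[abs_def] by (rule ea(1))
  define E where "E = (\<Sum>j. \<Lambda> j * (coef u j)\<^sup>2)"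
  have Ev: "(\<Sum>j<N. \<Lambda> j * (coef v j)\<^sup>2) \<le> E" for N
    using ea(2) unfolding E_def v_def[abs_def] .
  have vv: "ip M v v = ip M u u" unfolding ip_def v_def by simp
  have fuv: "ip M f u \<le> ip M f v"
    unfolding ip_def
  proof (rule integral_mono_AE[OF l2_mult_integrable[OF f u(1)] l2_mult_integrable[OF f v]])
    show "AE x in M. f x * u x \<le> f x * v x"
      using f0 by eventually_elim (auto simp: v_def intro: mult_left_mono)
  qed
  let ?R = "\<lambda>N. E - (\<Sum>j<N. \<Lambda> j * (coef u j)\<^sup>2) + \<mu> * ((\<Sum>j<N. coef v j * coef v j) - (\<Sum>j<N. coef u j * coef u j))
      + 2 * ((\<Sum>j<N. coef f j * coef u j) - (\<Sum>j<N. coef f j * coef v j))"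
  have le: "\<mu> * (\<Sum>j<N. coef (\<lambda>x. v x - u x) j * coef (\<lambda>x. v x - u x) j) \<le> ?R N" for N
  proof -
    have "\<mu> * (\<Sum>j<N. coef (\<lambda>x. v x - u x) j * coef (\<lambda>x. v x - u x) j) = (\<Sum>j<N. \<mu> * (coef v j - coef u j)\<^sup>2)"
      by (simp add: coef_diff[OF v u(1)] sum_distrib_left power2_eq_square)
    also have "\<dots> \<le> (\<Sum>j<N. (\<Lambda> j * (coef v j)\<^sup>2 - \<Lambda> j * (coef u j)\<^sup>2) + \<mu> * (coef v j * coef v j - coef u j * coef u j)
        + 2 * (coef f j * coef u j - coef f j * coef v j))"
    proof (rule sum_mono)
      fix j
      \<comment> \<open>The equation for u turns the difference of the two functionals, coefficient
        by coefficient, into the complete square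
        \<open>(\<Lambda> j + \<mu>) * (coef v j - coef u j)\<^sup>2\<close>.\<close>
      have fj: "coef f j = (\<Lambda> j + \<mu>) * coef u j" using shifted_eigenvalue_pos[OF \<mu>, of j] by (simp add: u(2))
      have "(\<Lambda> j + \<mu>) * (coef v j - coef u j)\<^sup>2 = (\<Lambda> j * (coef v j)\<^sup>2 - \<Lambda> j * (coef u j)\<^sup>2) + \<mu> * (coef v j * coef v j - coef u j * coef u j)
        + 2 * (coef f j * coef u j - coef f j * coef v j)"
        unfolding fj by (simp add: power2_eq_square algebra_simps)
      moreover have "\<mu> * (coef v j - coef u j)\<^sup>2 \<le> (\<Lambda> j + \<mu>) * (coef v j - coef u j)\<^sup>2"
        using eigenvalue_nonneg[of j] by (intro mult_right_mono) auto
      ultimately show "\<mu> * (coef v j - coef u j)\<^sup>2 \<le> (\<Lambda> j * (coef v j)\<^sup>2 - \<Lambda> j * (coef u j)\<^sup>2) + \<mu> * (coef v j * coef v j - coef u j * coef u j)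
        + 2 * (coef f j * coef u j - coef f j * coef v j)" by simp
    qed
    also have "\<dots> = (\<Sum>j<N. \<Lambda> j * (coef v j)\<^sup>2) - (\<Sum>j<N. \<Lambda> j * (coef u j)\<^sup>2) + \<mu> * ((\<Sum>j<N. coef v j * coef v j) - (\<Sum>j<N. coef u j * coef u j))
      + 2 * ((\<Sum>j<N. coef f j * coef u j) - (\<Sum>j<N. coef f j * coef v j))"
      by (simp only: sum.distrib sum_subtractf sum_distrib_left[symmetric])
    also have "\<dots> \<le> ?R N" using Ev[of N] by linarith
    finally show ?thesis .
  qed
  have duv: "(\<lambda>x. v x - u x) \<in> l2 M" by (rule l2_diff[OF v u(1)])
  have "(\<lambda>N. \<mu> * (\<Sum>j<N. coef (\<lambda>x. v x - u x) j * coef (\<lambda>x. v x - u x) j)) \<longlonglongrightarrow> \<mu> * ip M (\<lambda>x. v x - u x) (\<lambda>x. v x - u x)"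
    using parseval[OF duv duv] unfolding sums_def by (intro tendsto_intros)
  moreover have "?R \<longlonglongrightarrow> E - E + \<mu> * (ip M v v - ip M u u) + 2 * (ip M f u - ip M f v)"
    using parseval[OF v v] parseval[OF u(1) u(1)] parseval[OF f u(1)] parseval[OF f v] summable_sums[OF s, folded E_def]
    unfolding sums_def by (intro tendsto_intros)
  ultimately have "\<mu> * ip M (\<lambda>x. v x - u x) (\<lambda>x. v x - u x) \<le> E - E + \<mu> * (ip M v v - ip M u u) + 2 * (ip M f u - ip M f v)"
    by (rule LIMSEQ_le) (use le in auto)
  then have "\<mu> * ip M (\<lambda>x. v x - u x) (\<lambda>x. v x - u x) \<le> 0" using fuv vv by simp
  then have "ip M (\<lambda>x. v x - u x) (\<lambda>x. v x - u x) \<le> 0" using \<mu> by (simp add: mult_le_0_iff)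
  then have "ip M (\<lambda>x. v x - u x) (\<lambda>x. v x - u x) = 0" using ip_self_nonneg[of M "\<lambda>x. v x - u x"] by linarith
  then have "AE x in M. v x - u x = 0" using ip_self_eq_0_iff[OF duv] by simp
  then show ?thesis unfolding u_def[symmetric] by eventually_elim (simp add: v_def)
qed

lemma res_diff_AE:
  assumes "\<mu> > 0" "f \<in> l2 M" "g \<in> l2 M"
  shows "AE x in M. res \<mu> (\<lambda>x. f x - g x) x = res \<mu> f x - res \<mu> g x"
  by (rule coef_eq_imp_AE_eq)
    (use assms in \<open>auto simp: res_l2 l2_diff coef_diff coef_res diff_divide_distrib\<close>)

lemma res_scale_AE:
  assumes "\<mu> > 0" "f \<in> l2 M"
  shows "AE x in M. res \<mu> (\<lambda>x. c * f x) x = c * res \<mu> f x"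
  by (rule coef_eq_imp_AE_eq)
    (use assms in \<open>auto simp: res_l2 l2_scale coef_res ip_scale_left\<close>)

lemma res_mono_AE:
  assumes "\<mu> > 0" "f \<in> l2 M" "g \<in> l2 M" "AE x in M. f x \<le> g x"
  shows "AE x in M. res \<mu> f x \<le> res \<mu> g x"
proof -
  have "AE x in M. 0 \<le> g x - f x" using assms(4) by eventually_elim simp
  from res_nonneg[OF assms(1) l2_diff[OF assms(3,2)] this] res_diff_AE[OF assms(1,3,2)]
  show ?thesis by eventually_elim simp
qed

lemma nrm_res_le:
  assumes "\<mu> > 0" "f \<in> l2 M"
  shows "nrm M (res \<mu> f) \<le> nrm M f / \<mu>"
proof -
  have "ip M (res \<mu> f) (res \<mu> f) \<le> (1 / \<mu>\<^sup>2) * ip M f f"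
  proof (rule sums_le[OF _ parseval[OF res_l2[OF assms] res_l2[OF assms]] sums_mult[OF parseval[OF assms(2,2)]]])
    fix j
    have "\<mu>\<^sup>2 \<le> (\<Lambda> j + \<mu>)\<^sup>2" using eigenvalue_nonneg[of j] assms(1) by (intro power_mono) auto
    then have "(coef f j)\<^sup>2 / (\<Lambda> j + \<mu>)\<^sup>2 \<le> (coef f j)\<^sup>2 / \<mu>\<^sup>2"
      using assms(1) by (intro divide_left_mono) (auto intro!: mult_pos_pos simp: zero_less_power2 dest: shifted_eigenvalue_pos[of \<mu> j])
    then show "coef (res \<mu> f) j * coef (res \<mu> f) j \<le> (1 / \<mu>\<^sup>2) * (coef f j * coef f j)"
      by (simp add: coef_res[OF assms] power2_eq_square)
  qed
  then have "(nrm M (res \<mu> f))\<^sup>2 \<le> (nrm M f / \<mu>)\<^sup>2" by (simp add: power_divide)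
  moreover have "0 \<le> nrm M f / \<mu>" using assms(1) by simp
  ultimately show ?thesis by (rule power2_le_imp_le)
qed

lemma res_tendsto:
  assumes \<mu>: "\<mu> > 0" and f: "\<And>n. f n \<in> l2 M" "g \<in> l2 M" and lim: "(\<lambda>n. nrm M (\<lambda>x. f n x - g x)) \<longlonglongrightarrow> 0"
  shows "(\<lambda>n. nrm M (\<lambda>x. res \<mu> (f n) x - res \<mu> g x)) \<longlonglongrightarrow> 0"
proof (rule tendsto_sandwich[OF _ _ tendsto_const])
  show "(\<lambda>n. nrm M (\<lambda>x. f n x - g x) / \<mu>) \<longlonglongrightarrow> 0" by (rule tendsto_divide_zero[OF lim])
  have "nrm M (\<lambda>x. res \<mu> (f n) x - res \<mu> g x) \<le> nrm M (\<lambda>x. f n x - g x) / \<mu>" for n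
  proof -
    have "ip M (res \<mu> (\<lambda>x. f n x - g x)) (res \<mu> (\<lambda>x. f n x - g x)) =
       ip M (\<lambda>x. res \<mu> (f n) x - res \<mu> g x) (\<lambda>x. res \<mu> (f n) x - res \<mu> g x)"
      by (intro ip_cong_AE l2_measurable res_l2 l2_diff res_diff_AE \<mu> f)
    then show ?thesis using nrm_res_le[OF \<mu> l2_diff[OF f(1)[of n] f(2)]] by (simp add: nrm_def)
  qed
  then show "\<forall>\<^sub>F n in sequentially. nrm M (\<lambda>x. res \<mu> (f n) x - res \<mu> g x) \<le> nrm M (\<lambda>x. f n x - g x) / \<mu>" by simp
qed simp

lemma resolvent_identity_AE:
  assumes "\<mu> > 0" "\<nu> > 0" "f \<in> l2 M"
  shows "AE x in M. res \<mu> f x = res \<nu> f x + (\<nu> - \<mu>) * res \<nu> (res \<mu> f) x"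
proof (rule coef_eq_imp_AE_eq)
  show "res \<mu> f \<in> l2 M" by (rule res_l2[OF assms(1,3)])
  show "(\<lambda>x. res \<nu> f x + (\<nu> - \<mu>) * res \<nu> (res \<mu> f) x) \<in> l2 M"
    by (intro l2_add l2_scale res_l2 assms)
  fix j
  have p: "\<Lambda> j + \<mu> > 0" "\<Lambda> j + \<nu> > 0" using shifted_eigenvalue_pos assms by auto
  have "coef (\<lambda>x. res \<nu> f x + (\<nu> - \<mu>) * res \<nu> (res \<mu> f) x) j =
    coef f j / (\<Lambda> j + \<nu>) + (\<nu> - \<mu>) * (coef f j / (\<Lambda> j + \<mu>) / (\<Lambda> j + \<nu>))"
    by (simp only: coef_add l2_scale res_l2 assms ip_scale_left coef_res)
  also have "\<dots> = coef f j / (\<Lambda> j + \<mu>)"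
  proof -
    have "coef f j / (\<Lambda> j + \<nu>) = coef f j * (\<Lambda> j + \<mu>) / ((\<Lambda> j + \<mu>) * (\<Lambda> j + \<nu>))" using p by simp
    moreover have "(\<nu> - \<mu>) * (coef f j / (\<Lambda> j + \<mu>) / (\<Lambda> j + \<nu>)) = coef f j * (\<nu> - \<mu>) / ((\<Lambda> j + \<mu>) * (\<Lambda> j + \<nu>))"
      by (simp add: mult_ac)
    ultimately have "coef f j / (\<Lambda> j + \<nu>) + (\<nu> - \<mu>) * (coef f j / (\<Lambda> j + \<mu>) / (\<Lambda> j + \<nu>)) =
       coef f j * (\<Lambda> j + \<nu>) / ((\<Lambda> j + \<mu>) * (\<Lambda> j + \<nu>))"
      by (simp only: add_divide_distrib[symmetric] distrib_left[symmetric]) simp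
    also have "\<dots> = coef f j / (\<Lambda> j + \<mu>)" using p by simp
    finally show ?thesis .
  qed
  finally show "coef (res \<mu> f) j = coef (\<lambda>x. res \<nu> f x + (\<nu> - \<mu>) * res \<nu> (res \<mu> f) x) j"
    by (simp add: coef_res[OF assms(1,3)])
qed

text \<open>What lives on the set where \<open>res \<mu> f\<close> is positive stays there under
  resolvents: multiples of \<open>res \<mu> f\<close> do, and positivity of the resolvent extends
  this to everything they dominate.\<close>

lemma res_preserves_positivity_set:
  assumes \<mu>: "\<mu> > 0" "\<nu> > \<mu>" and f: "f \<in> l2 M" "AE x in M. 0 \<le> f x"
    and w: "w \<in> l2 M" "\<And>x. res \<mu> f x \<le> 0 \<Longrightarrow> w x = 0"
  shows "AE x in M. res \<mu> f x \<le> 0 \<longrightarrow> res \<nu> w x = 0"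
proof -
  have \<nu>: "\<nu> > 0" using \<mu> by simp
  define u where "u = res \<mu> f"
  have u: "u \<in> l2 M" unfolding u_def by (rule res_l2[OF \<mu>(1) f(1)])
  have u0: "AE x in M. 0 \<le> u x" unfolding u_def by (rule res_nonneg[OF \<mu>(1) f])
  \<comment> \<open>By the resolvent identity u is a sum of two terms that are nonnegative, the
    second because \<nu> > \<mu>; where u is 0, both are 0.\<close>
  have ru: "AE x in M. u x \<le> 0 \<longrightarrow> res \<nu> u x = 0"
    using resolvent_identity_AE[OF \<mu>(1) \<nu> f(1), folded u_def] res_nonneg[OF \<nu> f] res_nonneg[OF \<nu> u u0]
  proof eventually_elim
    case (elim x)
    show ?case
    proof
      assume "u x \<le> 0"
      then have "(\<nu> - \<mu>) * res \<nu> u x \<le> 0" using elim by linarith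
      then show "res \<nu> u x = 0" using elim(3) \<mu>(2) by (simp add: mult_le_0_iff)
    qed
  qed
  have pos: "AE x in M. u x \<le> 0 \<longrightarrow> res \<nu> w x = 0"
    if w: "w \<in> l2 M" "\<And>x. u x \<le> 0 \<Longrightarrow> w x = 0" "\<And>x. 0 \<le> w x" for w
  proof -
    \<comment> \<open>Cutting at n u gives functions below a multiple of u that reach w at every
      point where u is positive; where u is not positive, w is 0 anyway.\<close>
    define wn where "wn n x = max 0 (min (w x) (real n * u x))" for n x
    note [measurable] = l2_measurable[OF w(1)] l2_measurable[OF u]
    have m: "wn n \<in> borel_measurable M" for n unfolding wn_def by measurable
    have wn: "wn n \<in> l2 M" for n by (rule l2_dominated[OF m w(1)]) (use w(3) in \<open>auto simp: wn_def\<close>)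
    have "(\<lambda>n. wn n x) \<longlonglongrightarrow> w x" for x
    proof (cases "u x \<le> 0")
      case True
      then have "wn n x = w x" for n using w(2)[OF True] by (simp add: wn_def)
      then show ?thesis by simp
    next
      case False
      then obtain k :: nat where k: "w x / u x \<le> real k" using real_arch_simple by blast
      have "wn n x = w x" if "n \<ge> k" for n
      proof -
        have "w x / u x \<le> real n" using k that by (meson of_nat_le_iff order_trans)
        then have "w x \<le> real n * u x" using False by (simp add: pos_divide_le_eq)
        then show ?thesis using w(3)[of x] by (simp add: wn_def)
      qed
      then show ?thesis by (intro tendsto_eventually) (auto simp: eventually_sequentially)
    qed
    moreover have "\<bar>wn n x - w x\<bar> \<le> w x" for n x using w(3)[of x] by (auto simp: wn_def)
    ultimately have "(\<lambda>n. nrm M (\<lambda>x. wn n x - w x)) \<longlonglongrightarrow> 0"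
      by (intro l2_dominated_convergence[OF m l2_measurable[OF w(1)] w(1)]) auto
    from res_tendsto[OF \<nu> wn w(1) this]
    have lim: "(\<lambda>n. nrm M (\<lambda>x. res \<nu> (wn n) x - res \<nu> w x)) \<longlonglongrightarrow> 0" .
    have z: "AE x in M. x \<in> {x. u x \<le> 0} \<longrightarrow> res \<nu> (wn n) x = 0" for n
    proof -
      have "AE x in M. wn n x \<le> real n * u x" using u0 by eventually_elim (auto simp: wn_def)
      note le = res_mono_AE[OF \<nu> wn l2_scale[OF u] this]
      have "AE x in M. 0 \<le> wn n x" by (simp add: wn_def)
      from res_nonneg[OF \<nu> wn this] le res_scale_AE[OF \<nu> u, of "real n"] ru
      show ?thesis
      proof eventually_elim
        case (elim x)
        show ?case
        proof
          assume "x \<in> {x. u x \<le> 0}"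
          then have "res \<nu> u x = 0" using elim(4) by simp
          then show "res \<nu> (wn n) x = 0" using elim(1-3) by simp
        qed
      qed
    qed
    from AE_zero_if_l2_limit[OF res_l2[OF \<nu> wn] res_l2[OF \<nu> w(1)] lim z]
    show ?thesis by simp
  qed
  define p where "p x = max 0 (w x)" for x
  define q where "q x = max 0 (- w x)" for x
  note [measurable] = l2_measurable[OF w(1)]
  have p: "p \<in> l2 M" by (rule l2_dominated[OF _ w(1)]) (auto simp: p_def[abs_def])
  have q: "q \<in> l2 M" by (rule l2_dominated[OF _ w(1)]) (auto simp: q_def[abs_def])
  have wpq: "w = (\<lambda>x. p x - q x)" by (rule ext) (auto simp: p_def q_def)
  have "AE x in M. u x \<le> 0 \<longrightarrow> res \<nu> p x = 0" by (rule pos[OF p]) (use w(2) in \<open>auto simp: p_def u_def\<close>)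
  moreover have "AE x in M. u x \<le> 0 \<longrightarrow> res \<nu> q x = 0" by (rule pos[OF q]) (use w(2) in \<open>auto simp: q_def u_def\<close>)
  ultimately have "AE x in M. u x \<le> 0 \<longrightarrow> res \<nu> w x = 0"
    using res_diff_AE[OF \<nu> p q] unfolding wpq[symmetric] by eventually_elim simp
  then show ?thesis unfolding u_def .
qed

text \<open>Compares energies through the forms \<nu> (v - \<nu> R v, v), with R the resolvent at
  \<nu>. These have the bounded symbol \<open>\<nu> * \<Lambda> j / (\<Lambda> j + \<nu>)\<close>,
  which is at most \<open>\<Lambda> j\<close> and tends to it for large \<nu>.\<close>

lemma cut_energy:
  assumes \<mu>: "\<mu> > 0" and f: "f \<in> l2 M" "AE x in M. 0 \<le> f x"
    and v: "v \<in> l2 M" and s: "summable (\<lambda>j. \<Lambda> j * (coef v j)\<^sup>2)"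
  defines "c \<equiv> \<lambda>x. if res \<mu> f x > 0 then v x else 0"
  shows "c \<in> l2 M" "summable (\<lambda>j. \<Lambda> j * (coef c j)\<^sup>2)"
proof -
  define d where "d x = v x - c x" for x
  note [measurable] = l2_measurable[OF v] l2_measurable[OF res_l2[OF \<mu> f(1)]]
  have cm: "c \<in> borel_measurable M" unfolding c_def by measurable
  show c: "c \<in> l2 M" by (rule l2_dominated[OF cm v]) (auto simp: c_def)
  have d: "d \<in> l2 M" unfolding d_def[abs_def] by (rule l2_diff[OF v c])
  have vcd: "coef v j = coef c j + coef d j" for j using coef_diff[OF v c, of j] by (simp add: d_def[abs_def])
  define E where "E = (\<Sum>j. \<Lambda> j * (coef v j)\<^sup>2)"
  \<comment> \<open>The cut part c and the remainder d are orthogonal in L2, and so are the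
    resolvent of c and d, because the resolvent of c stays in the set where d is 0. Hence the cross
    term of the approximating form vanishes.\<close>
  have bound: "(\<Sum>j<N. \<nu> * \<Lambda> j / (\<Lambda> j + \<nu>) * (coef c j)\<^sup>2) \<le> E" if \<nu>: "\<nu> > \<mu>" for \<nu> N
  proof -
    have \<nu>0: "\<nu> > 0" using \<nu> \<mu> by simp
    have "AE x in M. res \<mu> f x \<le> 0 \<longrightarrow> res \<nu> c x = 0"
      by (rule res_preserves_positivity_set[OF \<mu> \<nu> f c]) (simp add: c_def)
    then have "AE x in M. res \<nu> c x * d x = 0" by eventually_elim (auto simp: d_def c_def)
    then have "ip M (res \<nu> c) d = 0" unfolding ip_def by (rule integral_eq_zero_AE)
    moreover have "ip M c d = 0" unfolding ip_def by (rule integral_eq_zero_AE) (auto simp: d_def c_def)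
    ultimately have "(\<lambda>j. \<nu> * (coef c j * coef d j) - \<nu>\<^sup>2 * (coef (res \<nu> c) j * coef d j)) sums (\<nu> * 0 - \<nu>\<^sup>2 * 0)"
      using parseval[OF c d] parseval[OF res_l2[OF \<nu>0 c] d] by (intro sums_diff sums_mult) simp_all
    moreover have "\<nu> * (coef c j * coef d j) - \<nu>\<^sup>2 * (coef (res \<nu> c) j * coef d j) = \<nu> * \<Lambda> j / (\<Lambda> j + \<nu>) * (coef c j * coef d j)" for j
      using shifted_eigenvalue_pos[OF \<nu>0, of j] by (simp add: coef_res[OF \<nu>0 c] field_simps power2_eq_square)
    ultimately have cross: "(\<lambda>j. \<nu> * \<Lambda> j / (\<Lambda> j + \<nu>) * (coef c j * coef d j)) sums 0" by simp
    have w: "0 \<le> \<nu> * \<Lambda> j / (\<Lambda> j + \<nu>)" "\<nu> * \<Lambda> j / (\<Lambda> j + \<nu>) \<le> \<Lambda> j" for j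
      using shifted_eigenvalue_pos[OF \<nu>0, of j] eigenvalue_nonneg[of j] \<nu>0 by (auto simp: divide_le_eq algebra_simps)
    have le: "(\<Sum>j<n. \<nu> * \<Lambda> j / (\<Lambda> j + \<nu>) * (coef c j)\<^sup>2) + 2 * (\<Sum>j<n. \<nu> * \<Lambda> j / (\<Lambda> j + \<nu>) * (coef c j * coef d j)) \<le> E" for n
    proof -
      have "(\<Sum>j<n. \<nu> * \<Lambda> j / (\<Lambda> j + \<nu>) * (coef c j)\<^sup>2) + 2 * (\<Sum>j<n. \<nu> * \<Lambda> j / (\<Lambda> j + \<nu>) * (coef c j * coef d j)) =
        (\<Sum>j<n. \<nu> * \<Lambda> j / (\<Lambda> j + \<nu>) * ((coef c j)\<^sup>2 + 2 * (coef c j * coef d j)))"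
        by (simp add: sum_distrib_left distrib_left sum.distrib mult_ac)
      also have "\<dots> \<le> (\<Sum>j<n. \<Lambda> j * (coef v j)\<^sup>2)"
      proof (rule sum_mono)
        fix j
        have "\<nu> * \<Lambda> j / (\<Lambda> j + \<nu>) * ((coef c j)\<^sup>2 + 2 * (coef c j * coef d j)) \<le> \<nu> * \<Lambda> j / (\<Lambda> j + \<nu>) * (coef v j)\<^sup>2"
          by (intro mult_left_mono w) (simp add: vcd power2_sum)
        also have "\<dots> \<le> \<Lambda> j * (coef v j)\<^sup>2" by (intro mult_right_mono w) simp
        finally show "\<nu> * \<Lambda> j / (\<Lambda> j + \<nu>) * ((coef c j)\<^sup>2 + 2 * (coef c j * coef d j)) \<le> \<Lambda> j * (coef v j)\<^sup>2" .
      qed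
      also have "\<dots> \<le> E" unfolding E_def by (rule sum_le_suminf[OF s]) (auto simp: eigenvalue_nonneg)
      finally show ?thesis .
    qed
    \<comment> \<open>Only the complete cross series is 0, not its partial sums; therefore N is kept
      fixed in the first sum while the second runs to infinity.\<close>
    have "(\<lambda>n. (\<Sum>j<N. \<nu> * \<Lambda> j / (\<Lambda> j + \<nu>) * (coef c j)\<^sup>2) + 2 * (\<Sum>j<n. \<nu> * \<Lambda> j / (\<Lambda> j + \<nu>) * (coef c j * coef d j)))
      \<longlonglongrightarrow> (\<Sum>j<N. \<nu> * \<Lambda> j / (\<Lambda> j + \<nu>) * (coef c j)\<^sup>2) + 2 * 0"
      using cross unfolding sums_def by (intro tendsto_intros)
    moreover have "\<exists>n0. \<forall>n\<ge>n0. (\<Sum>j<N. \<nu> * \<Lambda> j / (\<Lambda> j + \<nu>) * (coef c j)\<^sup>2) + 2 * (\<Sum>j<n. \<nu> * \<Lambda> j / (\<Lambda> j + \<nu>) * (coef c j * coef d j)) \<le> E"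
    proof (intro exI[of _ N] allI impI)
      fix n assume "n \<ge> N"
      then have "(\<Sum>j<N. \<nu> * \<Lambda> j / (\<Lambda> j + \<nu>) * (coef c j)\<^sup>2) \<le> (\<Sum>j<n. \<nu> * \<Lambda> j / (\<Lambda> j + \<nu>) * (coef c j)\<^sup>2)"
        by (intro sum_mono2 mult_nonneg_nonneg w(1)) auto
      then show "(\<Sum>j<N. \<nu> * \<Lambda> j / (\<Lambda> j + \<nu>) * (coef c j)\<^sup>2) + 2 * (\<Sum>j<n. \<nu> * \<Lambda> j / (\<Lambda> j + \<nu>) * (coef c j * coef d j)) \<le> E"
        using le[of n] by linarith
    qed
    ultimately show ?thesis using LIMSEQ_le_const2 by fastforce
  qed
  have "(\<Sum>j<N. \<Lambda> j * (coef c j)\<^sup>2) \<le> E" for N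
  proof -
    \<comment> \<open>The parameter \<nu> runs through the integers beyond \<mu>; for finitely many
      j the symbols converge together.\<close>
    have "(\<lambda>n. \<Sum>j<N. real n * \<Lambda> j / (\<Lambda> j + real n) * (coef c j)\<^sup>2) \<longlonglongrightarrow> (\<Sum>j<N. \<Lambda> j * (coef c j)\<^sup>2)"
    proof (intro tendsto_sum tendsto_mult tendsto_const)
      fix j
      have "(\<lambda>n. \<Lambda> j - \<Lambda> j * (\<Lambda> j / (\<Lambda> j + real n))) \<longlonglongrightarrow> \<Lambda> j - \<Lambda> j * 0"
        by (intro tendsto_intros real_tendsto_divide_at_top[OF tendsto_const] filterlim_tendsto_add_at_top[OF tendsto_const] filterlim_real_sequentially)
      moreover have "\<forall>\<^sub>F n in sequentially. \<Lambda> j - \<Lambda> j * (\<Lambda> j / (\<Lambda> j + real n)) = real n * \<Lambda> j / (\<Lambda> j + real n)"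
      proof (rule eventually_mono[OF eventually_gt_at_top[of 0]])
        fix n :: nat assume "0 < n"
        then have "\<Lambda> j + real n > 0" using eigenvalue_nonneg[of j] by (simp add: add_nonneg_pos)
        then show "\<Lambda> j - \<Lambda> j * (\<Lambda> j / (\<Lambda> j + real n)) = real n * \<Lambda> j / (\<Lambda> j + real n)"
          by (simp add: field_simps)
      qed
      ultimately show "(\<lambda>n. real n * \<Lambda> j / (\<Lambda> j + real n)) \<longlonglongrightarrow> \<Lambda> j"
        by (simp add: Lim_transform_eventually)
    qed
    moreover obtain n0 :: nat where "\<mu> < real n0" using reals_Archimedean2 by blast
    then have "\<exists>n0. \<forall>n\<ge>n0. (\<Sum>j<N. real n * \<Lambda> j / (\<Lambda> j + real n) * (coef c j)\<^sup>2) \<le> E"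
      by (intro exI[of _ n0] allI impI bound) (meson less_le_trans of_nat_le_iff)
    ultimately show ?thesis by (rule LIMSEQ_le_const2)
  qed
  then show "summable (\<lambda>j. \<Lambda> j * (coef c j)\<^sup>2)"
    by (intro bounded_imp_summable[where B=E]) (auto simp: eigenvalue_nonneg simp del: sum.lessThan_Suc simp flip: lessThan_Suc_atMost)
qed

end

section \<open>Weak derivatives vanish on zero sets\<close>

text \<open>By Lindelof countably many of the neighbourhoods cover the set, so the exceptional null
  sets can be united.\<close>

lemma AE_local:
  fixes \<Omega> :: "'a::euclidean_space set"
  assumes "\<And>x. x \<in> \<Omega> \<Longrightarrow> \<exists>B. open B \<and> x \<in> B \<and> (AE y in lborel. y \<in> B \<longrightarrow> P y)"
  shows "AE y in lborel. y \<in> \<Omega> \<longrightarrow> P y"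
proof -
  let ?F = "{B. open B \<and> (AE y in lborel. y \<in> B \<longrightarrow> P y)}"
  obtain F where F: "F \<subseteq> ?F" "countable F" "\<Union>F = \<Union>?F"
    using Lindelof[of ?F] by blast
  have "AE y in lborel. \<forall>B\<in>F. y \<in> B \<longrightarrow> P y"
    using F(1,2) by (subst AE_ball_countable) auto
  then show ?thesis
  proof eventually_elim
    case (elim y)
    show ?case
    proof
      assume "y \<in> \<Omega>"
      then have "y \<in> \<Union>?F" using assms by blast
      then show "P y" using elim F(3) by blast
    qed
  qed
qed

lemma ft_cos_sin:
  assumes f: "integrable lborel f"
  shows "ft f \<xi> = Complex (LINT x|lborel. f x * cos (x \<bullet> \<xi>)) (- (LINT x|lborel. f x * sin (x \<bullet> \<xi>)))"
proof -
  note i = ft_integrable[OF f, of \<xi>]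
  have "Re (ft f \<xi>) = (LINT x|lborel. Re (cis (- (x \<bullet> \<xi>)) * complex_of_real (f x)))"
    unfolding ft_def by (rule integral_Re[OF i, symmetric])
  moreover have "Im (ft f \<xi>) = (LINT x|lborel. Im (cis (- (x \<bullet> \<xi>)) * complex_of_real (f x)))"
    unfolding ft_def by (rule integral_Im[OF i, symmetric])
  ultimately show ?thesis by (simp add: complex_eq_iff mult.commute)
qed

lemma l2c_mult_test:
  assumes f: "f \<in> l2c" and \<eta>: "\<eta> \<in> test_functions U"
  shows "(\<lambda>x. f x * \<eta> x) \<in> l2c"
proof -
  note [measurable] = l2c_measurable[OF f] test_functions_borel[OF \<eta>]
  obtain B where B: "\<And>x. \<bar>\<eta> x\<bar> \<le> B" using test_functions_bounded[OF \<eta>] by auto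
  show ?thesis
    by (rule l2c_dominated[OF _ f, of _ B])
      (auto simp: abs_mult mult.commute[of B] intro: mult_left_mono[OF B])
qed

lemma integrable_mult_cos_sin:
  assumes [measurable]: "integrable lborel f"
  shows "integrable lborel (\<lambda>x. f x * cos (x \<bullet> \<xi>))" "integrable lborel (\<lambda>x. f x * sin (x \<bullet> \<xi>))"
  by (rule Bochner_Integration.integrable_bound[OF assms]; auto simp: abs_mult intro!: mult_left_le)+

text \<open>The weak equation is tested with \<eta> times the cosine and the sine of the plane wave.
  The product rule yields the transform of the derivative of u \<eta>, without any regularity of u
  beyond its weak derivative inside the domain.\<close>

lemma ft_partial_identity:
  fixes u g \<eta> :: "'a::euclidean_space \<Rightarrow> real"
  assumes u: "u \<in> l2c" and g: "g \<in> l2c" and b: "b \<in> Basis" and \<eta>: "\<eta> \<in> test_functions \<Omega>"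
    and weak: "\<And>\<psi>. \<psi> \<in> test_functions \<Omega> \<Longrightarrow> ip lborel u (\<lambda>x. frechet_derivative \<psi> (at x) b) = - ip lborel g \<psi>"
  shows "ft (\<lambda>x. g x * \<eta> x + u x * frechet_derivative \<eta> (at x) b) \<xi> = \<i> * complex_of_real (b \<bullet> \<xi>) * ft (\<lambda>x. u x * \<eta> x) \<xi>"
proof -
  note d\<eta> = test_functions_partial[OF \<eta> b]
  note I1 = integrable_mult_cos_sin[OF l2c_integrable[OF l2c_mult_test[OF g \<eta>]], of \<xi>]
    and I2 = integrable_mult_cos_sin[OF l2c_integrable[OF l2c_mult_test[OF u d\<eta>]], of \<xi>]
    and I3 = integrable_mult_cos_sin[OF l2c_integrable[OF l2c_mult_test[OF u \<eta>]], of \<xi>]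
  have c: "frechet_derivative (\<lambda>x. \<eta> x * cos (x \<bullet> \<xi>)) (at x) b = - (b \<bullet> \<xi>) * (\<eta> x * sin (x \<bullet> \<xi>)) + frechet_derivative \<eta> (at x) b * cos (x \<bullet> \<xi>)" for x
    by (subst C_infinity_partial_mult[OF test_functions_C_infinity[OF \<eta>] C_infinity_cos_inner]) (simp add: partial_cos_inner)
  have s: "frechet_derivative (\<lambda>x. \<eta> x * sin (x \<bullet> \<xi>)) (at x) b = (b \<bullet> \<xi>) * (\<eta> x * cos (x \<bullet> \<xi>)) + frechet_derivative \<eta> (at x) b * sin (x \<bullet> \<xi>)" for x
    by (subst C_infinity_partial_mult[OF test_functions_C_infinity[OF \<eta>] C_infinity_sin_inner]) (simp add: partial_sin_inner)
  have "ip lborel u (\<lambda>x. - (b \<bullet> \<xi>) * (\<eta> x * sin (x \<bullet> \<xi>)) + frechet_derivative \<eta> (at x) b * cos (x \<bullet> \<xi>)) = - ip lborel g (\<lambda>x. \<eta> x * cos (x \<bullet> \<xi>))"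
    using weak[OF test_functions_mult[OF \<eta> C_infinity_cos_inner, of \<xi>]] unfolding c .
  moreover have "ip lborel u (\<lambda>x. - (b \<bullet> \<xi>) * (\<eta> x * sin (x \<bullet> \<xi>)) + frechet_derivative \<eta> (at x) b * cos (x \<bullet> \<xi>)) =
    (LINT x|lborel. - (b \<bullet> \<xi>) * (u x * \<eta> x * sin (x \<bullet> \<xi>)) + u x * frechet_derivative \<eta> (at x) b * cos (x \<bullet> \<xi>))"
    unfolding ip_def by (simp add: algebra_simps)
  moreover have "\<dots> = - (b \<bullet> \<xi>) * (LINT x|lborel. u x * \<eta> x * sin (x \<bullet> \<xi>)) + (LINT x|lborel. u x * frechet_derivative \<eta> (at x) b * cos (x \<bullet> \<xi>))"
    by (subst Bochner_Integration.integral_add[OF integrable_mult_right[OF I3(2)] I2(1)]) (simp only: integral_mult_right_zero)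
  ultimately have C: "- (b \<bullet> \<xi>) * (LINT x|lborel. u x * \<eta> x * sin (x \<bullet> \<xi>)) + (LINT x|lborel. u x * frechet_derivative \<eta> (at x) b * cos (x \<bullet> \<xi>))
      = - (LINT x|lborel. g x * \<eta> x * cos (x \<bullet> \<xi>))"
    by (simp add: ip_def mult.assoc)
  have "ip lborel u (\<lambda>x. (b \<bullet> \<xi>) * (\<eta> x * cos (x \<bullet> \<xi>)) + frechet_derivative \<eta> (at x) b * sin (x \<bullet> \<xi>)) = - ip lborel g (\<lambda>x. \<eta> x * sin (x \<bullet> \<xi>))"
    using weak[OF test_functions_mult[OF \<eta> C_infinity_sin_inner, of \<xi>]] unfolding s .
  moreover have "ip lborel u (\<lambda>x. (b \<bullet> \<xi>) * (\<eta> x * cos (x \<bullet> \<xi>)) + frechet_derivative \<eta> (at x) b * sin (x \<bullet> \<xi>)) =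
    (LINT x|lborel. (b \<bullet> \<xi>) * (u x * \<eta> x * cos (x \<bullet> \<xi>)) + u x * frechet_derivative \<eta> (at x) b * sin (x \<bullet> \<xi>))"
    unfolding ip_def by (simp add: algebra_simps)
  moreover have "\<dots> = (b \<bullet> \<xi>) * (LINT x|lborel. u x * \<eta> x * cos (x \<bullet> \<xi>)) + (LINT x|lborel. u x * frechet_derivative \<eta> (at x) b * sin (x \<bullet> \<xi>))"
    by (subst Bochner_Integration.integral_add[OF integrable_mult_right[OF I3(1)] I2(2)]) (simp only: integral_mult_right_zero)
  ultimately have S: "(b \<bullet> \<xi>) * (LINT x|lborel. u x * \<eta> x * cos (x \<bullet> \<xi>)) + (LINT x|lborel. u x * frechet_derivative \<eta> (at x) b * sin (x \<bullet> \<xi>))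
      = - (LINT x|lborel. g x * \<eta> x * sin (x \<bullet> \<xi>))"
    by (simp add: ip_def mult.assoc)
  have "ft (\<lambda>x. g x * \<eta> x + u x * frechet_derivative \<eta> (at x) b) \<xi> = ft (\<lambda>x. g x * \<eta> x) \<xi> + ft (\<lambda>x. u x * frechet_derivative \<eta> (at x) b) \<xi>"
    by (intro ft_add l2c_integrable l2c_mult_test[OF g \<eta>] l2c_mult_test[OF u d\<eta>])
  also have "\<dots> = \<i> * complex_of_real (b \<bullet> \<xi>) * ft (\<lambda>x. u x * \<eta> x) \<xi>"
    unfolding ft_cos_sin[OF l2c_integrable[OF l2c_mult_test[OF g \<eta>]]] ft_cos_sin[OF l2c_integrable[OF l2c_mult_test[OF u d\<eta>]]]
      ft_cos_sin[OF l2c_integrable[OF l2c_mult_test[OF u \<eta>]]]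
    using C S by (simp add: complex_eq_iff)
  finally show ?thesis .
qed

lemma box_neighbourhood:
  assumes "open \<Omega>" "x \<in> \<Omega>"
  shows "\<exists>a c. x \<in> box a c \<and> cbox a c \<subseteq> \<Omega>"
  using open_contains_cbox[OF assms] by metis

text \<open>Near a point, u is multiplied by a bump. The derivative of the product has the same
  transform as the one given by \<open>weak_partial_exists\<close>, so they agree almost everywhere;
  at zeros of u the Leibniz formula leaves g times the bump, which is positive there.\<close>

lemma partial_zero_on_zero_set:
  fixes u g :: "'a::euclidean_space \<Rightarrow> real"
  assumes O: "open \<Omega>" and u: "u \<in> l2c" and g: "g \<in> l2c" and b: "b \<in> Basis"
    and weak: "\<And>\<psi>. \<psi> \<in> test_functions \<Omega> \<Longrightarrow> ip lborel u (\<lambda>x. frechet_derivative \<psi> (at x) b) = - ip lborel g \<psi>"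
  shows "AE x in lborel. x \<in> \<Omega> \<longrightarrow> u x = 0 \<longrightarrow> g x = 0"
proof (rule AE_local)
  fix x assume "x \<in> \<Omega>"
  then obtain a c where ac: "x \<in> box a c" "cbox a c \<subseteq> \<Omega>" using box_neighbourhood[OF O] by blast
  define \<eta> where "\<eta> = box_bump 1 a c"
  have \<eta>: "\<eta> \<in> test_functions \<Omega>" unfolding \<eta>_def by (rule box_bump_test[OF _ ac(2)]) simp
  note d\<eta> = test_functions_partial[OF \<eta> b]
  let ?w = "\<lambda>x. u x * \<eta> x" and ?F = "\<lambda>x. g x * \<eta> x + u x * frechet_derivative \<eta> (at x) b"
  have w: "?w \<in> l2c" by (rule l2c_mult_test[OF u \<eta>])
  have F: "?F \<in> l2c" by (intro l2c_add l2c_mult_test[OF g \<eta>] l2c_mult_test[OF u d\<eta>])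
  have id: "ft ?F \<xi> = \<i> * complex_of_real (b \<bullet> \<xi>) * ft ?w \<xi>" for \<xi>
    by (rule ft_partial_identity[OF u g b \<eta> weak])
  have "(cmod (ft ?F \<xi>))\<^sup>2 = (b \<bullet> \<xi>)\<^sup>2 * (cmod (ft ?w \<xi>))\<^sup>2" for \<xi>
    unfolding id by (simp add: norm_mult power_mult_distrib)
  then have "integrable lborel (\<lambda>\<xi>. (b \<bullet> \<xi>)\<^sup>2 * (cmod (ft ?w \<xi>))\<^sup>2)" using plancherel(1)[OF F] by (simp only:)
  from weak_partial_exists[OF w this]
  obtain F' where F': "F' \<in> l2c" "\<And>\<xi>. ft F' \<xi> = \<i> * complex_of_real (b \<bullet> \<xi>) * ft ?w \<xi>" "\<And>x. ?w x = 0 \<Longrightarrow> F' x = 0" by blast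
  have "AE x in lborel. F' x = ?F x"
    by (rule plancherel_injective[OF F'(1) F]) (simp only: F'(2) id)
  then have "AE y in lborel. y \<in> box a c \<longrightarrow> u y = 0 \<longrightarrow> g y = 0"
  proof eventually_elim
    case (elim y)
    show ?case
    proof (intro impI)
      assume "y \<in> box a c" "u y = 0"
      moreover from this have "\<eta> y > 0" unfolding \<eta>_def by (subst box_bump_pos_iff) auto
      ultimately show "g y = 0" using elim F'(3)[of y] by simp
    qed
  qed
  then show "\<exists>B. open B \<and> x \<in> B \<and> (AE y in lborel. y \<in> B \<longrightarrow> u y = 0 \<longrightarrow> g y = 0)"
    using ac(1) open_box by blast
qed

text \<open>\<open>h\<close> plays the role of \<open>- \<Delta> u\<close>. The Fourier transform of \<open>\<eta> u\<close> is multiplied by \<open>- |\<xi>|\<^sup>2\<close> under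
  \<open>u \<eta> \<mapsto> - h \<eta> + 2 \<nabla>u \<bullet> \<nabla>\<eta> + u \<Delta>\<eta>\<close>, so second partial derivatives of \<open>u \<eta>\<close> exist in \<open>L\<^sup>2\<close>.\<close>

lemma laplacian_zero_on_zero_set:
  fixes u h :: "'a::euclidean_space \<Rightarrow> real" and g :: "'a \<Rightarrow> 'a \<Rightarrow> real"
  assumes O: "open \<Omega>" and u: "u \<in> l2c" and g: "\<And>b. b \<in> Basis \<Longrightarrow> g b \<in> l2c" and h: "h \<in> l2c"
    and weak: "\<And>b \<psi>. b \<in> Basis \<Longrightarrow> \<psi> \<in> test_functions \<Omega> \<Longrightarrow> ip lborel u (\<lambda>x. frechet_derivative \<psi> (at x) b) = - ip lborel (g b) \<psi>"
    and eq: "\<And>\<psi>. \<psi> \<in> test_functions \<Omega> \<Longrightarrow> (\<Sum>b\<in>Basis. ip lborel (g b) (\<lambda>x. frechet_derivative \<psi> (at x) b)) = ip lborel h \<psi>"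
  shows "AE x in lborel. x \<in> \<Omega> \<longrightarrow> u x = 0 \<longrightarrow> h x = 0"
proof (rule AE_local)
  fix x assume "x \<in> \<Omega>"
  then obtain a c where ac: "x \<in> box a c" "cbox a c \<subseteq> \<Omega>" using box_neighbourhood[OF O] by blast
  define \<eta> where "\<eta> = box_bump 1 a c"
  have \<eta>: "\<eta> \<in> test_functions \<Omega>" unfolding \<eta>_def by (rule box_bump_test[OF _ ac(2)]) simp
  define d where "d b x = frechet_derivative \<eta> (at x) b" for b x
  have d: "d b \<in> test_functions \<Omega>" if "b \<in> Basis" for b unfolding d_def[abs_def] by (rule test_functions_partial[OF \<eta> that])
  define dd where "dd b x = frechet_derivative (d b) (at x) b" for b x
  have dd: "dd b \<in> test_functions \<Omega>" if "b \<in> Basis" for b unfolding dd_def[abs_def] by (rule test_functions_partial[OF d[OF that] that])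
  let ?w = "\<lambda>x. u x * \<eta> x" and ?F = "\<lambda>b x. g b x * \<eta> x + u x * d b x"
  have w: "?w \<in> l2c" by (rule l2c_mult_test[OF u \<eta>])
  have F: "?F b \<in> l2c" if "b \<in> Basis" for b by (intro l2c_add l2c_mult_test[OF g[OF that] \<eta>] l2c_mult_test[OF u d[OF that]])
  have id1: "ft (?F b) \<xi> = \<i> * complex_of_real (b \<bullet> \<xi>) * ft ?w \<xi>" if "b \<in> Basis" for b \<xi>
    unfolding d_def by (rule ft_partial_identity[OF u g[OF that] that \<eta> weak[OF that]])
  have id2: "ft (\<lambda>x. g b x * d b x + u x * dd b x) \<xi> = \<i> * complex_of_real (b \<bullet> \<xi>) * ft (\<lambda>x. u x * d b x) \<xi>" if "b \<in> Basis" for b \<xi>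
    unfolding dd_def by (rule ft_partial_identity[OF u g[OF that] that d[OF that] weak[OF that]])
  have id3: "(\<Sum>b\<in>Basis. \<i> * complex_of_real (b \<bullet> \<xi>) * ft (\<lambda>x. g b x * \<eta> x) \<xi>) = (\<Sum>b\<in>Basis. ft (\<lambda>x. g b x * d b x) \<xi>) - ft (\<lambda>x. h x * \<eta> x) \<xi>" for \<xi>
  proof -
    let ?C = "\<lambda>f. (LINT x|lborel. f x * cos (x \<bullet> \<xi>))" and ?S = "\<lambda>f. (LINT x|lborel. f x * sin (x \<bullet> \<xi>))"
    have ic: "ip lborel (g b) (\<lambda>x. frechet_derivative (\<lambda>x. \<eta> x * cos (x \<bullet> \<xi>)) (at x) b) = ?C (\<lambda>x. g b x * d b x) - (b \<bullet> \<xi>) * ?S (\<lambda>x. g b x * \<eta> x)" if b: "b \<in> Basis" for b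
    proof -
      note I1 = integrable_mult_cos_sin[OF l2c_integrable[OF l2c_mult_test[OF g[OF b] \<eta>]], of \<xi>]
        and I2 = integrable_mult_cos_sin[OF l2c_integrable[OF l2c_mult_test[OF g[OF b] d[OF b]]], of \<xi>]
      have "ip lborel (g b) (\<lambda>x. frechet_derivative (\<lambda>x. \<eta> x * cos (x \<bullet> \<xi>)) (at x) b) =
        (LINT x|lborel. g b x * d b x * cos (x \<bullet> \<xi>) - (b \<bullet> \<xi>) * (g b x * \<eta> x * sin (x \<bullet> \<xi>)))"
        unfolding ip_def d_def
        by (subst C_infinity_partial_mult[OF test_functions_C_infinity[OF \<eta>] C_infinity_cos_inner]) (simp add: partial_cos_inner algebra_simps)
      also have "\<dots> = ?C (\<lambda>x. g b x * d b x) - (b \<bullet> \<xi>) * ?S (\<lambda>x. g b x * \<eta> x)"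
        by (subst Bochner_Integration.integral_diff[OF I2(1) integrable_mult_right[OF I1(2)]]) (simp only: integral_mult_right_zero)
      finally show ?thesis .
    qed
    have iss: "ip lborel (g b) (\<lambda>x. frechet_derivative (\<lambda>x. \<eta> x * sin (x \<bullet> \<xi>)) (at x) b) = ?S (\<lambda>x. g b x * d b x) + (b \<bullet> \<xi>) * ?C (\<lambda>x. g b x * \<eta> x)" if b: "b \<in> Basis" for b
    proof -
      note I1 = integrable_mult_cos_sin[OF l2c_integrable[OF l2c_mult_test[OF g[OF b] \<eta>]], of \<xi>]
        and I2 = integrable_mult_cos_sin[OF l2c_integrable[OF l2c_mult_test[OF g[OF b] d[OF b]]], of \<xi>]
      have "ip lborel (g b) (\<lambda>x. frechet_derivative (\<lambda>x. \<eta> x * sin (x \<bullet> \<xi>)) (at x) b) =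
        (LINT x|lborel. g b x * d b x * sin (x \<bullet> \<xi>) + (b \<bullet> \<xi>) * (g b x * \<eta> x * cos (x \<bullet> \<xi>)))"
        unfolding ip_def d_def
        by (subst C_infinity_partial_mult[OF test_functions_C_infinity[OF \<eta>] C_infinity_sin_inner]) (simp add: partial_sin_inner algebra_simps)
      also have "\<dots> = ?S (\<lambda>x. g b x * d b x) + (b \<bullet> \<xi>) * ?C (\<lambda>x. g b x * \<eta> x)"
        by (subst Bochner_Integration.integral_add[OF I2(2) integrable_mult_right[OF I1(1)]]) (simp only: integral_mult_right_zero)
      finally show ?thesis .
    qed
    have C: "(\<Sum>b\<in>Basis. ?C (\<lambda>x. g b x * d b x)) - (\<Sum>b\<in>Basis. (b \<bullet> \<xi>) * ?S (\<lambda>x. g b x * \<eta> x)) = ?C (\<lambda>x. h x * \<eta> x)"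
      using eq[OF test_functions_mult[OF \<eta> C_infinity_cos_inner, of \<xi>]]
      by (simp add: ic sum_subtractf) (simp add: ip_def mult.assoc)
    have S: "(\<Sum>b\<in>Basis. ?S (\<lambda>x. g b x * d b x)) + (\<Sum>b\<in>Basis. (b \<bullet> \<xi>) * ?C (\<lambda>x. g b x * \<eta> x)) = ?S (\<lambda>x. h x * \<eta> x)"
      using eq[OF test_functions_mult[OF \<eta> C_infinity_sin_inner, of \<xi>]]
      by (simp add: iss sum.distrib) (simp add: ip_def mult.assoc)
    have "(\<Sum>b\<in>Basis. \<i> * complex_of_real (b \<bullet> \<xi>) * ft (\<lambda>x. g b x * \<eta> x) \<xi>) =
      (\<Sum>b\<in>Basis. Complex ((b \<bullet> \<xi>) * ?S (\<lambda>x. g b x * \<eta> x)) ((b \<bullet> \<xi>) * ?C (\<lambda>x. g b x * \<eta> x)))"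
      by (intro sum.cong refl) (simp add: ft_cos_sin[OF l2c_integrable[OF l2c_mult_test[OF g \<eta>]]] complex_eq_iff)
    moreover have "(\<Sum>b\<in>Basis. ft (\<lambda>x. g b x * d b x) \<xi>) =
      (\<Sum>b\<in>Basis. Complex (?C (\<lambda>x. g b x * d b x)) (- ?S (\<lambda>x. g b x * d b x)))"
      by (intro sum.cong refl ft_cos_sin l2c_integrable l2c_mult_test[OF g d])
    ultimately show ?thesis
      using C S by (simp add: ft_cos_sin[OF l2c_integrable[OF l2c_mult_test[OF h \<eta>]]] complex_eq_iff sum_negf)
  qed
  let ?H = "\<lambda>x. (\<Sum>b\<in>Basis. 2 * (g b x * d b x) + u x * dd b x) - h x * \<eta> x"
  have Hb: "(\<lambda>x. 2 * (g b x * d b x) + u x * dd b x) \<in> l2c" if "b \<in> Basis" for b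
    by (intro l2c_add l2c_scale l2c_mult_test[OF g[OF that] d[OF that]] l2c_mult_test[OF u dd[OF that]])
  have Hs: "(\<lambda>x. \<Sum>b\<in>Basis. 2 * (g b x * d b x) + u x * dd b x) \<in> l2c" by (rule l2c_sum[OF Hb])
  have H: "?H \<in> l2c" by (intro l2c_diff Hs l2c_mult_test[OF h \<eta>])
  have ftH: "ft ?H \<xi> = (\<Sum>b\<in>Basis. (\<i> * complex_of_real (b \<bullet> \<xi>)) * ((\<i> * complex_of_real (b \<bullet> \<xi>)) * ft ?w \<xi>))" for \<xi>
  proof -
    have "ft ?H \<xi> = (\<Sum>b\<in>Basis. ft (\<lambda>x. 2 * (g b x * d b x) + u x * dd b x) \<xi>) - ft (\<lambda>x. h x * \<eta> x) \<xi>"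
      by (subst ft_diff[OF l2c_integrable[OF Hs] l2c_integrable[OF l2c_mult_test[OF h \<eta>]]], subst ft_sum[OF l2c_integrable[OF Hb]]) auto
    also have "(\<Sum>b\<in>Basis. ft (\<lambda>x. 2 * (g b x * d b x) + u x * dd b x) \<xi>) =
       (\<Sum>b\<in>Basis. ft (\<lambda>x. g b x * d b x) \<xi> + ft (\<lambda>x. g b x * d b x + u x * dd b x) \<xi>)"
    proof (intro sum.cong refl)
      fix b :: 'a assume b: "b \<in> Basis"
      \<comment> \<open>One copy of \<open>g b x * d b x\<close> completes the derivative of
        \<open>u x * d b x\<close> in \<open>id2\<close>; the other combines with h through
        \<open>id3\<close>.\<close>
      have "(\<lambda>x. 2 * (g b x * d b x) + u x * dd b x) = (\<lambda>x. g b x * d b x + (g b x * d b x + u x * dd b x))" by (simp add: algebra_simps)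
      then show "ft (\<lambda>x. 2 * (g b x * d b x) + u x * dd b x) \<xi> = ft (\<lambda>x. g b x * d b x) \<xi> + ft (\<lambda>x. g b x * d b x + u x * dd b x) \<xi>"
        by (simp only:) (intro ft_add l2c_integrable l2c_add l2c_mult_test[OF g[OF b] d[OF b]] l2c_mult_test[OF u dd[OF b]])
    qed
    also have "\<dots> = (\<Sum>b\<in>Basis. ft (\<lambda>x. g b x * d b x) \<xi>) + (\<Sum>b\<in>Basis. \<i> * complex_of_real (b \<bullet> \<xi>) * ft (\<lambda>x. u x * d b x) \<xi>)"
      by (simp only: sum.distrib) (simp add: id2)
    finally have "ft ?H \<xi> = (\<Sum>b\<in>Basis. \<i> * complex_of_real (b \<bullet> \<xi>) * ft (\<lambda>x. g b x * \<eta> x) \<xi>) + (\<Sum>b\<in>Basis. \<i> * complex_of_real (b \<bullet> \<xi>) * ft (\<lambda>x. u x * d b x) \<xi>)"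
      by (simp only: id3 diff_add_eq)
    also have "\<dots> = (\<Sum>b\<in>Basis. \<i> * complex_of_real (b \<bullet> \<xi>) * ft (?F b) \<xi>)"
      unfolding sum.distrib[symmetric]
    proof (intro sum.cong refl)
      fix b :: 'a assume b: "b \<in> Basis"
      have "ft (?F b) \<xi> = ft (\<lambda>x. g b x * \<eta> x) \<xi> + ft (\<lambda>x. u x * d b x) \<xi>"
        by (intro ft_add l2c_integrable l2c_mult_test[OF g[OF b] \<eta>] l2c_mult_test[OF u d[OF b]])
      then show "\<i> * complex_of_real (b \<bullet> \<xi>) * ft (\<lambda>x. g b x * \<eta> x) \<xi> + \<i> * complex_of_real (b \<bullet> \<xi>) * ft (\<lambda>x. u x * d b x) \<xi> = \<i> * complex_of_real (b \<bullet> \<xi>) * ft (?F b) \<xi>"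
        by (simp only: distrib_left)
    qed
    also have "\<dots> = (\<Sum>b\<in>Basis. (\<i> * complex_of_real (b \<bullet> \<xi>)) * ((\<i> * complex_of_real (b \<bullet> \<xi>)) * ft ?w \<xi>))"
      by (intro sum.cong refl) (simp only: id1)
    finally show ?thesis .
  qed
  have normH: "cmod (ft ?H \<xi>) = (norm \<xi>)\<^sup>2 * cmod (ft ?w \<xi>)" for \<xi>
  proof -
    have "ft ?H \<xi> = complex_of_real (- (\<Sum>b\<in>Basis. (b \<bullet> \<xi>)\<^sup>2)) * ft ?w \<xi>"
    proof -
      have "(\<i> * complex_of_real t) * ((\<i> * complex_of_real t) * z) = complex_of_real (- (t\<^sup>2)) * z" for t z
        by (simp add: complex_eq_iff power2_eq_square algebra_simps)
      then show ?thesis unfolding ftH by (simp only: sum_distrib_right[symmetric] of_real_sum[symmetric] sum_negf)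
    qed
    also have "(\<Sum>b\<in>Basis. (b \<bullet> \<xi>)\<^sup>2) = (norm \<xi>)\<^sup>2" by (subst norm_square_Basis_sum) (simp add: inner_commute)
    finally show ?thesis by (simp only: norm_mult norm_of_real abs_minus_cancel) simp
  qed
  \<comment> \<open>The fourth power of |\<xi>| dominates that of each coordinate, so the bound on
    the Laplacian of the product bounds each pure second derivative separately.\<close>
  have i4: "integrable lborel (\<lambda>\<xi>. norm \<xi> ^ 4 * (cmod (ft ?w \<xi>))\<^sup>2)"
  proof -
    have "(cmod (ft ?H \<xi>))\<^sup>2 = norm \<xi> ^ 4 * (cmod (ft ?w \<xi>))\<^sup>2" for \<xi>
      unfolding normH by (simp add: power_mult_distrib flip: power_mult)
    then show ?thesis using plancherel(1)[OF H] by (simp only:)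
  qed
  \<comment> \<open>\<open>weak_partial_exists\<close> is applied twice in the same direction, and
    each application preserves the zero set.\<close>
  have "\<exists>F2\<in>l2c. (\<forall>\<xi>. ft F2 \<xi> = (\<i> * complex_of_real (b \<bullet> \<xi>)) * ((\<i> * complex_of_real (b \<bullet> \<xi>)) * ft ?w \<xi>)) \<and> (\<forall>x. ?w x = 0 \<longrightarrow> F2 x = 0)"
    if b: "b \<in> Basis" for b
  proof -
    have n1: "(cmod (ft (?F b) \<xi>))\<^sup>2 = (b \<bullet> \<xi>)\<^sup>2 * (cmod (ft ?w \<xi>))\<^sup>2" for \<xi>
      unfolding id1[OF b] by (simp add: norm_mult power_mult_distrib)
    have "integrable lborel (\<lambda>\<xi>. (b \<bullet> \<xi>)\<^sup>2 * (cmod (ft ?w \<xi>))\<^sup>2)" using plancherel(1)[OF F[OF b]] by (simp only: n1)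
    from weak_partial_exists[OF w this]
    obtain F1 where F1: "F1 \<in> l2c" "\<And>\<xi>. ft F1 \<xi> = \<i> * complex_of_real (b \<bullet> \<xi>) * ft ?w \<xi>" "\<And>x. ?w x = 0 \<Longrightarrow> F1 x = 0" by blast
    have ile: "(b \<bullet> \<xi>)\<^sup>2 \<le> (norm \<xi>)\<^sup>2" for \<xi>
      using Cauchy_Schwarz_ineq2[of b \<xi>] b by (simp add: abs_le_square_iff[symmetric])
    have "integrable lborel (\<lambda>\<xi>. ((b \<bullet> \<xi>)\<^sup>2 * (b \<bullet> \<xi>)\<^sup>2) * (cmod (ft ?w \<xi>))\<^sup>2)"
    proof (rule weighted_integrable_mono[OF w _ _ _ i4])
      fix \<xi> :: 'a
      have "(b \<bullet> \<xi>)\<^sup>2 * (b \<bullet> \<xi>)\<^sup>2 \<le> (norm \<xi>)\<^sup>2 * (norm \<xi>)\<^sup>2" by (intro mult_mono ile) auto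
      also have "\<dots> = norm \<xi> ^ 4" by (simp flip: power_add)
      finally show "(b \<bullet> \<xi>)\<^sup>2 * (b \<bullet> \<xi>)\<^sup>2 \<le> 1 + norm \<xi> ^ 4" by simp
    qed auto
    moreover have "((b \<bullet> \<xi>)\<^sup>2 * (b \<bullet> \<xi>)\<^sup>2) * (cmod (ft ?w \<xi>))\<^sup>2 = (b \<bullet> \<xi>)\<^sup>2 * (cmod (ft F1 \<xi>))\<^sup>2" for \<xi>
      unfolding F1(2) by (simp add: norm_mult power_mult_distrib)
    ultimately have "integrable lborel (\<lambda>\<xi>. (b \<bullet> \<xi>)\<^sup>2 * (cmod (ft F1 \<xi>))\<^sup>2)" by (simp only:)
    from weak_partial_exists[OF F1(1) this]
    obtain F2 where F2: "F2 \<in> l2c" "\<And>\<xi>. ft F2 \<xi> = \<i> * complex_of_real (b \<bullet> \<xi>) * ft F1 \<xi>" "\<And>x. F1 x = 0 \<Longrightarrow> F2 x = 0" by blast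
    show ?thesis
    proof (rule bexI[OF _ F2(1)], intro conjI allI impI)
      show "ft F2 \<xi> = (\<i> * complex_of_real (b \<bullet> \<xi>)) * ((\<i> * complex_of_real (b \<bullet> \<xi>)) * ft ?w \<xi>)" for \<xi>
        unfolding F2(2) F1(2) ..
      show "F2 x = 0" if "?w x = 0" for x using F2(3)[OF F1(3)[OF that]] .
    qed
  qed
  then have "\<forall>b\<in>Basis. \<exists>F2. F2 \<in> l2c \<and> (\<forall>\<xi>. ft F2 \<xi> = (\<i> * complex_of_real (b \<bullet> \<xi>)) * ((\<i> * complex_of_real (b \<bullet> \<xi>)) * ft ?w \<xi>)) \<and> (\<forall>x. ?w x = 0 \<longrightarrow> F2 x = 0)"
    by blast
  from bchoice[OF this] obtain F2 where F2: "\<forall>b\<in>Basis. F2 b \<in> l2c \<and> (\<forall>\<xi>. ft (F2 b) \<xi> = (\<i> * complex_of_real (b \<bullet> \<xi>)) * ((\<i> * complex_of_real (b \<bullet> \<xi>)) * ft ?w \<xi>)) \<and> (\<forall>x. ?w x = 0 \<longrightarrow> F2 b x = 0)"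
    by (rule exE)
  then have F2l: "\<And>b. b \<in> Basis \<Longrightarrow> F2 b \<in> l2c" by blast
  have "AE x in lborel. (\<Sum>b\<in>Basis. F2 b x) = ?H x"
  proof (rule plancherel_injective[OF l2c_sum[OF F2l] H])
    fix \<xi> :: 'a
    have "ft (\<lambda>x. \<Sum>b\<in>Basis. F2 b x) \<xi> = (\<Sum>b\<in>Basis. ft (F2 b) \<xi>)" by (rule ft_sum[OF l2c_integrable[OF F2l]])
    also have "\<dots> = ft ?H \<xi>" unfolding ftH using F2 by (intro sum.cong refl) blast
    finally show "ft (\<lambda>x. \<Sum>b\<in>Basis. F2 b x) \<xi> = ft ?H \<xi>" .
  qed simp
  moreover have "AE x in lborel. \<forall>b\<in>Basis. x \<in> \<Omega> \<longrightarrow> u x = 0 \<longrightarrow> g b x = 0"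
    by (subst AE_ball_countable) (auto intro!: countable_finite partial_zero_on_zero_set[OF O u g _ weak])
  ultimately have "AE y in lborel. y \<in> box a c \<longrightarrow> u y = 0 \<longrightarrow> h y = 0"
  proof eventually_elim
    case (elim y)
    show ?case
    proof (intro impI)
      assume y: "y \<in> box a c" "u y = 0"
      then have y\<Omega>: "y \<in> \<Omega>" using ac(2) box_subset_cbox by blast
      have pos: "\<eta> y > 0" using y unfolding \<eta>_def by (subst box_bump_pos_iff) auto
      have "(\<Sum>b\<in>Basis. F2 b y) = 0" using F2 y(2) by (intro sum.neutral) auto
      \<comment> \<open>The first order terms vanish at zeros of u by
        \<open>partial_zero_on_zero_set\<close>, so that only h times the bump remains.\<close>
      moreover have "(\<Sum>b\<in>Basis. 2 * (g b y * d b y) + u y * dd b y) = 0" using elim(2) y\<Omega> y(2) by (intro sum.neutral) auto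
      ultimately show "h y = 0" using elim(1) pos by simp
    qed
  qed
  then show "\<exists>B. open B \<and> x \<in> B \<and> (AE y in lborel. y \<in> B \<longrightarrow> u y = 0 \<longrightarrow> h y = 0)"
    using ac(1) open_box by blast
qed

section \<open>Irreducibility\<close>

text \<open>In frequency a shift by h changes the transform by a factor of modulus at most |h|
  |\<xi>|, so one square integrable derivative gives a bound quadratic in |h|.\<close>

lemma shift_difference_bound:
  fixes w :: "'a::euclidean_space \<Rightarrow> real"
  assumes w: "w \<in> l2c" and i: "integrable lborel (\<lambda>\<xi>. (norm \<xi>)\<^sup>2 * (cmod (ft w \<xi>))\<^sup>2)"
  shows "\<exists>C\<ge>0. \<forall>h. ip lborel (\<lambda>x. w (x + h) - w x) (\<lambda>x. w (x + h) - w x) \<le> C * (norm h)\<^sup>2"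
proof -
  define \<kappa> where "\<kappa> = (2 * pi) ^ DIM('a)"
  have \<kappa>: "\<kappa> > 0" by (simp add: \<kappa>_def)
  define A where "A = (LINT \<xi>|lborel. (norm \<xi>)\<^sup>2 * (cmod (ft w \<xi>))\<^sup>2)"
  have "ip lborel (\<lambda>x. w (x + h) - w x) (\<lambda>x. w (x + h) - w x) \<le> A / \<kappa> * (norm h)\<^sup>2" for h
  proof -
    have d: "(\<lambda>x. w (x + h) - w x) \<in> l2c" by (intro l2c_diff l2c_shift w)
    have "\<kappa> * ip lborel (\<lambda>x. w (x + h) - w x) (\<lambda>x. w (x + h) - w x) = (LINT \<xi>|lborel. (cmod (ft (\<lambda>x. w (x + h) - w x) \<xi>))\<^sup>2)"
      unfolding \<kappa>_def by (rule plancherel(2)[OF d, symmetric])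
    also have "\<dots> \<le> (LINT \<xi>|lborel. (norm h)\<^sup>2 * ((norm \<xi>)\<^sup>2 * (cmod (ft w \<xi>))\<^sup>2))"
    proof (rule integral_mono[OF plancherel(1)[OF d] integrable_mult_right[OF i]])
      fix \<xi>
      have "ft (\<lambda>x. w (x + h) - w x) \<xi> = ft (\<lambda>x. w (x + h)) \<xi> - ft w \<xi>"
        by (intro ft_diff l2c_integrable l2c_shift w)
      also have "ft (\<lambda>x. w (x + h)) \<xi> = cis (h \<bullet> \<xi>) * ft w \<xi>" by (rule ft_shift[OF l2c_measurable[OF w]])
      finally have "cmod (ft (\<lambda>x. w (x + h) - w x) \<xi>) = cmod (cis (h \<bullet> \<xi>) - 1) * cmod (ft w \<xi>)"
        by (simp add: norm_mult[symmetric] left_diff_distrib)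
      also have "\<dots> \<le> (norm h * norm \<xi>) * cmod (ft w \<xi>)"
        using order_trans[OF cis_minus_one_bound Cauchy_Schwarz_ineq2] by (rule mult_right_mono) simp
      finally have "(cmod (ft (\<lambda>x. w (x + h) - w x) \<xi>))\<^sup>2 \<le> ((norm h * norm \<xi>) * cmod (ft w \<xi>))\<^sup>2"
        by (intro power_mono) auto
      then show "(cmod (ft (\<lambda>x. w (x + h) - w x) \<xi>))\<^sup>2 \<le> (norm h)\<^sup>2 * ((norm \<xi>)\<^sup>2 * (cmod (ft w \<xi>))\<^sup>2)"
        by (simp add: power_mult_distrib mult.assoc)
    qed
    also have "\<dots> = (norm h)\<^sup>2 * A" unfolding A_def by (rule integral_mult_right_zero)
    finally show ?thesis using \<kappa> by (simp add: field_simps)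
  qed
  moreover have "A / \<kappa> \<ge> 0" using \<kappa> by (simp add: A_def)
  ultimately show ?thesis by blast
qed

lemma emeasure_lborel_shift:
  fixes A :: "'a::euclidean_space set"
  assumes "A \<in> sets borel"
  shows "emeasure lborel ((\<lambda>x. x + a) -` A) = emeasure lborel A"
proof -
  have "emeasure (distr lborel borel ((+) a)) A = emeasure lborel ((+) a -` A \<inter> space lborel)"
    by (rule emeasure_distr) (use assms in auto)
  then show ?thesis by (simp add: lborel_distr_plus add.commute[of a] vimage_def)
qed

lemma AE_lborel_shift:
  fixes x :: "'a::euclidean_space"
  assumes "{y. P y} \<in> sets borel" "AE h in lborel. P (x + h)"
  shows "AE y in lborel. P y"
proof -
  have "AE y in distr lborel borel ((+) x). P y"
    using assms by (subst AE_distr_iff) auto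
  then show ?thesis unfolding lborel_distr_plus .
qed

text \<open>Cutting a shift into \<open>n\<close> equal steps gains a factor \<open>1 / n\<close>, since an indicator function has
  \<open>\<bar>\<chi> - \<chi>'\<bar> = \<bar>\<chi> - \<chi>'\<bar>\<^sup>2\<close>.\<close>

lemma indicator_shift_invariant:
  fixes \<theta> v :: "'a::euclidean_space \<Rightarrow> real"
  assumes [measurable]: "E \<in> sets borel" "B \<in> sets borel" and cB: "convex B"
    and c: "c > 0" "\<And>x. x \<in> B \<Longrightarrow> c \<le> \<theta> x"
    and v: "v \<in> l2c" "\<And>x. v x = (if x \<in> E then \<theta> x else 0)"
    and C: "C \<ge> 0" "\<And>h. ip lborel (\<lambda>x. v (x + h) - v x) (\<lambda>x. v (x + h) - v x) \<le> C * (norm h)\<^sup>2"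
  shows "AE x in lborel. x \<in> B \<longrightarrow> x + h \<in> B \<longrightarrow> (x \<in> E \<longleftrightarrow> x + h \<in> E)"
proof -
  define D where "D h = {x. x \<in> B \<and> x + h \<in> B \<and> (x \<in> E) \<noteq> (x + h \<in> E)}" for h
  have D_meas [measurable]: "D h \<in> sets borel" for h
  proof -
    have "{x \<in> space borel. x \<in> B \<and> x + h \<in> B \<and> (x \<in> E) \<noteq> (x + h \<in> E)} \<in> sets borel" by measurable
    then show ?thesis by (simp add: D_def)
  qed
  \<comment> \<open>If exactly one of x and x + h lies in E, and both lie in B, then v jumps by at
    least c. Chebyshev converts the quadratic bound on the jump into one on the measure of such
    x.\<close>
  have est: "emeasure lborel (D h) \<le> ennreal (C * (norm h)\<^sup>2 / c\<^sup>2)" for h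
  proof -
    have d: "(\<lambda>x. v (x + h) - v x) \<in> l2c" by (intro l2c_diff l2c_shift v)
    have "emeasure lborel (D h) = (\<integral>\<^sup>+x. indicator (D h) x \<partial>lborel)" by simp
    also have "\<dots> \<le> (\<integral>\<^sup>+x. ennreal (((1 / c) * (v (x + h) - v x))\<^sup>2) \<partial>lborel)"
    proof (rule nn_integral_mono)
      fix x
      have "1 \<le> ((1 / c) * (v (x + h) - v x))\<^sup>2" if "x \<in> D h"
      proof -
        have "c \<le> \<bar>v (x + h) - v x\<bar>" using that c(2)[of x] c(2)[of "x + h"] c(1) by (auto simp: D_def v(2))
        then have "1 \<le> \<bar>(1 / c) * (v (x + h) - v x)\<bar>" using c(1) by (simp add: abs_mult)
        then have "1\<^sup>2 \<le> \<bar>(1 / c) * (v (x + h) - v x)\<bar>\<^sup>2" by (intro power_mono) auto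
        then show ?thesis by (simp only: power2_abs one_power2)
      qed
      then show "indicator (D h) x \<le> ennreal (((1 / c) * (v (x + h) - v x))\<^sup>2)"
        by (auto simp: indicator_def)
    qed
    also have "\<dots> = ennreal (ip lborel (\<lambda>x. (1 / c) * (v (x + h) - v x)) (\<lambda>x. (1 / c) * (v (x + h) - v x)))"
      by (rule nn_integral_square_l2[OF l2_scale[OF l2cD[OF d]]])
    also have "ip lborel (\<lambda>x. (1 / c) * (v (x + h) - v x)) (\<lambda>x. (1 / c) * (v (x + h) - v x)) =
      ip lborel (\<lambda>x. v (x + h) - v x) (\<lambda>x. v (x + h) - v x) / c\<^sup>2"
      unfolding ip_scale_left ip_scale_right by (simp add: power2_eq_square)
    also have "ennreal \<dots> \<le> ennreal (C * (norm h)\<^sup>2 / c\<^sup>2)"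
      by (intro ennreal_leI divide_right_mono C) simp
    finally show ?thesis .
  qed
  have steps: "emeasure lborel (D h) \<le> ennreal (C * (norm h)\<^sup>2 / c\<^sup>2 * inverse (real (Suc n)))" for n
  proof -
    let ?N = "real (Suc n)"
    define t where "t k = real k / ?N" for k
    let ?h = "(1 / ?N) *\<^sub>R h"
    \<comment> \<open>If membership in E changes between x and x + h, it changes in one of the equal
      steps, and convexity keeps all the intermediate points in B. The n + 1 steps cost (n + 1)
      times a bound that has shrunk by (n + 1)^2.\<close>
    have sub: "D h \<subseteq> (\<Union>k<Suc n. (\<lambda>x. x + t k *\<^sub>R h) -` D ?h)"
    proof
      fix x assume x: "x \<in> D h"
      have inB: "x + t k *\<^sub>R h \<in> B" if "k \<le> Suc n" for k
      proof -
        have t: "0 \<le> t k" "t k \<le> 1" using that by (auto simp: t_def)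
        have "(1 - t k) *\<^sub>R x + t k *\<^sub>R (x + h) \<in> B"
          using x t by (intro convexD[OF cB]) (auto simp: D_def)
        then show ?thesis by (simp add: algebra_simps)
      qed
      have "\<exists>k<Suc n. (x + t k *\<^sub>R h \<in> E) \<noteq> (x + t (Suc k) *\<^sub>R h \<in> E)"
      proof (rule ccontr)
        assume "\<not> ?thesis"
        then have eq: "(x + t k *\<^sub>R h \<in> E) = (x + t (Suc k) *\<^sub>R h \<in> E)" if "k < Suc n" for k using that by blast
        have "(x + t k *\<^sub>R h \<in> E) = (x \<in> E)" if "k \<le> Suc n" for k
          using that
        proof (induction k)
          case (Suc k)
          then show ?case using eq[of k] by simp
        qed (simp add: t_def)
        from this[of "Suc n"] have "(x + h \<in> E) = (x \<in> E)" by (simp add: t_def)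
        with x show False by (auto simp: D_def)
      qed
      then obtain k where k: "k < Suc n" "(x + t k *\<^sub>R h \<in> E) \<noteq> (x + t (Suc k) *\<^sub>R h \<in> E)" by blast
      have "t (Suc k) *\<^sub>R h = t k *\<^sub>R h + ?h"
        by (simp add: t_def add_divide_distrib scaleR_add_left[symmetric] add.commute)
      then have "x + t k *\<^sub>R h \<in> D ?h"
        using k inB[of k] inB[of "Suc k"] by (simp add: D_def add.assoc)
      then show "x \<in> (\<Union>k<Suc n. (\<lambda>x. x + t k *\<^sub>R h) -` D ?h)" using k(1) by auto
    qed
    have "emeasure lborel (D h) \<le> emeasure lborel (\<Union>k<Suc n. (\<lambda>x. x + t k *\<^sub>R h) -` D ?h)"
    proof (rule emeasure_mono[OF sub])
      have "(\<lambda>x. x + t k *\<^sub>R h) -` D ?h \<in> sets borel" for k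
        using measurable_sets[of "\<lambda>x. x + t k *\<^sub>R h" borel borel "D ?h"] by simp
      then show "(\<Union>k<Suc n. (\<lambda>x. x + t k *\<^sub>R h) -` D ?h) \<in> sets lborel" by (auto intro!: sets.finite_UN)
    qed
    also have "\<dots> \<le> (\<Sum>k<Suc n. emeasure lborel ((\<lambda>x. x + t k *\<^sub>R h) -` D ?h))"
    proof (rule emeasure_subadditive_finite)
      show "(\<lambda>k. (\<lambda>x. x + t k *\<^sub>R h) -` D ?h) ` {..<Suc n} \<subseteq> sets lborel"
        using measurable_sets[of "\<lambda>x. x + t _ *\<^sub>R h" borel borel "D ?h"] by auto
    qed simp
    also have "\<dots> = (\<Sum>k<Suc n. emeasure lborel (D ?h))"
      by (intro sum.cong refl emeasure_lborel_shift) measurable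
    also have "\<dots> \<le> (\<Sum>k<Suc n. ennreal (C * (norm ?h)\<^sup>2 / c\<^sup>2))" by (intro sum_mono est)
    also have "\<dots> = ennreal (?N * (C * (norm ?h)\<^sup>2 / c\<^sup>2))"
      unfolding sum_constant card_lessThan
      by (simp only: ennreal_of_nat_eq_real_of_nat ennreal_mult'[OF of_nat_0_le_iff])
    also have "?N * (C * (norm ?h)\<^sup>2 / c\<^sup>2) = C * (norm h)\<^sup>2 / c\<^sup>2 * inverse ?N"
      by (simp add: power_divide field_simps power2_eq_square del: of_nat_Suc)
    finally show ?thesis .
  qed
  have "emeasure lborel (D h) \<le> 0"
  proof (rule LIMSEQ_le_const)
    have "(\<lambda>n. C * (norm h)\<^sup>2 / c\<^sup>2 * inverse (real (Suc n))) \<longlonglongrightarrow> C * (norm h)\<^sup>2 / c\<^sup>2 * 0"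
      by (intro tendsto_intros LIMSEQ_inverse_real_of_nat)
    from tendsto_ennrealI[OF this]
    show "(\<lambda>n. ennreal (C * (norm h)\<^sup>2 / c\<^sup>2 * inverse (real (Suc n)))) \<longlonglongrightarrow> 0" by simp
    show "\<exists>N. \<forall>n\<ge>N. emeasure lborel (D h) \<le> ennreal (C * (norm h)\<^sup>2 / c\<^sup>2 * inverse (real (Suc n)))"
      using steps by blast
  qed
  then have "D h \<in> null_sets lborel" by (intro null_setsI) auto
  then have "AE x in lborel. x \<notin> D h" by (rule AE_not_in)
  then show ?thesis by eventually_elim (auto simp: D_def)
qed

text \<open>Fubini exchanges the quantifiers: for almost every x, almost every y of B lies on the
  same side of E as x. A single such x in B and E then decides for almost all of B.\<close>

lemma shift_invariant_dichotomy:
  fixes E B :: "'a::euclidean_space set"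
  assumes [measurable]: "E \<in> sets borel" "B \<in> sets borel"
    and inv: "\<And>h. AE x in lborel. x \<in> B \<longrightarrow> x + h \<in> B \<longrightarrow> (x \<in> E \<longleftrightarrow> x + h \<in> E)"
  shows "(AE x in lborel. x \<in> B \<longrightarrow> x \<notin> E) \<or> (AE x in lborel. x \<in> B \<longrightarrow> x \<in> E)"
proof -
  have "AE h in (lborel :: 'a measure). AE x in lborel. x \<in> B \<longrightarrow> x + h \<in> B \<longrightarrow> (x \<in> E \<longleftrightarrow> x + h \<in> E)"
    using inv by simp
  then have "AE x in lborel. AE h in lborel. x \<in> B \<longrightarrow> x + h \<in> B \<longrightarrow> (x \<in> E \<longleftrightarrow> x + h \<in> E)"
    by (subst lborel_pair.AE_commute) measurable
  then have ae: "AE x in lborel. AE y in lborel. x \<in> B \<longrightarrow> y \<in> B \<longrightarrow> (x \<in> E \<longleftrightarrow> y \<in> E)"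
  proof eventually_elim
    case (elim x)
    show ?case
    proof (rule AE_lborel_shift[OF _ elim])
      have "{y \<in> space borel. x \<in> B \<longrightarrow> y \<in> B \<longrightarrow> (x \<in> E) = (y \<in> E)} \<in> sets borel" by measurable
      then show "{y. x \<in> B \<longrightarrow> y \<in> B \<longrightarrow> (x \<in> E) = (y \<in> E)} \<in> sets borel" by simp
    qed
  qed
  show ?thesis
  proof (cases "AE x in lborel. x \<in> B \<longrightarrow> x \<notin> E")
    case False
    have "\<exists>x. x \<in> B \<and> x \<in> E \<and> (AE y in lborel. x \<in> B \<longrightarrow> y \<in> B \<longrightarrow> (x \<in> E \<longleftrightarrow> y \<in> E))"
    proof (rule ccontr)
      assume no: "\<not> ?thesis"
      from ae have "AE x in lborel. x \<in> B \<longrightarrow> x \<notin> E" by eventually_elim (use no in blast)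
      with False show False by blast
    qed
    then obtain x where "x \<in> B" "x \<in> E" "AE y in lborel. x \<in> B \<longrightarrow> y \<in> B \<longrightarrow> (x \<in> E \<longleftrightarrow> y \<in> E)" by blast
    then have "AE y in lborel. y \<in> B \<longrightarrow> y \<in> E" by simp
    then show ?thesis ..
  qed simp
qed

text \<open>The points near which E is null and those near which it has full measure form two open
  sets that cover the domain. They are disjoint because nonempty open sets are not
  negligible.\<close>

lemma connected_dichotomy:
  fixes \<Omega> E :: "'a::euclidean_space set"
  assumes con: "connected \<Omega>"
    and loc: "\<And>x. x \<in> \<Omega> \<Longrightarrow> \<exists>B. open B \<and> x \<in> B \<and> ((AE y in lborel. y \<in> B \<longrightarrow> y \<notin> E) \<or> (AE y in lborel. y \<in> B \<longrightarrow> y \<in> E))"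
  shows "(AE y in lborel. y \<in> \<Omega> \<longrightarrow> y \<notin> E) \<or> (AE y in lborel. y \<in> \<Omega> \<longrightarrow> y \<in> E)"
proof -
  define U where "U = \<Union>{B. open B \<and> (AE y in lborel. y \<in> B \<longrightarrow> y \<notin> E)}"
  define V where "V = \<Union>{B. open B \<and> (AE y in lborel. y \<in> B \<longrightarrow> y \<in> E)}"
  have open_UV: "open U" "open V" unfolding U_def V_def by (intro open_Union; blast)+
  have cover: "\<Omega> \<subseteq> U \<union> V" unfolding U_def V_def using loc by blast
  have "U \<inter> V = {}"
  proof (rule ccontr)
    assume "U \<inter> V \<noteq> {}"
    then obtain x B B' where x: "x \<in> B" "x \<in> B'" "open B" "open B'"
      and ae: "AE y in lborel. y \<in> B \<longrightarrow> y \<notin> E" "AE y in lborel. y \<in> B' \<longrightarrow> y \<in> E"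
      unfolding U_def V_def by blast
    have "AE y in lborel. y \<notin> B \<inter> B'" using ae by eventually_elim blast
    then have "B \<inter> B' \<in> null_sets lborel" using x by (subst AE_iff_null_sets) auto
    then have "negligible (B \<inter> B')" unfolding negligible_iff_null_sets by (rule null_sets_completionI)
    moreover have "open (B \<inter> B')" "B \<inter> B' \<noteq> {}" using x by auto
    ultimately show False using open_not_negligible by blast
  qed
  then have "U \<inter> \<Omega> = {} \<or> V \<inter> \<Omega> = {}"
    using connectedD[OF con open_UV _ cover] by blast
  then show ?thesis
  proof
    assume "U \<inter> \<Omega> = {}"
    then have "\<And>x. x \<in> \<Omega> \<Longrightarrow> x \<in> V" using cover by blast
    then have "AE y in lborel. y \<in> \<Omega> \<longrightarrow> y \<in> E" unfolding V_def by (intro AE_local) blast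
    then show ?thesis ..
  next
    assume "V \<inter> \<Omega> = {}"
    then have "\<And>x. x \<in> \<Omega> \<Longrightarrow> x \<in> U" using cover by blast
    then have "AE y in lborel. y \<in> \<Omega> \<longrightarrow> y \<notin> E" unfolding U_def by (intro AE_local) blast
    then show ?thesis ..
  qed
qed

section \<open>Local constancy of the positivity set of a resolvent\<close>

context dirichlet_system begin

text \<open>A fixed selection from \<open>borel_representative\<close>, so that the positivity set
  is a definite Borel set.\<close>

definition rep :: "('a \<Rightarrow> real) \<Rightarrow> 'a \<Rightarrow> real" where
  "rep u = (SOME w. w \<in> l2c \<and> (\<forall>x. x \<notin> \<Omega> \<longrightarrow> w x = 0) \<and> (AE x in lborel. (if x \<in> \<Omega> then u x else 0) = w x))"

lemma rep:
  assumes "u \<in> l2 M"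
  shows rep_l2c: "rep u \<in> l2c" and rep_outside: "\<And>x. x \<notin> \<Omega> \<Longrightarrow> rep u x = 0"
    and rep_AE: "AE x in lborel. (if x \<in> \<Omega> then u x else 0) = rep u x"
proof -
  have "\<exists>w. w \<in> l2c \<and> (\<forall>x. x \<notin> \<Omega> \<longrightarrow> w x = 0) \<and> (AE x in lborel. (if x \<in> \<Omega> then u x else 0) = w x)"
    using borel_representative[OF open_domain bounded_domain assms] by blast
  from someI_ex[OF this] show "rep u \<in> l2c" "\<And>x. x \<notin> \<Omega> \<Longrightarrow> rep u x = 0" "AE x in lborel. (if x \<in> \<Omega> then u x else 0) = rep u x"
    unfolding rep_def by blast+
qed

lemma rep_AE_M: "u \<in> l2 M \<Longrightarrow> AE x in M. u x = rep u x"
  unfolding AE_lebesgue_on_iff[OF open_domain] using rep_AE by (rule AE_mp) (auto intro!: AE_I2)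

lemma ip_rep:
  assumes u: "u \<in> l2 M" and \<psi>: "\<psi> \<in> test_functions \<Omega>"
  shows "ip M u \<psi> = ip lborel (rep u) \<psi>"
proof -
  note b = l2c_measurable[OF rep_l2c[OF u]]
  have "ip M u \<psi> = ip M (rep u) \<psi>"
    by (intro ip_cong_AE l2_measurable[OF u] borel_measurable_lebesgue_on[OF b] borel_measurable_lebesgue_on[OF test_functions_borel[OF \<psi>]] rep_AE_M[OF u]) simp
  also have "\<dots> = ip lborel (rep u) \<psi>"
    by (rule ip_lebesgue_on_borel[OF open_domain b test_functions_borel[OF \<psi>] rep_outside[OF u]])
  finally show ?thesis .
qed

lemma weak_gradient_rep:
  assumes w: "weak_gradient \<Omega> u G" and b: "b \<in> Basis" and \<psi>: "\<psi> \<in> test_functions \<Omega>"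
  shows "ip lborel (rep u) (\<lambda>x. frechet_derivative \<psi> (at x) b) = - ip lborel (rep (\<lambda>x. G x \<bullet> b)) \<psi>"
proof -
  note l = weak_gradient_l2[OF w]
  have "ip M u (\<lambda>x. frechet_derivative \<psi> (at x) b) = - ip M (\<lambda>x. G x \<bullet> b) \<psi>"
    using w b \<psi> unfolding weak_gradient_def ip_def by blast
  then show ?thesis
    using ip_rep[OF conjunct1[OF l] test_functions_partial[OF \<psi> b]] ip_rep[OF vl2D[OF conjunct2[OF l] b] \<psi>] by simp
qed

lemma test_function_energy:
  assumes "\<psi> \<in> test_functions \<Omega>"
  shows "summable (\<lambda>j. \<Lambda> j * (coef \<psi> j)\<^sup>2)"
  by (rule bounded_imp_summable[where B="vip M (classical_gradient \<psi>) (classical_gradient \<psi>)"])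
    (auto simp: eigenvalue_nonneg energy_bessel[OF h10_test_function[OF open_domain assms]] simp del: sum.lessThan_Suc simp flip: lessThan_Suc_atMost)

text \<open>A bump cut down to E still has finite energy by \<open>cut_energy\<close>, hence shifts
  change it only quadratically in L2, and this is impossible for a genuine jump across the boundary
  of E.\<close>

lemma positivity_set_local_dichotomy:
  assumes \<mu>: "\<mu> > 0" and f: "f \<in> l2 M" "AE x in M. 0 \<le> f x" and x: "x \<in> \<Omega>"
  defines "E \<equiv> {x. rep (res \<mu> f) x > 0}"
  shows "\<exists>B. open B \<and> x \<in> B \<and> ((AE y in lborel. y \<in> B \<longrightarrow> y \<notin> E) \<or> (AE y in lborel. y \<in> B \<longrightarrow> y \<in> E))"
proof -
  note rl = res_l2[OF \<mu> f(1)]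
  note [measurable] = l2c_measurable[OF rep_l2c[OF rl]]
  have E [measurable]: "E \<in> sets borel"
  proof -
    have "{x \<in> space borel. rep (res \<mu> f) x > 0} \<in> sets borel" by measurable
    then show ?thesis by (simp add: E_def)
  qed
  obtain a c where ac: "x \<in> box a c" "cbox a c \<subseteq> \<Omega>" using box_neighbourhood[OF open_domain x] by blast
  \<comment> \<open>A smaller closed box on which the bump is bounded away from 0; the jump across E
    then has a positive minimal height.\<close>
  obtain a' c' where ac': "x \<in> box a' c'" "cbox a' c' \<subseteq> box a c" using box_neighbourhood[OF open_box ac(1)] by blast
  define \<psi> where "\<psi> = box_bump 1 a c"
  have \<psi>: "\<psi> \<in> test_functions \<Omega>" unfolding \<psi>_def by (rule box_bump_test[OF _ ac(2)]) simp
  note [measurable] = test_functions_borel[OF \<psi>]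
  have pl: "\<psi> \<in> l2 M" by (rule test_functions_l2_on[OF open_domain \<psi>])
  define q where "q x = (if res \<mu> f x > 0 then \<psi> x else 0)" for x
  have qe: "(\<lambda>x. if res \<mu> f x > 0 then \<psi> x else 0) = q" unfolding q_def ..
  note ce = cut_energy[OF \<mu> f pl test_function_energy[OF \<psi>], unfolded qe]
  obtain G where G: "h10 \<Omega> q G" using energy_gradient[OF ce] by blast
  then have wg: "weak_gradient \<Omega> q G" unfolding h10_def by blast
  let ?u = "rep q" and ?g = "\<lambda>b. rep (\<lambda>x. G x \<bullet> b)"
  have u: "?u \<in> l2c" by (rule rep_l2c[OF ce(1)])
  have g: "?g b \<in> l2c" if "b \<in> Basis" for b by (rule rep_l2c[OF vl2D[OF h10_vl2[OF G] that]])
  \<comment> \<open>The cut function is multiplied by the bump a second time, since its weak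
    gradient can be transformed only after localization by a test function.\<close>
  let ?w = "\<lambda>x. ?u x * \<psi> x"
  have w: "?w \<in> l2c" by (rule l2c_mult_test[OF u \<psi>])
  have ib: "integrable lborel (\<lambda>\<xi>. (b \<bullet> \<xi>)\<^sup>2 * (cmod (ft ?w \<xi>))\<^sup>2)" if b: "b \<in> Basis" for b
  proof -
    let ?F = "\<lambda>x. ?g b x * \<psi> x + ?u x * frechet_derivative \<psi> (at x) b"
    have F: "?F \<in> l2c" by (intro l2c_add l2c_mult_test[OF g[OF b] \<psi>] l2c_mult_test[OF u test_functions_partial[OF \<psi> b]])
    have id: "ft ?F \<xi> = \<i> * complex_of_real (b \<bullet> \<xi>) * ft ?w \<xi>" for \<xi>
      by (rule ft_partial_identity[OF u g[OF b] b \<psi> weak_gradient_rep[OF wg b]])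
    have "(cmod (ft ?F \<xi>))\<^sup>2 = (b \<bullet> \<xi>)\<^sup>2 * (cmod (ft ?w \<xi>))\<^sup>2" for \<xi>
      unfolding id by (simp add: norm_mult power_mult_distrib)
    then show ?thesis using plancherel(1)[OF F] by (simp only:)
  qed
  have i: "integrable lborel (\<lambda>\<xi>. (norm \<xi>)\<^sup>2 * (cmod (ft ?w \<xi>))\<^sup>2)"
  proof -
    have "(norm \<xi>)\<^sup>2 * (cmod (ft ?w \<xi>))\<^sup>2 = (\<Sum>b\<in>Basis. (b \<bullet> \<xi>)\<^sup>2 * (cmod (ft ?w \<xi>))\<^sup>2)" for \<xi>
      unfolding sum_distrib_right[symmetric] by (subst norm_square_Basis_sum) (simp add: inner_commute)
    then show ?thesis using ib by (simp only:) (rule Bochner_Integration.integrable_sum)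
  qed
  \<comment> \<open>The two factors of the bump make the height of the cut function \<psi>^2. The
    definition by E at every point is what \<open>indicator_shift_invariant\<close> expects; it
    agrees with \<open>?w\<close> almost everywhere.\<close>
  define v where "v x = (if x \<in> E then \<psi> x * \<psi> x else 0)" for x
  have vm: "v \<in> borel_measurable borel" unfolding v_def by measurable
  have wv: "AE x in lborel. ?w x = v x"
    using rep_AE[OF ce(1)] rep_AE[OF rl]
  proof eventually_elim
    case (elim x)
    show ?case
    proof (cases "x \<in> \<Omega>")
      case True
      then show ?thesis using elim by (auto simp: v_def E_def q_def)
    next
      case False
      then show ?thesis using test_functions_outside[OF \<psi>] by (simp add: v_def)
    qed
  qed
  obtain R where R: "\<And>x. norm x > R \<Longrightarrow> \<psi> x = 0" using test_functions_support[OF \<psi>] by auto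
  have "v \<in> l2 lborel" by (rule l2_cong_AE[OF l2cD[OF w] _ wv]) (simp add: vm)
  moreover have "\<forall>x. norm x > R \<longrightarrow> v x = 0" using R by (simp add: v_def)
  ultimately have v: "v \<in> l2c" unfolding l2c_def by blast
  have "ft ?w = ft v" by (rule ft_cong_AE[OF l2c_measurable[OF w] vm wv])
  then have "integrable lborel (\<lambda>\<xi>. (norm \<xi>)\<^sup>2 * (cmod (ft v \<xi>))\<^sup>2)" using i by (simp only:)
  from shift_difference_bound[OF v this]
  obtain C where C: "C \<ge> 0" "\<And>h. ip lborel (\<lambda>x. v (x + h) - v x) (\<lambda>x. v (x + h) - v x) \<le> C * (norm h)\<^sup>2" by blast
  have ne: "cbox a' c' \<noteq> {}" using ac'(1) box_subset_cbox by blast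
  obtain x0 where x0: "x0 \<in> cbox a' c'" "\<And>x. x \<in> cbox a' c' \<Longrightarrow> \<psi> x0 \<le> \<psi> x"
    using continuous_attains_inf[OF compact_cbox ne test_functions_continuous[OF \<psi>]] by blast
  have p0: "\<psi> x0 > 0" using x0(1) ac'(2) unfolding \<psi>_def by (subst box_bump_pos_iff) auto
  let ?B = "box a' c'"
  have inv: "AE x in lborel. x \<in> ?B \<longrightarrow> x + h \<in> ?B \<longrightarrow> (x \<in> E \<longleftrightarrow> x + h \<in> E)" for h
  proof (rule indicator_shift_invariant[OF E _ convex_box(2) _ _ v v_def C])
    show "?B \<in> sets borel" by simp
    show "\<psi> x0 * \<psi> x0 > 0" using p0 by simp
    show "\<psi> x0 * \<psi> x0 \<le> \<psi> x * \<psi> x" if "x \<in> ?B" for x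
    proof -
      have "x \<in> cbox a' c'" using that box_subset_cbox by blast
      from x0(2)[OF this] show ?thesis using p0 by (intro mult_mono) auto
    qed
  qed
  have "(AE y in lborel. y \<in> ?B \<longrightarrow> y \<notin> E) \<or> (AE y in lborel. y \<in> ?B \<longrightarrow> y \<in> E)"
    by (rule shift_invariant_dichotomy[OF E _ inv]) simp
  then show ?thesis using ac'(1) open_box by blast
qed

text \<open>The dichotomy leaves two cases if the pairing is 0: the resolvent of f vanishes almost
  everywhere, or it is positive almost everywhere and then g vanishes.\<close>

lemma res_pairing_pos:
  assumes con: "connected \<Omega>" and \<mu>: "\<mu> > 0"
    and f: "f \<in> l2 M" "AE x in M. 0 \<le> f x" "\<not> (AE x in M. f x = 0)"
    and g: "g \<in> l2 M" "AE x in M. 0 \<le> g x" "\<not> (AE x in M. g x = 0)"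
  shows "ip M (res \<mu> f) g > 0"
proof -
  let ?u = "res \<mu> f"
  note u = res_l2[OF \<mu> f(1)]
  have u0: "AE x in M. 0 \<le> ?u x" by (rule res_nonneg[OF \<mu> f(1,2)])
  have nn: "AE x in M. 0 \<le> ?u x * g x" using u0 g(2) by eventually_elim simp
  have "ip M ?u g \<noteq> 0"
  proof
    assume "ip M ?u g = 0"
    then have ug: "AE x in M. ?u x * g x = 0"
      unfolding ip_def using integral_nonneg_eq_0_iff_AE[OF l2_mult_integrable[OF u g(1)] nn] by simp
    define E where "E = {x. rep ?u x > 0}"
    have "(AE y in lborel. y \<in> \<Omega> \<longrightarrow> y \<notin> E) \<or> (AE y in lborel. y \<in> \<Omega> \<longrightarrow> y \<in> E)"
      unfolding E_def by (rule connected_dichotomy[OF con positivity_set_local_dichotomy[OF \<mu> f(1,2)]])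
    then show False
    proof
      assume "AE y in lborel. y \<in> \<Omega> \<longrightarrow> y \<notin> E"
      then have "AE y in M. y \<notin> E" unfolding AE_lebesgue_on_iff[OF open_domain] .
      with rep_AE_M[OF u] u0 have "AE x in M. ?u x = 0"
        by eventually_elim (auto simp: E_def)
      \<comment> \<open>A resolvent that is 0 has coefficients 0; multiplying by the positive
        \<open>\<Lambda> j + \<mu>\<close> gives the same for f, so completeness contradicts that f
        is non-trivial.\<close>
      then have "ip M ?u (\<phi> j) = 0" for j
        unfolding ip_def by (intro integral_eq_zero_AE) (auto elim: AE_mp)
      then have "coef f j = 0" for j
        using coef_res[OF \<mu> f(1), of j] shifted_eigenvalue_pos[OF \<mu>, of j] by simp
      from complete[OF f(1) this] f(3) show False by blast
    next
      assume "AE y in lborel. y \<in> \<Omega> \<longrightarrow> y \<in> E"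
      then have "AE y in M. y \<in> E" unfolding AE_lebesgue_on_iff[OF open_domain] .
      with rep_AE_M[OF u] ug have "AE x in M. g x = 0"
        by eventually_elim (auto simp: E_def)
      with g(3) show False by blast
    qed
  qed
  moreover have "ip M ?u g \<ge> 0" unfolding ip_def by (rule integral_nonneg_AE[OF nn])
  ultimately show ?thesis by simp
qed

end

section \<open>The spectral fractional Laplacian\<close>

lemma power_le_one_plus_power:
  fixes x :: real
  assumes "0 \<le> x" "i \<le> k"
  shows "x ^ i \<le> 1 + x ^ k"
proof (cases "x \<le> 1")
  case True
  then show ?thesis using power_le_one[OF assms(1) True, of i] assms by (simp add: add_increasing2)
next
  case False
  then have "x ^ i \<le> x ^ k" by (intro power_increasing assms(2)) simp
  then show ?thesis by simp
qed

lemma power_le_one_plus_powr: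
  assumes "0 \<le> x" "real k < s"
  shows "x ^ k \<le> 1 + x powr s"
proof (cases "x \<le> 1")
  case True
  then show ?thesis using power_le_one[OF assms(1) True, of k] by (intro add_increasing2) auto
next
  case False
  then have "x ^ k = x powr real k" by (simp add: powr_realpow)
  also have "\<dots> \<le> x powr s" using False assms by (intro powr_mono) auto
  finally show ?thesis by simp
qed

section \<open>Locality of integer powers of the spectral Laplacian\<close>

context dirichlet_system begin

lemma gradient_zero_on_zero_set:
  assumes w: "weak_gradient \<Omega> u G" and b: "b \<in> Basis"
  shows "AE x in M. u x = 0 \<longrightarrow> G x \<bullet> b = 0"
proof -
  note ul = conjunct1[OF weak_gradient_l2[OF w]]
  note gl = vl2D[OF conjunct2[OF weak_gradient_l2[OF w]] b]
  have "AE x in M. rep u x = 0 \<longrightarrow> rep (\<lambda>x. G x \<bullet> b) x = 0"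
    unfolding AE_lebesgue_on_iff[OF open_domain]
    by (rule partial_zero_on_zero_set[OF open_domain rep_l2c[OF ul] rep_l2c[OF gl] b weak_gradient_rep[OF w b]])
  with rep_AE_M[OF ul] rep_AE_M[OF gl] show ?thesis by eventually_elim simp
qed

lemma vip_zero_if_disjoint:
  assumes u: "weak_gradient \<Omega> u G" and v: "weak_gradient \<Omega> v H" and uv: "AE x in M. u x * v x = 0"
  shows "vip M G H = 0"
proof -
  have "ip M (\<lambda>x. G x \<bullet> b) (\<lambda>x. H x \<bullet> b) = 0" if b: "b \<in> Basis" for b
    unfolding ip_def
  proof (rule integral_eq_zero_AE)
    show "AE x in M. G x \<bullet> b * (H x \<bullet> b) = 0"
      using gradient_zero_on_zero_set[OF u b] gradient_zero_on_zero_set[OF v b] uv by eventually_elim auto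
  qed
  then show ?thesis by (simp add: vip_def)
qed

text \<open>The pairing of h with u is the spectral energy of u, so u lies in the form domain and h
  is -Delta u against test functions. The local result on second derivatives then applies.\<close>

lemma spectral_laplacian_zero_on_zero_set:
  assumes u: "u \<in> l2 M" and h: "h \<in> l2 M" and uh: "\<And>j. coef h j = \<Lambda> j * coef u j"
  shows "AE x in M. u x = 0 \<longrightarrow> h x = 0"
proof -
  have "summable (\<lambda>j. coef h j * coef u j)" using parseval[OF h u] by (rule sums_summable)
  then have "summable (\<lambda>j. \<Lambda> j * (coef u j)\<^sup>2)" by (simp add: uh power2_eq_square mult.assoc)
  from energy_gradient[OF u this] obtain G where G: "h10 \<Omega> u G"
    and pair: "\<And>v H. h10 \<Omega> v H \<Longrightarrow> (\<lambda>j. \<Lambda> j * coef u j * coef v j) sums vip M G H" by blast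
  have wg: "weak_gradient \<Omega> u G" using G unfolding h10_def by blast
  have gl: "(\<lambda>x. G x \<bullet> b) \<in> l2 M" if "b \<in> Basis" for b by (rule vl2D[OF h10_vl2[OF G] that])
  have eq: "(\<Sum>b\<in>Basis. ip lborel (rep (\<lambda>x. G x \<bullet> b)) (\<lambda>x. frechet_derivative \<psi> (at x) b)) = ip lborel (rep h) \<psi>"
    if \<psi>: "\<psi> \<in> test_functions \<Omega>" for \<psi>
  proof -
    have "(\<Sum>b\<in>Basis. ip lborel (rep (\<lambda>x. G x \<bullet> b)) (\<lambda>x. frechet_derivative \<psi> (at x) b)) =
        (\<Sum>b\<in>Basis. ip M (\<lambda>x. G x \<bullet> b) (\<lambda>x. frechet_derivative \<psi> (at x) b))"
      by (intro sum.cong refl ip_rep[OF gl test_functions_partial[OF \<psi>], symmetric])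
    also have "\<dots> = vip M G (classical_gradient \<psi>)" by (simp add: vip_def classical_gradient_inner)
    also have "\<dots> = ip M h \<psi>"
      using pair[OF h10_test_function[OF open_domain \<psi>]] parseval[OF h test_functions_l2_on[OF open_domain \<psi>]]
      unfolding uh by (rule sums_unique2)
    also have "\<dots> = ip lborel (rep h) \<psi>" by (rule ip_rep[OF h \<psi>])
    finally show ?thesis .
  qed
  have "AE x in M. rep u x = 0 \<longrightarrow> rep h x = 0"
    unfolding AE_lebesgue_on_iff[OF open_domain]
    by (rule laplacian_zero_on_zero_set[OF open_domain rep_l2c[OF u] rep_l2c[OF gl] rep_l2c[OF h] weak_gradient_rep[OF wg] eq])
  with rep_AE_M[OF u] rep_AE_M[OF h] show ?thesis by eventually_elim simp
qed

lemma summable_lower_power: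
  assumes f: "f \<in> l2 M" and s: "summable (\<lambda>j. \<Lambda> j ^ k * (coef f j)\<^sup>2)" and i: "i \<le> k"
  shows "summable (\<lambda>j. \<Lambda> j ^ i * (coef f j)\<^sup>2)"
proof (rule summable_comparison_test'[OF summable_add[OF summable_coef_square[OF f] s]])
  fix j :: nat
  have "\<Lambda> j ^ i * (coef f j)\<^sup>2 \<le> (1 + \<Lambda> j ^ k) * (coef f j)\<^sup>2"
    by (intro mult_right_mono power_le_one_plus_power eigenvalue_nonneg i) simp
  then show "norm (\<Lambda> j ^ i * (coef f j)\<^sup>2) \<le> (coef f j)\<^sup>2 + \<Lambda> j ^ k * (coef f j)\<^sup>2"
    by (simp add: abs_mult eigenvalue_nonneg algebra_simps)
qed

text \<open>Iterates the previous result. The intermediate powers exist in L2 because lower powers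
  of the eigenvalues are controlled by 1 plus the highest one.\<close>

lemma spectral_power_zero_on_zero_set:
  assumes f: "f \<in> l2 M" and s: "summable (\<lambda>j. \<Lambda> j ^ (2 * i) * (coef f j)\<^sup>2)"
  shows "\<exists>u \<in> l2 M. (\<forall>j. coef u j = \<Lambda> j ^ i * coef f j) \<and> (AE x in M. f x = 0 \<longrightarrow> u x = 0)"
  using s
proof (induction i)
  case 0
  show ?case using f by (intro bexI[of _ f]) auto
next
  case (Suc i)
  have "summable (\<lambda>j. \<Lambda> j ^ (2 * i) * (coef f j)\<^sup>2)"
    by (rule summable_lower_power[OF f Suc.prems]) simp
  from Suc.IH[OF this] obtain u where u: "u \<in> l2 M" "\<And>j. coef u j = \<Lambda> j ^ i * coef f j"
    "AE x in M. f x = 0 \<longrightarrow> u x = 0" by blast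
  have "(\<Lambda> j ^ Suc i * coef f j)\<^sup>2 = \<Lambda> j ^ (2 * Suc i) * (coef f j)\<^sup>2" for j
    by (simp only: power_mult_distrib power_mult[symmetric] mult.commute)
  then have "summable (\<lambda>j. (\<Lambda> j ^ Suc i * coef f j)\<^sup>2)" using Suc.prems by simp
  from riesz_fischer[OF this] obtain h where h: "h \<in> l2 M" "\<And>j. coef h j = \<Lambda> j ^ Suc i * coef f j" by blast
  have "AE x in M. u x = 0 \<longrightarrow> h x = 0"
    by (rule spectral_laplacian_zero_on_zero_set[OF u(1) h(1)]) (simp add: h(2) u(2))
  with u(3) have "AE x in M. f x = 0 \<longrightarrow> h x = 0" by eventually_elim blast
  with h show ?case by blast
qed

text \<open>The power is shared between f and g, so that each side needs no more than its own moment
  of order k. For even k the two halves are paired in L2; for odd k the remaining eigenvalue is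
  absorbed by the Dirichlet form, and the gradients are disjoint as well.\<close>

lemma spectral_orthogonality:
  assumes f: "f \<in> l2 M" and g: "g \<in> l2 M" and fg: "AE x in M. f x * g x = 0"
    and sf: "summable (\<lambda>j. \<Lambda> j ^ k * (coef f j)\<^sup>2)" and sg: "summable (\<lambda>j. \<Lambda> j ^ k * (coef g j)\<^sup>2)"
  shows "(\<lambda>j. \<Lambda> j ^ k * (coef f j * coef g j)) sums 0"
proof -
  define i where "i = k div 2"
  have i: "2 * i \<le> k" by (simp add: i_def)
  obtain u where u: "u \<in> l2 M" "\<And>j. coef u j = \<Lambda> j ^ i * coef f j" "AE x in M. f x = 0 \<longrightarrow> u x = 0"
    using spectral_power_zero_on_zero_set[OF f summable_lower_power[OF f sf i]] by blast
  obtain v where v: "v \<in> l2 M" "\<And>j. coef v j = \<Lambda> j ^ i * coef g j" "AE x in M. g x = 0 \<longrightarrow> v x = 0"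
    using spectral_power_zero_on_zero_set[OF g summable_lower_power[OF g sg i]] by blast
  have uv: "AE x in M. u x * v x = 0" using u(3) v(3) fg by eventually_elim auto
  show ?thesis
  proof (cases "even k")
    case True
    then have "k = i + i" by (auto simp: i_def)
    then have e: "\<Lambda> j ^ k * (coef f j * coef g j) = coef u j * coef v j" for j
      by (simp add: u(2) v(2) power_add)
    have "ip M u v = 0" unfolding ip_def by (rule integral_eq_zero_AE[OF uv])
    then show ?thesis using parseval[OF u(1) v(1)] by (simp only: e)
  next
    case False
    then have k: "k = Suc (i + i)" by (simp add: i_def) presburger
    have e: "\<Lambda> j ^ k * (coef f j * coef g j) = \<Lambda> j * coef u j * coef v j" for j
      by (simp add: u(2) v(2) power_add k)
    have "summable (\<lambda>j. \<Lambda> j * (coef u j)\<^sup>2)" "summable (\<lambda>j. \<Lambda> j * (coef v j)\<^sup>2)"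
      using sf sg by (simp_all add: u(2) v(2) power_add k power2_eq_square ac_simps)
    note en = energy_gradient[OF u(1) this(1)] energy_gradient[OF v(1) this(2)]
    obtain G where G: "h10 \<Omega> u G" "\<And>v H. h10 \<Omega> v H \<Longrightarrow> (\<lambda>j. \<Lambda> j * coef u j * coef v j) sums vip M G H"
      using en(1) by blast
    obtain H where H: "h10 \<Omega> v H" using en(2) by blast
    have "vip M G H = 0" using G(1) H uv unfolding h10_def by (intro vip_zero_if_disjoint[of u G v H]) blast+
    with G(2)[OF H] show ?thesis by (simp only: e)
  qed
qed

lemma Q_DSp_sums:
  assumes "(\<lambda>j. \<Lambda> j powr s * (coef v j)\<^sup>2) sums r"
  shows "Q_DSp \<Omega> \<Lambda> \<phi> s v = ennreal r" "r \<ge> 0"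
proof -
  have r: "r = (\<Sum>j. \<Lambda> j powr s * (coef v j)\<^sup>2)" by (rule sums_unique[OF assms])
  show "Q_DSp \<Omega> \<Lambda> \<phi> s v = ennreal r"
    unfolding Q_DSp_def L2_inner_eq_ip r by (rule suminf_ennreal2[OF _ sums_summable[OF assms]]) simp
  show "r \<ge> 0" unfolding r by (rule suminf_nonneg[OF sums_summable[OF assms]]) simp
qed

text \<open>As on the whole space, only the cross term distinguishes the sum from the difference.
  Its sign comes from \<open>fractional_power_sign\<close> with the eigenvalues as spectral variable
  and the products of coefficients as density.\<close>

lemma spectral_form_inequality:
  assumes con: "connected \<Omega>"
    and f: "f \<in> l2 M" "AE x in M. 0 \<le> f x" "\<not> (AE x in M. f x = 0)"
    and g: "g \<in> l2 M" "AE x in M. 0 \<le> g x" "\<not> (AE x in M. g x = 0)"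
    and fg: "AE x in M. f x * g x = 0"
    and s: "real m < s" "s < real m + 1"
    and Q: "Q_DSp \<Omega> \<Lambda> \<phi> s f < \<infinity>" "Q_DSp \<Omega> \<Lambda> \<phi> s g < \<infinity>"
  shows "even m \<Longrightarrow> Q_DSp \<Omega> \<Lambda> \<phi> s (\<lambda>x. f x + g x) < Q_DSp \<Omega> \<Lambda> \<phi> s (\<lambda>x. f x - g x)"
    and "odd m \<Longrightarrow> Q_DSp \<Omega> \<Lambda> \<phi> s (\<lambda>x. f x - g x) < Q_DSp \<Omega> \<Lambda> \<phi> s (\<lambda>x. f x + g x)"
proof -
  let ?c = "\<lambda>j. coef f j * coef g j"
  have "summable (\<lambda>j. \<Lambda> j powr s * (coef v j)\<^sup>2)" if "Q_DSp \<Omega> \<Lambda> \<phi> s v < \<infinity>" for v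
  proof (rule summable_suminf_not_top)
    show "(\<Sum>j. ennreal (\<Lambda> j powr s * (coef v j)\<^sup>2)) \<noteq> top"
      using that unfolding Q_DSp_def L2_inner_eq_ip infinity_ennreal_def by (rule less_imp_neq)
  qed simp
  note sf = this[OF Q(1)] and sg = this[OF Q(2)]
  have low: "summable (\<lambda>j. \<Lambda> j ^ k * (coef v j)\<^sup>2)"
    if "k \<le> m" "v \<in> l2 M" "summable (\<lambda>j. \<Lambda> j powr s * (coef v j)\<^sup>2)" for k v
  proof (rule summable_comparison_test'[OF summable_add[OF summable_coef_square[OF that(2)] that(3)]])
    fix j :: nat
    have "\<Lambda> j ^ k * (coef v j)\<^sup>2 \<le> (1 + \<Lambda> j powr s) * (coef v j)\<^sup>2"
      using that(1) s(1) by (intro mult_right_mono power_le_one_plus_powr eigenvalue_nonneg) auto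
    then show "norm (\<Lambda> j ^ k * (coef v j)\<^sup>2) \<le> (coef v j)\<^sup>2 + \<Lambda> j powr s * (coef v j)\<^sup>2"
      by (simp add: abs_mult eigenvalue_nonneg algebra_simps)
  qed
  have am: "\<bar>a * b\<bar> \<le> a\<^sup>2 + b\<^sup>2" for a b :: real
  proof -
    have "\<bar>a\<bar> * \<bar>b\<bar> \<ge> 0" by simp
    then show ?thesis using sum_squares_bound[of "\<bar>a\<bar>" "\<bar>b\<bar>"] unfolding abs_mult power2_abs by linarith
  qed
  have cs: "summable (\<lambda>j. norm (\<Lambda> j powr s * ?c j))"
  proof (rule summable_comparison_test'[OF summable_add[OF sf sg]])
    fix j :: nat
    have "\<Lambda> j powr s * \<bar>?c j\<bar> \<le> \<Lambda> j powr s * ((coef f j)\<^sup>2 + (coef g j)\<^sup>2)"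
      by (intro mult_left_mono am) simp
    then show "norm (norm (\<Lambda> j powr s * ?c j)) \<le> \<Lambda> j powr s * (coef f j)\<^sup>2 + \<Lambda> j powr s * (coef g j)\<^sup>2"
      by (simp add: abs_mult[of "\<Lambda> j powr s"] distrib_left)
  qed
  have c: "summable (\<lambda>j. norm (?c j))"
    by (rule summable_comparison_test'[OF summable_add[OF summable_coef_square[OF f(1)] summable_coef_square[OF g(1)]]])
      (simp only: real_norm_def abs_abs am)
  let ?N = "count_space (UNIV :: nat set)"
  \<comment> \<open>Integration over the counting measure needs absolute summability, whereas
    Parseval and the orthogonality relations only provide the value of the sum.\<close>
  have int: "(LINT j|?N. h j) = r" if "summable (\<lambda>j. norm (h j))" "h sums r" for h :: "nat \<Rightarrow> real" and r
    using that by (simp add: integral_count_space_nat integrable_count_space_nat_iff sums_iff)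
  have key: "(-1) ^ Suc m * (LINT j|?N. \<Lambda> j powr s * ?c j) > 0"
  proof (rule fractional_power_sign[OF sigma_finite_measure_count_space _ _ eigenvalue_nonneg s])
    show "integrable ?N ?c" "integrable ?N (\<lambda>j. \<Lambda> j powr s * ?c j)"
      using c cs by (simp_all add: integrable_count_space_nat_iff)
    show "(LINT j|?N. \<Lambda> j ^ k * ?c j) = 0" if "k \<le> m" for k
    proof (rule int[OF _ spectral_orthogonality[OF f(1) g(1) fg low[OF that f(1) sf] low[OF that g(1) sg]]])
      show "summable (\<lambda>j. norm (\<Lambda> j ^ k * ?c j))"
      proof (rule summable_comparison_test'[OF summable_add[OF low[OF that f(1) sf] low[OF that g(1) sg]]])
        fix j :: nat
        have "\<Lambda> j ^ k * \<bar>?c j\<bar> \<le> \<Lambda> j ^ k * ((coef f j)\<^sup>2 + (coef g j)\<^sup>2)"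
          by (intro mult_left_mono am) (simp add: eigenvalue_nonneg)
        then show "norm (norm (\<Lambda> j ^ k * ?c j)) \<le> \<Lambda> j ^ k * (coef f j)\<^sup>2 + \<Lambda> j ^ k * (coef g j)\<^sup>2"
          by (simp add: abs_mult[of "\<Lambda> j ^ k"] eigenvalue_nonneg distrib_left)
      qed
    qed
    show "(LINT j|?N. ?c j / (\<Lambda> j + \<mu>)) > 0" if \<mu>: "\<mu> > 0" for \<mu>
    proof -
      have "(\<lambda>j. ?c j / (\<Lambda> j + \<mu>)) sums ip M (res \<mu> f) g"
        using parseval[OF res_l2[OF \<mu> f(1)] g(1)] by (simp add: coef_res[OF \<mu> f(1)])
      moreover have "summable (\<lambda>j. norm (?c j / (\<Lambda> j + \<mu>)))"
      proof (rule summable_comparison_test'[OF summable_mult[OF c, of "1 / \<mu>"]])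
        fix j :: nat
        have "\<bar>?c j\<bar> / (\<Lambda> j + \<mu>) \<le> \<bar>?c j\<bar> / \<mu>"
          using \<mu> eigenvalue_nonneg[of j] by (intro divide_left_mono) auto
        then show "norm (norm (?c j / (\<Lambda> j + \<mu>))) \<le> 1 / \<mu> * norm (?c j)"
          using shifted_eigenvalue_pos[OF \<mu>, of j] by simp
      qed
      ultimately have "(LINT j|?N. ?c j / (\<Lambda> j + \<mu>)) = ip M (res \<mu> f) g" by (rule int[rotated])
      then show ?thesis using res_pairing_pos[OF con \<mu> f g] by simp
    qed
  qed simp_all
  define S where "S = (\<Sum>j. \<Lambda> j powr s * ?c j)"
  have S: "(\<lambda>j. \<Lambda> j powr s * ?c j) sums S" unfolding S_def by (rule summable_sums[OF summable_norm_cancel[OF cs]])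
  define F where "F = (\<Sum>j. \<Lambda> j powr s * (coef f j)\<^sup>2) + (\<Sum>j. \<Lambda> j powr s * (coef g j)\<^sup>2)"
  have FS: "(\<lambda>j. \<Lambda> j powr s * (coef f j)\<^sup>2 + \<Lambda> j powr s * (coef g j)\<^sup>2) sums F"
    unfolding F_def by (intro sums_add summable_sums sf sg)
  have key: "(-1) ^ Suc m * S > 0" using key unfolding int[OF cs S] .
  have sq_add: "l * (a + b)\<^sup>2 = l * a\<^sup>2 + l * b\<^sup>2 + 2 * (l * (a * b))"
    and sq_diff: "l * (a - b)\<^sup>2 = l * a\<^sup>2 + l * b\<^sup>2 - 2 * (l * (a * b))" for l a b :: real
    by (simp_all add: power2_eq_square algebra_simps)
  have plus: "(\<lambda>j. \<Lambda> j powr s * (coef (\<lambda>x. f x + g x) j)\<^sup>2) sums (F + 2 * S)"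
    using sums_add[OF FS sums_mult[OF S, of 2]] by (simp only: coef_add[OF f(1) g(1)] sq_add)
  have minus: "(\<lambda>j. \<Lambda> j powr s * (coef (\<lambda>x. f x - g x) j)\<^sup>2) sums (F - 2 * S)"
    using sums_diff[OF FS sums_mult[OF S, of 2]] by (simp only: coef_diff[OF f(1) g(1)] sq_diff)
  show "Q_DSp \<Omega> \<Lambda> \<phi> s (\<lambda>x. f x + g x) < Q_DSp \<Omega> \<Lambda> \<phi> s (\<lambda>x. f x - g x)" if "even m"
    unfolding Q_DSp_sums(1)[OF plus] Q_DSp_sums(1)[OF minus]
    using key that Q_DSp_sums(2)[OF plus] by (intro ennreal_lessI) auto
  show "Q_DSp \<Omega> \<Lambda> \<phi> s (\<lambda>x. f x - g x) < Q_DSp \<Omega> \<Lambda> \<phi> s (\<lambda>x. f x + g x)" if "odd m"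
    unfolding Q_DSp_sums(1)[OF plus] Q_DSp_sums(1)[OF minus]
    using key that Q_DSp_sums(2)[OF minus] by (intro ennreal_lessI) auto
qed

end

theorem theorem1:
  fixes \<Omega> :: "(real ^ 'n) set"
    and \<Lambda> :: "nat \<Rightarrow> real" and \<phi> :: "nat \<Rightarrow> real ^ 'n \<Rightarrow> real"
    and s :: real and f g :: "real ^ 'n \<Rightarrow> real"
  assumes "open \<Omega>" and "connected \<Omega>" and "bounded \<Omega>" and "strictly_lipschitz \<Omega>"
    and "dirichlet_eigensystem \<Omega> \<Lambda> \<phi>"
    and "s > 0" and "s \<notin> \<nat>"
    and "f \<in> Dom_DSp \<Omega> \<Lambda> \<phi> s" and "g \<in> Dom_DSp \<Omega> \<Lambda> \<phi> s"
    and "AE x in lebesgue_on \<Omega>. f x \<ge> 0" and "AE x in lebesgue_on \<Omega>. g x \<ge> 0"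
    and "\<not> (AE x in lebesgue_on \<Omega>. f x = 0)" and "\<not> (AE x in lebesgue_on \<Omega>. g x = 0)"
    and "AE x in lebesgue_on \<Omega>. f x * g x = 0"
  shows "(even \<lfloor>s\<rfloor> \<longrightarrow>
            Q_DSp \<Omega> \<Lambda> \<phi> s (\<lambda>x. f x + g x) < Q_DSp \<Omega> \<Lambda> \<phi> s (\<lambda>x. f x - g x)) \<and>
         (odd \<lfloor>s\<rfloor> \<longrightarrow>
            Q_DSp \<Omega> \<Lambda> \<phi> s (\<lambda>x. f x + g x) > Q_DSp \<Omega> \<Lambda> \<phi> s (\<lambda>x. f x - g x)) \<and>
         (f \<in> Dom_DR \<Omega> s \<and> g \<in> Dom_DR \<Omega> s \<longrightarrow>
            (even \<lfloor>s\<rfloor> \<longrightarrow>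
               Q_DR \<Omega> s (\<lambda>x. f x + g x) < Q_DR \<Omega> s (\<lambda>x. f x - g x)) \<and>
            (odd \<lfloor>s\<rfloor> \<longrightarrow>
               Q_DR \<Omega> s (\<lambda>x. f x + g x) > Q_DR \<Omega> s (\<lambda>x. f x - g x)))"
proof -
  interpret dirichlet_system \<Omega> \<Lambda> \<phi> by unfold_locales (rule assms)+
  define m where "m = nat \<lfloor>s\<rfloor>"
  have floor: "\<lfloor>s\<rfloor> = int m" using \<open>s > 0\<close> by (simp add: m_def)
  \<comment> \<open>Since s is not a natural number, the lower bound in the floor is strict, which
    keeps the fractional part strictly inside the unit interval.\<close>
  have "s \<noteq> real m" using \<open>s \<notin> \<nat>\<close> by (metis of_nat_in_Nats)
  then have s: "real m < s" "s < real m + 1"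
    using floor_correct[of s] unfolding floor by auto
  have f: "f \<in> l2 (lebesgue_on \<Omega>)" "Q_DSp \<Omega> \<Lambda> \<phi> s f < \<infinity>"
    and g: "g \<in> l2 (lebesgue_on \<Omega>)" "Q_DSp \<Omega> \<Lambda> \<phi> s g < \<infinity>"
    using assms(8,9) by (auto simp: Dom_DSp_def L2_on_eq_l2)
  note DSp = spectral_form_inequality[OF \<open>connected \<Omega>\<close> f(1) assms(10,12) g(1) assms(11,13,14) s f(2) g(2)]
  note DR = restricted_form_inequality[OF \<open>open \<Omega>\<close> \<open>bounded \<Omega>\<close> f(1) assms(10,12) g(1) assms(11,13,14) s \<open>s > 0\<close>]
  show ?thesis
    using DSp DR by (auto simp: floor Dom_DR_def sobolev_H_tilde_def)
qed

end
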